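(* Let $n\ge 3$ and let $(\alpha,\beta)$ satisfy $\beta\ge 0$, $0<\alpha+\beta<n-\beta$ and $\frac{n-\alpha-2\beta}{2n}+\frac{n-\alpha}{2(n-1)}<1$. Then: (1) If $\alpha\le 1$ (equivalently $p\ge 2$), there exists a constant $c_0>0$ such that for all $u\in L^p(\mathbb S^{n-1})$ with $u\not\equiv 0$, $$c^p_{\alpha,\beta}-\frac{\|Q_{\alpha,\beta}u\|^p_{L^q(\mathbb B^n)}}{\|u\|^p_{L^p(\mathbb S^{n-1})}}\ \ge\ c_0\inf_{\Psi,\lambda}\Big(\big\|\lambda|\mathbb S^{n-1}|^{\frac1p}u_\Psi-1\big\|^p_{L^p(\mathbb S^{n-1})}+\big\|\lambda|\mathbb S^{n-1}|^{\frac1p}u_\Psi-1\big\|^2_{L^2(\mathbb S^{n-1})}\Big).$$ (2) If $1<\alpha<n$ (equivalently $1<p<2$), there exists a constant $c_0>0$ such that for all $u\in L^p(\mathbb S^{n-1})$ with $u\not\equiv 0$, $$c^p_{\alpha,\beta}-\frac{\|Q_{\alpha,\beta}u\|^p_{L^q(\mathbb B^n)}}{\|u\|^p_{L^p(\mathbb S^{n-1})}}\ \ge\ c_0\inf_{\Psi,\lambda}\big\|\lambda|\mathbb S^{n-1}|^{\frac1p}u_\Psi-1\big\|^2_{L^p(\mathbb S^{n-1})}.$$ In both cases the infimum is over all conformal transformations $\Psi$ of $\mathbb B^n$ and all $\lambda\in\mathbb R$.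
   Context: $\mathbb B^n$ is the open unit ball in $\mathbb R^n$, $\mathbb S^{n-1}$ the unit sphere with its standard surface measure $\mathrm dV$, $|\mathbb S^{n-1}|$ its area. Set $p=\frac{2(n-1)}{n+\alpha-2}$, $q=\frac{2n}{n-\alpha-2\beta}$. For $u$ on $\mathbb S^{n-1}$ and $\xi\in\mathbb B^n$, $Q_{\alpha,\beta}(u)(\xi)=\left(\frac{1-|\xi|^2}{2}\right)^{\beta}\int_{\mathbb S^{n-1}}|\xi-\eta|^{\alpha-n}u(\eta)\,\mathrm dV(\eta)$. The constant $c_{\alpha,\beta}$ is the sharp constant $c_{\alpha,\beta}=\sup\{\|Q_{\alpha,\beta}u\|_{L^q(\mathbb B^n)}/\|u\|_{L^p(\mathbb S^{n-1})}: 0\not\equiv u\in L^p(\mathbb S^{n-1})\}$, which is finite and equals $|\mathbb S^{n-1}|^{-1/p}\|Q_{\alpha,\beta}(1)\|_{L^q(\mathbb B^n)}$. A conformal transformation $\Psi$ of $\mathbb B^n$ is a conformal (Möbius) diffeomorphism of $\overline{\mathbb B^n}$ onto itself (e.g. compositions of orthogonal maps with $\Psi_\zeta(\eta)=\frac{(1-|\zeta|^2)(\eta-\zeta)-|\eta-\zeta|^2\zeta}{1-2\zeta\cdot\eta+|\zeta|^2|\eta|^2}$, $\zeta\in\mathbb B^n$); for such $\Psi$, $u_\Psi:=(\det \mathrm d\Psi|_{\partial\mathbb B^n})^{1/p}\,u\circ\Psi$, where $\det\mathrm d\Psi|_{\partial\mathbb B^n}$ is the Jacobian of the restriction of $\Psi$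 to $\mathbb S^{n-1}$ (for $\Psi_\zeta$ it equals $\big(\frac{1-|\zeta|^2}{1-2\zeta\cdot\eta+|\zeta|^2}\big)^{n-1}$). *)

theory Defs
  imports "HOL-Analysis.Analysis"
begin

text \<open>Dimension n = DIM('a). Surface measure on the unit sphere S^{n-1}, defined as
  n times the push-forward of Lebesgue measure on the punctured unit ball under the radial
  projection x \<mapsto> x/|x| (the cone-measure construction; for A \<subseteq> S^{n-1} this is
  n * vol({t x. 0<t<1, x\<in>A}), i.e. the standard surface measure).\<close>
definition sphere_measure :: "'a::euclidean_space measure" where
  "sphere_measure = scale_measure (of_nat DIM('a))
     (distr (restrict_space lborel (ball 0 1 - {0})) (restrict_space borel (sphere 0 1))
        (\<lambda>x. x /\<^sub>R norm x))"

definition ball_measure :: "'a::euclidean_space measure" where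
  "ball_measure = restrict_space lborel (ball 0 1)"

definition sphere_area :: "'a::euclidean_space itself \<Rightarrow> real" where
  "sphere_area _ = measure (sphere_measure :: 'a measure) (sphere 0 1)"

definition in_Lp :: "'a measure \<Rightarrow> real \<Rightarrow> ('a \<Rightarrow> real) \<Rightarrow> bool" where
  "in_Lp M r f \<longleftrightarrow> f \<in> borel_measurable M \<and> integrable M (\<lambda>x. \<bar>f x\<bar> powr r)"

definition Lp_norm :: "'a measure \<Rightarrow> real \<Rightarrow> ('a \<Rightarrow> real) \<Rightarrow> real" where
  "Lp_norm M r f = (\<integral>x. \<bar>f x\<bar> powr r \<partial>M) powr (1 / r)"

definition p_exp :: "'a::euclidean_space itself \<Rightarrow> real \<Rightarrow> real" where
  "p_exp _ \<alpha> = 2 * (real DIM('a) - 1) / (real DIM('a) + \<alpha> - 2)"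

definition q_exp :: "'a::euclidean_space itself \<Rightarrow> real \<Rightarrow> real \<Rightarrow> real" where
  "q_exp _ \<alpha> \<beta> = 2 * real DIM('a) / (real DIM('a) - \<alpha> - 2 * \<beta>)"

definition Qop :: "real \<Rightarrow> real \<Rightarrow> ('a::euclidean_space \<Rightarrow> real) \<Rightarrow> 'a \<Rightarrow> real" where
  "Qop \<alpha> \<beta> u \<xi> = ((1 - (norm \<xi>)\<^sup>2) / 2) powr \<beta> *
     (\<integral>\<eta>. norm (\<xi> - \<eta>) powr (\<alpha> - real DIM('a)) * u \<eta> \<partial>(sphere_measure :: 'a measure))"

definition sharp_const :: "'a::euclidean_space itself \<Rightarrow> real \<Rightarrow> real \<Rightarrow> real" where
  "sharp_const T \<alpha> \<beta> = Sup {Lp_norm (ball_measure :: 'a measure) (q_exp T \<alpha> \<beta>) (Qop \<alpha> \<beta> u)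
       / Lp_norm (sphere_measure :: 'a measure) (p_exp T \<alpha>) u | u.
       in_Lp (sphere_measure :: 'a measure) (p_exp T \<alpha>) u
       \<and> Lp_norm (sphere_measure :: 'a measure) (p_exp T \<alpha>) u \<noteq> 0}"

definition conformal_ball_auto :: "('a::euclidean_space \<Rightarrow> 'a) \<Rightarrow> bool" where
  "conformal_ball_auto \<Psi> \<longleftrightarrow>
     bij_betw \<Psi> (cball 0 1) (cball 0 1)
   \<and> (\<forall>x\<in>cball 0 1. \<Psi> differentiable (at x within cball 0 1))
   \<and> (\<forall>v. continuous_on (cball 0 1) (\<lambda>x. frechet_derivative \<Psi> (at x within cball 0 1) v))
   \<and> (\<forall>y\<in>cball 0 1. inv_into (cball 0 1) \<Psi> differentiable (at y within cball 0 1))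
   \<and> (\<forall>x\<in>cball 0 1. \<exists>c>0. \<forall>v. norm (frechet_derivative \<Psi> (at x within cball 0 1) v) = c * norm v)"

text \<open>Jacobian of the restriction of a conformal map to the sphere: for a conformal
  map with conformal factor c(\<eta>) (= operator norm of the derivative) it is c(\<eta>)^{n-1}.\<close>
definition sphere_jac :: "('a::euclidean_space \<Rightarrow> 'a) \<Rightarrow> 'a \<Rightarrow> real" where
  "sphere_jac \<Psi> \<eta> = onorm (frechet_derivative \<Psi> (at \<eta> within cball 0 1)) ^ (DIM('a) - 1)"

definition pullback :: "real \<Rightarrow> ('a::euclidean_space \<Rightarrow> 'a) \<Rightarrow> ('a \<Rightarrow> real) \<Rightarrow> 'a \<Rightarrow> real" where
  "pullback p \<Psi> u \<eta> = sphere_jac \<Psi> \<eta> powr (1 / p) * u (\<Psi> \<eta>)"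

end

theory Submission
  imports Defs "HOL-Analysis.Analysis"
begin

text \<open>
  With \<open>s = (n - \<alpha>) / 2\<close> and \<open>T u (\<xi>) = \<integral> ((1 - |\<xi>|\<^sup>2) / (2 |\<xi> - \<eta>|\<^sup>2))\<^sup>s u(\<eta>) d\<eta>\<close>, the \<open>q\<close>-th power of the norm of
  \<open>Q u\<close> is the integral of \<open>|T u|\<^sup>q\<close> against hyperbolic measure, and everything is invariant under the
  conformal group. Let \<open>u\<close> be normalised with deficit \<open>\<tau>\<close>. A conformal map moves an almost maximum point
  of \<open>T |u|\<close> to the origin, which makes the first moments of \<open>|u|\<close> of order \<open>\<surd>\<tau>\<close>. Polarization with
  respect to a hyperplane through the origin can raise the norm of \<open>Q u\<close> only up to the sharp
  constant; quantified, this bounds the difference of \<open>u\<close> and its reflections, and averaging over reflections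
  gives \<open>\<parallel>u - l\<parallel>\<^sub>1 = O(\<surd>\<tau>)\<close> for the mean \<open>l\<close> of \<open>u\<close>.
  For \<open>w = u / l - 1\<close> strict convexity of \<open>x \<mapsto> x powr (q / p)\<close> excludes that a part of the mass concentrates,
  so \<open>w\<close> is small in \<open>L\<^sup>p\<close>. In the expansion around the constant the coercive term \<open>\<integral> min(w\<^sup>2, |w|\<^sup>p)\<close> of the
  \<open>L\<^sup>p\<close> norm dominates, because the quadratic term of \<open>\<integral> |T u|\<^sup>q\<close> is at most \<open>A \<parallel>w\<parallel>\<^sub>1\<^sup>2 + \<epsilon> \<parallel>w\<parallel>\<^sup>2\<close>: the kernel is
  bounded away from the sphere and the contribution near the sphere is small. As \<open>\<parallel>w\<parallel>\<^sub>1\<^sup>2 = O(\<tau>)\<close>, no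
  spectral information on the second variation is needed.
\<close>

section \<open>Change of variables\<close>

text \<open>The conformal group is not compact, so near-maximisers may concentrate or spread out.
  Compactness is avoided by the refined bound \<open>strong_type\<close>: the norm of T v carries a
  positive power of sup T v, so a near-maximiser must have T v large somewhere. Once this point is
  moved to the origin, the mean is bounded below (\<open>mean_lower\<close>); a slack \<tau> is
  allowed because the supremum need not be attained. Polarization alone controls only a product A *
  B, where A and B are the weighted distances of v and of its mirror image to the polarized
  function; either factor may be large. The difference B - A is twice a first moment, so the
  normalization at the origin supplies the missing information through (A + B)^2 = (B - A)^2 + 4 A
  B. The rate sqrt \<tau> for the L^1 distance is exactly what is needed, as its square has the
  order of the deficit and pays for the quadratic term away from the sphere. All constants come from
  explicit inequalities. Of the conformal maps, only the identity and inversions in spheres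
  orthogonal to the unit sphere are used.\<close>

typedef (overloaded) 'a ix = "{..<DIM('a::euclidean_space)}"
  using DIM_positive by blast

instance ix :: (euclidean_space) finite
proof
  have "(UNIV :: 'a ix set) = Abs_ix ` {..<DIM('a)}"
    using type_definition.Abs_image[OF type_definition_ix] by blast
  then show "finite (UNIV :: 'a ix set)"
    by (metis finite_imageI finite_lessThan)
qed

text \<open>Determinants and measures of differentiable images are available for
  \<open>real ^ 'n\<close> with a finite well-ordered index type. The order of the natural numbers
  is transported to give one with DIM('a) elements.\<close>

instantiation ix :: (euclidean_space) wellorder
begin

definition less_eq_ix :: "'a ix \<Rightarrow> 'a ix \<Rightarrow> bool" where
  "i \<le> j \<longleftrightarrow> Rep_ix i \<le> Rep_ix j"

definition less_ix :: "'a ix \<Rightarrow> 'a ix \<Rightarrow> bool" where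
  "i < j \<longleftrightarrow> Rep_ix i < Rep_ix j"

instance
proof
  fix P :: "'a ix \<Rightarrow> bool" and a :: "'a ix"
  assume step: "\<And>x. (\<And>y. y < x \<Longrightarrow> P y) \<Longrightarrow> P x"
  show "P a"
    by (induction a rule: measure_induct_rule[where f = Rep_ix]) (rule step, simp add: less_ix_def)
qed (auto simp: less_eq_ix_def less_ix_def Rep_ix_inject)

end

section \<open>Isometric transfer between Euclidean space and coordinate vectors\<close>

definition basis_of :: "'a::euclidean_space ix \<Rightarrow> 'a" where
  "basis_of i = (SOME f. bij_betw f {..<DIM('a)} (Basis :: 'a set)) (Rep_ix i)"

lemma bij_basis_of: "bij_betw (basis_of :: 'a::euclidean_space ix \<Rightarrow> 'a) UNIV Basis"
proof -
  define f where "f = (SOME f. bij_betw f {..<DIM('a)} (Basis :: 'a set))"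
  have "\<exists>f. bij_betw f {..<DIM('a)} (Basis :: 'a set)"
    by (metis atLeast0LessThan ex_bij_betw_nat_finite finite_Basis)
  then have "bij_betw f {..<DIM('a)} (Basis :: 'a set)"
    unfolding f_def by (rule someI_ex)
  moreover have "bij_betw (Rep_ix :: 'a ix \<Rightarrow> nat) UNIV {..<DIM('a)}"
    by (simp add: bij_betw_def inj_on_def Rep_ix_inject type_definition.Rep_range[OF type_definition_ix])
  ultimately have "bij_betw (f \<circ> Rep_ix) (UNIV :: 'a ix set) Basis"
    by (rule bij_betw_trans[rotated])
  then show ?thesis
    by (simp add: basis_of_def[abs_def] f_def comp_def)
qed

lemma basis_of_Basis [simp]: "basis_of i \<in> Basis"
  using bij_basis_of by (auto simp: bij_betw_def)

lemma inj_basis_of: "inj basis_of"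
  using bij_basis_of by (auto simp: bij_betw_def)

lemma card_ix: "CARD('a::euclidean_space ix) = DIM('a)"
  using bij_betw_same_card[OF bij_basis_of] by auto

definition to_vec :: "'a::euclidean_space \<Rightarrow> real ^ 'a ix" where
  "to_vec x = (\<chi> i. x \<bullet> basis_of i)"

definition of_vec :: "real ^ 'a ix \<Rightarrow> 'a::euclidean_space" where
  "of_vec y = (\<Sum>i\<in>UNIV. (y $ i) *\<^sub>R basis_of i)"

lemma inner_basis_of: "basis_of i \<bullet> basis_of j = (if i = j then 1 else 0)"
  using inj_basis_of by (auto simp: inner_Basis dest: injD)

lemma to_vec_of_vec [simp]: "to_vec (of_vec y) = y"
  by (simp add: to_vec_def of_vec_def vec_eq_iff inner_sum_left inner_basis_of if_distrib cong: if_cong)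

lemma sum_basis_of: "(\<Sum>b\<in>Basis. g b) = (\<Sum>i\<in>UNIV. g (basis_of i :: 'a::euclidean_space))"
  by (rule sum.reindex_bij_betw[symmetric, OF bij_basis_of])

lemma prod_basis_of: "(\<Prod>b\<in>Basis. g b) = (\<Prod>i\<in>UNIV. g (basis_of i :: 'a::euclidean_space))"
  by (rule prod.reindex_bij_betw[symmetric, OF bij_basis_of])

lemma of_vec_to_vec [simp]: "of_vec (to_vec x) = x"
  using euclidean_representation[of x] by (simp add: to_vec_def of_vec_def sum_basis_of)

lemma to_vec_eq_iff [simp]: "to_vec x = to_vec y \<longleftrightarrow> x = y"
  by (metis of_vec_to_vec)

lemma of_vec_eq_iff [simp]: "of_vec x = of_vec y \<longleftrightarrow> x = y"
  by (metis to_vec_of_vec)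

lemma linear_to_vec: "linear to_vec"
  by (intro linearI) (simp_all add: to_vec_def vec_eq_iff inner_add_left)

lemma linear_of_vec: "linear of_vec"
  by (intro linearI) (simp_all add: of_vec_def sum.distrib scaleR_add_left scaleR_sum_right)

lemma inner_to_vec [simp]: "to_vec x \<bullet> to_vec y = x \<bullet> y"
  by (simp add: inner_vec_def to_vec_def euclidean_inner[of x y] sum_basis_of)

lemma norm_to_vec [simp]: "norm (to_vec x) = norm x"
  by (simp add: norm_eq_sqrt_inner)

lemma inner_of_vec [simp]: "of_vec x \<bullet> of_vec y = x \<bullet> y"
  using inner_to_vec[of "of_vec x" "of_vec y"] by simp

lemma norm_of_vec [simp]: "norm (of_vec x) = norm x"
  by (simp add: norm_eq_sqrt_inner)

lemma bounded_linear_to_vec: "bounded_linear to_vec"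
  using linear_to_vec linear_conv_bounded_linear by blast

lemma bounded_linear_of_vec: "bounded_linear of_vec"
  using linear_of_vec linear_conv_bounded_linear by blast

lemma of_vec_borel [measurable]: "of_vec \<in> borel \<rightarrow>\<^sub>M borel"
  by (intro borel_measurable_continuous_onI linear_continuous_on bounded_linear_of_vec)

text \<open>Boxes correspond to boxes with the same side lengths, and Lebesgue measure is determined
  by its values on boxes.\<close>

lemma distr_of_vec: "distr lborel borel of_vec = (lborel :: 'a::euclidean_space measure)"
proof (rule lborel_eqI[symmetric])
  fix l u :: 'a
  assume le: "\<And>b. b \<in> Basis \<Longrightarrow> l \<bullet> b \<le> u \<bullet> b"
  have eq: "of_vec -` box l u = box (to_vec l) (to_vec u)"
  proof (intro set_eqI)
    fix y :: "real ^ 'a ix"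
    have c: "of_vec y \<bullet> basis_of i = y $ i" for i
      by (metis to_vec_def to_vec_of_vec vec_lambda_beta)
    have "y \<in> of_vec -` box l u \<longleftrightarrow> (\<forall>b\<in>range basis_of. l \<bullet> b < of_vec y \<bullet> b \<and> of_vec y \<bullet> b < u \<bullet> b)"
      using bij_basis_of[where 'a='a] by (simp add: box_def bij_betw_def)
    then show "y \<in> of_vec -` box l u \<longleftrightarrow> y \<in> box (to_vec l) (to_vec u)"
      by (simp add: mem_box_cart to_vec_def c)
  qed
  have "emeasure (distr lborel borel of_vec) (box l u) = emeasure lborel (of_vec -` box l u)"
    by (subst emeasure_distr) auto
  also have "\<dots> = (\<Prod>b\<in>Basis. (to_vec u - to_vec l) \<bullet> b)"
    unfolding eq
  proof (rule emeasure_lborel_box)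
    fix b :: "real ^ 'a ix"
    assume "b \<in> Basis"
    then show "to_vec l \<bullet> b \<le> to_vec u \<bullet> b"
      by (auto simp: Basis_vec_def inner_axis to_vec_def le)
  qed
  also have "(\<Prod>b\<in>Basis. (to_vec u - to_vec l) \<bullet> b) = (\<Prod>b\<in>Basis. (u - l) \<bullet> b)"
  proof -
    have "(\<Prod>b\<in>(Basis :: (real ^ 'a ix) set). (to_vec u - to_vec l) \<bullet> b)
        = (\<Prod>i\<in>UNIV. (to_vec u - to_vec l) \<bullet> axis i 1)"
      by (rule prod.reindex_cong[where l = "\<lambda>i. axis i 1"])
         (auto simp: Basis_vec_def inj_on_def axis_eq_axis)
    also have "\<dots> = (\<Prod>i\<in>UNIV. (u - l) \<bullet> basis_of i)"
      by (simp add: inner_axis to_vec_def inner_diff_left)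
    finally show ?thesis
      by (simp add: prod_basis_of)
  qed
  finally show "emeasure (distr lborel borel of_vec) (box l u) = (\<Prod>b\<in>Basis. (u - l) \<bullet> b)"
    by simp
qed simp

lemma emeasure_of_vec_vimage:
  "A \<in> sets borel \<Longrightarrow> emeasure lborel (of_vec -` A) = emeasure lborel (A :: 'a::euclidean_space set)"
  by (subst (2) distr_of_vec[symmetric]) (simp add: emeasure_distr)

lemma nn_integral_of_vec:
  assumes [measurable]: "g \<in> borel_measurable (borel :: 'a::euclidean_space measure)"
  shows "(\<integral>\<^sup>+y. g (of_vec y) \<partial>lborel) = (\<integral>\<^sup>+x. g x \<partial>lborel)"
  by (subst (2) distr_of_vec[symmetric]) (simp add: nn_integral_distr)

section \<open>Jacobians of linear maps and the substitution rule\<close>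

definition jac :: "('a::euclidean_space \<Rightarrow> 'a) \<Rightarrow> real" where
  "jac L = \<bar>det (matrix (to_vec \<circ> L \<circ> of_vec))\<bar>"

lemma jac_nonneg [simp]: "0 \<le> jac L"
  by (simp add: jac_def)

lemma of_vec_vimage_image: "to_vec ` A = of_vec -` A"
  by (auto simp: image_iff) (metis to_vec_of_vec)

text \<open>The measure formula for injective differentiable images, carried over from coordinates.
  Finite measure of \<open>V\<close> and the bound \<open>B\<close> make the Jacobian integrable, so
  its Lebesgue integral can serve as the gauge integral of that formula. The Jacobian enters as a
  Borel function \<open>J\<close> on the whole space that is tied to the derivative only on
  \<open>V\<close>.\<close>

lemma emeasure_image_eq_jac:
  fixes f :: "'a::euclidean_space \<Rightarrow> 'a"
  assumes V: "V \<in> sets borel" and fin: "emeasure lborel V < \<infinity>" and fV: "f ` V \<in> sets borel"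
    and der: "\<And>x. x \<in> V \<Longrightarrow> (f has_derivative f' x) (at x within V)"
    and inj: "inj_on f V"
    and J [measurable]: "J \<in> borel_measurable borel"
    and Jeq: "\<And>x. x \<in> V \<Longrightarrow> J x = jac (f' x)"
    and bd: "\<And>x. x \<in> V \<Longrightarrow> J x \<le> B"
  shows "emeasure lborel (f ` V) = (\<integral>\<^sup>+x\<in>V. ennreal (J x) \<partial>lborel)"
proof -
  define W where "W = of_vec -` V"
  define F where "F = to_vec \<circ> f \<circ> of_vec"
  define F' where "F' = (\<lambda>y. to_vec \<circ> f' (of_vec y) \<circ> of_vec)"
  have W [measurable]: "W \<in> sets borel"
    using V measurable_sets_borel[OF of_vec_borel] by (simp add: W_def)
  have Wfin: "emeasure lborel W < \<infinity>"
    using fin V by (simp add: W_def emeasure_of_vec_vimage)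
  have FW: "F ` W = of_vec -` (f ` V)"
    unfolding F_def W_def of_vec_vimage_image[symmetric] by (simp add: image_comp comp_assoc[symmetric])
  have derF: "(F has_derivative F' y) (at y within W)" if "y \<in> W" for y
  proof -
    have 1: "(of_vec has_derivative of_vec) (at y within W)"
      using bounded_linear_of_vec bounded_linear_imp_has_derivative by blast
    have "of_vec ` W = V"
      unfolding W_def of_vec_vimage_image[symmetric] by (simp add: image_comp)
    then have 2: "(f has_derivative f' (of_vec y)) (at (of_vec y) within of_vec ` W)"
      using der that by (auto simp: W_def)
    have 3: "(to_vec has_derivative to_vec) (at (f (of_vec y)) within f ` of_vec ` W)"
      using bounded_linear_to_vec bounded_linear_imp_has_derivative by blast
    show ?thesis
      unfolding F_def F'_def comp_assoc
      using diff_chain_within[OF diff_chain_within[OF 1 2], of to_vec to_vec] 3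
      by (simp add: image_comp comp_def)
  qed
  have injF: "inj_on F W"
  proof (rule inj_onI)
    fix y z
    assume "y \<in> W" "z \<in> W" "F y = F z"
    then show "y = z"
      using inj by (simp add: F_def W_def inj_on_eq_iff)
  qed
  have detF: "\<bar>det (matrix (F' y))\<bar> = J (of_vec y)" if "y \<in> W" for y
    using that Jeq by (simp add: W_def F'_def jac_def)
  have Jn: "0 \<le> J x" if "x \<in> V" for x
    using Jeq that by simp
  define m where "m = (\<integral>y. indicator W y * J (of_vec y) \<partial>lborel)"
  have int: "integrable lborel (\<lambda>y. indicator W y * J (of_vec y))"
  proof (rule Bochner_Integration.integrable_bound[of _ "\<lambda>y. \<bar>B\<bar> * indicator W y"])
    show "integrable lborel (\<lambda>y. \<bar>B\<bar> * indicator W y :: real)"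
      using Wfin W by simp
    show "AE y in lborel. norm (indicator W y * J (of_vec y)) \<le> norm (\<bar>B\<bar> * indicator W y :: real)"
    proof (rule AE_I2)
      fix y
      show "norm (indicator W y * J (of_vec y)) \<le> norm (\<bar>B\<bar> * indicator W y :: real)"
        using Jn[of "of_vec y"] bd[of "of_vec y"] by (cases "y \<in> W") (auto simp: W_def)
    qed
  qed simp
  have "((\<lambda>y. indicator W y * J (of_vec y)) has_integral m) UNIV"
    unfolding m_def using has_integral_integral_lborel[OF int] by simp
  moreover have "(\<lambda>y. indicator W y * J (of_vec y)) = (\<lambda>y. if y \<in> W then J (of_vec y) else 0)"
    by auto
  ultimately have "((\<lambda>y. J (of_vec y)) has_integral m) W"
    by (simp only: has_integral_restrict_UNIV)
  then have "((\<lambda>y. \<bar>det (matrix (F' y))\<bar>) has_integral m) W"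
    by (rule has_integral_eq[rotated]) (simp add: detF)
  then have img: "F ` W \<in> lmeasurable" "measure lebesgue (F ` W) = m"
    using has_measure_differentiable_image[of W F F' m] derF injF W by (auto simp: sets_completionI_sets)
  have FWb: "F ` W \<in> sets borel"
    unfolding FW using fV measurable_sets_borel[OF of_vec_borel] by simp
  have "emeasure lborel (f ` V) = emeasure lborel (F ` W)"
    using fV by (simp add: FW emeasure_of_vec_vimage)
  also have "\<dots> = ennreal m"
  proof -
    have "emeasure lebesgue (F ` W) = ennreal m"
      using img emeasure_eq_measure2 by blast
    then show ?thesis
      using FWb by (simp add: emeasure_completion)
  qed
  also have "\<dots> = (\<integral>\<^sup>+y. ennreal (indicator W y * J (of_vec y)) \<partial>lborel)"
    unfolding m_def by (rule nn_integral_eq_integral[symmetric, OF int]) (auto simp: indicator_def W_def Jn)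
  also have "\<dots> = (\<integral>\<^sup>+y. ennreal (indicator V (of_vec y) * J (of_vec y)) \<partial>lborel)"
    by (simp add: W_def indicator_def)
  also have "\<dots> = (\<integral>\<^sup>+x. ennreal (indicator V x * J x) \<partial>lborel)"
    using V by (intro nn_integral_of_vec) simp
  also have "\<dots> = (\<integral>\<^sup>+x\<in>V. ennreal (J x) \<partial>lborel)"
    by (rule nn_integral_cong) (auto simp: indicator_def)
  finally show ?thesis .
qed

text \<open>Both sides integrate \<open>g\<close> against a measure: the image under
  \<open>f\<close> of the density \<open>J\<close> on \<open>U\<close>, and Lebesgue measure on the
  image of \<open>U\<close>. The two measures agree on a Borel set A by the image formula for the
  part of \<open>U\<close> that \<open>f\<close> maps into A.\<close>

lemma nn_integral_substitution:
  fixes f :: "'a::euclidean_space \<Rightarrow> 'a"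
  assumes U [measurable]: "U \<in> sets borel" and fin: "emeasure lborel U < \<infinity>" and fU [measurable]: "f ` U \<in> sets borel"
    and f [measurable]: "f \<in> borel \<rightarrow>\<^sub>M borel"
    and der: "\<And>x. x \<in> U \<Longrightarrow> (f has_derivative f' x) (at x within U)"
    and inj: "inj_on f U"
    and J [measurable]: "J \<in> borel_measurable borel"
    and Jeq: "\<And>x. x \<in> U \<Longrightarrow> J x = jac (f' x)"
    and bd: "\<And>x. x \<in> U \<Longrightarrow> J x \<le> B"
    and g [measurable]: "g \<in> borel_measurable borel"
  shows "(\<integral>\<^sup>+x\<in>U. ennreal (J x) * g (f x) \<partial>lborel) = (\<integral>\<^sup>+y\<in>f ` U. g y \<partial>lborel)"
proof -
  define M1 where "M1 = distr (density lborel (\<lambda>x. ennreal (J x) * indicator U x)) borel f"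
  define M2 where "M2 = density lborel (indicator (f ` U) :: 'a \<Rightarrow> ennreal)"
  have "M1 = M2"
  proof (rule measure_eqI)
    show "sets M1 = sets M2"
      by (simp add: M1_def M2_def)
    fix A assume "A \<in> sets M1"
    then have A [measurable]: "A \<in> sets borel"
      by (simp add: M1_def)
    define V where "V = U \<inter> f -` A"
    have fA: "f -` A \<in> sets borel"
      using measurable_sets_borel[OF f A] .
    then have V: "V \<in> sets borel"
      by (simp add: V_def)
    have fV: "f ` V = f ` U \<inter> A"
      by (auto simp: V_def)
    have "emeasure M1 A = (\<integral>\<^sup>+x. ennreal (J x) * indicator U x * indicator (f -` A) x \<partial>lborel)"
      unfolding M1_def using fA by (simp add: emeasure_distr emeasure_density)
    also have "\<dots> = (\<integral>\<^sup>+x\<in>V. ennreal (J x) \<partial>lborel)"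
      by (rule nn_integral_cong) (auto simp: V_def indicator_def)
    also have "\<dots> = emeasure lborel (f ` V)"
    proof (rule emeasure_image_eq_jac[symmetric, where f' = f' and B = B])
      show "emeasure lborel V < \<infinity>"
        by (rule le_less_trans[OF emeasure_mono fin]) (auto simp: V_def)
      show "f ` V \<in> sets borel"
        unfolding fV by simp
    qed (use V J Jeq bd der inj in \<open>auto simp: V_def inj_on_def intro: has_derivative_subset\<close>)
    also have "\<dots> = emeasure M2 A"
      unfolding M2_def fV by (simp add: emeasure_density indicator_inter_arith[symmetric])
    finally show "emeasure M1 A = emeasure M2 A" .
  qed
  then have "(\<integral>\<^sup>+y. g y \<partial>M1) = (\<integral>\<^sup>+y. g y \<partial>M2)"
    by simp
  then show ?thesis
    unfolding M1_def M2_def by (simp add: nn_integral_distr nn_integral_density mult_ac)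
qed

lemma jac_compose:
  assumes "linear L1" "linear L2"
  shows "jac (L1 \<circ> L2) = jac L1 * jac L2"
proof -
  have "to_vec \<circ> (L1 \<circ> L2) \<circ> of_vec = (to_vec \<circ> L1 \<circ> of_vec) \<circ> (to_vec \<circ> L2 \<circ> of_vec)"
    by (auto simp: fun_eq_iff)
  then show ?thesis
    unfolding jac_def using assms
    by (simp add: matrix_compose linear_compose linear_to_vec linear_of_vec det_mul abs_mult)
qed

lemma jac_orthogonal:
  assumes "orthogonal_transformation R"
  shows "jac R = 1"
proof -
  have "orthogonal_transformation (to_vec \<circ> R \<circ> of_vec)"
    using assms unfolding orthogonal_transformation
    by (simp add: linear_compose linear_to_vec linear_of_vec)
  then show ?thesis
    by (simp add: jac_def)
qed

lemma jac_scaleR: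
  assumes "linear L"
  shows "jac (\<lambda>x. c *\<^sub>R L x) = \<bar>c\<bar> ^ DIM('a) * jac (L :: 'a::euclidean_space \<Rightarrow> 'a)"
proof -
  have "jac ((\<lambda>x. c *\<^sub>R x) :: 'a \<Rightarrow> 'a) = \<bar>c\<bar> ^ DIM('a)"
  proof -
    have "to_vec \<circ> ((\<lambda>x. c *\<^sub>R x) :: 'a \<Rightarrow> 'a) \<circ> of_vec = (\<lambda>y. c *\<^sub>R y)"
      by (auto simp: fun_eq_iff linear_scale[OF linear_to_vec])
    then show ?thesis
      unfolding jac_def by (simp add: det_matrix_scaleR card_ix power_abs)
  qed
  then show ?thesis
    using jac_compose[of "\<lambda>x. c *\<^sub>R x" L] assms by (simp add: comp_def)
qed

text \<open>The map is the identity along \<eta> and multiplication by \<open>c\<close> on the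
  orthogonal complement. A rotation that carries a coordinate axis to \<eta> conjugates it to the
  diagonal map \<open>D\<close>, with one entry 1 and all others \<open>c\<close>. It appears below
  as the stretching part of the derivative of a radial extension.\<close>

lemma jac_axial:
  fixes \<eta> :: "'a::euclidean_space"
  assumes \<eta>: "norm \<eta> = 1" and c: "c > 0"
  shows "jac (\<lambda>h. (h \<bullet> \<eta>) *\<^sub>R \<eta> + c *\<^sub>R (h - (h \<bullet> \<eta>) *\<^sub>R \<eta>)) = c ^ (DIM('a) - 1)"
proof -
  define L where "L = (\<lambda>h::'a. (h \<bullet> \<eta>) *\<^sub>R \<eta> + c *\<^sub>R (h - (h \<bullet> \<eta>) *\<^sub>R \<eta>))"
  obtain k :: "'a ix" where True
    by simp
  define D where "D = (\<lambda>y::real ^ 'a ix. c *\<^sub>R y + ((1 - c) * y $ k) *\<^sub>R axis k 1)"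
  obtain U :: "real ^ 'a ix \<Rightarrow> real ^ 'a ix" where U: "orthogonal_transformation U" "U (axis k 1) = to_vec \<eta>"
    using orthogonal_transformation_exists[of "axis k 1" "to_vec \<eta>"] \<eta> by auto
  have linU: "linear U"
    using U(1) orthogonal_transformation_linear by blast
  define V where "V = inv U"
  have V: "orthogonal_transformation V" "\<And>y. U (V y) = y"
    using orthogonal_transformation_inv[OF U(1)] orthogonal_transformation_surj[OF U(1)]
    by (simp_all add: V_def surj_f_inv_f)
  have linV: "linear V"
    using V(1) orthogonal_transformation_linear by blast
  have linD: "linear D"
    unfolding D_def by (intro linearI) (simp_all add: algebra_simps)
  have "(to_vec \<circ> L \<circ> of_vec) y = (U \<circ> D \<circ> V) y" for y
  proof -
    have "V y $ k = V y \<bullet> axis k 1"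
      by (simp add: inner_axis)
    also have "\<dots> = U (V y) \<bullet> U (axis k 1)"
      using U(1) by (simp add: orthogonal_transformation_def)
    also have "\<dots> = of_vec y \<bullet> \<eta>"
      using inner_to_vec[of "of_vec y" \<eta>] U(2) V(2) by simp
    finally have *: "V y $ k = of_vec y \<bullet> \<eta>" .
    show ?thesis
      using U(2) V(2)
      by (simp add: D_def L_def * linear_add[OF linU] linear_diff[OF linU] linear_scale[OF linU] linear_add[OF linear_to_vec]
          linear_diff[OF linear_to_vec] linear_scale[OF linear_to_vec] algebra_simps)
  qed
  then have "to_vec \<circ> L \<circ> of_vec = U \<circ> D \<circ> V"
    by (rule ext)
  then have "jac L = \<bar>det (matrix D)\<bar>"
    unfolding jac_def using linU linD linV U(1) V(1)
    by (simp add: matrix_compose linear_compose det_mul abs_mult)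
  also have "det (matrix D) = (\<Prod>i\<in>UNIV. matrix D $ i $ i)"
    by (rule det_diagonal) (auto simp: matrix_def D_def axis_def)
  also have "\<dots> = (\<Prod>i\<in>UNIV. if i = k then 1 else c)"
    by (intro prod.cong refl) (auto simp: matrix_def D_def axis_def)
  also have "\<dots> = c ^ (DIM('a) - 1)"
    by (subst prod.remove[of _ k]) (auto simp: card_Diff_singleton card_ix)
  finally show ?thesis
    using c by (simp add: L_def)
qed

text \<open>The Leibniz expansion has n! terms, and each is a product of n entries bounded by
  \<open>B\<close>. Such a crude bound suffices, since only some constant depending on the dimension
  is wanted.\<close>

lemma jac_le:
  fixes L :: "'a::euclidean_space \<Rightarrow> 'a"
  assumes B: "\<And>h. norm (L h) \<le> B * norm h"
  shows "jac L \<le> fact DIM('a) * B ^ DIM('a)"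
proof -
  have "0 \<le> B * norm (SOME b. b \<in> (Basis :: 'a set))"
    using B norm_ge_zero order_trans by blast
  then have B0: "0 \<le> B"
    using norm_Basis[OF SOME_Basis] by simp
  define A where "A = matrix (to_vec \<circ> L \<circ> of_vec)"
  have A: "\<bar>A $ i $ j\<bar> \<le> B" for i j
  proof -
    have "\<bar>A $ i $ j\<bar> \<le> norm (to_vec (L (of_vec (axis j 1))))"
      using component_le_norm_cart[of "to_vec (L (of_vec (axis j 1)))" i] by (simp add: A_def matrix_def)
    also have "\<dots> \<le> B"
      using B[of "of_vec (axis j 1)"] by simp
    finally show ?thesis .
  qed
  have "\<bar>det A\<bar> \<le> (\<Sum>p\<in>{p. p permutes (UNIV :: 'a ix set)}. \<bar>of_int (sign p) * (\<Prod>i\<in>UNIV. A $ i $ p i)\<bar>)"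
    unfolding det_def by (rule sum_abs)
  also have "\<dots> \<le> (\<Sum>p\<in>{p. p permutes (UNIV :: 'a ix set)}. B ^ DIM('a))"
  proof (rule sum_mono)
    fix p
    have "\<bar>of_int (sign p) * (\<Prod>i\<in>UNIV. A $ i $ p i)\<bar> = (\<Prod>i\<in>UNIV. \<bar>A $ i $ p i\<bar>)"
      by (simp add: abs_mult abs_prod sign_def)
    also have "\<dots> \<le> (\<Prod>i\<in>(UNIV :: 'a ix set). B)"
      by (rule prod_mono) (simp add: A)
    finally show "\<bar>of_int (sign p) * (\<Prod>i\<in>UNIV. A $ i $ p i)\<bar> \<le> B ^ DIM('a)"
      by (simp add: card_ix)
  qed
  also have "\<dots> = fact DIM('a) * B ^ DIM('a)"
    by (simp add: card_permutations card_ix)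
  finally show ?thesis
    by (simp add: jac_def A_def)
qed

section \<open>Reflections and inversions\<close>

lemma space_sphere_measure [simp]: "space (sphere_measure :: 'a::euclidean_space measure) = sphere 0 1"
  by (simp add: sphere_measure_def space_scale_measure space_restrict_space)

lemma sets_sphere_measure: "sets (sphere_measure :: 'a::euclidean_space measure) = sets (restrict_space borel (sphere 0 1))"
  by (simp add: sphere_measure_def)

lemma borel_measurable_sphere_measureI:
  "f \<in> borel \<rightarrow>\<^sub>M N \<Longrightarrow> f \<in> (sphere_measure :: 'a::euclidean_space measure) \<rightarrow>\<^sub>M N"
  using measurable_restrict_space1 measurable_cong_sets[OF sets_sphere_measure refl] by blast

text \<open>Spherical integrals become integrals over the punctured ball of functions that are
  constant along rays. Hence substitution rules on the sphere follow from maps of the ball.\<close>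

lemma nn_integral_sphere_measure:
  fixes g :: "'a::euclidean_space \<Rightarrow> ennreal"
  assumes [measurable]: "g \<in> borel_measurable borel"
  shows "(\<integral>\<^sup>+\<eta>. g \<eta> \<partial>sphere_measure) = of_nat DIM('a) * (\<integral>\<^sup>+x\<in>ball 0 1 - {0}. g (x /\<^sub>R norm x) \<partial>lborel)"
proof -
  let ?R = "restrict_space lborel (ball 0 1 - {0}) :: 'a measure"
  have m: "(\<lambda>x. x /\<^sub>R norm x) \<in> ?R \<rightarrow>\<^sub>M restrict_space borel (sphere 0 1)"
  proof (rule measurable_restrict_space2)
    show "(\<lambda>x. x /\<^sub>R norm x) \<in> space ?R \<rightarrow> sphere 0 1"
      by (auto simp: space_restrict_space)
    show "(\<lambda>x. x /\<^sub>R norm x) \<in> ?R \<rightarrow>\<^sub>M borel"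
      by (rule measurable_restrict_space1) measurable
  qed
  have g: "g \<in> borel_measurable (distr ?R (restrict_space borel (sphere 0 1)) (\<lambda>x. x /\<^sub>R norm x))"
    by (simp add: measurable_restrict_space1)
  have "(\<integral>\<^sup>+\<eta>. g \<eta> \<partial>sphere_measure)
      = of_nat DIM('a) * (\<integral>\<^sup>+x. g (x /\<^sub>R norm x) \<partial>?R)"
    unfolding sphere_measure_def
    by (subst nn_integral_scale_measure[OF g], subst nn_integral_distr[OF m]) (simp_all add: measurable_restrict_space1)
  also have "(\<integral>\<^sup>+x. g (x /\<^sub>R norm x) \<partial>?R) = (\<integral>\<^sup>+x\<in>ball 0 1 - {0}. g (x /\<^sub>R norm x) \<partial>lborel)"
    by (subst nn_integral_restrict_space) auto
  finally show ?thesis .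
qed

lemma emeasure_sphere_measure_space: "emeasure (sphere_measure :: 'a::euclidean_space measure) (sphere 0 1)
    = of_nat DIM('a) * emeasure lborel (ball 0 1 :: 'a set)"
proof -
  have "emeasure (sphere_measure :: 'a measure) (sphere 0 1) = (\<integral>\<^sup>+\<eta>. 1 \<partial>(sphere_measure :: 'a measure))"
    by simp
  also have "\<dots> = of_nat DIM('a) * emeasure lborel (ball 0 1 - {0} :: 'a set)"
    by (subst nn_integral_sphere_measure) simp_all
  also have "emeasure lborel (ball 0 1 - {0} :: 'a set) = emeasure lborel (ball 0 1 :: 'a set)"
    by (rule emeasure_Diff_null_set) auto
  finally show ?thesis .
qed

interpretation sphere: finite_measure "sphere_measure :: 'a::euclidean_space measure"
proof
  have "emeasure lborel (ball 0 1 :: 'a set) < \<infinity>"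
    using emeasure_lborel_ball_finite by blast
  then show "emeasure (sphere_measure :: 'a measure) (space sphere_measure) \<noteq> \<infinity>"
    by (simp add: emeasure_sphere_measure_space ennreal_mult_eq_top_iff)
qed

lemma sphere_area_pos: "0 < sphere_area TYPE('a::euclidean_space)"
proof -
  have "emeasure lborel (ball 0 1 :: 'a set) \<noteq> 0"
    using content_ball_pos[of 1 "0::'a"] by (auto simp: measure_def)
  then show ?thesis
    unfolding sphere_area_def
    using emeasure_lborel_ball_finite[of "0::'a" 1] DIM_positive[where 'a='a]
    by (simp add: measure_def emeasure_sphere_measure_space enn2real_positive_iff ennreal_zero_less_mult_iff
        ennreal_mult_less_top of_nat_less_top zero_less_iff_neq_zero)
qed

section \<open>Reflections in hyperplanes through the origin\<close>

definition hrefl :: "'a::euclidean_space \<Rightarrow> 'a \<Rightarrow> 'a" where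
  "hrefl \<nu> x = x - (2 * (x \<bullet> \<nu>)) *\<^sub>R \<nu>"

lemma linear_refl: "linear (hrefl \<nu>)"
  by (intro linearI) (simp_all add: hrefl_def algebra_simps)

lemma inner_refl [simp]: "norm \<nu> = 1 \<Longrightarrow> hrefl \<nu> x \<bullet> hrefl \<nu> y = x \<bullet> y"
  by (simp add: hrefl_def inner_diff_left inner_diff_right norm_eq_1 inner_commute[of \<nu> y])

lemma norm_refl [simp]: "norm \<nu> = 1 \<Longrightarrow> norm (hrefl \<nu> x) = norm x"
  by (simp add: norm_eq_sqrt_inner[of "hrefl \<nu> x"] norm_eq_sqrt_inner[of x])

lemma refl_refl [simp]: "norm \<nu> = 1 \<Longrightarrow> hrefl \<nu> (hrefl \<nu> x) = x"
  by (simp add: hrefl_def inner_diff_left norm_eq_1)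

lemma hrefl_0 [simp]: "hrefl \<nu> 0 = 0"
  by (simp add: hrefl_def)

lemma inner_refl_axis [simp]: "norm \<nu> = 1 \<Longrightarrow> hrefl \<nu> x \<bullet> \<nu> = - (x \<bullet> \<nu>)"
  by (simp add: hrefl_def inner_diff_left norm_eq_1)

lemma orthogonal_transformation_refl: "norm \<nu> = 1 \<Longrightarrow> orthogonal_transformation (hrefl \<nu>)"
  by (simp add: orthogonal_transformation_def linear_refl)

lemma refl_borel [measurable]: "hrefl \<nu> \<in> borel \<rightarrow>\<^sub>M borel"
  unfolding hrefl_def by measurable

lemma norm_refl_diff: "norm \<nu> = 1 \<Longrightarrow> norm (hrefl \<nu> x - hrefl \<nu> y) = norm (x - y)"
  using norm_refl[of \<nu> "x - y"] by (simp add: linear_diff[OF linear_refl])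

lemma norm_refl_diff1: "norm \<nu> = 1 \<Longrightarrow> norm (hrefl \<nu> x - y) = norm (x - hrefl \<nu> y)"
  using norm_refl_diff[of \<nu> x "hrefl \<nu> y"] by simp

lemma refl_ball: "norm \<nu> = 1 \<Longrightarrow> hrefl \<nu> ` (ball 0 1) = ball 0 1"
proof -
  assume \<nu>: "norm \<nu> = 1"
  have "x \<in> hrefl \<nu> ` ball 0 1" if "x \<in> ball 0 1" for x
    using that \<nu> by (intro image_eqI[of _ _ "hrefl \<nu> x"]) simp_all
  then show ?thesis
    using \<nu> by auto
qed

lemma nn_integral_refl_ball:
  fixes g :: "'a::euclidean_space \<Rightarrow> ennreal"
  assumes \<nu>: "norm \<nu> = 1" and [measurable]: "g \<in> borel_measurable borel"
  shows "(\<integral>\<^sup>+x\<in>ball 0 1. g (hrefl \<nu> x) \<partial>lborel) = (\<integral>\<^sup>+x\<in>ball 0 1. g x \<partial>lborel)"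
proof -
  have "(\<integral>\<^sup>+x\<in>ball 0 1. ennreal 1 * g (hrefl \<nu> x) \<partial>lborel) = (\<integral>\<^sup>+y\<in>hrefl \<nu> ` ball 0 1. g y \<partial>lborel)"
  proof (rule nn_integral_substitution[where f' = "\<lambda>_. hrefl \<nu>" and B = 1])
    show "emeasure lborel (ball 0 1 :: 'a set) < \<infinity>"
      using emeasure_lborel_ball_finite by blast
    show "(hrefl \<nu> has_derivative hrefl \<nu>) (at x within ball 0 1)" for x
      using linear_refl linear_conv_bounded_linear bounded_linear_imp_has_derivative by blast
    show "inj_on (hrefl \<nu>) (ball 0 1)"
      using \<nu> by (metis inj_onI refl_refl)
    show "1 = jac (hrefl \<nu>)"
      using jac_orthogonal orthogonal_transformation_refl \<nu> by metis
    show "hrefl \<nu> ` ball 0 1 \<in> sets borel"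
      unfolding refl_ball[OF \<nu>] by simp
  qed (rule assms order_refl borel_measurable_const refl_borel borel_open open_ball)+
  then show ?thesis
    using \<nu> by (simp add: refl_ball)
qed

text \<open>A reflection is linear and preserves norms, so it commutes with the radial projection.
  The indicator of the complement of the origin is carried along so that the rule for the full ball
  applies.\<close>

lemma nn_integral_refl_sphere:
  fixes g :: "'a::euclidean_space \<Rightarrow> ennreal"
  assumes \<nu>: "norm \<nu> = 1" and [measurable]: "g \<in> borel_measurable borel"
  shows "(\<integral>\<^sup>+\<eta>. g (hrefl \<nu> \<eta>) \<partial>sphere_measure) = (\<integral>\<^sup>+\<eta>. g \<eta> \<partial>sphere_measure)"
proof -
  have eq: "(\<integral>\<^sup>+x\<in>ball 0 1 - {0}. h (x /\<^sub>R norm x) \<partial>lborel)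
      = (\<integral>\<^sup>+x\<in>ball 0 1. h (x /\<^sub>R norm x) * indicator (- {0}) x \<partial>lborel)" for h :: "'a \<Rightarrow> ennreal"
    by (rule nn_integral_cong) (auto simp: indicator_def)
  have "(\<integral>\<^sup>+x\<in>ball 0 1. g (hrefl \<nu> (x /\<^sub>R norm x)) * indicator (- {0}) x \<partial>lborel)
      = (\<integral>\<^sup>+x\<in>ball 0 1. g (hrefl \<nu> x /\<^sub>R norm (hrefl \<nu> x)) * indicator (- {0}) (hrefl \<nu> x) \<partial>lborel)"
    using \<nu> by (intro nn_integral_cong)
      (auto simp: linear_scale[OF linear_refl] indicator_def dest: arg_cong[of _ _ norm])
  also have "\<dots> = (\<integral>\<^sup>+x\<in>ball 0 1. g (x /\<^sub>R norm x) * indicator (- {0}) x \<partial>lborel)"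
    by (rule nn_integral_refl_ball[OF \<nu>]) measurable
  finally show ?thesis
    by (simp add: nn_integral_sphere_measure eq[of g] eq[of "\<lambda>y. g (hrefl \<nu> y)"])
qed

section \<open>Inversions that preserve the unit ball\<close>

definition inv_fac :: "'a::euclidean_space \<Rightarrow> 'a \<Rightarrow> real" where
  "inv_fac a x = (a \<bullet> a - 1) / ((x - a) \<bullet> (x - a))"

text \<open>Inversion in the sphere with centre \<open>a\<close> and squared radius a \<bullet> a -
  1. For |a| > 1 this sphere meets the unit sphere at right angles, which is why the unit ball is
  preserved; \<open>inv_fac a x\<close> is the local scale factor at \<open>x\<close>.\<close>

definition inv_map :: "'a::euclidean_space \<Rightarrow> 'a \<Rightarrow> 'a" where
  "inv_map a x = a + inv_fac a x *\<^sub>R (x - a)"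

lemma inv_fac_borel [measurable]: "inv_fac a \<in> borel_measurable borel"
  unfolding inv_fac_def by measurable

lemma inv_map_borel [measurable]: "inv_map a \<in> borel \<rightarrow>\<^sub>M borel"
  unfolding inv_map_def by measurable

context
  fixes a :: "'a::euclidean_space"
  assumes a: "1 < norm a"
begin

lemma inversion_center_inner: "1 < a \<bullet> a"
  using a by (simp add: dot_square_norm one_less_power)

lemma inversion_center_ne: "norm x \<le> 1 \<Longrightarrow> x \<noteq> a"
  using a by auto

lemma inversion_denom_pos: "x \<noteq> a \<Longrightarrow> 0 < (x - a) \<bullet> (x - a)"
  by simp

lemma inv_fac_pos: "x \<noteq> a \<Longrightarrow> 0 < inv_fac a x"
  using inversion_center_inner by (simp add: inv_fac_def)

lemma inv_fac_denom: "x \<noteq> a \<Longrightarrow> inv_fac a x * ((x - a) \<bullet> (x - a)) = a \<bullet> a - 1"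
  by (simp add: inv_fac_def)

lemma inv_map_diff_center: "inv_map a x - a = inv_fac a x *\<^sub>R (x - a)"
  by (simp add: inv_map_def)

lemma inv_fac_inv_map: "x \<noteq> a \<Longrightarrow> inv_fac a (inv_map a x) = 1 / inv_fac a x"
  using inv_fac_pos[of x] inversion_center_inner
  by (simp add: inv_fac_def[of a "inv_map a x"] inv_map_diff_center) (simp add: inv_fac_def)

lemma inv_map_inv_map: "x \<noteq> a \<Longrightarrow> inv_map a (inv_map a x) = x"
  using inv_fac_pos[of x]
  by (simp add: inv_map_def[of a "inv_map a x"] inv_map_diff_center inv_fac_inv_map)

text \<open>Follows by expanding the square and replacing
  \<open>l * ((x - a) \<bullet> (x - a))\<close> by its constant value. The identity shows at once
  that ball and sphere are preserved and that the weight 1 - |x|^2 scales with the conformal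
  factor.\<close>

lemma inv_map_norm:
  assumes "x \<noteq> a"
  shows "1 - inv_map a x \<bullet> inv_map a x = inv_fac a x * (1 - x \<bullet> x)"
proof -
  define l where "l = inv_fac a x"
  have l: "l * ((x - a) \<bullet> (x - a)) = a \<bullet> a - 1"
    unfolding l_def using assms by (rule inv_fac_denom)
  have "inv_map a x \<bullet> inv_map a x = a \<bullet> a + 2 * l * (a \<bullet> (x - a)) + l * (l * ((x - a) \<bullet> (x - a)))"
    unfolding inv_map_def l_def[symmetric] by (simp add: algebra_simps inner_commute)
  also have "\<dots> = a \<bullet> a + 2 * l * (a \<bullet> (x - a)) + l * (a \<bullet> a - 1)"
    by (simp only: l)
  finally have "1 - inv_map a x \<bullet> inv_map a x = - (l * ((x - a) \<bullet> (x - a))) - 2 * l * (a \<bullet> (x - a)) - l * (a \<bullet> a - 1)"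
    using l by simp
  also have "\<dots> = l * (1 - x \<bullet> x)"
    by (simp add: algebra_simps inner_commute)
  finally show ?thesis
    by (simp add: l_def)
qed

lemma inv_map_dist:
  assumes x: "x \<noteq> a" and y: "y \<noteq> a"
  shows "(norm (inv_map a x - inv_map a y))\<^sup>2 = inv_fac a x * inv_fac a y * (norm (x - y))\<^sup>2"
proof -
  define l m where "l = inv_fac a x" and "m = inv_fac a y"
  define X Y where "X = x - a" and "Y = y - a"
  have l: "l * (X \<bullet> X) = a \<bullet> a - 1" and m: "m * (Y \<bullet> Y) = a \<bullet> a - 1"
    unfolding l_def m_def X_def Y_def using x y by (simp_all add: inv_fac_denom)
  have "inv_map a x - inv_map a y = l *\<^sub>R X - m *\<^sub>R Y"
    by (simp add: inv_map_def l_def m_def X_def Y_def)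
  moreover have "(norm (l *\<^sub>R X - m *\<^sub>R Y))\<^sup>2 = l * (l * (X \<bullet> X)) - 2 * l * m * (X \<bullet> Y) + m * (m * (Y \<bullet> Y))"
    by (simp add: power2_norm_eq_inner inner_diff_left inner_diff_right inner_commute[of Y X] algebra_simps)
  ultimately have "(norm (inv_map a x - inv_map a y))\<^sup>2 = l * (l * (X \<bullet> X)) - 2 * l * m * (X \<bullet> Y) + m * (m * (Y \<bullet> Y))"
    by simp
  also have "\<dots> = l * (m * (Y \<bullet> Y)) - 2 * l * m * (X \<bullet> Y) + m * (l * (X \<bullet> X))"
    by (simp only: l m)
  also have "\<dots> = l * m * ((X - Y) \<bullet> (X - Y))"
    by (simp add: inner_diff_left inner_diff_right inner_commute[of Y X] algebra_simps)
  also have "X - Y = x - y"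
    by (simp add: X_def Y_def)
  finally show ?thesis
    by (simp add: l_def m_def power2_norm_eq_inner)
qed

text \<open>Differentiating the factor adds a rank-one term along x - a. Together with the scaling
  it is the reflection along x - a, so the derivative is a multiple of an isometry.\<close>

lemma inv_map_has_derivative:
  assumes x: "x \<noteq> a"
  shows "(inv_map a has_derivative (\<lambda>h. inv_fac a x *\<^sub>R hrefl ((x - a) /\<^sub>R norm (x - a)) h)) (at x within S)"
proof -
  define N where "N = (x - a) \<bullet> (x - a)"
  have N: "N > 0" "norm (x - a) * norm (x - a) = N"
    using x by (simp_all add: N_def dot_square_norm power2_eq_square)
  have "(inv_map a has_derivative (\<lambda>h. inv_fac a x *\<^sub>R h
       + (- ((a \<bullet> a - 1) * (2 * ((x - a) \<bullet> h))) / (N * N)) *\<^sub>R (x - a))) (at x within S)"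
    unfolding inv_map_def[abs_def] inv_fac_def[abs_def]
    using x N(1) unfolding N_def
    by (auto intro!: derivative_eq_intros simp: inner_commute field_simps)
  moreover have "inv_fac a x *\<^sub>R h + (- ((a \<bullet> a - 1) * (2 * ((x - a) \<bullet> h))) / (N * N)) *\<^sub>R (x - a)
     = inv_fac a x *\<^sub>R hrefl ((x - a) /\<^sub>R norm (x - a)) h" for h
  proof -
    have "hrefl ((x - a) /\<^sub>R norm (x - a)) h = h - (2 * (h \<bullet> (x - a)) / (norm (x - a) * norm (x - a))) *\<^sub>R (x - a)"
      by (simp add: hrefl_def divide_inverse mult_ac)
    then show ?thesis
      using N by (simp add: inv_fac_def N_def[symmetric] scaleR_diff_right inner_commute)
  qed
  ultimately show ?thesis
    by simp
qed

lemma inv_map_norm_less_iff: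
  assumes "x \<noteq> a"
  shows "norm (inv_map a x) < 1 \<longleftrightarrow> norm x < 1"
proof -
  have "norm y < 1 \<longleftrightarrow> 0 < 1 - y \<bullet> y" for y :: 'a
    by (simp add: dot_square_norm abs_square_less_1)
  then show ?thesis
    using inv_map_norm[OF assms] inv_fac_pos[OF assms] by (simp only: zero_less_mult_iff) auto
qed

lemma inv_map_norm_eq_iff: "x \<noteq> a \<Longrightarrow> norm (inv_map a x) = 1 \<longleftrightarrow> norm x = 1"
  using inv_map_norm[of x] inv_fac_pos[of x]
  by (auto simp: norm_eq_1)

lemma inv_map_norm_le_iff: "x \<noteq> a \<Longrightarrow> norm (inv_map a x) \<le> 1 \<longleftrightarrow> norm x \<le> 1"
  using inv_map_norm_less_iff[of x] inv_map_norm_eq_iff[of x] by linarith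

lemma inv_map_ball: "inv_map a ` ball 0 1 = ball 0 1"
proof -
  have "x \<in> inv_map a ` ball 0 1" if "x \<in> ball 0 1" for x
    using that inv_map_norm_less_iff[of x] inversion_center_ne[of x] inv_map_inv_map[of x]
    by (intro image_eqI[of _ _ "inv_map a x"]) simp_all
  then show ?thesis
    using inv_map_norm_less_iff inversion_center_ne by auto
qed

lemma inj_on_inv_map: "inj_on (inv_map a) (cball 0 1)"
  using inv_map_inv_map inversion_center_ne
  by (intro inj_on_inverseI[of _ "inv_map a"]) simp

lemma inv_fac_le:
  assumes "norm x \<le> 1"
  shows "inv_fac a x \<le> (a \<bullet> a - 1) / (norm a - 1)\<^sup>2"
proof -
  have "norm a - 1 \<le> norm (x - a)"
    using assms norm_triangle_ineq2[of a x] by (simp add: norm_minus_commute)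
  then have "(norm a - 1)\<^sup>2 \<le> (x - a) \<bullet> (x - a)"
    using a by (simp add: dot_square_norm power_mono)
  then show ?thesis
    unfolding inv_fac_def
    using a inversion_center_inner inversion_denom_pos[OF inversion_center_ne[OF assms]]
    by (intro divide_left_mono) auto
qed

lemma norm_normalize_diff: "x \<noteq> a \<Longrightarrow> norm ((x - a) /\<^sub>R norm (x - a)) = 1"
  by simp

lemma nn_integral_inversion_ball:
  fixes g :: "'a \<Rightarrow> ennreal"
  assumes [measurable]: "g \<in> borel_measurable borel"
  shows "(\<integral>\<^sup>+x\<in>ball 0 1. ennreal (inv_fac a x ^ DIM('a)) * g (inv_map a x) \<partial>lborel) = (\<integral>\<^sup>+x\<in>ball 0 1. g x \<partial>lborel)"
proof -
  let ?B = "(a \<bullet> a - 1) / (norm a - 1)\<^sup>2"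
  have "(\<integral>\<^sup>+x\<in>ball 0 1. ennreal (inv_fac a x ^ DIM('a)) * g (inv_map a x) \<partial>lborel)
      = (\<integral>\<^sup>+y\<in>inv_map a ` ball 0 1. g y \<partial>lborel)"
  proof (rule nn_integral_substitution
      [where f' = "\<lambda>x h. inv_fac a x *\<^sub>R hrefl ((x - a) /\<^sub>R norm (x - a)) h" and B = "?B ^ DIM('a)"])
    show "emeasure lborel (ball 0 1 :: 'a set) < \<infinity>"
      using emeasure_lborel_ball_finite by blast
    show "inv_map a ` ball 0 1 \<in> sets borel"
      unfolding inv_map_ball by simp
    show "inj_on (inv_map a) (ball 0 1)"
      using inj_on_inv_map ball_subset_cball inj_on_subset by blast
    fix x :: 'a
    assume "x \<in> ball 0 1"
    then have x: "x \<noteq> a" "norm x \<le> 1"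
      using inversion_center_ne[of x] by auto
    show "(inv_map a has_derivative (\<lambda>h. inv_fac a x *\<^sub>R hrefl ((x - a) /\<^sub>R norm (x - a)) h)) (at x within ball 0 1)"
      by (rule inv_map_has_derivative[OF x(1)])
    show "inv_fac a x ^ DIM('a) = jac (\<lambda>h. inv_fac a x *\<^sub>R hrefl ((x - a) /\<^sub>R norm (x - a)) h)"
      using jac_orthogonal[OF orthogonal_transformation_refl[OF norm_normalize_diff[OF x(1)]]] inv_fac_pos[OF x(1)]
      by (simp add: jac_scaleR linear_refl)
    show "inv_fac a x ^ DIM('a) \<le> ?B ^ DIM('a)"
      using inv_fac_pos[OF x(1)] inv_fac_le[OF x(2)] by (intro power_mono) simp_all
  qed (use assms in measurable)
  then show ?thesis
    by (simp add: inv_map_ball)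
qed

text \<open>The line through \<open>a\<close> and \<eta> meets the sphere in two points (which
  coincide for a tangent); both the inversion and the reflection along \<eta> - a exchange them. As
  this reflection is also the linear part of the derivative at \<eta>, it can be factored out of the
  derivative of the radial extension.\<close>

lemma inv_map_eq_refl:
  assumes "norm \<eta> = 1"
  shows "inv_map a \<eta> = hrefl ((\<eta> - a) /\<^sub>R norm (\<eta> - a)) \<eta>"
proof -
  define N where "N = (\<eta> - a) \<bullet> (\<eta> - a)"
  have N: "N > 0" "norm (\<eta> - a) * norm (\<eta> - a) = N"
    using inversion_center_ne[of \<eta>] assms by (simp_all add: N_def dot_square_norm power2_eq_square)
  have 1: "hrefl ((\<eta> - a) /\<^sub>R norm (\<eta> - a)) \<eta> = \<eta> - (2 * (\<eta> \<bullet> (\<eta> - a)) / (norm (\<eta> - a) * norm (\<eta> - a))) *\<^sub>R (\<eta> - a)"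
    by (simp add: hrefl_def divide_inverse mult_ac)
  have "a \<bullet> a - 1 = N - 2 * (\<eta> \<bullet> (\<eta> - a))"
    using assms by (simp add: N_def norm_eq_1 inner_diff_left inner_diff_right inner_commute)
  then have "inv_fac a \<eta> = 1 - 2 * (\<eta> \<bullet> (\<eta> - a)) / N"
    using N(1) by (simp add: inv_fac_def N_def[symmetric] diff_divide_distrib)
  then show ?thesis
    unfolding 1 N(2) by (simp add: inv_map_def scaleR_diff_left)
qed

text \<open>The radial extension \<open>x \<mapsto> |x| I(x/|x|)\<close> of the inversion preserves the unit ball,
  and its Jacobian is that of the restriction of \<open>I\<close> to the sphere.\<close>

lemma nn_integral_inversion_sphere:
  fixes g :: "'a \<Rightarrow> ennreal"
  assumes [measurable]: "g \<in> borel_measurable borel"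
  shows "(\<integral>\<^sup>+\<eta>. ennreal (inv_fac a \<eta> ^ (DIM('a) - 1)) * g (inv_map a \<eta>) \<partial>sphere_measure) = (\<integral>\<^sup>+\<eta>. g \<eta> \<partial>sphere_measure)"
proof -
  let ?B = "(a \<bullet> a - 1) / (norm a - 1)\<^sup>2"
  let ?U = "ball 0 1 - {0} :: 'a set"
  define e where "e x = x /\<^sub>R norm x" for x :: 'a
  define F where "F x = norm x *\<^sub>R inv_map a (e x)" for x
  define R where "R = (\<lambda>x::'a. hrefl ((e x - a) /\<^sub>R norm (e x - a)))"
  \<comment> \<open>The radial direction is kept in length and the tangential directions are scaled
    by \<open>inv_fac\<close>; the isometry \<open>R x\<close> acts afterwards. The radial component
    has the image \<open>R x (e x)\<close> because of \<open>inv_map_eq_refl\<close>.\<close>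
  define F' where "F' = (\<lambda>x h. R x ((h \<bullet> e x) *\<^sub>R e x + inv_fac a (e x) *\<^sub>R (h - (h \<bullet> e x) *\<^sub>R e x)))"
  have [measurable]: "e \<in> borel \<rightarrow>\<^sub>M borel" "F \<in> borel \<rightarrow>\<^sub>M borel"
    unfolding e_def[abs_def] F_def[abs_def] by measurable
  have e1: "norm (e x) = 1" if "x \<noteq> 0" for x
    using that by (simp add: e_def)
  have ea: "e x \<noteq> a" if "x \<noteq> 0" for x
    using that e1[of x] inversion_center_ne[of "e x"] by simp
  have Ie1: "norm (inv_map a (e x)) = 1" if "x \<noteq> 0" for x
    using inv_map_norm_eq_iff[OF ea[OF that]] e1[OF that] by simp
  have nF: "norm (F x) = norm x" for x
    using Ie1[of x] by (cases "x = 0") (simp_all add: F_def)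
  have F0: "F x = 0 \<longleftrightarrow> x = 0" for x
    using nF[of x] norm_eq_zero[of x] norm_eq_zero[of "F x"] by linarith
  have eF: "e (F x) = inv_map a (e x)" if "x \<noteq> 0" for x
    using that nF[of x] by (simp add: e_def[of "F x"]) (simp add: F_def)
  have FF: "F (F x) = x" if "x \<noteq> 0" for x
  proof -
    have "F (F x) = norm (F x) *\<^sub>R inv_map a (e (F x))"
      by (simp add: F_def[of "F x"])
    also have "\<dots> = norm x *\<^sub>R e x"
      using that by (simp add: nF eF inv_map_inv_map ea)
    finally show ?thesis
      using that by (simp add: e_def)
  qed
  have FU: "F ` ?U = ?U"
  proof -
    have "x \<in> F ` ?U" if "x \<in> ?U" for x
    proof (rule image_eqI[of _ _ "F x"])
      show "x = F (F x)"
        using FF that by simp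
      show "F x \<in> ?U"
        using nF[of x] F0[of x] that by simp
    qed
    then have "?U \<subseteq> F ` ?U"
      by (rule subsetI)
    moreover have "F ` ?U \<subseteq> ?U"
      by (rule image_subsetI) (simp add: nF F0)
    ultimately show ?thesis
      by (rule equalityI[rotated])
  qed
  have "(\<integral>\<^sup>+x\<in>?U. ennreal (inv_fac a (e x) ^ (DIM('a) - 1)) * g (e (F x)) \<partial>lborel)
      = (\<integral>\<^sup>+y\<in>F ` ?U. g (e y) \<partial>lborel)"
  proof (rule nn_integral_substitution[where f' = F' and B = "?B ^ (DIM('a) - 1)"])
    have "emeasure lborel ?U \<le> emeasure lborel (ball 0 1 :: 'a set)"
      by (intro emeasure_mono) auto
    then show "emeasure lborel ?U < \<infinity>"
      using emeasure_lborel_ball_finite le_less_trans by blast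
    show "F ` ?U \<in> sets borel"
      unfolding FU by simp
    show "inj_on F ?U"
      by (intro inj_on_inverseI[of _ F]) (simp add: FF)
    fix x
    assume "x \<in> ?U"
    then have x: "x \<noteq> 0" "norm (e x) = 1"
      using e1 by simp_all
    note orth = orthogonal_transformation_refl[OF norm_normalize_diff[OF ea[OF x(1)]]]
    have der_n: "(norm has_derivative (\<lambda>h. h \<bullet> e x)) (at x within ?U)"
      using has_derivative_at_withinI[OF has_derivative_norm[OF x(1)]] by (simp add: e_def sgn_div_norm)
    have "((\<lambda>x. inverse (norm x) *\<^sub>R x) has_derivative
        (\<lambda>h. inverse (norm x) *\<^sub>R h + (- (inverse (norm x) * (h \<bullet> e x) * inverse (norm x))) *\<^sub>R x)) (at x within ?U)"
      by (rule has_derivative_scaleR[OF has_derivative_compose[OF der_n has_derivative_inverse'] has_derivative_ident])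
        (use x(1) in simp)
    moreover have "inverse (norm x) *\<^sub>R h + (- (inverse (norm x) * (h \<bullet> e x) * inverse (norm x))) *\<^sub>R x
        = (h - (h \<bullet> e x) *\<^sub>R e x) /\<^sub>R norm x" for h
      by (simp add: e_def scaleR_diff_right)
    ultimately have der_e: "(e has_derivative (\<lambda>h. (h - (h \<bullet> e x) *\<^sub>R e x) /\<^sub>R norm x)) (at x within ?U)"
      by (simp add: e_def[abs_def])
    have "(F has_derivative (\<lambda>h. norm x *\<^sub>R (inv_fac a (e x) *\<^sub>R R x ((h - (h \<bullet> e x) *\<^sub>R e x) /\<^sub>R norm x))
        + (h \<bullet> e x) *\<^sub>R inv_map a (e x))) (at x within ?U)"
      unfolding F_def[abs_def]
    proof (rule has_derivative_scaleR)
      show "(norm has_derivative (\<lambda>h. h \<bullet> e x)) (at x within ?U)"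
        by (rule der_n)
      show "((\<lambda>x. inv_map a (e x)) has_derivative
          (\<lambda>h. inv_fac a (e x) *\<^sub>R R x ((h - (h \<bullet> e x) *\<^sub>R e x) /\<^sub>R norm x))) (at x within ?U)"
        using has_derivative_compose[OF der_e inv_map_has_derivative[OF ea[OF x(1)]]] by (simp add: R_def)
    qed
    moreover have "norm x *\<^sub>R (inv_fac a (e x) *\<^sub>R R x ((h - (h \<bullet> e x) *\<^sub>R e x) /\<^sub>R norm x))
        + (h \<bullet> e x) *\<^sub>R inv_map a (e x) = F' x h" for h
    proof -
      have "inv_map a (e x) = R x (e x)"
        unfolding R_def by (rule inv_map_eq_refl[OF x(2)])
      moreover have "linear (R x)"
        by (simp add: R_def linear_refl)
      ultimately show ?thesis
        using x(1) by (simp add: F'_def linear_add linear_scale)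
    qed
    ultimately show "(F has_derivative F' x) (at x within ?U)"
      by simp
    have lin: "linear (\<lambda>h. (h \<bullet> e x) *\<^sub>R e x + inv_fac a (e x) *\<^sub>R (h - (h \<bullet> e x) *\<^sub>R e x))"
      by (intro linearI) (simp_all add: algebra_simps)
    have "jac (F' x) = inv_fac a (e x) ^ (DIM('a) - 1)"
      using jac_compose[of "R x", OF _ lin] jac_orthogonal[OF orth] jac_axial[OF x(2) inv_fac_pos[OF ea[OF x(1)]]]
      by (simp add: F'_def R_def linear_refl comp_def)
    then show "inv_fac a (e x) ^ (DIM('a) - 1) = jac (F' x)"
      by simp
    show "inv_fac a (e x) ^ (DIM('a) - 1) \<le> ?B ^ (DIM('a) - 1)"
      using inv_fac_pos[OF ea[OF x(1)]] inv_fac_le[of "e x"] x(2) by (intro power_mono) simp_all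
  qed (use assms in measurable)
  then have "(\<integral>\<^sup>+x\<in>?U. g (e x) \<partial>lborel)
      = (\<integral>\<^sup>+x\<in>?U. ennreal (inv_fac a (e x) ^ (DIM('a) - 1)) * g (e (F x)) \<partial>lborel)"
    by (simp add: FU)
  also have "\<dots> = (\<integral>\<^sup>+x\<in>?U. ennreal (inv_fac a (e x) ^ (DIM('a) - 1)) * g (inv_map a (e x)) \<partial>lborel)"
    by (intro nn_integral_cong) (auto simp: indicator_def eF)
  finally show ?thesis
    by (simp add: nn_integral_sphere_measure flip: e_def)
qed

end

section \<open>Spherical and hyperbolic measure\<close>

text \<open>The surface measure regarded as a Borel measure on the whole space that is concentrated
  on the sphere. Functions can then be taken Borel on the whole space, and reflections and
  inversions are measurable without restricting domains.\<close>

definition sph :: "'a::euclidean_space measure" where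
  "sph = distr sphere_measure borel (\<lambda>x. x)"

lemma sets_sph [measurable_cong, simp]: "sets sph = sets borel"
  by (simp add: sph_def)

lemma space_sph [simp]: "space sph = UNIV"
  by (simp add: sph_def)

lemma id_sphere_measurable: "(\<lambda>x. x) \<in> sphere_measure \<rightarrow>\<^sub>M (borel :: 'a::euclidean_space measure)"
  by (rule borel_measurable_sphere_measureI) simp

lemma nn_integral_sph:
  "g \<in> borel_measurable borel \<Longrightarrow> (\<integral>\<^sup>+\<eta>. g \<eta> \<partial>sph) = (\<integral>\<^sup>+\<eta>. g \<eta> \<partial>(sphere_measure :: 'a::euclidean_space measure))"
  unfolding sph_def by (rule nn_integral_distr[OF id_sphere_measurable]) simp

lemma integral_sph:
  "g \<in> borel_measurable borel \<Longrightarrow> (\<integral>\<eta>. g \<eta> \<partial>sph) = (\<integral>\<eta>. (g \<eta> :: real) \<partial>(sphere_measure :: 'a::euclidean_space measure))"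
  unfolding sph_def by (rule integral_distr[OF id_sphere_measurable]) simp

lemma integrable_sph:
  "g \<in> borel_measurable borel \<Longrightarrow> integrable sph g \<longleftrightarrow> integrable (sphere_measure :: 'a::euclidean_space measure) (g :: 'a \<Rightarrow> real)"
  unfolding sph_def by (rule integrable_distr_eq[OF id_sphere_measurable]) simp

interpretation sph: finite_measure "sph :: 'a::euclidean_space measure"
  unfolding sph_def by (rule sphere.finite_measure_distr[OF id_sphere_measurable])

lemma measure_sph: "measure (sph :: 'a::euclidean_space measure) UNIV = sphere_area TYPE('a)"
  unfolding sph_def sphere_area_def by (subst measure_distr[OF id_sphere_measurable]) auto

lemma emeasure_sph: "emeasure (sph :: 'a::euclidean_space measure) UNIV = ennreal (sphere_area TYPE('a))"
  using sph.emeasure_eq_measure[of "UNIV :: 'a set"] by (simp add: measure_sph)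

lemma AE_sph: "AE \<eta> in sph. norm \<eta> = 1"
  unfolding sph_def by (subst AE_distr_iff[OF id_sphere_measurable]) (auto intro!: AE_I2)

lemma nn_integral_sph_ball:
  fixes g :: "'a::euclidean_space \<Rightarrow> ennreal"
  assumes "g \<in> borel_measurable borel"
  shows "(\<integral>\<^sup>+\<eta>. g \<eta> \<partial>sph) = of_nat DIM('a) * (\<integral>\<^sup>+x\<in>ball 0 1 - {0}. g (x /\<^sub>R norm x) \<partial>lborel)"
  using assms by (simp add: nn_integral_sph nn_integral_sphere_measure)

section \<open>Hyperbolic measure on the ball\<close>

definition wt :: "'a::euclidean_space \<Rightarrow> real" where
  "wt x = (1 - (norm x)\<^sup>2) / 2"

lemma wt_borel [measurable]: "wt \<in> borel_measurable borel"
  unfolding wt_def by measurable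

lemma wt_pos: "norm x < 1 \<Longrightarrow> 0 < wt x"
  by (simp add: wt_def abs_square_less_1)

lemma wt_le: "wt x \<le> 1 / 2"
  by (simp add: wt_def)

lemma wt_refl [simp]: "norm \<nu> = 1 \<Longrightarrow> wt (hrefl \<nu> x) = wt x"
  by (simp add: wt_def)

lemma wt_inversion: "1 < norm a \<Longrightarrow> x \<noteq> a \<Longrightarrow> wt (inv_map a x) = inv_fac a x * wt x"
  using inv_map_norm[of a x] by (simp add: wt_def dot_square_norm)

lemma ball_borel [measurable]: "ball x r \<in> sets borel"
  by simp

text \<open>The volume of the Poincare ball: the metric is |dx| / wt x, so the density is the power
  -n of \<open>wt\<close>. Because \<open>wt\<close> scales with the conformal factor, this measure
  is invariant under the inversions.\<close>

definition hyp :: "'a::euclidean_space measure" where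
  "hyp = density lborel (\<lambda>x. ennreal (wt x powr - real DIM('a)) * indicator (ball 0 1) x)"

lemma sets_hyp [measurable_cong, simp]: "sets hyp = sets borel"
  by (simp add: hyp_def)

lemma space_hyp [simp]: "space hyp = UNIV"
  by (simp add: hyp_def)

lemma nn_integral_hyp:
  fixes g :: "'a::euclidean_space \<Rightarrow> ennreal"
  assumes [measurable]: "g \<in> borel_measurable borel"
  shows "(\<integral>\<^sup>+x. g x \<partial>hyp) = (\<integral>\<^sup>+x\<in>ball 0 1. ennreal (wt x powr - real DIM('a)) * g x \<partial>lborel)"
  unfolding hyp_def by (subst nn_integral_density) (auto intro!: nn_integral_cong simp: mult_ac)

lemma AE_hyp: "AE x in (hyp :: 'a::euclidean_space measure). norm x < 1"
proof -
  have m: "(\<lambda>x::'a. ennreal (wt x powr - real DIM('a)) * indicator (ball 0 1) x) \<in> borel_measurable lborel"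
    by measurable
  show ?thesis
    unfolding hyp_def AE_density[OF m] by (auto intro!: AE_I2 simp: indicator_def split: if_splits)
qed

interpretation hyp: sigma_finite_measure "hyp :: 'a::euclidean_space measure"
  unfolding hyp_def
  by (subst sigma_finite_measure.sigma_finite_iff_density_finite[OF sigma_finite_lborel]) (auto simp: indicator_def intro!: AE_I2 ennreal_mult_less_top)

lemma nn_integral_refl_sph:
  assumes "norm \<nu> = 1" "g \<in> borel_measurable borel"
  shows "(\<integral>\<^sup>+\<eta>. g (hrefl \<nu> \<eta>) \<partial>sph) = (\<integral>\<^sup>+\<eta>. g \<eta> \<partial>(sph :: 'a::euclidean_space measure))"
  using nn_integral_refl_sphere[OF assms] assms(2) by (simp add: nn_integral_sph)

lemma nn_integral_refl_hyp:
  assumes \<nu>: "norm \<nu> = 1" and [measurable]: "g \<in> borel_measurable borel"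
  shows "(\<integral>\<^sup>+x. g (hrefl \<nu> x) \<partial>hyp) = (\<integral>\<^sup>+x. g x \<partial>(hyp :: 'a::euclidean_space measure))"
proof -
  have "(\<integral>\<^sup>+x. g (hrefl \<nu> x) \<partial>hyp)
      = (\<integral>\<^sup>+x\<in>ball 0 1. ennreal (wt (hrefl \<nu> x) powr - real DIM('a)) * g (hrefl \<nu> x) \<partial>lborel)"
    using \<nu> by (subst nn_integral_hyp) simp_all
  also have "\<dots> = (\<integral>\<^sup>+x\<in>ball 0 1. ennreal (wt x powr - real DIM('a)) * g x \<partial>lborel)"
    by (rule nn_integral_refl_ball[OF \<nu>]) measurable
  finally show ?thesis
    by (simp add: nn_integral_hyp)
qed

lemma nn_integral_inversion_sph:
  fixes a :: "'a::euclidean_space"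
  assumes "1 < norm a" "g \<in> borel_measurable borel"
  shows "(\<integral>\<^sup>+\<eta>. ennreal (inv_fac a \<eta> ^ (DIM('a) - 1)) * g (inv_map a \<eta>) \<partial>sph) = (\<integral>\<^sup>+\<eta>. g \<eta> \<partial>sph)"
  using nn_integral_inversion_sphere[OF assms] assms(2) by (simp add: nn_integral_sph)

lemma nn_integral_inversion_hyp:
  fixes a :: "'a::euclidean_space"
  assumes a: "1 < norm a" and [measurable]: "g \<in> borel_measurable borel"
  shows "(\<integral>\<^sup>+x. g (inv_map a x) \<partial>hyp) = (\<integral>\<^sup>+x. g x \<partial>hyp)"
proof -
  have "(\<integral>\<^sup>+x. g x \<partial>hyp) = (\<integral>\<^sup>+x\<in>ball 0 1. ennreal (inv_fac a x ^ DIM('a)) *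
      (ennreal (wt (inv_map a x) powr - real DIM('a)) * g (inv_map a x)) \<partial>lborel)"
    unfolding nn_integral_hyp[OF assms(2)] by (rule nn_integral_inversion_ball[OF a, symmetric]) measurable
  also have "\<dots> = (\<integral>\<^sup>+x\<in>ball 0 1. ennreal (wt x powr - real DIM('a)) * g (inv_map a x) \<partial>lborel)"
  proof (rule nn_integral_cong)
    fix x :: 'a
    show "ennreal (inv_fac a x ^ DIM('a)) * (ennreal (wt (inv_map a x) powr - real DIM('a)) * g (inv_map a x)) * indicator (ball 0 1) x
        = ennreal (wt x powr - real DIM('a)) * g (inv_map a x) * indicator (ball 0 1) x"
    proof (cases "norm x < 1")
      case True
      then have x: "x \<noteq> a" and w: "0 < wt x"
        using a wt_pos by auto
      have "inv_fac a x ^ DIM('a) * wt (inv_map a x) powr - real DIM('a) = wt x powr - real DIM('a)"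
        using inv_fac_pos[OF a x] w
        by (simp add: wt_inversion[OF a x] powr_mult powr_minus powr_realpow)
      then show ?thesis
        by (metis ennreal_mult' mult.assoc powr_ge_zero ennreal_mult'' )
    qed simp
  qed
  also have "\<dots> = (\<integral>\<^sup>+x. g (inv_map a x) \<partial>hyp)"
    by (subst nn_integral_hyp) simp_all
  finally show ?thesis
    by simp
qed

text \<open>Transfers a substitution rule from nonnegative functions to integrability and integrals
  of signed functions, by applying it to the absolute value and to the positive and negative
  parts.\<close>

lemma bochner_substitution:
  fixes h :: "'b \<Rightarrow> real"
  assumes sub: "\<And>g. g \<in> borel_measurable N \<Longrightarrow> (\<integral>\<^sup>+x. ennreal (w x) * g (\<phi> x) \<partial>M) = (\<integral>\<^sup>+y. g y \<partial>N)"
    and w: "w \<in> borel_measurable M" "AE x in M. 0 \<le> w x" and \<phi> [measurable]: "\<phi> \<in> M \<rightarrow>\<^sub>M N"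
    and h [measurable]: "h \<in> borel_measurable N"
  shows "integrable M (\<lambda>x. w x * h (\<phi> x)) \<longleftrightarrow> integrable N h"
    and "(\<integral>x. w x * h (\<phi> x) \<partial>M) = (\<integral>y. h y \<partial>N)"
proof -
  note [measurable] = w(1)
  have nn: "(\<integral>\<^sup>+x. ennreal (w x * f (\<phi> x)) \<partial>M) = (\<integral>\<^sup>+y. ennreal (f y) \<partial>N)"
    if "f \<in> borel_measurable N" for f :: "'b \<Rightarrow> real"
  proof -
    have "(\<integral>\<^sup>+x. ennreal (w x * f (\<phi> x)) \<partial>M) = (\<integral>\<^sup>+x. ennreal (w x) * ennreal (f (\<phi> x)) \<partial>M)"
      using w(2) by (intro nn_integral_cong_AE) (auto simp: ennreal_mult')
    also have "\<dots> = (\<integral>\<^sup>+y. ennreal (f y) \<partial>N)"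
      using that by (intro sub) simp
    finally show ?thesis .
  qed
  have "(\<integral>\<^sup>+x. ennreal (norm (w x * h (\<phi> x))) \<partial>M) = (\<integral>\<^sup>+x. ennreal (w x * \<bar>h (\<phi> x)\<bar>) \<partial>M)"
    using w(2) by (intro nn_integral_cong_AE) (auto simp: abs_mult)
  also have "\<dots> = (\<integral>\<^sup>+y. ennreal (norm (h y)) \<partial>N)"
    by (subst nn[of "\<lambda>y. \<bar>h y\<bar>"]) simp_all
  finally show 1: "integrable M (\<lambda>x. w x * h (\<phi> x)) \<longleftrightarrow> integrable N h"
    by (simp add: integrable_iff_bounded)
  show "(\<integral>x. w x * h (\<phi> x) \<partial>M) = (\<integral>y. h y \<partial>N)"
  proof (cases "integrable N h")
    case True
    then show ?thesis
      using 1 nn[of h] nn[of "\<lambda>y. - h y"] by (simp add: real_lebesgue_integral_def)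
  qed (use 1 in \<open>simp add: not_integrable_integral_eq\<close>)
qed

lemma
  fixes h :: "'a::euclidean_space \<Rightarrow> real"
  assumes \<nu>: "norm \<nu> = 1" and [measurable]: "h \<in> borel_measurable borel"
  shows integrable_refl_sph: "integrable sph (\<lambda>\<eta>. h (hrefl \<nu> \<eta>)) \<longleftrightarrow> integrable sph h"
    and integral_refl_sph: "(\<integral>\<eta>. h (hrefl \<nu> \<eta>) \<partial>sph) = (\<integral>\<eta>. h \<eta> \<partial>sph)"
  using bochner_substitution[where M = sph and w = "\<lambda>_. 1" and \<phi> = "hrefl \<nu>" and N = sph and h = h] nn_integral_refl_sph[OF \<nu>] by simp_all

lemma
  fixes h :: "'a::euclidean_space \<Rightarrow> real"
  assumes a: "1 < norm a" and [measurable]: "h \<in> borel_measurable borel"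
  shows integrable_inversion_sph: "integrable sph (\<lambda>\<eta>. inv_fac a \<eta> ^ (DIM('a) - 1) * h (inv_map a \<eta>)) \<longleftrightarrow> integrable sph h"
    and integral_inversion_sph: "(\<integral>\<eta>. inv_fac a \<eta> ^ (DIM('a) - 1) * h (inv_map a \<eta>) \<partial>sph) = (\<integral>\<eta>. h \<eta> \<partial>sph)"
proof -
  have "AE \<eta> in sph. 0 \<le> inv_fac a \<eta> ^ (DIM('a) - 1)"
    using AE_sph
  proof eventually_elim
    fix \<eta> :: 'a
    assume "norm \<eta> = 1"
    then show "0 \<le> inv_fac a \<eta> ^ (DIM('a) - 1)"
      using inv_fac_pos[OF a, of \<eta>] a by (cases "\<eta> = a") simp_all
  qed
  then show "integrable sph (\<lambda>\<eta>. inv_fac a \<eta> ^ (DIM('a) - 1) * h (inv_map a \<eta>)) \<longleftrightarrow> integrable sph h"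
    "(\<integral>\<eta>. inv_fac a \<eta> ^ (DIM('a) - 1) * h (inv_map a \<eta>) \<partial>sph) = (\<integral>\<eta>. h \<eta> \<partial>sph)"
    using bochner_substitution[where M = sph and w = "\<lambda>\<eta>. inv_fac a \<eta> ^ (DIM('a) - 1)" and \<phi> = "inv_map a" and N = sph and h = h]
      nn_integral_inversion_sph[OF a] by simp_all
qed

section \<open>The conformally covariant kernel and its transform\<close>

definition ker :: "real \<Rightarrow> 'a::euclidean_space \<Rightarrow> 'a \<Rightarrow> real" where
  "ker s \<xi> \<eta> = (wt \<xi> / (norm (\<xi> - \<eta>))\<^sup>2) powr s"

lemma ker_borel [measurable]: "(\<lambda>(\<xi>, \<eta>). ker s \<xi> \<eta>) \<in> borel_measurable (borel \<Otimes>\<^sub>M borel)"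
  unfolding ker_def by measurable

lemma ker_borel' [measurable]:
  assumes [measurable]: "f \<in> M \<rightarrow>\<^sub>M borel" "g \<in> M \<rightarrow>\<^sub>M borel"
  shows "(\<lambda>x. ker s (f x) (g x)) \<in> borel_measurable M"
  unfolding ker_def by measurable

lemma ker_nonneg [simp]: "0 \<le> ker s \<xi> \<eta>"
  by (simp add: ker_def)

lemma ker_refl: "norm \<nu> = 1 \<Longrightarrow> ker s (hrefl \<nu> \<xi>) (hrefl \<nu> \<eta>) = ker s \<xi> \<eta>"
  by (simp add: ker_def norm_refl_diff)

lemma ker_refl1: "norm \<nu> = 1 \<Longrightarrow> ker s (hrefl \<nu> \<xi>) \<eta> = ker s \<xi> (hrefl \<nu> \<eta>)"
  by (simp add: ker_def norm_refl_diff1)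

definition Tr :: "real \<Rightarrow> ('a::euclidean_space \<Rightarrow> real) \<Rightarrow> 'a \<Rightarrow> real" where
  "Tr s u \<xi> = (\<integral>\<eta>. ker s \<xi> \<eta> * u \<eta> \<partial>sph)"

lemma Tr_borel [measurable]:
  assumes [measurable]: "u \<in> borel_measurable borel"
  shows "Tr s u \<in> borel_measurable borel"
  unfolding Tr_def[abs_def] by measurable

lemma Tr_refl:
  assumes [simp]: "norm \<nu> = 1" and [measurable]: "u \<in> borel_measurable borel"
  shows "Tr s (\<lambda>\<eta>. u (hrefl \<nu> \<eta>)) \<xi> = Tr s u (hrefl \<nu> \<xi>)"
  using integral_refl_sph[of \<nu> "\<lambda>\<eta>. ker s (hrefl \<nu> \<xi>) \<eta> * u \<eta>"]
  by (simp add: Tr_def ker_refl)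

text \<open>The exponent is m - s with m the dimension of the sphere: the power m comes from the
  spherical Jacobian, the power -s from the kernel.\<close>

lemma Tr_inversion:
  fixes a :: "'a::euclidean_space"
  assumes a: "1 < norm a" and \<xi>: "norm \<xi> < 1" and [measurable]: "u \<in> borel_measurable borel"
  shows "Tr s (\<lambda>\<eta>. inv_fac a \<eta> powr (real (DIM('a) - 1) - s) * u (inv_map a \<eta>)) \<xi> = Tr s u (inv_map a \<xi>)"
proof -
  have "Tr s u (inv_map a \<xi>) = (\<integral>\<eta>. inv_fac a \<eta> ^ (DIM('a) - 1) * (ker s (inv_map a \<xi>) (inv_map a \<eta>) * u (inv_map a \<eta>)) \<partial>sph)"
    unfolding Tr_def by (rule integral_inversion_sph[OF a, symmetric]) measurable
  also have "\<dots> = (\<integral>\<eta>. ker s \<xi> \<eta> * (inv_fac a \<eta> powr (real (DIM('a) - 1) - s) * u (inv_map a \<eta>)) \<partial>sph)"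
  proof (rule integral_cong_AE)
    show "AE \<eta> in sph. inv_fac a \<eta> ^ (DIM('a) - 1) * (ker s (inv_map a \<xi>) (inv_map a \<eta>) * u (inv_map a \<eta>))
        = ker s \<xi> \<eta> * (inv_fac a \<eta> powr (real (DIM('a) - 1) - s) * u (inv_map a \<eta>))"
      using AE_sph
    proof eventually_elim
      fix \<eta> :: 'a
      assume \<eta>: "norm \<eta> = 1"
      have ne: "\<eta> \<noteq> a" "\<xi> \<noteq> a" "\<xi> \<noteq> \<eta>"
        using a \<xi> \<eta> by auto
      have pos: "0 < inv_fac a \<eta>" "0 < inv_fac a \<xi>" "0 < wt \<xi>"
        using inv_fac_pos[OF a] ne wt_pos \<xi> by auto
      \<comment> \<open>The factor at \<xi> cancels between the weight and the squared distance;
        only the reciprocal of the factor at \<eta> is left.\<close>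
      have "wt (inv_map a \<xi>) / (norm (inv_map a \<xi> - inv_map a \<eta>))\<^sup>2 = (wt \<xi> / (norm (\<xi> - \<eta>))\<^sup>2) * (1 / inv_fac a \<eta>)"
        using ne pos by (simp add: wt_inversion[OF a] inv_map_dist[OF a])
      then have "ker s (inv_map a \<xi>) (inv_map a \<eta>) = ker s \<xi> \<eta> * (1 / inv_fac a \<eta>) powr s"
        unfolding ker_def using pos by (simp only: powr_mult)
      also have "(1 / inv_fac a \<eta>) powr s = inv_fac a \<eta> powr - s"
        using pos by (simp add: powr_minus_divide powr_divide)
      finally show "inv_fac a \<eta> ^ (DIM('a) - 1) * (ker s (inv_map a \<xi>) (inv_map a \<eta>) * u (inv_map a \<eta>))
        = ker s \<xi> \<eta> * (inv_fac a \<eta> powr (real (DIM('a) - 1) - s) * u (inv_map a \<eta>))"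
        unfolding powr_realpow[OF pos(1), symmetric] by (simp only: powr_diff powr_minus_divide) simp
    qed
  qed measurable
  finally show ?thesis
    by (simp add: Tr_def)
qed

lemma refl_swap:
  assumes "norm \<eta> = norm \<zeta>" "\<eta> \<noteq> \<zeta>"
  shows "hrefl ((\<eta> - \<zeta>) /\<^sub>R norm (\<eta> - \<zeta>)) \<eta> = \<zeta>"
proof -
  define d where "d = \<eta> - \<zeta>"
  have N: "norm d * norm d = d \<bullet> d" "d \<bullet> d > 0"
    using assms by (simp_all add: d_def dot_square_norm power2_eq_square)
  have "\<eta> \<bullet> \<eta> = \<zeta> \<bullet> \<zeta>"
    using assms by (simp add: dot_square_norm)
  then have "2 * (\<eta> \<bullet> d) = d \<bullet> d"
    by (simp add: d_def inner_diff_left inner_diff_right inner_commute)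
  moreover have "hrefl (d /\<^sub>R norm d) \<eta> = \<eta> - (2 * (\<eta> \<bullet> d) / (norm d * norm d)) *\<^sub>R d"
    by (simp add: hrefl_def divide_inverse mult_ac)
  ultimately have "hrefl (d /\<^sub>R norm d) \<eta> = \<eta> - d"
    using N by simp
  then show ?thesis
    by (simp add: d_def)
qed

text \<open>The integral over \<xi> has the same value for every boundary point, since reflections
  act transitively on the sphere and preserve \<open>hyp\<close>. It therefore equals its spherical
  average, and Fubini moves the average onto the kernel.\<close>

lemma radial_average:
  fixes \<eta> :: "'a::euclidean_space"
  assumes \<eta>: "norm \<eta> = 1" and [measurable]: "F \<in> borel_measurable borel" "k \<in> borel_measurable borel"
  shows "ennreal (sphere_area TYPE('a)) * (\<integral>\<^sup>+\<xi>. F (norm \<xi>) * k (norm (\<xi> - \<eta>)) \<partial>hyp)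
       = (\<integral>\<^sup>+\<xi>. F (norm \<xi>) * (\<integral>\<^sup>+\<zeta>. k (norm (\<xi> - \<zeta>)) \<partial>sph) \<partial>(hyp :: 'a measure))"
proof -
  define A where "A \<zeta> = (\<integral>\<^sup>+\<xi>. F (norm \<xi>) * k (norm (\<xi> - \<zeta>)) \<partial>(hyp :: 'a measure))" for \<zeta> :: 'a
  interpret pair_sigma_finite "sph :: 'a measure" "hyp :: 'a measure" ..
  have eq: "A \<zeta> = A \<eta>" if "norm \<zeta> = 1" for \<zeta>
  proof (cases "\<zeta> = \<eta>")
    case False
    define \<nu> where "\<nu> = (\<zeta> - \<eta>) /\<^sub>R norm (\<zeta> - \<eta>)"
    have \<nu>: "norm \<nu> = 1" "hrefl \<nu> \<zeta> = \<eta>"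
      using False refl_swap[of \<zeta> \<eta>] that \<eta> by (simp_all add: \<nu>_def)
    have "A \<zeta> = (\<integral>\<^sup>+\<xi>. F (norm (hrefl \<nu> \<xi>)) * k (norm (hrefl \<nu> \<xi> - \<zeta>)) \<partial>(hyp :: 'a measure))"
      unfolding A_def using \<nu>(1) by (intro nn_integral_refl_hyp[symmetric]) simp_all
    also have "\<dots> = A \<eta>"
      unfolding A_def using \<nu> by (simp add: norm_refl_diff1)
    finally show ?thesis .
  qed simp
  have "AE \<zeta> in sph. A \<zeta> = A \<eta>"
    using AE_sph by eventually_elim (rule eq)
  then have "(\<integral>\<^sup>+\<zeta>. A \<zeta> \<partial>sph) = (\<integral>\<^sup>+\<zeta>. A \<eta> \<partial>(sph :: 'a measure))"
    by (rule nn_integral_cong_AE)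
  then have "ennreal (sphere_area TYPE('a)) * A \<eta> = (\<integral>\<^sup>+\<zeta>. A \<zeta> \<partial>sph)"
    by (simp add: emeasure_sph mult.commute)
  also have "\<dots> = (\<integral>\<^sup>+\<xi>. (\<integral>\<^sup>+\<zeta>. F (norm \<xi>) * k (norm (\<xi> - \<zeta>)) \<partial>sph) \<partial>(hyp :: 'a measure))"
    unfolding A_def by (rule Fubini'[symmetric]) measurable
  also have "\<dots> = (\<integral>\<^sup>+\<xi>. F (norm \<xi>) * (\<integral>\<^sup>+\<zeta>. k (norm (\<xi> - \<zeta>)) \<partial>sph) \<partial>(hyp :: 'a measure))"
    by (simp add: nn_integral_cmult)
  finally show ?thesis
    by (simp add: A_def)
qed

text \<open>The centre is the mirror image of \<zeta> in the unit sphere. Its inversion sends the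
  origin to \<zeta>, and its scale factor on the sphere is the basic Poisson quotient.\<close>

lemma inversion_center_of_point:
  fixes \<zeta> :: "'a::euclidean_space"
  assumes "norm \<zeta> < 1" "\<zeta> \<noteq> 0"
  defines "a \<equiv> \<zeta> /\<^sub>R (norm \<zeta>)\<^sup>2"
  shows "1 < norm a" "inv_map a 0 = \<zeta>" "norm \<eta> = 1 \<Longrightarrow> inv_fac a \<eta> = 2 * wt \<zeta> / (norm (\<zeta> - \<eta>))\<^sup>2"
proof -
  have na: "norm a = 1 / norm \<zeta>"
    using assms by (simp add: power2_eq_square divide_inverse)
  then show "1 < norm a"
    using assms by simp
  have aa: "a \<bullet> a = 1 / (norm \<zeta>)\<^sup>2"
    using na by (simp add: dot_square_norm power_divide)
  have "inv_map a 0 = (1 - (a \<bullet> a - 1) / (a \<bullet> a)) *\<^sub>R a"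
    by (simp add: inv_map_def inv_fac_def scaleR_diff_left)
  also have "1 - (a \<bullet> a - 1) / (a \<bullet> a) = (norm \<zeta>)\<^sup>2"
    unfolding aa using assms by (simp add: field_simps)
  finally show "inv_map a 0 = \<zeta>"
    using assms by (simp add: a_def)
  assume \<eta>: "norm \<eta> = 1"
  have "(\<eta> - a) \<bullet> (\<eta> - a) = 1 - 2 * (a \<bullet> \<eta>) + a \<bullet> a"
    using \<eta> by (simp add: inner_diff_left inner_diff_right norm_eq_1 inner_commute)
  also have "a \<bullet> \<eta> = (\<zeta> \<bullet> \<eta>) / (norm \<zeta>)\<^sup>2"
    by (simp add: a_def divide_inverse mult.commute)
  finally have 1: "(norm \<zeta>)\<^sup>2 * ((\<eta> - a) \<bullet> (\<eta> - a)) = (norm \<zeta>)\<^sup>2 - 2 * (\<zeta> \<bullet> \<eta>) + 1"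
    unfolding aa using assms by (simp add: field_simps)
  have "(norm (\<zeta> - \<eta>))\<^sup>2 = (norm \<zeta>)\<^sup>2 - 2 * (\<zeta> \<bullet> \<eta>) + 1"
    using \<eta> by (simp add: power2_norm_eq_inner inner_diff_left inner_diff_right norm_eq_1 inner_commute)
  then have 2: "(norm \<zeta>)\<^sup>2 * ((\<eta> - a) \<bullet> (\<eta> - a)) = (norm (\<zeta> - \<eta>))\<^sup>2"
    using 1 by simp
  have "inv_fac a \<eta> = ((norm \<zeta>)\<^sup>2 * (a \<bullet> a - 1)) / ((norm \<zeta>)\<^sup>2 * ((\<eta> - a) \<bullet> (\<eta> - a)))"
    using assms by (simp add: inv_fac_def)
  also have "(norm \<zeta>)\<^sup>2 * (a \<bullet> a - 1) = 2 * wt \<zeta>"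
    unfolding aa using assms by (simp add: wt_def field_simps)
  finally show "inv_fac a \<eta> = 2 * wt \<zeta> / (norm (\<zeta> - \<eta>))\<^sup>2"
    unfolding 2 .
qed

text \<open>The integrand is the spherical Jacobian of the inversion that carries the origin to
  \<zeta>, so its total mass is the area. At \<zeta> = 0, where there is no such inversion, it is
  constantly 1.\<close>

lemma nn_integral_poisson_power:
  fixes \<zeta> :: "'a::euclidean_space"
  assumes "norm \<zeta> < 1"
  shows "(\<integral>\<^sup>+\<eta>. ennreal ((2 * wt \<zeta> / (norm (\<zeta> - \<eta>))\<^sup>2) ^ (DIM('a) - 1)) \<partial>sph) = ennreal (sphere_area TYPE('a))"
proof (cases "\<zeta> = 0")
  case True
  have "(\<integral>\<^sup>+\<eta>. ennreal ((2 * wt \<zeta> / (norm (\<zeta> - \<eta>))\<^sup>2) ^ (DIM('a) - 1)) \<partial>sph) = (\<integral>\<^sup>+\<eta>. 1 \<partial>(sph :: 'a measure))"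
    by (rule nn_integral_cong_AE) (use AE_sph in eventually_elim, simp add: True wt_def)
  then show ?thesis
    by (simp add: emeasure_sph)
next
  case False
  note inv = inversion_center_of_point[OF assms False]
  have "(\<integral>\<^sup>+\<eta>. ennreal ((2 * wt \<zeta> / (norm (\<zeta> - \<eta>))\<^sup>2) ^ (DIM('a) - 1)) \<partial>sph)
      = (\<integral>\<^sup>+\<eta>. ennreal (inv_fac (\<zeta> /\<^sub>R (norm \<zeta>)\<^sup>2) \<eta> ^ (DIM('a) - 1)) * 1 \<partial>sph)"
    by (rule nn_integral_cong_AE) (use AE_sph in eventually_elim, simp add: inv(3))
  also have "\<dots> = (\<integral>\<^sup>+\<eta>. 1 \<partial>(sph :: 'a measure))"
    by (rule nn_integral_inversion_sph[OF inv(1)]) simp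
  finally show ?thesis
    by (simp add: emeasure_sph)
qed

section \<open>Averaging over reflections\<close>

lemma jac_borel:
  fixes L :: "'a::euclidean_space \<Rightarrow> 'a \<Rightarrow> 'a"
  assumes [measurable]: "\<And>b. (\<lambda>x. L x b) \<in> borel_measurable borel"
  shows "(\<lambda>x. jac (L x)) \<in> borel_measurable borel"
proof -
  have "jac (L x) = \<bar>\<Sum>p | p permutes (UNIV :: 'a ix set). of_int (sign p) *
      (\<Prod>i\<in>UNIV. L x (of_vec (axis (p i) 1)) \<bullet> basis_of i)\<bar>" for x
    by (simp add: jac_def det_def matrix_def to_vec_def)
  then show ?thesis
    by simp
qed

text \<open>A point \<zeta> other than \<eta> is the image of \<eta> under a reflection whose
  direction is unique up to sign. The change of variables from directions to points has a bounded
  Jacobian, and the distance from \<eta> to its image is 2 |\<nu> \<bullet> \<eta>|. Away from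
  \<eta> the weight |\<nu> \<bullet> \<eta>| is thus bounded below; this costs the factor 2 /
  \<rho>.\<close>

lemma refl_average:
  fixes \<eta> :: "'a::euclidean_space"
  assumes \<eta>: "norm \<eta> = 1" and \<rho>: "\<rho> > 0" and f [measurable]: "f \<in> borel_measurable borel"
  shows "(\<integral>\<^sup>+\<zeta>. f \<zeta> * indicator {\<zeta>. \<rho> \<le> norm (\<zeta> - \<eta>)} \<zeta> \<partial>sph)
    \<le> ennreal (2 * (fact DIM('a) * 6 ^ DIM('a)) / \<rho>) * (\<integral>\<^sup>+\<nu>. f (hrefl \<nu> \<eta>) * ennreal \<bar>\<nu> \<bullet> \<eta>\<bar> \<partial>sph)"
proof -
  let ?B = "fact DIM('a) * 6 ^ DIM('a) :: real"
  define U where "U = {x::'a. norm x < 1 \<and> 0 < x \<bullet> \<eta>}"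
  \<comment> \<open>The extension of \<open>\<lambda>\<nu>. hrefl \<nu> \<eta>\<close> that is
    homogeneous of degree two. It is a polynomial map and is injective on the half ball
    \<open>U\<close>.\<close>
  define F where "F x = (x \<bullet> x) *\<^sub>R \<eta> - (2 * (x \<bullet> \<eta>)) *\<^sub>R x" for x
  define F' where "F' x h = (2 * (x \<bullet> h)) *\<^sub>R \<eta> - (2 * (h \<bullet> \<eta>)) *\<^sub>R x - (2 * (x \<bullet> \<eta>)) *\<^sub>R h" for x h
  \<comment> \<open>The inverse of \<open>F\<close>: the reflecting direction is the normalized
    difference of |y| \<eta> and y, and its length is sqrt |y| because \<open>F\<close> squares
    norms. Only the ray through \<eta> is missed by \<open>F\<close>, and there \<open>h\<close>
    vanishes.\<close>
  define G where "G y = (let d = norm y *\<^sub>R \<eta> - y in (sqrt (norm y) / norm d) *\<^sub>R d)" for y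
  define h where "h \<zeta> = f \<zeta> * indicator {\<zeta>. \<rho> \<le> norm (\<zeta> - \<eta>)} \<zeta>" for \<zeta>
  have [measurable]: "h \<in> borel_measurable borel"
    unfolding h_def by measurable
  have \<eta>\<eta>: "\<eta> \<bullet> \<eta> = 1"
    using \<eta> by (simp add: norm_eq_1)
  have nF: "norm (F x) = x \<bullet> x" for x
  proof -
    have "(norm (F x))\<^sup>2 = (x \<bullet> x)\<^sup>2"
      unfolding power2_norm_eq_inner F_def
      by (simp add: inner_diff_left inner_diff_right \<eta>\<eta> inner_commute[of \<eta> x] power2_eq_square algebra_simps)
    then show ?thesis
      by simp
  qed
  have GF: "G (F x) = x" if "x \<in> U" for x
  proof -
    have pos: "x \<noteq> 0" "0 < x \<bullet> \<eta>"
      using that by (auto simp: U_def)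
    have d: "norm (F x) *\<^sub>R \<eta> - F x = (2 * (x \<bullet> \<eta>)) *\<^sub>R x"
      unfolding nF by (simp add: F_def)
    show ?thesis
      unfolding G_def Let_def unfolding d unfolding nF using pos by (simp add: norm_eq_sqrt_inner[symmetric])
  qed
  have FG: "G y \<in> U \<and> F (G y) = y" if y: "norm y < 1" "y \<bullet> \<eta> < norm y" for y
  proof -
    define d where "d = norm y *\<^sub>R \<eta> - y"
    define c where "c = sqrt (norm y) / norm d"
    have d\<eta>: "d \<bullet> \<eta> = norm y - y \<bullet> \<eta>"
      by (simp add: d_def inner_diff_left \<eta>\<eta>)
    have y0: "0 < norm y" and d0: "d \<noteq> 0"
      using y(2) d\<eta> by auto
    have dd: "(norm d)\<^sup>2 = 2 * norm y * (d \<bullet> \<eta>)"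
    proof -
      have "(norm d)\<^sup>2 = norm y * norm y - 2 * norm y * (y \<bullet> \<eta>) + y \<bullet> y"
        unfolding power2_norm_eq_inner d_def
        by (simp add: inner_diff_left inner_diff_right \<eta>\<eta> inner_commute[of \<eta> y] algebra_simps)
      then show ?thesis
        unfolding d\<eta> by (simp add: dot_square_norm power2_eq_square algebra_simps)
    qed
    have cc: "c\<^sup>2 * (norm d)\<^sup>2 = norm y"
      using d0 by (simp add: c_def power_divide)
    have Gy: "G y = c *\<^sub>R d"
      by (simp add: G_def Let_def d_def c_def)
    have "norm (G y) = sqrt (norm y)"
      using d0 by (simp add: Gy c_def)
    moreover have "0 < G y \<bullet> \<eta>"
      using y d0 y0 by (simp add: Gy c_def d\<eta>)
    ultimately have "G y \<in> U"
      using y(1) by (simp add: U_def)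
    have 1: "G y \<bullet> G y = c\<^sup>2 * (norm d)\<^sup>2"
      by (simp add: Gy dot_square_norm power2_eq_square)
    have 2: "(2 * (G y \<bullet> \<eta>)) *\<^sub>R G y = (2 * c\<^sup>2 * (d \<bullet> \<eta>)) *\<^sub>R d"
      by (simp add: Gy power2_eq_square)
    have "2 * c\<^sup>2 * (d \<bullet> \<eta>) = 1"
      using cc unfolding dd using y0 by (simp add: algebra_simps)
    then have "F (G y) = norm y *\<^sub>R \<eta> - d"
      unfolding F_def 1 2 cc by simp
    then show ?thesis
      using \<open>G y \<in> U\<close> by (simp add: d_def)
  qed
  have FU: "F ` U = {y. norm y < 1 \<and> y \<bullet> \<eta> < norm y}"
  proof (intro equalityI subsetI)
    fix y assume "y \<in> F ` U"
    then obtain x where x: "x \<in> U" "y = F x"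
      by auto
    have "norm y < 1"
      using x by (simp add: nF U_def dot_square_norm abs_square_less_1)
    moreover have "y \<bullet> \<eta> = norm y - 2 * (x \<bullet> \<eta>)\<^sup>2"
      unfolding x(2) nF by (simp add: F_def inner_diff_left \<eta>\<eta> power2_eq_square)
    ultimately show "y \<in> {y. norm y < 1 \<and> y \<bullet> \<eta> < norm y}"
      using x(1) by (simp add: U_def)
  next
    fix y assume "y \<in> {y. norm y < 1 \<and> y \<bullet> \<eta> < norm y}"
    then show "y \<in> F ` U"
      using FG[of y] by (intro image_eqI[of _ _ "G y"]) simp_all
  qed
  have [measurable]: "F \<in> borel \<rightarrow>\<^sub>M borel" "U \<in> sets borel"
    unfolding F_def U_def by measurable
  have Jb: "jac (F' x) \<le> ?B" if "x \<in> U" for x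
  proof (rule jac_le)
    fix k
    have x: "norm x \<le> 1"
      using that by (simp add: U_def)
    have 1: "norm ((2 * (x \<bullet> k)) *\<^sub>R \<eta>) \<le> 2 * norm k"
      using Cauchy_Schwarz_ineq2[of x k] mult_right_mono[OF x norm_ge_zero[of k]] \<eta> by simp
    have 2: "norm ((2 * (k \<bullet> \<eta>)) *\<^sub>R x) \<le> 2 * norm k"
      using Cauchy_Schwarz_ineq2[of k \<eta>] \<eta> mult_mono[of "\<bar>k \<bullet> \<eta>\<bar>" "norm k" "norm x" 1] x by simp
    have 3: "norm ((2 * (x \<bullet> \<eta>)) *\<^sub>R k) \<le> 2 * norm k"
      using Cauchy_Schwarz_ineq2[of x \<eta>] \<eta> x mult_right_mono[of "\<bar>x \<bullet> \<eta>\<bar>" 1 "norm k"] by simp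
    show "norm (F' x k) \<le> 6 * norm k"
      unfolding F'_def
      by (rule order_trans[OF norm_triangle_ineq4], rule order_trans[OF add_right_mono[OF norm_triangle_ineq4]])
         (use 1 2 3 in linarith)
  qed
  have "(\<integral>\<^sup>+x\<in>U. ennreal (jac (F' x)) * h (F x /\<^sub>R norm (F x)) \<partial>lborel) = (\<integral>\<^sup>+y\<in>F ` U. h (y /\<^sub>R norm y) \<partial>lborel)"
  proof (rule nn_integral_substitution[where f' = F' and B = ?B])
    have "emeasure lborel U \<le> emeasure lborel (ball 0 1 :: 'a set)"
      by (intro emeasure_mono) (auto simp: U_def)
    then show "emeasure lborel U < \<infinity>"
      using emeasure_lborel_ball_finite le_less_trans by blast
    show "F ` U \<in> sets borel"
      unfolding FU by measurable
    show "inj_on F U"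
      by (intro inj_on_inverseI[of _ G]) (rule GF)
    show "(F has_derivative F' x) (at x within U)" for x
      unfolding F_def[abs_def] F'_def
      by (auto intro!: derivative_eq_intros simp: fun_eq_iff inner_commute algebra_simps)
    show "(\<lambda>x. jac (F' x)) \<in> borel_measurable borel"
      by (rule jac_borel) (simp add: F'_def)
  qed (auto intro: Jb)
  moreover have "(\<integral>\<^sup>+y\<in>F ` U. h (y /\<^sub>R norm y) \<partial>lborel) = (\<integral>\<^sup>+y\<in>ball 0 1 - {0}. h (y /\<^sub>R norm y) \<partial>lborel)"
  proof (rule nn_integral_cong)
    fix y :: 'a
    have "h (y /\<^sub>R norm y) = 0" if "y \<noteq> 0" "\<not> y \<bullet> \<eta> < norm y"
    proof -
      have "y \<bullet> \<eta> = norm y * norm \<eta>"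
        using that norm_cauchy_schwarz[of y \<eta>] \<eta> by simp
      then have "norm y *\<^sub>R \<eta> = norm \<eta> *\<^sub>R y"
        using norm_cauchy_schwarz_eq by blast
      then have "y /\<^sub>R norm y = \<eta>"
        using that(1) \<eta> by (metis divideR_right norm_eq_zero scaleR_one)
      then show ?thesis
        using \<rho> by (simp add: h_def)
    qed
    moreover have "\<not> 0 \<bullet> \<eta> < norm (0::'a)"
      by simp
    ultimately show "h (y /\<^sub>R norm y) * indicator (F ` U) y = h (y /\<^sub>R norm y) * indicator (ball 0 1 - {0}) y"
      unfolding FU by (cases "y = 0") (auto simp: indicator_def)
  qed
  ultimately have "(\<integral>\<^sup>+y\<in>ball 0 1 - {0}. h (y /\<^sub>R norm y) \<partial>lborel) = (\<integral>\<^sup>+x\<in>U. ennreal (jac (F' x)) * h (F x /\<^sub>R norm (F x)) \<partial>lborel)"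
    by simp
  also have "\<dots> \<le> (\<integral>\<^sup>+x\<in>ball 0 1 - {0}. ennreal (2 * ?B / \<rho>) * (f (hrefl (x /\<^sub>R norm x) \<eta>) * ennreal \<bar>(x /\<^sub>R norm x) \<bullet> \<eta>\<bar>) \<partial>lborel)"
  proof (rule nn_integral_mono)
    fix x :: 'a
    show "ennreal (jac (F' x)) * h (F x /\<^sub>R norm (F x)) * indicator U x
       \<le> ennreal (2 * ?B / \<rho>) * (f (hrefl (x /\<^sub>R norm x) \<eta>) * ennreal \<bar>(x /\<^sub>R norm x) \<bullet> \<eta>\<bar>) * indicator (ball 0 1 - {0}) x"
    proof (cases "x \<in> U")
      case True
      then have x0: "x \<noteq> 0" and xU: "x \<in> ball 0 1 - {0}"
        by (auto simp: U_def)
      define \<nu> where "\<nu> = x /\<^sub>R norm x"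
      have \<nu>: "norm \<nu> = 1"
        using x0 by (simp add: \<nu>_def)
      have xx: "x \<bullet> x = norm x * norm x"
        by (simp add: dot_square_norm power2_eq_square)
      have e: "F x /\<^sub>R norm (F x) = hrefl \<nu> \<eta>"
        unfolding nF using x0
        by (simp add: F_def hrefl_def \<nu>_def xx scaleR_diff_right inner_commute divide_inverse mult_ac)
      have diff: "norm (hrefl \<nu> \<eta> - \<eta>) = 2 * \<bar>\<nu> \<bullet> \<eta>\<bar>"
        using \<nu> by (simp add: hrefl_def inner_commute)
      \<comment> \<open>On the support of \<open>h\<close> one has 2 |\<nu> \<bullet> \<eta>| \<ge>
        \<rho>, so the weight can be inserted at the cost of the constant.\<close>
      have "h (hrefl \<nu> \<eta>) \<le> ennreal (2 / \<rho>) * (f (hrefl \<nu> \<eta>) * ennreal \<bar>\<nu> \<bullet> \<eta>\<bar>)"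
      proof (cases "\<rho> \<le> 2 * \<bar>\<nu> \<bullet> \<eta>\<bar>")
        case True
        then have "1 \<le> 2 / \<rho> * \<bar>\<nu> \<bullet> \<eta>\<bar>"
          using \<rho> by (simp add: field_simps)
        moreover have "ennreal (2 / \<rho>) * ennreal \<bar>\<nu> \<bullet> \<eta>\<bar> = ennreal (2 / \<rho> * \<bar>\<nu> \<bullet> \<eta>\<bar>)"
          using \<rho> by (intro ennreal_mult[symmetric]) simp_all
        ultimately have "1 \<le> ennreal (2 / \<rho>) * ennreal \<bar>\<nu> \<bullet> \<eta>\<bar>"
          using ennreal_leI ennreal_1 by metis
        then have "f (hrefl \<nu> \<eta>) * 1 \<le> f (hrefl \<nu> \<eta>) * (ennreal (2 / \<rho>) * ennreal \<bar>\<nu> \<bullet> \<eta>\<bar>)"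
          using \<rho> by (intro mult_left_mono) (simp_all add: ennreal_mult)
        then show ?thesis
          using True by (simp add: h_def diff mult_ac)
      qed (simp add: h_def diff)
      then have "ennreal (jac (F' x)) * h (hrefl \<nu> \<eta>) \<le> ennreal ?B * (ennreal (2 / \<rho>) * (f (hrefl \<nu> \<eta>) * ennreal \<bar>\<nu> \<bullet> \<eta>\<bar>))"
        using Jb[OF True] by (intro mult_mono) (simp_all add: ennreal_leI)
      also have "ennreal ?B * (ennreal (2 / \<rho>) * (f (hrefl \<nu> \<eta>) * ennreal \<bar>\<nu> \<bullet> \<eta>\<bar>))
          = ennreal (2 * ?B / \<rho>) * (f (hrefl \<nu> \<eta>) * ennreal \<bar>\<nu> \<bullet> \<eta>\<bar>)"
      proof -
        have "ennreal ?B * ennreal (2 / \<rho>) = ennreal (?B * (2 / \<rho>))"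
          using \<rho> by (intro ennreal_mult[symmetric]) simp_all
        also have "?B * (2 / \<rho>) = 2 * ?B / \<rho>"
          by simp
        finally show ?thesis
          by (simp only: mult.assoc[symmetric])
      qed
      finally show ?thesis
        using xU True by (simp add: e \<nu>_def)
    qed simp
  qed
  finally have "of_nat DIM('a) * (\<integral>\<^sup>+y\<in>ball 0 1 - {0}. h (y /\<^sub>R norm y) \<partial>lborel)
     \<le> of_nat DIM('a) * (\<integral>\<^sup>+x\<in>ball 0 1 - {0}. ennreal (2 * ?B / \<rho>) * (f (hrefl (x /\<^sub>R norm x) \<eta>) * ennreal \<bar>(x /\<^sub>R norm x) \<bullet> \<eta>\<bar>) \<partial>lborel)"
    by (rule mult_left_mono) simp
  moreover have [measurable]: "(\<lambda>\<nu>. f (hrefl \<nu> \<eta>)) \<in> borel_measurable borel"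
    unfolding hrefl_def by measurable
  ultimately have "(\<integral>\<^sup>+\<zeta>. h \<zeta> \<partial>sph) \<le> (\<integral>\<^sup>+\<nu>. ennreal (2 * ?B / \<rho>) * (f (hrefl \<nu> \<eta>) * ennreal \<bar>\<nu> \<bullet> \<eta>\<bar>) \<partial>sph)"
    by (simp add: nn_integral_sph_ball)
  also have "\<dots> = ennreal (2 * ?B / \<rho>) * (\<integral>\<^sup>+\<nu>. f (hrefl \<nu> \<eta>) * ennreal \<bar>\<nu> \<bullet> \<eta>\<bar> \<partial>sph)"
    by (rule nn_integral_cmult) measurable
  finally show ?thesis
    by (simp add: h_def[abs_def])
qed

section \<open>Inversions as conformal automorphisms of the closed ball\<close>

lemma has_derivative_unique_within_cball:
  fixes f :: "'a::euclidean_space \<Rightarrow> 'b::real_normed_vector"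
  assumes x: "x \<in> cball 0 1"
    and D1: "(f has_derivative D1) (at x within cball 0 1)"
    and D2: "(f has_derivative D2) (at x within cball 0 1)"
  shows "D1 = D2"
proof -
  have lin: "linear D1" "linear D2"
    using D1 D2 by (simp_all add: has_derivative_linear)
  \<comment> \<open>At a boundary point only directions into the ball can be tested. By convexity
    the segments to the points y of the ball are available, and the vectors y - x, with the origin
    among the y, determine a linear map.\<close>
  have path: "((\<lambda>t. f (x + t *\<^sub>R (y - x))) has_vector_derivative D (y - x)) (at 0 within {0..1})"
    if y: "y \<in> cball 0 1" and D: "(f has_derivative D) (at x within cball 0 1)" for y D
  proof -
    define \<gamma> where "\<gamma> t = x + t *\<^sub>R (y - x)" for t :: real
    have 1: "(\<gamma> has_derivative (\<lambda>t. t *\<^sub>R (y - x))) (at 0 within {0..1})"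
      unfolding \<gamma>_def[abs_def] by (auto intro!: derivative_eq_intros)
    have "\<gamma> t \<in> cball 0 1" if "t \<in> {0..1}" for t
      using convexD_alt[OF convex_cball x y, of t] that by (simp add: \<gamma>_def algebra_simps)
    then have 2: "(f has_derivative D) (at (\<gamma> 0) within \<gamma> ` {0..1})"
      using has_derivative_subset[OF D, of "\<gamma> ` {0..1}"] by (auto simp: \<gamma>_def[of 0] image_subset_iff)
    show ?thesis
      using diff_chain_within[OF 1 2] linear_scale[OF has_derivative_linear[OF D]]
      by (simp add: has_vector_derivative_def comp_def \<gamma>_def)
  qed
  have eq: "D1 (y - x) = D2 (y - x)" if "y \<in> cball 0 1" for y
    using vector_derivative_unique_within[OF _ path[OF that D1] path[OF that D2]]
    by (simp add: trivial_limit_within islimpt_Icc)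
  have z: "D1 y = D2 y" if "y \<in> cball 0 1" for y
    using eq[OF that] eq[of 0] lin by (simp add: linear_diff linear_neg)
  show ?thesis
  proof
    fix v
    show "D1 v = D2 v"
    proof (cases "v = 0")
      case False
      then have "D1 (norm v *\<^sub>R (v /\<^sub>R norm v)) = D2 (norm v *\<^sub>R (v /\<^sub>R norm v))"
        using z[of "v /\<^sub>R norm v"] lin by (simp only: linear_scale) simp
      then show ?thesis
        using False by simp
    qed (use lin in \<open>simp add: linear_0\<close>)
  qed
qed

lemma frechet_derivative_cball:
  fixes f :: "'a::euclidean_space \<Rightarrow> 'b::real_normed_vector"
  assumes "x \<in> cball 0 1" "(f has_derivative D) (at x within cball 0 1)"
  shows "frechet_derivative f (at x within cball 0 1) = D"
  using has_derivative_unique_within_cball[OF assms(1)] assms(2) frechet_derivative_works differentiableI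
  by blast

lemma frechet_derivative_inv_map:
  assumes "1 < norm a" "norm x \<le> 1"
  shows "frechet_derivative (inv_map a) (at x within cball 0 1)
    = (\<lambda>h. inv_fac a x *\<^sub>R hrefl ((x - a) /\<^sub>R norm (x - a)) h)"
  using assms inversion_center_ne[OF assms] inv_map_has_derivative[OF assms(1)]
  by (intro frechet_derivative_cball) simp_all

lemma conformal_ball_auto_inv_map:
  fixes a :: "'a::euclidean_space"
  assumes a: "1 < norm a"
  shows "conformal_ball_auto (inv_map a)"
  unfolding conformal_ball_auto_def
proof (intro conjI allI ballI)
  have ne: "x \<noteq> a" if "x \<in> cball 0 1" for x
    using inversion_center_ne[OF a] that by simp
  have inv: "inv_map a (inv_map a x) = x" "inv_map a x \<in> cball 0 1" if "x \<in> cball 0 1" for x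
    using inv_map_inv_map[OF a ne[OF that]] inv_map_norm_le_iff[OF a ne[OF that]] that by simp_all
  show "bij_betw (inv_map a) (cball 0 1) (cball 0 1)"
    by (rule bij_betw_byWitness[where f' = "inv_map a"]) (use inv in auto)
  have diff: "inv_map a differentiable at x within cball 0 1" if "x \<in> cball 0 1" for x
    using inv_map_has_derivative[OF a ne[OF that]] differentiableI by blast
  show "inv_map a differentiable at x within cball 0 1" if "x \<in> cball 0 1" for x
    using diff that .
  have inv_into: "inv_into (cball 0 1) (inv_map a) y = inv_map a y" if "y \<in> cball 0 1" for y
    using inv_into_f_f[OF inj_on_inv_map[OF a] inv(2)[OF that]] inv(1)[OF that] by simp
  show "inv_into (cball 0 1) (inv_map a) differentiable at y within cball 0 1" if y: "y \<in> cball 0 1" for y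
  proof -
    obtain D where "(inv_map a has_derivative D) (at y within cball 0 1)"
      using diff[OF y] by (auto simp: differentiable_def)
    then have "(inv_into (cball 0 1) (inv_map a) has_derivative D) (at y within cball 0 1)"
      by (rule has_derivative_transform[OF y, rotated]) (simp add: inv_into)
    then show ?thesis
      by (rule differentiableI)
  qed
  fix v
  have "continuous_on (cball 0 1) (\<lambda>x. inv_fac a x *\<^sub>R hrefl ((x - a) /\<^sub>R norm (x - a)) v)"
    unfolding inv_fac_def hrefl_def using ne by (intro continuous_intros) auto
  then show "continuous_on (cball 0 1) (\<lambda>x. frechet_derivative (inv_map a) (at x within cball 0 1) v)"
    by (rule continuous_on_eq) (simp add: frechet_derivative_inv_map[OF a])
next
  fix x :: 'a
  assume "x \<in> cball 0 1"
  then have x: "norm x \<le> 1" "x \<noteq> a"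
    using inversion_center_ne[OF a] by auto
  show "\<exists>c>0. \<forall>v. norm (frechet_derivative (inv_map a) (at x within cball 0 1) v) = c * norm v"
    using inv_fac_pos[OF a x(2)] norm_refl[OF norm_normalize_diff[OF a x(2)]]
    by (intro exI[of _ "inv_fac a x"]) (simp add: frechet_derivative_inv_map[OF a x(1)])
qed

lemma onorm_conformal:
  fixes f :: "'a::euclidean_space \<Rightarrow> 'a"
  assumes "linear f" "\<And>v. norm (f v) = c * norm v"
  shows "onorm f = c"
proof (rule antisym)
  show "onorm f \<le> c"
    using assms(2) by (intro onorm_le) simp
  obtain b :: 'a where "b \<in> Basis"
    using nonempty_Basis by blast
  then have "norm (f b) \<le> onorm f * norm b" "norm b = 1"
    using assms(1) onorm[of f b] linear_conv_bounded_linear by auto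
  then show "c \<le> onorm f"
    using assms(2)[of b] by simp
qed

lemma sphere_jac_inv_map:
  fixes \<eta> :: "'a::euclidean_space"
  assumes a: "1 < norm a" and \<eta>: "norm \<eta> = 1"
  shows "sphere_jac (inv_map a) \<eta> = inv_fac a \<eta> ^ (DIM('a) - 1)"
proof -
  have ne: "\<eta> \<noteq> a"
    using a \<eta> by auto
  have "onorm (\<lambda>h. inv_fac a \<eta> *\<^sub>R hrefl ((\<eta> - a) /\<^sub>R norm (\<eta> - a)) h) = inv_fac a \<eta>"
    using inv_fac_pos[OF a ne] norm_refl[OF norm_normalize_diff[OF a ne]]
    by (intro onorm_conformal linear_compose_scale_right linear_refl) simp
  then show ?thesis
    using \<eta> by (simp add: sphere_jac_def frechet_derivative_inv_map[OF a])
qed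

lemma frechet_derivative_id_cball:
  "norm x \<le> 1 \<Longrightarrow> frechet_derivative (\<lambda>x. x) (at x within cball 0 1) = (\<lambda>h::'a::euclidean_space. h)"
  by (intro frechet_derivative_cball) simp_all

lemma conformal_ball_auto_id: "conformal_ball_auto (\<lambda>x::'a::euclidean_space. x)"
  unfolding conformal_ball_auto_def
proof (intro conjI allI ballI)
  show "bij_betw (\<lambda>x. x) (cball 0 1) (cball 0 1 :: 'a set)"
    by (simp add: bij_betw_def)
  show "inv_into (cball 0 1) (\<lambda>x. x) differentiable at y within cball 0 1" if "y \<in> cball 0 1" for y :: 'a
  proof -
    have "(inv_into (cball 0 1) (\<lambda>x. x) has_derivative (\<lambda>h. h)) (at y within cball 0 1)"
      by (rule has_derivative_transform[OF that _ has_derivative_ident]) (simp add: inv_into_f_f[of "\<lambda>x. x"])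
    then show ?thesis
      by (rule differentiableI)
  qed
  show "continuous_on (cball 0 1) (\<lambda>x. frechet_derivative (\<lambda>x. x) (at x within cball 0 1) v)" for v :: 'a
    by (rule continuous_on_eq[OF continuous_on_const]) (simp add: frechet_derivative_id_cball)
  show "\<exists>c>0. \<forall>v. norm (frechet_derivative (\<lambda>x. x) (at x within cball 0 1) v) = c * norm v"
    if "x \<in> cball 0 1" for x :: 'a
    using that by (intro exI[of _ 1]) (simp add: frechet_derivative_id_cball)
qed simp

lemma sphere_jac_id: "norm \<eta> = 1 \<Longrightarrow> sphere_jac (\<lambda>x::'a::euclidean_space. x) \<eta> = 1"
  using onorm_conformal[of "\<lambda>h::'a. h" 1] by (simp add: sphere_jac_def frechet_derivative_id_cball linear_id[unfolded id_def])

section \<open>Boundedness of the operator\<close>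

text \<open>Young's inequality for the functions divided by their norms. The data are upper bounds
  \<open>A\<close> and \<open>B\<close> instead of the norms themselves; when one of them is 0 the
  normalization fails, but then the product vanishes almost everywhere.\<close>

lemma nn_integral_Holder:
  fixes f g :: "'b \<Rightarrow> real"
  assumes [measurable]: "f \<in> borel_measurable M" "g \<in> borel_measurable M"
    and f0: "\<And>x. 0 \<le> f x" and g0: "\<And>x. 0 \<le> g x"
    and ab: "1 < a" "1 < b" "1 / a + 1 / b = 1" and A: "0 \<le> A" and B: "0 \<le> B"
    and fA: "(\<integral>\<^sup>+x. ennreal (f x powr a) \<partial>M) \<le> ennreal A"
    and gB: "(\<integral>\<^sup>+x. ennreal (g x powr b) \<partial>M) \<le> ennreal B"
  shows "(\<integral>\<^sup>+x. ennreal (f x * g x) \<partial>M) \<le> ennreal (A powr (1 / a) * B powr (1 / b))"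
proof (cases "A = 0 \<or> B = 0")
  case True
  have "AE x in M. f x = 0 \<or> g x = 0"
    using True
  proof
    assume "A = 0"
    then have "AE x in M. ennreal (f x powr a) = 0"
      using fA by (subst nn_integral_0_iff_AE[symmetric]) auto
    then show ?thesis
      by eventually_elim (use ab f0 in \<open>auto simp: ennreal_eq_0_iff\<close>)
  next
    assume "B = 0"
    then have "AE x in M. ennreal (g x powr b) = 0"
      using gB by (subst nn_integral_0_iff_AE[symmetric]) auto
    then show ?thesis
      by eventually_elim (use ab g0 in \<open>auto simp: ennreal_eq_0_iff\<close>)
  qed
  then have "AE x in M. ennreal (f x * g x) = 0"
    by eventually_elim auto
  then have "(\<integral>\<^sup>+x. ennreal (f x * g x) \<partial>M) = 0"
    by (subst nn_integral_0_iff_AE) auto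
  then show ?thesis
    by simp
next
  case False
  define \<alpha> \<beta> where "\<alpha> = A powr (1 / a)" and "\<beta> = B powr (1 / b)"
  have pos: "0 < A" "0 < B" "0 < \<alpha>" "0 < \<beta>"
    using False A B by (auto simp: \<alpha>_def \<beta>_def)
  have pw: "\<alpha> powr a = A" "\<beta> powr b = B"
    using pos ab by (simp_all add: \<alpha>_def \<beta>_def powr_powr)
  have "ennreal (f x * g x) \<le> ennreal (\<alpha> * \<beta> / (a * A)) * ennreal (f x powr a) + ennreal (\<alpha> * \<beta> / (b * B)) * ennreal (g x powr b)" for x
  proof -
    have "(f x / \<alpha>) * (g x / \<beta>) \<le> (f x / \<alpha>) powr a / a + (g x / \<beta>) powr b / b"
      using ab f0 g0 pos by (intro Youngs_inequality) auto
    then have "\<alpha> * \<beta> * ((f x / \<alpha>) * (g x / \<beta>)) \<le> \<alpha> * \<beta> * ((f x / \<alpha>) powr a / a + (g x / \<beta>) powr b / b)"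
      using pos by (intro mult_left_mono) auto
    also have "\<alpha> * \<beta> * ((f x / \<alpha>) * (g x / \<beta>)) = f x * g x"
      using pos by simp
    also have "\<alpha> * \<beta> * ((f x / \<alpha>) powr a / a + (g x / \<beta>) powr b / b)
        = \<alpha> * \<beta> / (a * A) * (f x powr a) + \<alpha> * \<beta> / (b * B) * (g x powr b)"
      using pos f0 g0 by (simp add: powr_divide pw distrib_left mult_ac)
    finally have "f x * g x \<le> \<alpha> * \<beta> / (a * A) * (f x powr a) + \<alpha> * \<beta> / (b * B) * (g x powr b)" .
    then show ?thesis
      using pos ab by (simp add: ennreal_mult[symmetric] ennreal_plus[symmetric] del: ennreal_plus)
  qed
  then have "(\<integral>\<^sup>+x. ennreal (f x * g x) \<partial>M)
      \<le> (\<integral>\<^sup>+x. ennreal (\<alpha> * \<beta> / (a * A)) * ennreal (f x powr a) + ennreal (\<alpha> * \<beta> / (b * B)) * ennreal (g x powr b) \<partial>M)"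
    by (intro nn_integral_mono)
  also have "\<dots> = ennreal (\<alpha> * \<beta> / (a * A)) * (\<integral>\<^sup>+x. ennreal (f x powr a) \<partial>M) + ennreal (\<alpha> * \<beta> / (b * B)) * (\<integral>\<^sup>+x. ennreal (g x powr b) \<partial>M)"
    by (simp add: nn_integral_add nn_integral_cmult)
  also have "\<dots> \<le> ennreal (\<alpha> * \<beta> / (a * A)) * ennreal A + ennreal (\<alpha> * \<beta> / (b * B)) * ennreal B"
    by (intro add_mono mult_left_mono fA gB) auto
  also have "\<dots> = ennreal (\<alpha> * \<beta> / (a * A) * A + \<alpha> * \<beta> / (b * B) * B)"
    using pos ab by (simp add: ennreal_mult[symmetric] ennreal_plus[symmetric] del: ennreal_plus)
  also have "\<alpha> * \<beta> / (a * A) * A + \<alpha> * \<beta> / (b * B) * B = \<alpha> * \<beta> * (1 / a + 1 / b)"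
    using pos by (simp add: distrib_left)
  finally show ?thesis
    using ab by (simp add: \<alpha>_def \<beta>_def)
qed

text \<open>Layer cake formula: the integral is that of the measure of {f > y} over y, which
  vanishes for y > Y and is at most \<open>C * y powr - a\<close> below. Since a < 1 this is
  integrable at 0.\<close>

lemma (in sigma_finite_measure) nn_integral_weak_bound:
  fixes f :: "'a \<Rightarrow> real"
  assumes [measurable]: "f \<in> borel_measurable M" and f0: "\<And>x. x \<in> space M \<Longrightarrow> 0 \<le> f x"
    and Y: "0 \<le> Y" "AE x in M. f x \<le> Y" and a: "0 < a" "a < 1" and C: "0 \<le> C"
    and weak: "\<And>y. 0 < y \<Longrightarrow> emeasure M {x \<in> space M. y < f x} \<le> ennreal (C * y powr - a)"
  shows "(\<integral>\<^sup>+x. ennreal (f x) \<partial>M) \<le> ennreal (C / (1 - a) * Y powr (1 - a))"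
proof -
  interpret pair_sigma_finite lborel M
    by (simp add: pair_sigma_finite_def sigma_finite_lborel sigma_finite_measure_axioms)
  have "(\<integral>\<^sup>+x. ennreal (f x) \<partial>M) = (\<integral>\<^sup>+x. (\<integral>\<^sup>+y. indicator {y. 0 < y \<and> y < f x} y \<partial>lborel) \<partial>M)"
  proof (rule nn_integral_cong)
    fix x assume "x \<in> space M"
    then have "emeasure lborel {0<..<f x} = ennreal (f x)"
      using f0 by simp
    moreover have "{y. 0 < y \<and> y < f x} = {0<..<f x}"
      by auto
    ultimately show "ennreal (f x) = (\<integral>\<^sup>+y. indicator {y. 0 < y \<and> y < f x} y \<partial>lborel)"
      by simp
  qed
  also have "\<dots> = (\<integral>\<^sup>+y. (\<integral>\<^sup>+x. indicator {y. 0 < y \<and> y < f x} y \<partial>M) \<partial>lborel)"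
    by (rule Fubini') measurable
  also have "\<dots> \<le> (\<integral>\<^sup>+y. ennreal (C * y powr - a) * indicator {0..Y} y \<partial>lborel)"
  proof (rule nn_integral_mono)
    fix y :: real
    have "(\<integral>\<^sup>+x. indicator {y. 0 < y \<and> y < f x} y \<partial>M) = (\<integral>\<^sup>+x. indicator {x \<in> space M. 0 < y \<and> y < f x} x \<partial>M)"
      by (intro nn_integral_cong) (auto simp: indicator_def)
    also have "\<dots> = emeasure M {x \<in> space M. 0 < y \<and> y < f x}"
      by simp
    also have "\<dots> \<le> ennreal (C * y powr - a) * indicator {0..Y} y"
    proof -
      consider "y \<le> 0" | "0 < y" "y \<le> Y" | "0 < y" "Y < y"
        by linarith
      then show ?thesis
      proof cases
        case 2
        then show ?thesis
          using weak[of y] by simp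
      next
        case 3
        have "AE x in M. \<not> (0 < y \<and> y < f x)"
          using Y(2) by eventually_elim (use 3 in auto)
        then have "emeasure M {x \<in> space M. 0 < y \<and> y < f x} = 0"
          by (subst (asm) AE_iff_measurable[OF _ refl]) auto
        then show ?thesis
          by simp
      qed simp
    qed
    finally show "(\<integral>\<^sup>+x. indicator {y. 0 < y \<and> y < f x} y \<partial>M) \<le> ennreal (C * y powr - a) * indicator {0..Y} y" .
  qed
  also have "\<dots> = ennreal (C * (Y powr (1 - a) / (1 - a)))"
  proof (rule nn_integral_has_integral_lebesgue')
    show "((\<lambda>y. C * y powr - a) has_integral C * (Y powr (1 - a) / (1 - a))) {0..Y}"
      using has_integral_powr_from_0[of "- a" Y] a Y by (intro has_integral_mult_right) (simp add: add.commute)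
  qed (use C in auto)
  finally show ?thesis
    by simp
qed

section \<open>Caps, boundary layers and integrals of kernel powers\<close>

lemma wt_le_dist:
  assumes "norm \<xi> < 1" "norm \<eta> = 1"
  shows "wt \<xi> \<le> norm (\<xi> - \<eta>)"
proof -
  have "wt \<xi> = (1 - norm \<xi>) * ((1 + norm \<xi>) / 2)"
    by (simp add: wt_def power2_eq_square algebra_simps)
  also have "\<dots> \<le> (1 - norm \<xi>) * 1"
    using assms by (intro mult_left_mono) auto
  also have "\<dots> \<le> norm (\<xi> - \<eta>)"
    using norm_triangle_ineq2[of \<eta> \<xi>] assms by (simp add: norm_minus_commute)
  finally show ?thesis .
qed

text \<open>The measure of a cap is read off from the known total mass of a Poisson power: the pole
  is placed at depth comparable with \<open>r\<close> below the cap, where the integrand is bounded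
  below.\<close>

lemma cap_measure:
  fixes \<xi> :: "'a::euclidean_space"
  assumes \<xi>: "norm \<xi> \<le> 1" and r: "0 < r"
  shows "emeasure sph {\<eta>. norm (\<xi> - \<eta>) < r} \<le> ennreal (sphere_area TYPE('a) * (9 * r / 2) ^ (DIM('a) - 1))"
proof (cases "r \<le> 1")
  case False
  have "emeasure sph {\<eta>. norm (\<xi> - \<eta>) < r} \<le> emeasure (sph :: 'a measure) UNIV"
    by (intro emeasure_mono) auto
  also have "\<dots> \<le> ennreal (sphere_area TYPE('a) * (9 * r / 2) ^ (DIM('a) - 1))"
    unfolding emeasure_sph using False sphere_area_pos[where 'a='a]
    by (intro ennreal_leI) (auto intro: one_le_power)
  finally show ?thesis .
next
  case True
  \<comment> \<open>Shrinking by 1 - r / 2 makes the depth at least r / 2 and moves the point by at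
    most r / 2. On the cap the distance is then at most 3 r / 2, and the Poisson quotient is at
    least (r / 2) / (3 r / 2)^2 = 2 / (9 r).\<close>
  define \<zeta> where "\<zeta> = (1 - r / 2) *\<^sub>R \<xi>"
  have n\<zeta>: "norm \<zeta> \<le> 1 - r / 2"
    using mult_left_mono[OF \<xi>, of "1 - r / 2"] True r by (simp add: \<zeta>_def)
  then have \<zeta>1: "norm \<zeta> < 1"
    using r by simp
  have "r / 2 \<le> 2 * wt \<zeta>"
  proof -
    have "(r / 2) * 1 \<le> (1 - norm \<zeta>) * (1 + norm \<zeta>)"
      using n\<zeta> r by (intro mult_mono) auto
    then show ?thesis
      by (simp add: wt_def power2_eq_square algebra_simps)
  qed
  have key: "(2 / (9 * r)) ^ (DIM('a) - 1) \<le> (2 * wt \<zeta> / (norm (\<zeta> - \<eta>))\<^sup>2) ^ (DIM('a) - 1)"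
    if "norm \<eta> = 1" "norm (\<xi> - \<eta>) < r" for \<eta>
  proof -
    have "norm (\<zeta> - \<xi>) \<le> r / 2"
      using mult_left_mono[OF \<xi>, of "r / 2"] r by (simp add: \<zeta>_def algebra_simps)
    then have d: "norm (\<zeta> - \<eta>) \<le> 3 * r / 2"
      using norm_triangle_ineq[of "\<zeta> - \<xi>" "\<xi> - \<eta>"] that by simp
    have d0: "0 < norm (\<zeta> - \<eta>)"
      using \<zeta>1 that by auto
    have "2 / (9 * r) = (r / 2) / (3 * r / 2)\<^sup>2"
      using r by (simp add: power2_eq_square field_simps)
    also have "\<dots> \<le> (2 * wt \<zeta>) / (norm (\<zeta> - \<eta>))\<^sup>2"
      using \<open>r / 2 \<le> 2 * wt \<zeta>\<close> d d0 r wt_pos[OF \<zeta>1] by (intro frac_le power_mono) auto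
    finally show ?thesis
      using r by (intro power_mono) auto
  qed
  have "ennreal ((2 / (9 * r)) ^ (DIM('a) - 1)) * emeasure sph {\<eta>. norm (\<xi> - \<eta>) < r}
      = (\<integral>\<^sup>+\<eta>. ennreal ((2 / (9 * r)) ^ (DIM('a) - 1)) * indicator {\<eta>. norm (\<xi> - \<eta>) < r} \<eta> \<partial>sph)"
    by (subst nn_integral_cmult_indicator) auto
  also have "\<dots> \<le> (\<integral>\<^sup>+\<eta>. ennreal ((2 * wt \<zeta> / (norm (\<zeta> - \<eta>))\<^sup>2) ^ (DIM('a) - 1)) \<partial>sph)"
    by (rule nn_integral_mono_AE) (use AE_sph in eventually_elim, auto simp: indicator_def intro!: ennreal_leI key[unfolded One_nat_def])
  also have "\<dots> = ennreal (sphere_area TYPE('a))"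
    by (rule nn_integral_poisson_power[OF \<zeta>1])
  finally have *: "ennreal ((2 / (9 * r)) ^ (DIM('a) - 1)) * emeasure sph {\<eta>. norm (\<xi> - \<eta>) < r} \<le> ennreal (sphere_area TYPE('a))" .
  have "emeasure sph {\<eta>. norm (\<xi> - \<eta>) < r}
      = ennreal ((9 * r / 2) ^ (DIM('a) - 1)) * (ennreal ((2 / (9 * r)) ^ (DIM('a) - 1)) * emeasure sph {\<eta>. norm (\<xi> - \<eta>) < r})"
    unfolding mult.assoc[symmetric] using r
    by (subst ennreal_mult[symmetric]) (auto simp: power_mult_distrib[symmetric])
  also have "\<dots> \<le> ennreal ((9 * r / 2) ^ (DIM('a) - 1)) * ennreal (sphere_area TYPE('a))"
    by (intro mult_left_mono *) simp
  also have "\<dots> = ennreal (sphere_area TYPE('a) * (9 * r / 2) ^ (DIM('a) - 1))"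
    using r sphere_area_pos[where 'a='a] by (subst ennreal_mult[symmetric]) (auto simp: mult.commute)
  finally show ?thesis .
qed

text \<open>The superlevel sets of the integrand are caps of radius y powr (- 1 / (2 t)), so the
  layer cake bound applies with exponent m / (2 t). The condition t > m / 2 puts this exponent below
  1, and the distance from \<xi> to the sphere bounds the integrand.\<close>

lemma kernel_power_integral:
  fixes T :: "'a::euclidean_space itself" and t :: real
  assumes m: "m = real (DIM('a) - 1)" and t: "m / 2 < t" "0 < m"
  obtains C where "0 < C" "\<And>\<xi>::'a. norm \<xi> < 1 \<Longrightarrow>
    (\<integral>\<^sup>+\<eta>. ennreal (norm (\<xi> - \<eta>) powr (- 2 * t)) \<partial>sph) \<le> ennreal (C * wt \<xi> powr (m - 2 * t))"
proof -
  define K where "K = sphere_area TYPE('a) * (9 / 2) powr m"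
  define a where "a = m / (2 * t)"
  have K: "0 < K"
    using sphere_area_pos[where 'a='a] by (simp add: K_def)
  have t0: "0 < t"
    using t by simp
  have a: "0 < a" "a < 1"
    using t t0 by (auto simp: a_def field_simps)
  show thesis
  proof
    show "0 < K / (1 - a)"
      using K a by simp
    fix \<xi> :: 'a
    assume \<xi>: "norm \<xi> < 1"
    have w: "0 < wt \<xi>"
      using wt_pos[OF \<xi>] .
    have "(\<integral>\<^sup>+\<eta>. ennreal (norm (\<xi> - \<eta>) powr (- 2 * t)) \<partial>sph) \<le> ennreal (K / (1 - a) * (wt \<xi> powr (- 2 * t)) powr (1 - a))"
    proof (rule sph.nn_integral_weak_bound)
      show "AE \<eta> in sph. norm (\<xi> - \<eta>) powr (- 2 * t) \<le> wt \<xi> powr (- 2 * t)"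
        using AE_sph by eventually_elim (use w t0 wt_le_dist[OF \<xi>] in \<open>auto intro!: powr_mono2'\<close>)
      fix y :: real
      assume y: "0 < y"
      define r where "r = y powr (- 1 / (2 * t))"
      have r: "0 < r"
        using y by (simp add: r_def)
      have "{\<eta> \<in> space sph. y < norm (\<xi> - \<eta>) powr (- 2 * t)} \<subseteq> {\<eta>. norm (\<xi> - \<eta>) < r}"
      proof (rule subsetI)
        fix \<eta>
        assume "\<eta> \<in> {\<eta> \<in> space sph. y < norm (\<xi> - \<eta>) powr (- 2 * t)}"
        then have 1: "y < norm (\<xi> - \<eta>) powr (- 2 * t)"
          by simp
        show "\<eta> \<in> {\<eta>. norm (\<xi> - \<eta>) < r}"
        proof (rule ccontr)
          assume "\<eta> \<notin> {\<eta>. norm (\<xi> - \<eta>) < r}"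
          then have "r \<le> norm (\<xi> - \<eta>)"
            by simp
          then have "norm (\<xi> - \<eta>) powr (- 2 * t) \<le> r powr (- 2 * t)"
            using r t0 by (intro powr_mono2') auto
          also have "r powr (- 2 * t) = y"
            using y t0 by (simp add: r_def powr_powr)
          finally show False
            using 1 by simp
        qed
      qed
      then have "emeasure sph {\<eta> \<in> space sph. y < norm (\<xi> - \<eta>) powr (- 2 * t)} \<le> emeasure sph {\<eta>. norm (\<xi> - \<eta>) < r}"
        by (intro emeasure_mono) auto
      also have "\<dots> \<le> ennreal (sphere_area TYPE('a) * (9 * r / 2) ^ (DIM('a) - 1))"
        using \<xi> r by (intro cap_measure) auto
      also have "sphere_area TYPE('a) * (9 * r / 2) ^ (DIM('a) - 1) = K * r powr m"
      proof -
        have "(9 * r / 2) ^ (DIM('a) - 1) = (9 / 2 * r) powr m"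
          unfolding m using r by (subst powr_realpow) auto
        also have "\<dots> = (9 / 2) powr m * r powr m"
          by (rule powr_mult)
        finally show ?thesis
          by (simp add: K_def)
      qed
      also have "r powr m = y powr - a"
        using y by (simp add: r_def powr_powr a_def)
      finally show "emeasure sph {\<eta> \<in> space sph. y < norm (\<xi> - \<eta>) powr (- 2 * t)} \<le> ennreal (K * y powr - a)" .
    qed (use K a in auto)
    also have "(wt \<xi> powr (- 2 * t)) powr (1 - a) = wt \<xi> powr (m - 2 * t)"
    proof -
      have "- 2 * t * (1 - a) = m - 2 * t"
        using t0 by (simp add: a_def right_diff_distrib)
      then show ?thesis
        by (simp add: powr_powr)
    qed
    finally show "(\<integral>\<^sup>+\<eta>. ennreal (norm (\<xi> - \<eta>) powr (- 2 * t)) \<partial>sph) \<le> ennreal (K / (1 - a) * wt \<xi> powr (m - 2 * t))" .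
  qed
qed

text \<open>As |x|^2 \<le> |x| in the ball, the layer lies outside the ball of radius 1 - 2 y;
  Bernoulli's inequality makes the difference of the volumes linear in y.\<close>

lemma boundary_layer_measure:
  assumes y: "0 < y"
  shows "emeasure lborel {x::'a::euclidean_space. norm x < 1 \<and> wt x < y}
    \<le> ennreal (2 * real DIM('a) * measure lborel (ball 0 1 :: 'a set) * y)"
proof -
  let ?V = "measure lborel (ball 0 1 :: 'a set)"
  let ?n = "DIM('a)"
  have V: "0 \<le> ?V"
    by simp
  show ?thesis
  proof (cases "y < 1 / 2")
    case False
    have "emeasure lborel {x::'a. norm x < 1 \<and> wt x < y} \<le> emeasure lborel (ball 0 1 :: 'a set)"
      by (intro emeasure_mono) auto
    also have "\<dots> = ennreal ?V"
      using emeasure_lborel_ball_finite[of "0::'a" 1] by (simp add: emeasure_eq_ennreal_measure)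
    also have "\<dots> \<le> ennreal (2 * real ?n * ?V * y)"
    proof (rule ennreal_leI)
      have "?V * 1 \<le> ?V * (2 * real ?n * y)"
        using False mult_mono[of 1 "real ?n" 1 "2 * y"] by (intro mult_left_mono) (auto simp: Suc_leI)
      then show "?V \<le> 2 * real ?n * ?V * y"
        by (simp add: mult_ac)
    qed
    finally show ?thesis .
  next
    case True
    define \<rho> where "\<rho> = 1 - 2 * y"
    have \<rho>: "0 < \<rho>" "\<rho> < 1"
      using True y by (auto simp: \<rho>_def)
    have "{x::'a. norm x < 1 \<and> wt x < y} \<subseteq> ball 0 1 - ball 0 \<rho>"
    proof (rule subsetI)
      fix x :: 'a
      assume "x \<in> {x. norm x < 1 \<and> wt x < y}"
      then have x: "norm x < 1" "\<rho> < (norm x)\<^sup>2"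
        by (auto simp: wt_def \<rho>_def)
      have "(norm x)\<^sup>2 \<le> norm x"
        using x(1) mult_left_mono[of "norm x" 1 "norm x"] by (simp add: power2_eq_square)
      then show "x \<in> ball 0 1 - ball 0 \<rho>"
        using x by auto
    qed
    then have "emeasure lborel {x::'a. norm x < 1 \<and> wt x < y} \<le> emeasure lborel (ball 0 1 - ball 0 \<rho> :: 'a set)"
      by (intro emeasure_mono) auto
    also have "\<dots> = emeasure lborel (ball 0 1 :: 'a set) - emeasure lborel (ball 0 \<rho> :: 'a set)"
      using \<rho> emeasure_lborel_ball_finite[of "0::'a" \<rho>] by (intro emeasure_Diff) auto
    also have "\<dots> = ennreal (?V - \<rho> ^ ?n * ?V)"
      using \<rho> emeasure_lborel_ball_finite[of "0::'a" \<rho>] emeasure_lborel_ball_finite[of "0::'a" 1]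
        content_ball_conv_unit_ball[of \<rho> "0::'a"]
      by (simp add: emeasure_eq_ennreal_measure ennreal_minus)
    also have "\<dots> \<le> ennreal (2 * real ?n * ?V * y)"
    proof (rule ennreal_leI)
      have "1 + real ?n * (- 2 * y) \<le> \<rho> ^ ?n"
        using Bernoulli_inequality[of "- 2 * y" ?n] True by (simp add: \<rho>_def)
      then have "?V * (1 - \<rho> ^ ?n) \<le> ?V * (2 * real ?n * y)"
        by (intro mult_left_mono V) simp
      then show "?V - \<rho> ^ ?n * ?V \<le> 2 * real ?n * ?V * y"
        by (simp add: algebra_simps)
    qed
    finally show ?thesis .
  qed
qed

text \<open>Against Lebesgue measure the integrand is the power -1 - c of \<open>wt\<close>, which
  just fails to be integrable at the sphere. The cut at \<tau> limits its height, and the boundary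
  layer estimate gives the distribution function.\<close>

lemma radial_power_integral:
  fixes T :: "'a::euclidean_space itself" and c :: real
  assumes c: "0 < c"
  obtains C where "0 \<le> C" "\<And>\<tau>. 0 < \<tau> \<Longrightarrow>
    (\<integral>\<^sup>+\<xi>. ennreal (wt \<xi> powr (real (DIM('a) - 1) - c)) * indicator {\<xi>. norm \<xi> < 1 \<and> \<tau> < wt \<xi>} \<xi> \<partial>(hyp :: 'a measure)) \<le> ennreal (C * \<tau> powr - c)"
proof -
  define K where "K = 2 * real DIM('a) * measure lborel (ball 0 1 :: 'a set)"
  define a where "a = 1 / (1 + c)"
  have K: "0 \<le> K"
    by (simp add: K_def)
  have a: "0 < a" "a < 1"
    using c by (auto simp: a_def)
  show thesis
  proof
    show "0 \<le> K / (1 - a)"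
      using K a by simp
    fix \<tau> :: real
    assume \<tau>: "0 < \<tau>"
    define f where "f \<xi> = wt \<xi> powr (- 1 - c) * indicator {\<xi>. norm \<xi> < 1 \<and> \<tau> < wt \<xi>} \<xi>" for \<xi> :: 'a
    have [measurable]: "f \<in> borel_measurable borel"
      unfolding f_def by measurable
    have "(\<integral>\<^sup>+\<xi>. ennreal (wt \<xi> powr (real (DIM('a) - 1) - c)) * indicator {\<xi>. norm \<xi> < 1 \<and> \<tau> < wt \<xi>} \<xi> \<partial>(hyp :: 'a measure))
       = (\<integral>\<^sup>+\<xi>. ennreal (f \<xi>) \<partial>lborel)"
    proof (subst nn_integral_hyp, measurable, rule nn_integral_cong)
      fix \<xi> :: 'a
      show "ennreal (wt \<xi> powr - real DIM('a)) * (ennreal (wt \<xi> powr (real (DIM('a) - 1) - c)) * indicator {\<xi>. norm \<xi> < 1 \<and> \<tau> < wt \<xi>} \<xi>) * indicator (ball 0 1) \<xi> = ennreal (f \<xi>)"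
      proof (cases "norm \<xi> < 1 \<and> \<tau> < wt \<xi>")
        case True
        have "wt \<xi> powr - real DIM('a) * wt \<xi> powr (real (DIM('a) - 1) - c) = wt \<xi> powr (- 1 - c)"
          unfolding powr_add[symmetric] by (simp add: of_nat_diff Suc_leI)
        then show ?thesis
          using True by (simp add: f_def ennreal_mult[symmetric])
      qed (simp add: f_def)
    qed
    also have "\<dots> \<le> ennreal (K / (1 - a) * (\<tau> powr (- 1 - c)) powr (1 - a))"
    proof (rule sigma_finite_measure.nn_integral_weak_bound[OF sigma_finite_lborel])
      show "AE \<xi> in lborel. f \<xi> \<le> \<tau> powr (- 1 - c)"
        using \<tau> c by (intro AE_I2) (auto simp: f_def indicator_def intro!: powr_mono2')
      fix y :: real
      assume y: "0 < y"
      have "{\<xi> \<in> space lborel. y < f \<xi>} \<subseteq> {\<xi>::'a. norm \<xi> < 1 \<and> wt \<xi> < y powr - a}"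
      proof (rule subsetI)
        fix \<xi> :: 'a
        assume "\<xi> \<in> {\<xi> \<in> space lborel. y < f \<xi>}"
        then have f: "y < f \<xi>"
          by simp
        have in_set: "norm \<xi> < 1 \<and> \<tau> < wt \<xi>"
          using f y by (intro ccontr[of "norm \<xi> < 1 \<and> \<tau> < wt \<xi>"]) (simp add: f_def)
        then have w: "y < wt \<xi> powr (- 1 - c)" "0 < wt \<xi>"
          using f \<tau> by (auto simp: f_def)
        have "(wt \<xi> powr (- 1 - c)) powr - a < y powr - a"
          using w y a by (intro powr_less_mono2_neg) auto
        moreover have "(wt \<xi> powr (- 1 - c)) powr - a = wt \<xi>"
        proof -
          have "(- 1 - c) * - a = 1"
            using c by (simp add: a_def field_simps)
          then show ?thesis
            using w by (simp add: powr_powr)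
        qed
        ultimately show "\<xi> \<in> {\<xi>. norm \<xi> < 1 \<and> wt \<xi> < y powr - a}"
          using in_set by simp
      qed
      then have "emeasure lborel {\<xi> \<in> space lborel. y < f \<xi>} \<le> emeasure lborel {\<xi>::'a. norm \<xi> < 1 \<and> wt \<xi> < y powr - a}"
        by (intro emeasure_mono) auto
      also have "\<dots> \<le> ennreal (K * y powr - a)"
        unfolding K_def using y by (intro boundary_layer_measure) simp
      finally show "emeasure lborel {\<xi> \<in> space lborel. y < f \<xi>} \<le> ennreal (K * y powr - a)" .
    qed (use K a in \<open>auto simp: f_def\<close>)
    also have "(\<tau> powr (- 1 - c)) powr (1 - a) = \<tau> powr - c"
    proof -
      have "(- 1 - c) * (1 - a) = - c"
        using c by (simp add: a_def field_simps)
      then show ?thesis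
        by (simp add: powr_powr)
    qed
    finally show "(\<integral>\<^sup>+\<xi>. ennreal (wt \<xi> powr (real (DIM('a) - 1) - c)) * indicator {\<xi>. norm \<xi> < 1 \<and> \<tau> < wt \<xi>} \<xi> \<partial>(hyp :: 'a measure)) \<le> ennreal (K / (1 - a) * \<tau> powr - c)" .
  qed
qed

section \<open>The invariant setting and the weak-type estimate\<close>

lemma measurable_sph [simp]: "measurable sph N = measurable borel N"
  by (rule measurable_cong_sets) simp_all

lemma measurable_hyp [simp]: "measurable hyp N = measurable borel N"
  by (rule measurable_cong_sets) simp_all

lemma powr_sum_le: "0 \<le> (x::real) \<Longrightarrow> 1 \<le> p \<Longrightarrow> x \<le> 1 + x powr p"
  using powr_mono[of 1 p x] by (cases "x \<le> 1") (auto intro: order_trans[of _ 1])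

text \<open>\<open>m\<close> is the dimension of the sphere and m / s the exponent conjugate to
  \<open>p\<close>. Inside the locale the parameters of the operator are represented by
  \<open>s\<close> and \<open>q\<close>; that \<open>q\<close> exceeds both conjugate exponents is
  the subcritical condition.\<close>

locale stab =
  fixes T :: "'a::euclidean_space itself" and S m s p q :: real
  assumes S: "S = sphere_area TYPE('a)" and dim: "3 \<le> DIM('a)" and m: "m = real (DIM('a) - 1)"
    and s: "0 < s" "s < m" and p: "p = m / (m - s)" and pq: "p < q" and sq: "m / s < q"
begin

lemma S_pos: "0 < S"
  unfolding S by (rule sphere_area_pos)

lemma m2: "2 \<le> m"
  using dim by (simp add: m of_nat_diff)

lemma p1: "1 < p"
  using s by (simp add: p)

lemma conj: "s / m + 1 / p = 1" "1 / (m / s) + 1 / p = 1" "1 < m / s"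
  using s by (simp_all add: p field_simps)

text \<open>One of the two conjugate exponents \<open>p\<close> and m / s is at least 2, and
  \<open>q\<close> is larger than both.\<close>

lemma q2: "2 < q"
proof (cases "p < 2")
  case True
  have "2 < m / s"
  proof -
    have "m < 2 * (m - s)"
      using True s by (simp add: p field_simps)
    then show ?thesis
      using s by (simp add: field_simps)
  qed
  then show ?thesis
    using sq by simp
qed (use pq in simp)

lemma ker_le:
  assumes "norm \<xi> \<le> R" "R < 1" "norm \<eta> = 1"
  shows "ker s \<xi> \<eta> \<le> (1 / (2 * (1 - R)\<^sup>2)) powr s"
proof -
  have d: "1 - R \<le> norm (\<xi> - \<eta>)"
    using norm_triangle_ineq2[of \<eta> \<xi>] assms by (simp add: norm_minus_commute)
  have "wt \<xi> / (norm (\<xi> - \<eta>))\<^sup>2 \<le> (1 / 2) / (1 - R)\<^sup>2"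
    using d assms wt_le[of \<xi>] by (intro frac_le power_mono) auto
  then show ?thesis
    unfolding ker_def using s assms wt_pos[of \<xi>] by (intro powr_mono2) (auto simp: divide_simps)
qed

lemma ker_ge:
  assumes "norm \<xi> \<le> R" "R < 1" "norm \<eta> = 1"
  shows "((1 - R\<^sup>2) / 8) powr s \<le> ker s \<xi> \<eta>"
proof -
  have R: "0 \<le> R"
    using assms norm_ge_zero order_trans by blast
  have d: "norm (\<xi> - \<eta>) \<le> 2" "0 < norm (\<xi> - \<eta>)"
    using norm_triangle_ineq4[of \<xi> \<eta>] assms by auto
  have "((1 - R\<^sup>2) / 2) / 2\<^sup>2 \<le> wt \<xi> / (norm (\<xi> - \<eta>))\<^sup>2"
    using d R assms wt_pos[of \<xi>] power_mono[OF d(1), of 2]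
    by (intro frac_le) (auto simp: wt_def intro: power_mono less_imp_le)
  then show ?thesis
    unfolding ker_def using s R assms by (intro powr_mono2) (auto simp: abs_square_le_1)
qed

lemma integrable_ker:
  assumes "norm \<xi> < 1" and [measurable]: "u \<in> borel_measurable borel" and u: "integrable sph u"
  shows "integrable sph (\<lambda>\<eta>. ker s \<xi> \<eta> * u \<eta>)"
proof (rule Bochner_Integration.integrable_bound[of _ "\<lambda>\<eta>. (1 / (2 * (1 - norm \<xi>)\<^sup>2)) powr s * \<bar>u \<eta>\<bar>"])
  show "integrable sph (\<lambda>\<eta>. (1 / (2 * (1 - norm \<xi>)\<^sup>2)) powr s * \<bar>u \<eta>\<bar>)"
    using u by simp
  show "AE \<eta> in sph. norm (ker s \<xi> \<eta> * u \<eta>) \<le> norm ((1 / (2 * (1 - norm \<xi>)\<^sup>2)) powr s * \<bar>u \<eta>\<bar>)"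
    using AE_sph by eventually_elim (use ker_le[OF order_refl assms(1)] in \<open>auto simp: abs_mult intro!: mult_right_mono\<close>)
qed simp

lemma
  assumes "norm \<xi> < 1" "u \<in> borel_measurable borel" "integrable sph u" "v \<in> borel_measurable borel" "integrable sph v"
  shows Tr_add: "Tr s (\<lambda>\<eta>. u \<eta> + v \<eta>) \<xi> = Tr s u \<xi> + Tr s v \<xi>"
    and Tr_diff: "Tr s (\<lambda>\<eta>. u \<eta> - v \<eta>) \<xi> = Tr s u \<xi> - Tr s v \<xi>"
  unfolding Tr_def using integrable_ker[OF assms(1-3)] integrable_ker[OF assms(1,4,5)]
  by (simp_all add: distrib_left right_diff_distrib)

lemma Tr_cmult: "Tr s (\<lambda>\<eta>. c * u \<eta>) \<xi> = c * Tr s u \<xi>"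
  unfolding Tr_def by (simp add: mult.left_commute)

lemma Tr_nonneg: "(\<And>\<eta>. 0 \<le> u \<eta>) \<Longrightarrow> 0 \<le> Tr s u \<xi>"
  unfolding Tr_def by (intro integral_nonneg_AE) auto

lemma Tr_abs:
  assumes "norm \<xi> < 1" "u \<in> borel_measurable borel" "integrable sph u"
  shows "\<bar>Tr s u \<xi>\<bar> \<le> Tr s (\<lambda>\<eta>. \<bar>u \<eta>\<bar>) \<xi>"
proof -
  have "\<bar>Tr s u \<xi>\<bar> \<le> (\<integral>\<eta>. \<bar>ker s \<xi> \<eta> * u \<eta>\<bar> \<partial>sph)"
    unfolding Tr_def by (rule integral_abs_bound)
  then show ?thesis
    by (simp add: Tr_def abs_mult)
qed

lemma nn_Tr:
  assumes "norm \<xi> < 1" "v \<in> borel_measurable borel" "integrable sph v" "\<And>\<eta>. 0 \<le> v \<eta>"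
  shows "(\<integral>\<^sup>+\<eta>. ennreal (ker s \<xi> \<eta> * v \<eta>) \<partial>sph) = ennreal (Tr s v \<xi>)"
  unfolding Tr_def using assms by (intro nn_integral_eq_integral integrable_ker) auto

lemma Tr_ge:
  assumes "norm \<xi> \<le> R" "R < 1" "v \<in> borel_measurable borel" "integrable sph v" "\<And>\<eta>. 0 \<le> v \<eta>"
  shows "((1 - R\<^sup>2) / 8) powr s * (\<integral>\<eta>. v \<eta> \<partial>sph) \<le> Tr s v \<xi>"
proof -
  have "(\<integral>\<eta>. ((1 - R\<^sup>2) / 8) powr s * v \<eta> \<partial>sph) \<le> Tr s v \<xi>"
    unfolding Tr_def
  proof (rule integral_mono_AE)
    show "AE \<eta> in sph. ((1 - R\<^sup>2) / 8) powr s * v \<eta> \<le> ker s \<xi> \<eta> * v \<eta>"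
      using AE_sph by eventually_elim (use ker_ge[OF assms(1,2)] assms(5) in \<open>auto intro: mult_right_mono\<close>)
  qed (use assms in \<open>auto intro: integrable_ker\<close>)
  then show ?thesis
    by simp
qed

lemma Tr_le:
  assumes "norm \<xi> \<le> R" "R < 1" "v \<in> borel_measurable borel" "integrable sph v"
  shows "\<bar>Tr s v \<xi>\<bar> \<le> (1 / (2 * (1 - R)\<^sup>2)) powr s * (\<integral>\<eta>. \<bar>v \<eta>\<bar> \<partial>sph)"
proof -
  have "\<bar>Tr s v \<xi>\<bar> \<le> Tr s (\<lambda>\<eta>. \<bar>v \<eta>\<bar>) \<xi>"
    using assms by (intro Tr_abs) auto
  also have "\<dots> \<le> (\<integral>\<eta>. (1 / (2 * (1 - R)\<^sup>2)) powr s * \<bar>v \<eta>\<bar> \<partial>sph)"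
    unfolding Tr_def
  proof (rule integral_mono_AE)
    show "AE \<eta> in sph. ker s \<xi> \<eta> * \<bar>v \<eta>\<bar> \<le> (1 / (2 * (1 - R)\<^sup>2)) powr s * \<bar>v \<eta>\<bar>"
      using AE_sph by eventually_elim (use ker_le[OF assms(1,2)] in \<open>auto intro: mult_right_mono\<close>)
  qed (use assms in \<open>auto intro: integrable_ker\<close>)
  finally show ?thesis
    by simp
qed

definition Lp :: "('a \<Rightarrow> real) \<Rightarrow> bool" where
  "Lp u \<longleftrightarrow> u \<in> borel_measurable borel \<and> integrable sph (\<lambda>\<eta>. \<bar>u \<eta>\<bar> powr p)"

definition E :: "('a \<Rightarrow> real) \<Rightarrow> real" where
  "E u = (\<integral>\<eta>. \<bar>u \<eta>\<bar> powr p \<partial>sph)"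

lemma LpD [simp]: "Lp u \<Longrightarrow> u \<in> borel_measurable borel" "Lp u \<Longrightarrow> integrable sph (\<lambda>\<eta>. \<bar>u \<eta>\<bar> powr p)"
  by (simp_all add: Lp_def)

lemma Lp_integrable:
  assumes "Lp u"
  shows "integrable sph u"
proof (rule Bochner_Integration.integrable_bound[of _ "\<lambda>\<eta>. 1 + \<bar>u \<eta>\<bar> powr p"])
  show "AE \<eta> in sph. norm (u \<eta>) \<le> norm (1 + \<bar>u \<eta>\<bar> powr p)"
    using powr_sum_le[of "\<bar>_\<bar>" p] p1 by (intro AE_I2) auto
qed (use assms in simp_all)

lemma E_nonneg: "0 \<le> E u"
  by (simp add: E_def)

lemma nn_E: "Lp u \<Longrightarrow> (\<integral>\<^sup>+\<eta>. ennreal (\<bar>u \<eta>\<bar> powr p) \<partial>sph) = ennreal (E u)"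
  unfolding E_def by (rule nn_integral_eq_integral) auto

text \<open>The power m / s of the kernel is a multiple of the Poisson power, whose mass does not
  depend on \<xi>. Hoelder's inequality with the conjugate exponent \<open>p\<close> gives a bound
  uniform in the ball.\<close>

lemma Tr_sup_bound:
  assumes u: "Lp u" and \<xi>: "norm \<xi> < 1"
  shows "\<bar>Tr s u \<xi>\<bar> \<le> (S / 2 powr m) powr (s / m) * E u powr (1 / p)"
proof -
  note [measurable] = LpD(1)[OF u]
  have "(\<integral>\<^sup>+\<eta>. ennreal (ker s \<xi> \<eta> powr (m / s)) \<partial>sph) = (\<integral>\<^sup>+\<eta>. ennreal (1 / 2 powr m) * ennreal ((2 * wt \<xi> / (norm (\<xi> - \<eta>))\<^sup>2) ^ (DIM('a) - 1)) \<partial>sph)"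
  proof (rule nn_integral_cong_AE, use AE_sph in eventually_elim)
    fix \<eta> :: 'a
    assume "norm \<eta> = 1"
    then have "\<xi> \<noteq> \<eta>"
      using \<xi> by auto
    then have pos: "0 < wt \<xi> / (norm (\<xi> - \<eta>))\<^sup>2"
      using wt_pos[OF \<xi>] by simp
    have "ker s \<xi> \<eta> powr (m / s) = (wt \<xi> / (norm (\<xi> - \<eta>))\<^sup>2) powr m"
      using s by (simp add: ker_def powr_powr)
    moreover have "(2 * wt \<xi> / (norm (\<xi> - \<eta>))\<^sup>2) ^ (DIM('a) - 1) = (2 * (wt \<xi> / (norm (\<xi> - \<eta>))\<^sup>2)) powr m"
      unfolding m using pos by (subst powr_realpow) auto
    moreover have "(2 * (wt \<xi> / (norm (\<xi> - \<eta>))\<^sup>2)) powr m = 2 powr m * (wt \<xi> / (norm (\<xi> - \<eta>))\<^sup>2) powr m"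
      by (rule powr_mult)
    ultimately show "ennreal (ker s \<xi> \<eta> powr (m / s)) = ennreal (1 / 2 powr m) * ennreal ((2 * wt \<xi> / (norm (\<xi> - \<eta>))\<^sup>2) ^ (DIM('a) - 1))"
      by (simp add: ennreal_mult'[symmetric])
  qed
  also have "\<dots> = ennreal (1 / 2 powr m) * ennreal S"
    by (subst nn_integral_cmult) (simp_all add: nn_integral_poisson_power[OF \<xi>, unfolded One_nat_def] S)
  also have "\<dots> = ennreal (S / 2 powr m)"
    using S_pos by (simp add: ennreal_mult'[symmetric])
  finally have K: "(\<integral>\<^sup>+\<eta>. ennreal (ker s \<xi> \<eta> powr (m / s)) \<partial>sph) = ennreal (S / 2 powr m)" .
  have "(\<integral>\<^sup>+\<eta>. ennreal (ker s \<xi> \<eta> * \<bar>u \<eta>\<bar>) \<partial>sph) \<le> ennreal ((S / 2 powr m) powr (1 / (m / s)) * E u powr (1 / p))"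
    using u conj p1 S_pos by (intro nn_integral_Holder) (simp_all add: K nn_E E_nonneg)
  then have "ennreal (Tr s (\<lambda>\<eta>. \<bar>u \<eta>\<bar>) \<xi>) \<le> ennreal ((S / 2 powr m) powr (s / m) * E u powr (1 / p))"
    using nn_Tr[OF \<xi>, of "\<lambda>\<eta>. \<bar>u \<eta>\<bar>"] u Lp_integrable[OF u] by simp
  then have "Tr s (\<lambda>\<eta>. \<bar>u \<eta>\<bar>) \<xi> \<le> (S / 2 powr m) powr (s / m) * E u powr (1 / p)"
    by (subst (asm) ennreal_le_iff) simp_all
  then show ?thesis
    using Tr_abs[OF \<xi> _ Lp_integrable[OF u]] u by simp
qed

text \<open>For each \<open>\<xi>\<close> the function is cut at the height \<open>h(\<xi>)\<close> at which Hoelder's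
  inequality bounds the low part by \<open>y/2\<close>; the high part is estimated by Jensen's inequality and Fubini.\<close>

lemma weak_type:
  obtains C e where "0 \<le> C" "0 < e" "e < q"
    "\<And>v y. Lp v \<Longrightarrow> (\<And>\<eta>. 0 \<le> v \<eta>) \<Longrightarrow> E v \<le> 1 \<Longrightarrow> 0 < y \<Longrightarrow>
      emeasure hyp {\<xi>. norm \<xi> < 1 \<and> y < Tr s v \<xi>} \<le> ennreal (C * y powr - e)"
proof -
  define P where "P = m / s"
  have P: "1 < P" "1 / P + 1 / p = 1" "P < q" "s * P = m" "(p - 1) * P = p"
    using conj sq s p1 unfolding P_def by (auto simp: p field_simps)
  define L1 where "L1 = 1 / (1 / q + 1 / P)"
  have q0: "0 < q"
    using q2 by simp
  have "1 / q + 1 / P < 1"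
    using P(2) divide_strict_left_mono[OF pq, of 1] p1 q0 by simp
  then have L1a: "1 < L1"
    using P q0 by (simp add: L1_def pos_less_divide_eq add_pos_pos)
  have "1 / q < 1 / P"
    using P q0 by (simp add: divide_strict_left_mono)
  then have "1 / q + 1 / P < 2 / P"
    by simp
  then have L1b: "P / 2 < L1"
    using P q0 divide_strict_left_mono[of "1 / q + 1 / P" "2 / P" 1] by (simp add: L1_def add_pos_pos)
  \<comment> \<open>The exponent \<open>l\<close> for the kernel must satisfy l > P / 2 so that the
    kernel powers are governed by \<open>kernel_power_integral\<close>, and 1 / l > 1 / q + 1 / P so
    that the final weak exponent \<open>e\<close> is below \<open>q\<close>. The second condition
    also gives l < P. The interval is nonempty because 1 / q is smaller than 1 / p and than 1 /
    P.\<close>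
  obtain l where l: "max 1 (P / 2) < l" "l < L1"
    using L1a L1b dense[of "max 1 (P / 2)" L1] by auto
  have l1: "1 < l" "P / 2 < l"
    using l by auto
  have il: "1 / q + 1 / P < 1 / l"
    using l l1 P q0 divide_strict_left_mono[of l L1 1] by (simp add: L1_def add_pos_pos)
  define t where "t = s * l"
  \<comment> \<open>After Hoelder's inequality the low part of T v is at most C1 (wt \<xi>)^\<kappa>
    h^g with cutting height h; \<kappa> and \<open>g\<close> are the exponents that arise
    there.\<close>
  define \<kappa> where "\<kappa> = m / l - s"
  define g where "g = p / l - (p - 1)"
  define e where "e = p / g"
  have ge: "g / p = 1 / l - 1 / P"
    using P p1 l1 by (simp add: g_def diff_divide_distrib)
  have "1 / q < g / p"
    using il ge by simp
  then have g0: "0 < g"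
    using q0 p1 less_trans[of 0 "1 / q" "g / p"] by (simp add: zero_less_divide_iff)
  have e: "0 < e" "e < q"
    using g0 p1 \<open>1 / q < g / p\<close> q0 by (auto simp: e_def field_simps)
  have t: "m / 2 < t"
    using l1(2) s P(4) mult_strict_left_mono[of "P / 2" l s] by (simp add: t_def)
  have "l < P"
  proof (rule ccontr)
    assume "\<not> l < P"
    then have "1 / l \<le> 1 / P"
      using P l1 by (simp add: frac_le)
    moreover have "0 < 1 / q"
      using q0 by simp
    ultimately show False
      using il by linarith
  qed
  then have \<kappa>0: "0 < \<kappa>"
    using l1 s P(4) mult_strict_left_mono[of l P s] by (simp add: \<kappa>_def field_simps)
  \<comment> \<open>This relation turns the exponent \<kappa> / g of the cutting height into s / (p
    - 1), so that the later integral in \<xi> leaves exactly the power p of v.\<close>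
  have \<kappa>g: "\<kappa> * (p - 1) = g * s"
  proof -
    have "m * p = m + p * s"
      using s by (simp add: p field_simps)
    then show ?thesis
      using l1 by (simp add: \<kappa>_def g_def field_simps)
  qed
  obtain C2 where C2: "0 < C2" "\<And>\<xi>::'a. norm \<xi> < 1 \<Longrightarrow>
      (\<integral>\<^sup>+\<eta>. ennreal (norm (\<xi> - \<eta>) powr (- 2 * t)) \<partial>sph) \<le> ennreal (C2 * wt \<xi> powr (m - 2 * t))"
    using kernel_power_integral[OF m t] m2 by auto
  obtain C3 where C3: "0 \<le> C3" "\<And>\<tau>. 0 < \<tau> \<Longrightarrow>
      (\<integral>\<^sup>+\<xi>. ennreal (wt \<xi> powr (m - s)) * indicator {\<xi>. norm \<xi> < 1 \<and> \<tau> < wt \<xi>} \<xi> \<partial>(hyp :: 'a measure)) \<le> ennreal (C3 * \<tau> powr - s)"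
    using radial_power_integral[OF s(1), where 'a='a] unfolding m[symmetric] by auto
  define C1 where "C1 = C2 powr (1 / l)"
  have C1: "0 < C1"
    using C2 by (simp add: C1_def)
  define C where "C = C2 * C3 / S * 2 powr l * (1 / (2 * C1)) powr (- ((p - 1) * l / g))"
  have kl: "ker s \<xi> \<eta> powr l = wt \<xi> powr t * norm (\<xi> - \<eta>) powr (- 2 * t)" if "norm \<xi> < 1" for \<xi> \<eta>
  proof -
    have "ker s \<xi> \<eta> powr l = (wt \<xi> / (norm (\<xi> - \<eta>))\<^sup>2) powr t"
      by (simp add: ker_def powr_powr t_def)
    also have "\<dots> = wt \<xi> powr t * norm (\<xi> - \<eta>) powr (- 2 * t)"
    proof (cases "\<xi> = \<eta>")
      case False
      then have "(norm (\<xi> - \<eta>))\<^sup>2 powr t = norm (\<xi> - \<eta>) powr (2 * t)"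
        by (simp add: powr_powr flip: powr_numeral)
      then show ?thesis
        using False by (simp add: powr_divide powr_minus_divide)
    qed (use s l1 in \<open>simp add: t_def\<close>)
    finally show ?thesis .
  qed
  show thesis
  proof
    show "0 \<le> C"
      using C2 C3 S_pos by (simp add: C_def)
    show "0 < e" "e < q"
      by (rule e)+
    fix v :: "'a \<Rightarrow> real" and y :: real
    assume v: "Lp v" and v0: "\<And>\<eta>. 0 \<le> v \<eta>" and Ev: "E v \<le> 1" and y: "0 < y"
    note [measurable] = LpD(1)[OF v]
    \<comment> \<open>The height \<open>h\<close> below is chosen so that the bound for the low part
      equals y / 2 at every \<xi>; \<open>B\<close> carries its dependence on
      \<open>y\<close>.\<close>
    define B where "B = (y / (2 * C1)) powr (1 / g)"
    have B: "0 < B"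
      using y C1 by (simp add: B_def)
    define h where "h \<xi> = B * wt \<xi> powr (- \<kappa> / g)" for \<xi> :: 'a
    have [measurable]: "h \<in> borel_measurable borel"
      unfolding h_def by measurable
    have Ev': "(\<integral>\<^sup>+\<eta>. ennreal (v \<eta> powr p) \<partial>sph) \<le> 1"
      using nn_E[OF v] v0 Ev by (simp add: ennreal_le_1)
    have kg: "\<kappa> / g = s / (p - 1)"
      using \<kappa>g g0 p1 by (simp add: field_simps)
    define D where "D \<xi> \<eta> = ker s \<xi> \<eta> powr l * (v \<eta> * indicator {x. h \<xi> < x} (v \<eta>))" for \<xi> \<eta>
    \<comment> \<open>A Chebyshev inequality in a form that can be integrated in \<xi>. Where T v >
      y, the high part exceeds y / 2, and its power l is controlled by the integral of
      \<open>ker\<close> to the power \<open>l\<close> times v over the set where v > h.\<close>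
    have pointwise: "1 \<le> ennreal ((2 / y) powr l * h \<xi> powr (- (p - 1) * (l - 1))) * (\<integral>\<^sup>+\<eta>. ennreal (D \<xi> \<eta>) \<partial>sph)"
      if \<xi>: "norm \<xi> < 1" and big: "y < Tr s v \<xi>" for \<xi>
    proof -
      have w: "0 < wt \<xi>"
        using wt_pos[OF \<xi>] .
      have h0: "0 < h \<xi>"
        using B w by (simp add: h_def)
      define l' where "l' = l / (l - 1)"
      have l': "1 < l'" "1 / l + 1 / l' = 1" "1 / l' = (l - 1) / l"
        using l1 by (simp_all add: l'_def field_simps)
      have pl': "1 - p / l' = g"
        using l1 by (simp add: l'_def g_def field_simps)
      have "p < l'"
        using pl' l'(1) mult_pos_pos[OF g0, of l'] by (simp add: field_simps)
      define v1 where "v1 \<eta> = v \<eta> * indicator {x. h \<xi> < x} (v \<eta>)" for \<eta>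
      define v2 where "v2 \<eta> = v \<eta> * indicator {x. x \<le> h \<xi>} (v \<eta>)" for \<eta>
      have [measurable]: "v1 \<in> borel_measurable borel" "v2 \<in> borel_measurable borel"
        unfolding v1_def v2_def by measurable
      have v12: "v1 \<eta> \<ge> 0" "v2 \<eta> \<ge> 0" "v \<eta> = v1 \<eta> + v2 \<eta>" for \<eta>
        using v0 by (auto simp: v1_def v2_def indicator_def)
      have kerl: "(\<integral>\<^sup>+\<eta>. ennreal (ker s \<xi> \<eta> powr l) \<partial>sph) \<le> ennreal (C2 * wt \<xi> powr (m - t))"
      proof -
        have "(\<integral>\<^sup>+\<eta>. ennreal (ker s \<xi> \<eta> powr l) \<partial>sph) = ennreal (wt \<xi> powr t) * (\<integral>\<^sup>+\<eta>. ennreal (norm (\<xi> - \<eta>) powr (- 2 * t)) \<partial>sph)"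
          by (subst nn_integral_cmult[symmetric]) (simp_all add: kl[OF \<xi>] ennreal_mult')
        also have "\<dots> \<le> ennreal (wt \<xi> powr t) * ennreal (C2 * wt \<xi> powr (m - 2 * t))"
          by (intro mult_left_mono C2 \<xi>) simp
        also have "\<dots> = ennreal (C2 * wt \<xi> powr (m - t))"
        proof -
          have "wt \<xi> powr t * wt \<xi> powr (m - 2 * t) = wt \<xi> powr (m - t)"
            unfolding powr_add[symmetric] by simp
          then show ?thesis
            using C2(1) by (simp add: ennreal_mult[symmetric] mult.left_commute)
        qed
        finally show ?thesis .
      qed
      have low: "(\<integral>\<^sup>+\<eta>. ennreal (ker s \<xi> \<eta> * v2 \<eta>) \<partial>sph) \<le> ennreal (y / 2)"
      proof -
        have "(\<integral>\<^sup>+\<eta>. ennreal (v2 \<eta> powr l') \<partial>sph) \<le> (\<integral>\<^sup>+\<eta>. ennreal (h \<xi> powr (l' - p)) * ennreal (v \<eta> powr p) \<partial>sph)"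
        proof (rule nn_integral_mono)
          fix \<eta>
          have "v2 \<eta> powr l' \<le> h \<xi> powr (l' - p) * v \<eta> powr p"
          proof (cases "v \<eta> \<le> h \<xi>")
            case True
            have "v \<eta> powr (l' - p) * v \<eta> powr p \<le> h \<xi> powr (l' - p) * v \<eta> powr p"
              using True v0 \<open>p < l'\<close> by (intro mult_right_mono powr_mono2) auto
            then show ?thesis
              using True unfolding powr_add[symmetric] by (simp add: v2_def)
          qed (simp add: v2_def)
          then show "ennreal (v2 \<eta> powr l') \<le> ennreal (h \<xi> powr (l' - p)) * ennreal (v \<eta> powr p)"
            by (simp add: ennreal_mult'[symmetric] ennreal_leI)
        qed
        also have "\<dots> \<le> ennreal (h \<xi> powr (l' - p)) * 1"
          by (subst nn_integral_cmult) (simp, rule mult_left_mono[OF Ev'], simp)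
        finally have v2l: "(\<integral>\<^sup>+\<eta>. ennreal (v2 \<eta> powr l') \<partial>sph) \<le> ennreal (h \<xi> powr (l' - p))"
          by simp
        have "(\<integral>\<^sup>+\<eta>. ennreal (ker s \<xi> \<eta> * v2 \<eta>) \<partial>sph) \<le> ennreal ((C2 * wt \<xi> powr (m - t)) powr (1 / l) * (h \<xi> powr (l' - p)) powr (1 / l'))"
          using l1 l' C2(1) v12 by (intro nn_integral_Holder kerl v2l) simp_all
        also have "(C2 * wt \<xi> powr (m - t)) powr (1 / l) * (h \<xi> powr (l' - p)) powr (1 / l') = y / 2"
        proof -
          have 1: "(C2 * wt \<xi> powr (m - t)) powr (1 / l) = C1 * wt \<xi> powr \<kappa>"
          proof -
            have "(m - t) * (1 / l) = \<kappa>"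
              using l1 by (simp add: t_def \<kappa>_def field_simps)
            then show ?thesis
              by (simp add: C1_def powr_mult powr_powr del: times_divide_eq_right)
          qed
          have 2: "(h \<xi> powr (l' - p)) powr (1 / l') = h \<xi> powr g"
          proof -
            have "(l' - p) * (1 / l') = g"
              using pl' l'(1) by (simp add: field_simps)
            then show ?thesis
              by (simp add: powr_powr del: times_divide_eq_right)
          qed
          have 3: "h \<xi> powr g = y / (2 * C1) * wt \<xi> powr - \<kappa>"
            using g0 y C1 by (simp add: h_def B_def powr_mult powr_powr)
          show ?thesis
            unfolding 1 2 3 using w C1 by (simp add: powr_minus field_simps)
        qed
        finally show ?thesis .
      qed
      have "ennreal y < ennreal (Tr s v \<xi>)"
        using big y by (simp add: ennreal_lessI)
      also have "\<dots> = (\<integral>\<^sup>+\<eta>. ennreal (ker s \<xi> \<eta> * v1 \<eta>) + ennreal (ker s \<xi> \<eta> * v2 \<eta>) \<partial>sph)"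
        unfolding nn_Tr[OF \<xi> LpD(1)[OF v] Lp_integrable[OF v] v0, symmetric]
        using v12 by (intro nn_integral_cong) (simp add: distrib_left flip: ennreal_plus)
      also have "\<dots> = (\<integral>\<^sup>+\<eta>. ennreal (ker s \<xi> \<eta> * v1 \<eta>) \<partial>sph) + (\<integral>\<^sup>+\<eta>. ennreal (ker s \<xi> \<eta> * v2 \<eta>) \<partial>sph)"
        by (rule nn_integral_add) simp_all
      also have "\<dots> \<le> (\<integral>\<^sup>+\<eta>. ennreal (ker s \<xi> \<eta> * v1 \<eta>) \<partial>sph) + ennreal (y / 2)"
        by (intro add_left_mono low)
      finally have "ennreal (y / 2) + ennreal (y / 2) < (\<integral>\<^sup>+\<eta>. ennreal (ker s \<xi> \<eta> * v1 \<eta>) \<partial>sph) + ennreal (y / 2)"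
        using y by (simp flip: ennreal_plus)
      then have high: "ennreal (y / 2) < (\<integral>\<^sup>+\<eta>. ennreal (ker s \<xi> \<eta> * v1 \<eta>) \<partial>sph)"
        by (meson add_right_mono linorder_not_le)
      define A where "A = (\<integral>\<^sup>+\<eta>. ennreal (D \<xi> \<eta>) \<partial>sph)"
      have D: "D \<xi> \<eta> = ker s \<xi> \<eta> powr l * v1 \<eta>" for \<eta>
        by (simp add: D_def v1_def)
      show ?thesis
      proof (cases "A = \<infinity>")
        case True
        then show ?thesis
          using y h0 unfolding A_def[symmetric] by (simp add: ennreal_mult_top)
      next
        case False
        then obtain A' where A': "A = ennreal A'" "0 \<le> A'"
          by (cases A) auto
        have v1p: "(\<integral>\<^sup>+\<eta>. ennreal (v1 \<eta>) \<partial>sph) \<le> ennreal (h \<xi> powr (1 - p))"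
        proof -
          have "(\<integral>\<^sup>+\<eta>. ennreal (v1 \<eta>) \<partial>sph) \<le> (\<integral>\<^sup>+\<eta>. ennreal (h \<xi> powr (1 - p)) * ennreal (v \<eta> powr p) \<partial>sph)"
          proof (rule nn_integral_mono)
            fix \<eta>
            have "v1 \<eta> \<le> h \<xi> powr (1 - p) * v \<eta> powr p"
            proof (cases "h \<xi> < v \<eta>")
              case True
              have "v \<eta> powr (1 - p) * v \<eta> powr p \<le> h \<xi> powr (1 - p) * v \<eta> powr p"
                using True h0 p1 by (intro mult_right_mono powr_mono2') auto
              then show ?thesis
                using True v0 unfolding powr_add[symmetric] by (simp add: v1_def)
            qed (simp add: v1_def)
            then show "ennreal (v1 \<eta>) \<le> ennreal (h \<xi> powr (1 - p)) * ennreal (v \<eta> powr p)"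
              by (simp add: ennreal_mult'[symmetric] ennreal_leI)
          qed
          also have "\<dots> \<le> ennreal (h \<xi> powr (1 - p)) * 1"
            by (subst nn_integral_cmult) (simp, rule mult_left_mono[OF Ev'], simp)
          finally show ?thesis
            by simp
        qed
        \<comment> \<open>Jensen's inequality in Hoelder form: \<open>v1\<close> is split into its
          powers 1 / l and 1 / l', and the second factor costs only the mass of \<open>v1\<close>,
          which is at most h powr (1 - p).\<close>
        have "(\<integral>\<^sup>+\<eta>. ennreal ((ker s \<xi> \<eta> * v1 \<eta> powr (1 / l)) * (v1 \<eta> powr (1 / l'))) \<partial>sph)
           \<le> ennreal (A' powr (1 / l) * (h \<xi> powr (1 - p)) powr (1 / l'))"
        proof (rule nn_integral_Holder)
          have "(ker s \<xi> \<eta> * v1 \<eta> powr (1 / l)) powr l = D \<xi> \<eta>" for \<eta>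
            using l1 v12 by (simp add: powr_mult powr_powr D)
          then show "(\<integral>\<^sup>+\<eta>. ennreal ((ker s \<xi> \<eta> * v1 \<eta> powr (1 / l)) powr l) \<partial>sph) \<le> ennreal A'"
            using A' by (simp add: A_def)
          show "(\<integral>\<^sup>+\<eta>. ennreal ((v1 \<eta> powr (1 / l')) powr l') \<partial>sph) \<le> ennreal (h \<xi> powr (1 - p))"
            using l'(1) v12(1) v1p by (simp add: powr_powr)
        qed (use l1 l' A' in simp_all)
        moreover have "(ker s \<xi> \<eta> * v1 \<eta> powr (1 / l)) * (v1 \<eta> powr (1 / l')) = ker s \<xi> \<eta> * v1 \<eta>" for \<eta>
          using v12 l'(2) unfolding mult.assoc powr_add[symmetric] by simp
        ultimately have "ennreal (y / 2) < ennreal (A' powr (1 / l) * (h \<xi> powr (1 - p)) powr (1 / l'))"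
          using high by simp
        then have "y / 2 < A' powr (1 / l) * (h \<xi> powr (1 - p)) powr (1 / l')"
          using y by (subst (asm) ennreal_less_iff) simp_all
        then have "(y / 2) powr l \<le> (A' powr (1 / l) * (h \<xi> powr (1 - p)) powr (1 / l')) powr l"
          using y l1 by (intro powr_mono2) simp_all
        also have "\<dots> = A' * h \<xi> powr (- (p - 1) * (l - 1))"
        proof -
          have "(1 - p) * (1 / l') * l = - (p - 1) * (l - 1)"
            unfolding l'(3) using l1 by (simp add: field_simps)
          then show ?thesis
            using A' l1 by (simp add: powr_mult powr_powr del: times_divide_eq_right mult_minus_left minus_diff_eq)
        qed
        finally have "(y / 2) powr l \<le> A' * h \<xi> powr (- (p - 1) * (l - 1))" .
        then have "(2 / y) powr l * (y / 2) powr l \<le> (2 / y) powr l * (A' * h \<xi> powr (- (p - 1) * (l - 1)))"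
          by (intro mult_left_mono) simp_all
        moreover have "(2 / y) powr l * (y / 2) powr l = 1"
          using y by (simp add: powr_mult[symmetric])
        ultimately have "1 \<le> (2 / y) powr l * h \<xi> powr (- (p - 1) * (l - 1)) * A'"
          by (simp add: mult_ac)
        then have "ennreal 1 \<le> ennreal ((2 / y) powr l * h \<xi> powr (- (p - 1) * (l - 1)) * A')"
          by (rule ennreal_leI)
        then show ?thesis
          unfolding A_def[symmetric] A'(1) using A'(2) by (simp add: ennreal_mult)
      qed
    qed
    \<comment> \<open>All dependence on |\<xi>| and on the value x = v \<eta> is collected here. For
      fixed x this is a radial weight, and \<eta> enters otherwise only through |\<xi> - \<eta>|, as
      \<open>radial_average\<close> requires.\<close>
    define G where "G r x = ennreal ((2 / y) powr l * (B * ((1 - r\<^sup>2) / 2) powr (- \<kappa> / g)) powr (- (p - 1) * (l - 1)) * ((1 - r\<^sup>2) / 2) powr t)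
        * indicator {z. z < x} (B * ((1 - r\<^sup>2) / 2) powr (- \<kappa> / g)) * indicator {..<1} r" for r x :: real
    have G: "G (norm \<xi>) x = ennreal ((2 / y) powr l * h \<xi> powr (- (p - 1) * (l - 1)) * wt \<xi> powr t)
        * indicator {z. z < x} (h \<xi>) * indicator {\<xi>. norm \<xi> < 1} \<xi>" for \<xi> :: 'a and x
      by (simp add: G_def h_def wt_def indicator_def)
    have [measurable]: "(\<lambda>r. G r x) \<in> borel_measurable borel" for x
      unfolding G_def by measurable
    have Gm [measurable]: "(\<lambda>(\<xi>, \<eta>). G (norm \<xi>) (v \<eta>) * (ennreal (norm (\<xi> - \<eta>) powr (- 2 * t)) * ennreal (v \<eta>))) \<in> borel_measurable (hyp \<Otimes>\<^sub>M sph)"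
      unfolding G by measurable
    interpret HS: pair_sigma_finite hyp "sph :: 'a measure" ..
    have inner: "(\<integral>\<^sup>+\<xi>. G (norm \<xi>) x * ennreal (norm (\<xi> - \<eta>) powr (- 2 * t)) \<partial>hyp)
        \<le> ennreal (C * y powr - e) * ennreal (x powr (p - 1))"
      if \<eta>: "norm \<eta> = 1" and x: "0 \<le> x" for \<eta> :: 'a and x
    proof (cases "x = 0")
      case True
      have "G (norm \<xi>) x = 0" if "norm \<xi> < 1" for \<xi> :: 'a
        using that True B wt_pos[of \<xi>] by (simp add: G h_def not_less)
      moreover have "G (norm \<xi>) x = 0" if "\<not> norm \<xi> < 1" for \<xi> :: 'a
        using that by (simp add: G)
      ultimately have "G (norm \<xi>) x = 0" for \<xi> :: 'a
        by blast
      then show ?thesis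
        by simp
    next
      case False
      then have x0: "0 < x"
        using x by simp
      \<comment> \<open>The height \<open>h\<close> is B times the power - s / (p - 1) of
        \<open>wt\<close>; hence h \<xi> < x forces wt \<xi> > \<tau>, and the integral stays away
        from the sphere.\<close>
      define \<tau> where "\<tau> = (B / x) powr ((p - 1) / s)"
      have \<tau>: "0 < \<tau>"
        using B x0 by (simp add: \<tau>_def)
      define c where "c = (2 / y) powr l * B powr (- (p - 1) * (l - 1)) * C2"
      have c0: "0 \<le> c"
        using C2 by (simp add: c_def)
      have "ennreal S * (\<integral>\<^sup>+\<xi>. G (norm \<xi>) x * ennreal (norm (\<xi> - \<eta>) powr (- 2 * t)) \<partial>hyp)
          = (\<integral>\<^sup>+\<xi>. G (norm \<xi>) x * (\<integral>\<^sup>+\<zeta>. ennreal (norm (\<xi> - \<zeta>) powr (- 2 * t)) \<partial>sph) \<partial>(hyp :: 'a measure))"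
        unfolding S by (rule radial_average[OF \<eta>, where k = "\<lambda>r. ennreal (r powr (- 2 * t))"]) measurable
      also have "\<dots> \<le> (\<integral>\<^sup>+\<xi>. ennreal c * (ennreal (wt \<xi> powr (m - s)) * indicator {\<xi>. norm \<xi> < 1 \<and> \<tau> < wt \<xi>} \<xi>) \<partial>(hyp :: 'a measure))"
      proof (rule nn_integral_mono)
        fix \<xi> :: 'a
        show "G (norm \<xi>) x * (\<integral>\<^sup>+\<zeta>. ennreal (norm (\<xi> - \<zeta>) powr (- 2 * t)) \<partial>sph)
           \<le> ennreal c * (ennreal (wt \<xi> powr (m - s)) * indicator {\<xi>. norm \<xi> < 1 \<and> \<tau> < wt \<xi>} \<xi>)"
        proof (cases "norm \<xi> < 1 \<and> h \<xi> < x")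
          case True
          then have \<xi>: "norm \<xi> < 1" and hx: "h \<xi> < x"
            by auto
          have w: "0 < wt \<xi>"
            using wt_pos[OF \<xi>] .
          have "\<tau> < wt \<xi>"
          proof -
            have "B / x < wt \<xi> powr (s / (p - 1))"
              using hx x0 w by (simp add: h_def kg powr_minus field_simps)
            then have "(B / x) powr ((p - 1) / s) < (wt \<xi> powr (s / (p - 1))) powr ((p - 1) / s)"
              using B x0 p1 s by (intro powr_less_mono2) auto
            then show ?thesis
              using w p1 s by (simp add: \<tau>_def powr_powr)
          qed
          have "G (norm \<xi>) x * (\<integral>\<^sup>+\<zeta>. ennreal (norm (\<xi> - \<zeta>) powr (- 2 * t)) \<partial>sph)
              \<le> ennreal ((2 / y) powr l * h \<xi> powr (- (p - 1) * (l - 1)) * wt \<xi> powr t) * ennreal (C2 * wt \<xi> powr (m - 2 * t))"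
          proof -
            have "G (norm \<xi>) x = ennreal ((2 / y) powr l * h \<xi> powr (- (p - 1) * (l - 1)) * wt \<xi> powr t)"
              using \<xi> hx by (simp add: G)
            then show ?thesis
              by (simp only:) (rule mult_left_mono[OF C2(2)[OF \<xi>]], simp)
          qed
          also have "\<dots> = ennreal ((2 / y) powr l * h \<xi> powr (- (p - 1) * (l - 1)) * wt \<xi> powr t * (C2 * wt \<xi> powr (m - 2 * t)))"
            using C2 by (intro ennreal_mult[symmetric]) simp_all
          also have "(2 / y) powr l * h \<xi> powr (- (p - 1) * (l - 1)) * wt \<xi> powr t * (C2 * wt \<xi> powr (m - 2 * t)) = c * wt \<xi> powr (m - s)"
          proof -
            have e1: "h \<xi> powr (- (p - 1) * (l - 1)) = B powr (- (p - 1) * (l - 1)) * wt \<xi> powr (s * (l - 1))"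
            proof -
              have "- \<kappa> / g * (- (p - 1) * (l - 1)) = s * (l - 1)"
              proof -
                have "- \<kappa> / g * (- (p - 1) * (l - 1)) = \<kappa> * (p - 1) * (l - 1) / g"
                  using g0 by (simp add: field_simps)
                then show ?thesis
                  unfolding \<kappa>g using g0 by simp
              qed
              then show ?thesis
                unfolding h_def powr_mult powr_powr by simp
            qed
            have e2: "wt \<xi> powr (s * (l - 1)) * wt \<xi> powr t * wt \<xi> powr (m - 2 * t) = wt \<xi> powr (m - s)"
              unfolding powr_add[symmetric] by (simp add: t_def algebra_simps)
            show ?thesis
              unfolding e1 c_def e2[symmetric] by (simp add: mult_ac)
          qed
          finally show ?thesis
            using \<xi> \<open>\<tau> < wt \<xi>\<close> c0 by (simp add: ennreal_mult)
        qed (auto simp: G)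
      qed
      also have "\<dots> \<le> ennreal c * ennreal (C3 * \<tau> powr - s)"
        by (subst nn_integral_cmult) (auto intro!: mult_left_mono C3 \<tau>)
      also have "\<dots> = ennreal S * (ennreal (C * y powr - e) * ennreal (x powr (p - 1)))"
      proof -
        have t1: "\<tau> powr - s = B powr (- (p - 1)) * x powr (p - 1)"
        proof -
          have "\<tau> powr - s = (B / x) powr (- (p - 1))"
            using s by (simp add: \<tau>_def powr_powr)
          also have "\<dots> = B powr (- (p - 1)) * x powr (p - 1)"
            unfolding powr_divide using x0 by (simp only: powr_minus) (simp add: divide_inverse)
          finally show ?thesis .
        qed
        have t2: "B powr (- (p - 1) * (l - 1)) * B powr (- (p - 1)) = (1 / (2 * C1)) powr (- ((p - 1) * l / g)) * y powr (- ((p - 1) * l / g))"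
        proof -
          have "B powr (- (p - 1) * (l - 1)) * B powr (- (p - 1)) = B powr (- ((p - 1) * l))"
            unfolding powr_add[symmetric] by (simp add: algebra_simps)
          also have "\<dots> = (1 / (2 * C1) * y) powr (- ((p - 1) * l / g))"
            by (simp add: B_def powr_powr)
          finally show ?thesis
            by (simp only: powr_mult)
        qed
        have t3: "(2 / y) powr l * y powr (- ((p - 1) * l / g)) = 2 powr l * y powr - e"
        proof -
          have "l + (p - 1) * l / g = e"
            using g0 l1 by (simp add: e_def g_def field_simps)
          then have "- l + - ((p - 1) * l / g) = - e"
            by linarith
          then have "y powr - l * y powr (- ((p - 1) * l / g)) = y powr - e"
            unfolding powr_add[symmetric] by simp
          moreover have "(2 / y) powr l = 2 powr l * y powr - l"
            unfolding powr_divide by (simp add: powr_minus divide_inverse)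
          ultimately show ?thesis
            by simp
        qed
        have "c * (C3 * \<tau> powr - s) = C2 * C3 * ((2 / y) powr l * (B powr (- (p - 1) * (l - 1)) * B powr (- (p - 1)))) * x powr (p - 1)"
          unfolding t1 c_def by (simp only: mult_ac)
        also have "\<dots> = C2 * C3 * ((1 / (2 * C1)) powr (- ((p - 1) * l / g)) * ((2 / y) powr l * y powr (- ((p - 1) * l / g)))) * x powr (p - 1)"
          unfolding t2 by (simp only: mult_ac)
        also have "\<dots> = S * (C * y powr - e * x powr (p - 1))"
          unfolding t3 C_def using S_pos by simp
        finally show ?thesis
          using c0 C3 C2 S_pos by (simp add: ennreal_mult[symmetric] C_def)
      qed
      finally have "ennreal S * (\<integral>\<^sup>+\<xi>. G (norm \<xi>) x * ennreal (norm (\<xi> - \<eta>) powr (- 2 * t)) \<partial>hyp)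
          \<le> ennreal S * (ennreal (C * y powr - e) * ennreal (x powr (p - 1)))" .
      then show ?thesis
        using S_pos by (subst (asm) ennreal_mult_le_mult_iff) auto
    qed
    have "emeasure hyp {\<xi>. norm \<xi> < 1 \<and> y < Tr s v \<xi>} = (\<integral>\<^sup>+\<xi>. indicator {\<xi>. norm \<xi> < 1 \<and> y < Tr s v \<xi>} \<xi> \<partial>hyp)"
      by simp
    also have "\<dots> \<le> (\<integral>\<^sup>+\<xi>. (\<integral>\<^sup>+\<eta>. G (norm \<xi>) (v \<eta>) * (ennreal (norm (\<xi> - \<eta>) powr (- 2 * t)) * ennreal (v \<eta>)) \<partial>sph) \<partial>hyp)"
    proof (rule nn_integral_mono)
      fix \<xi> :: 'a
      show "indicator {\<xi>. norm \<xi> < 1 \<and> y < Tr s v \<xi>} \<xi> \<le> (\<integral>\<^sup>+\<eta>. G (norm \<xi>) (v \<eta>) * (ennreal (norm (\<xi> - \<eta>) powr (- 2 * t)) * ennreal (v \<eta>)) \<partial>sph)"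
      proof (cases "norm \<xi> < 1 \<and> y < Tr s v \<xi>")
        case True
        then have \<xi>: "norm \<xi> < 1"
          by simp
        have "1 \<le> ennreal ((2 / y) powr l * h \<xi> powr (- (p - 1) * (l - 1))) * (\<integral>\<^sup>+\<eta>. ennreal (D \<xi> \<eta>) \<partial>sph)"
          using pointwise True by blast
        also have "\<dots> = (\<integral>\<^sup>+\<eta>. ennreal ((2 / y) powr l * h \<xi> powr (- (p - 1) * (l - 1))) * ennreal (D \<xi> \<eta>) \<partial>sph)"
          by (rule nn_integral_cmult[symmetric]) (simp add: D_def)
        also have "\<dots> = (\<integral>\<^sup>+\<eta>. G (norm \<xi>) (v \<eta>) * (ennreal (norm (\<xi> - \<eta>) powr (- 2 * t)) * ennreal (v \<eta>)) \<partial>sph)"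
          using \<xi> v0 unfolding G D_def kl[OF \<xi>]
          by (intro nn_integral_cong) (auto simp: indicator_def ennreal_mult[symmetric] mult_ac)
        finally show ?thesis
          using True by simp
      qed simp
    qed
    also have "\<dots> = (\<integral>\<^sup>+\<eta>. (\<integral>\<^sup>+\<xi>. G (norm \<xi>) (v \<eta>) * (ennreal (norm (\<xi> - \<eta>) powr (- 2 * t)) * ennreal (v \<eta>)) \<partial>hyp) \<partial>sph)"
      by (rule HS.Fubini'[symmetric]) (rule Gm)
    also have "\<dots> \<le> (\<integral>\<^sup>+\<eta>. ennreal (C * y powr - e) * ennreal (v \<eta> powr p) \<partial>sph)"
    proof (rule nn_integral_mono_AE, use AE_sph in eventually_elim)
      fix \<eta> :: 'a
      assume \<eta>: "norm \<eta> = 1"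
      have "(\<integral>\<^sup>+\<xi>. G (norm \<xi>) (v \<eta>) * (ennreal (norm (\<xi> - \<eta>) powr (- 2 * t)) * ennreal (v \<eta>)) \<partial>hyp)
          = (\<integral>\<^sup>+\<xi>. G (norm \<xi>) (v \<eta>) * ennreal (norm (\<xi> - \<eta>) powr (- 2 * t)) \<partial>hyp) * ennreal (v \<eta>)"
        by (subst nn_integral_multc[symmetric]) (simp_all add: mult.assoc)
      also have "\<dots> \<le> ennreal (C * y powr - e) * ennreal (v \<eta> powr (p - 1)) * ennreal (v \<eta>)"
        by (intro mult_right_mono inner \<eta> v0) simp
      also have "\<dots> = ennreal (C * y powr - e) * ennreal (v \<eta> powr p)"
      proof -
        have "v \<eta> powr (p - 1) * v \<eta> = v \<eta> powr p"
          using v0[of \<eta>] p1 powr_add[of "v \<eta>" "p - 1" 1] by (cases "v \<eta> = 0") simp_all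
        then show ?thesis
          using v0[of \<eta>] by (simp add: mult.assoc ennreal_mult[symmetric])
      qed
      finally show "(\<integral>\<^sup>+\<xi>. G (norm \<xi>) (v \<eta>) * (ennreal (norm (\<xi> - \<eta>) powr (- 2 * t)) * ennreal (v \<eta>)) \<partial>hyp) \<le> ennreal (C * y powr - e) * ennreal (v \<eta> powr p)" .
    qed
    also have "\<dots> \<le> ennreal (C * y powr - e) * 1"
      by (subst nn_integral_cmult) (simp, rule mult_left_mono[OF Ev'], simp)
    finally show "emeasure hyp {\<xi>. norm \<xi> < 1 \<and> y < Tr s v \<xi>} \<le> ennreal (C * y powr - e)"
      by simp
  qed
qed

end

section \<open>The strong bound and finiteness of the quotient\<close>

context stab
begin

text \<open>Integrating the weak estimate up to the level \<open>N\<close> converges at 0 because e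
  < q and leaves the positive power q - e of \<open>N\<close>. This gain in sup T v is what later
  prevents a normalized near-maximiser from having T v small everywhere.\<close>

lemma strong_type:
  obtains C e where "0 < C" "0 < e" "e < q"
    "\<And>v N. Lp v \<Longrightarrow> (\<And>\<eta>. 0 \<le> v \<eta>) \<Longrightarrow> E v \<le> 1 \<Longrightarrow> 0 \<le> N \<Longrightarrow> (\<And>\<xi>. norm \<xi> < 1 \<Longrightarrow> Tr s v \<xi> \<le> N) \<Longrightarrow>
      (\<integral>\<^sup>+\<xi>. ennreal (Tr s v \<xi> powr q) \<partial>hyp) \<le> ennreal (C * N powr (q - e))"
proof (rule weak_type)
  fix C e
  assume C: "0 \<le> C" and e: "0 < e" "e < q"
    and weak: "\<And>v y. Lp v \<Longrightarrow> (\<And>\<eta>. 0 \<le> v \<eta>) \<Longrightarrow> E v \<le> 1 \<Longrightarrow> 0 < y \<Longrightarrow>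
      emeasure hyp {\<xi>. norm \<xi> < 1 \<and> y < Tr s v \<xi>} \<le> ennreal (C * y powr - e)"
  define a where "a = e / q"
  have a: "0 < a" "a < 1"
    using e by (auto simp: a_def)
  show thesis
  proof
    \<comment> \<open>The added 1 makes the constant positive, so that later arguments may divide by
      it.\<close>
    show "0 < C / (1 - a) + 1" "0 < e" "e < q"
      using C a e by (simp_all add: add_nonneg_pos)
    fix v :: "'a \<Rightarrow> real" and N :: real
    assume v: "Lp v" and v0: "\<And>\<eta>. 0 \<le> v \<eta>" and Ev: "E v \<le> 1" and N: "0 \<le> N"
      and TN: "\<And>\<xi>. norm \<xi> < 1 \<Longrightarrow> Tr s v \<xi> \<le> N"
    note [measurable] = LpD(1)[OF v]
    have T0: "0 \<le> Tr s v \<xi>" for \<xi>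
      by (rule Tr_nonneg) (rule v0)
    define f where "f \<xi> = Tr s v \<xi> powr q * indicator {\<xi>. norm \<xi> < 1} \<xi>" for \<xi>
    have [measurable]: "f \<in> borel_measurable borel"
      unfolding f_def by measurable
    have "(\<integral>\<^sup>+\<xi>. ennreal (Tr s v \<xi> powr q) \<partial>hyp) = (\<integral>\<^sup>+\<xi>. ennreal (f \<xi>) \<partial>hyp)"
      by (rule nn_integral_cong_AE) (use AE_hyp in eventually_elim, simp add: f_def)
    also have "\<dots> \<le> ennreal (C / (1 - a) * (N powr q) powr (1 - a))"
    proof (rule hyp.nn_integral_weak_bound)
      show "AE \<xi> in hyp. f \<xi> \<le> N powr q"
        using AE_hyp by eventually_elim (use TN q2 T0 in \<open>auto simp: f_def intro!: powr_mono2\<close>)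
      fix y :: real
      assume y: "0 < y"
      have "{\<xi> \<in> space hyp. y < f \<xi>} \<subseteq> {\<xi>. norm \<xi> < 1 \<and> y powr (1 / q) < Tr s v \<xi>}"
      proof (rule subsetI)
        fix \<xi>
        assume "\<xi> \<in> {\<xi> \<in> space hyp. y < f \<xi>}"
        then have f: "y < f \<xi>"
          by simp
        have n1: "norm \<xi> < 1"
          using f y by (intro ccontr[of "norm \<xi> < 1"]) (simp add: f_def)
        then have "y powr (1 / q) < (Tr s v \<xi> powr q) powr (1 / q)"
          using f y q2 by (intro powr_less_mono2) (auto simp: f_def)
        then show "\<xi> \<in> {\<xi>. norm \<xi> < 1 \<and> y powr (1 / q) < Tr s v \<xi>}"
          using n1 q2 T0 by (simp add: powr_powr)
      qed
      then have "emeasure hyp {\<xi> \<in> space hyp. y < f \<xi>} \<le> emeasure hyp {\<xi>. norm \<xi> < 1 \<and> y powr (1 / q) < Tr s v \<xi>}"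
        by (intro emeasure_mono) auto
      also have "\<dots> \<le> ennreal (C * (y powr (1 / q)) powr - e)"
        using y by (intro weak v v0 Ev) simp
      also have "(y powr (1 / q)) powr - e = y powr - a"
        by (simp add: powr_powr a_def)
      finally show "emeasure hyp {\<xi> \<in> space hyp. y < f \<xi>} \<le> ennreal (C * y powr - a)" .
    qed (use a C in \<open>auto simp: f_def\<close>)
    also have "(N powr q) powr (1 - a) = N powr (q - e)"
    proof -
      have "q * (1 - a) = q - e"
        using q2 by (simp add: a_def right_diff_distrib)
      then show ?thesis
        by (simp add: powr_powr)
    qed
    also have "ennreal (C / (1 - a) * N powr (q - e)) \<le> ennreal ((C / (1 - a) + 1) * N powr (q - e))"
      by (intro ennreal_leI mult_right_mono) auto
    finally show "(\<integral>\<^sup>+\<xi>. ennreal (Tr s v \<xi> powr q) \<partial>hyp) \<le> ennreal ((C / (1 - a) + 1) * N powr (q - e))" .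
  qed
qed

definition H :: "('a \<Rightarrow> real) \<Rightarrow> real" where
  "H u = (\<integral>\<xi>. \<bar>Tr s u \<xi>\<bar> powr q \<partial>hyp)"

lemma H_nonneg: "0 \<le> H u"
  by (simp add: H_def)

lemma Lp_cmult: "Lp u \<Longrightarrow> Lp (\<lambda>\<eta>. c * u \<eta>)"
  unfolding Lp_def by (auto simp: abs_mult powr_mult)

lemma E_cmult: "E (\<lambda>\<eta>. c * u \<eta>) = \<bar>c\<bar> powr p * E u"
  by (simp add: E_def abs_mult powr_mult)

lemma Lp_abs: "Lp u \<Longrightarrow> Lp (\<lambda>\<eta>. \<bar>u \<eta>\<bar>)"
  unfolding Lp_def by auto

lemma E_abs: "E (\<lambda>\<eta>. \<bar>u \<eta>\<bar>) = E u"
  by (simp add: E_def)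

text \<open>For |u| scaled to norm 1 the supremum in \<open>strong_type\<close> is bounded by
  \<open>Tr_sup_bound\<close>; homogeneity then gives the general case.\<close>

lemma H_bound:
  obtains A where "0 \<le> A" "\<And>u. Lp u \<Longrightarrow> integrable hyp (\<lambda>\<xi>. \<bar>Tr s u \<xi>\<bar> powr q)"
    "\<And>u. Lp u \<Longrightarrow> H u \<le> A * E u powr (q / p)"
proof (rule strong_type)
  fix C e
  assume C: "0 < C" and e: "0 < e" "e < q"
    and strong: "\<And>v N. Lp v \<Longrightarrow> (\<And>\<eta>. 0 \<le> v \<eta>) \<Longrightarrow> E v \<le> 1 \<Longrightarrow> 0 \<le> N \<Longrightarrow> (\<And>\<xi>. norm \<xi> < 1 \<Longrightarrow> Tr s v \<xi> \<le> N) \<Longrightarrow>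
      (\<integral>\<^sup>+\<xi>. ennreal (Tr s v \<xi> powr q) \<partial>hyp) \<le> ennreal (C * N powr (q - e))"
  define K where "K = (S / 2 powr m) powr (s / m)"
  define A where "A = C * K powr (q - e)"
  have A: "0 \<le> A"
    using C by (simp add: A_def)
  have bd: "(\<integral>\<^sup>+\<xi>. ennreal (\<bar>Tr s u \<xi>\<bar> powr q) \<partial>hyp) \<le> ennreal (A * E u powr (q / p))" if u: "Lp u" for u
  proof (cases "E u = 0")
    case True
    have "(\<integral>\<^sup>+\<xi>. ennreal (\<bar>Tr s u \<xi>\<bar> powr q) \<partial>hyp) = (\<integral>\<^sup>+\<xi>. 0 \<partial>(hyp :: 'a measure))"
      by (rule nn_integral_cong_AE) (use AE_hyp in eventually_elim, use Tr_sup_bound[OF u] True p1 in simp)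
    then show ?thesis
      by simp
  next
    case False
    then have E: "0 < E u"
      using E_nonneg[of u] by simp
    define c where "c = E u powr (- 1 / p)"
    have cp: "c powr p = E u powr - 1" "c powr q = E u powr - (q / p)"
      using p1 by (simp_all add: c_def powr_powr)
    have c: "0 < c" "c powr p * E u = 1" "c powr q * E u powr (q / p) = 1"
      using E unfolding cp by (simp_all add: c_def powr_minus)
    define v where "v \<eta> = c * \<bar>u \<eta>\<bar>" for \<eta>
    have v: "Lp v" "E v = 1" "\<And>\<eta>. 0 \<le> v \<eta>"
      using u c by (simp_all add: v_def[abs_def] Lp_cmult Lp_abs E_cmult E_abs)
    have "(\<integral>\<^sup>+\<xi>. ennreal (Tr s v \<xi> powr q) \<partial>hyp) \<le> ennreal (C * K powr (q - e))"
    proof (intro strong v)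
      show "Tr s v \<xi> \<le> K" if "norm \<xi> < 1" for \<xi>
        using Tr_sup_bound[OF v(1) that] v(2) abs_le_D1 by (auto simp: K_def)
    qed (simp_all add: v K_def)
    have le: "\<bar>Tr s u \<xi>\<bar> powr q \<le> E u powr (q / p) * Tr s v \<xi> powr q" if "norm \<xi> < 1" for \<xi>
    proof -
      have "\<bar>Tr s u \<xi>\<bar> powr q \<le> Tr s (\<lambda>\<eta>. \<bar>u \<eta>\<bar>) \<xi> powr q"
        using Tr_abs[OF that _ Lp_integrable[OF u]] u q2 by (intro powr_mono2) auto
      also have "\<dots> = (E u powr (q / p) * c powr q) * Tr s (\<lambda>\<eta>. \<bar>u \<eta>\<bar>) \<xi> powr q"
        using c(3) by (simp add: mult.commute)
      also have "\<dots> = E u powr (q / p) * Tr s v \<xi> powr q"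
        using c(1) by (simp add: v_def[abs_def] Tr_cmult powr_mult)
      finally show ?thesis .
    qed
    have "(\<integral>\<^sup>+\<xi>. ennreal (\<bar>Tr s u \<xi>\<bar> powr q) \<partial>hyp) \<le> (\<integral>\<^sup>+\<xi>. ennreal (E u powr (q / p)) * ennreal (Tr s v \<xi> powr q) \<partial>hyp)"
      by (rule nn_integral_mono_AE) (use AE_hyp in eventually_elim, use le in \<open>simp add: ennreal_mult'[symmetric] ennreal_leI\<close>)
    also have "\<dots> = ennreal (E u powr (q / p)) * (\<integral>\<^sup>+\<xi>. ennreal (Tr s v \<xi> powr q) \<partial>hyp)"
      using LpD(1)[OF v(1)] by (intro nn_integral_cmult) simp
    also have "\<dots> \<le> ennreal (E u powr (q / p)) * ennreal (C * K powr (q - e))"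
      by (rule mult_left_mono) (fact, simp)
    also have "\<dots> = ennreal (A * E u powr (q / p))"
      using C by (simp add: A_def ennreal_mult[symmetric] mult_ac)
    finally show ?thesis .
  qed
  have int: "integrable hyp (\<lambda>\<xi>. \<bar>Tr s u \<xi>\<bar> powr q)" if "Lp u" for u
    using bd[OF that] LpD(1)[OF that] by (intro integrableI_bounded) (auto intro: le_less_trans)
  have "H u \<le> A * E u powr (q / p)" if u: "Lp u" for u
  proof -
    have "ennreal (H u) = (\<integral>\<^sup>+\<xi>. ennreal (\<bar>Tr s u \<xi>\<bar> powr q) \<partial>hyp)"
      unfolding H_def by (rule nn_integral_eq_integral[symmetric, OF int[OF u]]) simp
    then have "ennreal (H u) \<le> ennreal (A * E u powr (q / p))"
      using bd[OF u] by simp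
    then show ?thesis
      using A by (subst (asm) ennreal_le_iff) simp_all
  qed
  then show thesis
    using that[OF A int] by simp
qed

lemma H_integrable: "Lp u \<Longrightarrow> integrable hyp (\<lambda>\<xi>. \<bar>Tr s u \<xi>\<bar> powr q)"
proof (rule H_bound)
  assume "Lp u" "\<And>u. Lp u \<Longrightarrow> integrable hyp (\<lambda>\<xi>. \<bar>Tr s u \<xi>\<bar> powr q)"
  then show ?thesis
    by simp
qed

end

section \<open>Elementary inequalities\<close>

lemma powr_ge_tangent_1:
  fixes r t :: real
  assumes "1 \<le> r" "0 \<le> t"
  shows "1 + r * (t - 1) \<le> t powr r"
proof (cases "r = 1")
  case False
  then have r: "1 < r"
    using assms by simp
  define r' where "r' = r / (r - 1)"
  have r': "1 < r'" "1 / r + 1 / r' = 1"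
    using r by (simp_all add: r'_def field_simps)
  have "t * 1 \<le> t powr r / r + 1 powr r' / r'"
    using r r' assms by (intro Youngs_inequality) auto
  also have "1 powr r' / r' = 1 - 1 / r"
    using r'(2) by simp
  finally have "t \<le> t powr r / r + (1 - 1 / r)"
    by simp
  then have "r * t \<le> r * (t powr r / r + (1 - 1 / r))"
    using r by (intro mult_left_mono) auto
  then show ?thesis
    using r by (simp add: algebra_simps)
qed (use assms in simp)

lemma powr_ge_tangent:
  fixes r x y :: real
  assumes r: "1 \<le> r" and x: "0 < x" and y: "0 \<le> y"
  shows "x powr r + r * x powr (r - 1) * (y - x) \<le> y powr r"
proof -
  have "x powr r * (1 + r * (y / x - 1)) \<le> x powr r * (y / x) powr r"
    using r x y by (intro mult_left_mono powr_ge_tangent_1) auto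
  also have "x powr r * (y / x) powr r = y powr r"
    using x y by (simp add: powr_divide)
  also have "x powr r * (1 + r * (y / x - 1)) = x powr r + r * (x powr r / x) * (y - x)"
    using x by (simp add: field_simps)
  also have "x powr r / x = x powr (r - 1)"
    using x by (simp add: powr_diff)
  finally show ?thesis .
qed

lemma powr_diff_le:
  fixes r x y :: real
  assumes r: "1 \<le> r" and "0 \<le> y" "y \<le> x"
  shows "x powr r - y powr r \<le> r * x powr (r - 1) * (x - y)"
proof (cases "x = 0")
  case False
  then show ?thesis
    using powr_ge_tangent[OF r, of x y] assms by (simp add: algebra_simps)
qed (use assms in simp)

lemma powr_diff_le_abs:
  fixes r x y :: real
  assumes r: "1 \<le> r" and "0 \<le> y" "0 \<le> x" "x \<le> B" "y \<le> B"
  shows "\<bar>x powr r - y powr r\<bar> \<le> r * B powr (r - 1) * \<bar>x - y\<bar>"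
proof -
  have "x powr r - y powr r \<le> r * B powr (r - 1) * (x - y)" if "0 \<le> y" "y \<le> x" "x \<le> B" for x y
  proof -
    have "x powr r - y powr r \<le> r * x powr (r - 1) * (x - y)"
      by (rule powr_diff_le[OF r that(1,2)])
    also have "\<dots> \<le> r * B powr (r - 1) * (x - y)"
      using that r by (intro mult_right_mono mult_left_mono powr_mono2) auto
    finally show ?thesis .
  qed
  from this[of y x] this[of x y] show ?thesis
    using assms powr_mono2[of r x y] powr_mono2[of r y x] by (cases "y \<le> x") (auto simp: abs_if)
qed

text \<open>The mixed second difference of t powr q is an average of second derivatives, and for q >
  2 these are smallest at the base point \<open>a\<close>. In the proof the difference of the two
  sides is shown to be monotone in x.\<close>

lemma powr_second_difference:
  fixes q a x y :: real
  assumes q: "2 < q" and a: "0 < a" and x: "0 \<le> x" and y: "0 \<le> y"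
  shows "q * (q - 1) * a powr (q - 2) * x * y
    \<le> (a + x + y) powr q + a powr q - (a + x) powr q - (a + y) powr q"
proof -
  define h where "h t = (a + t + y) powr q - (a + t) powr q - q * (q - 1) * a powr (q - 2) * t * y" for t
  have "h 0 \<le> h x"
  proof (rule DERIV_nonneg_imp_nondecreasing[OF x])
    fix t :: real
    assume t: "0 \<le> t"
    define D where "D = q * (a + t + y) powr (q - 1) - q * (a + t) powr (q - 1) - q * (q - 1) * a powr (q - 2) * y"
    have "(h has_real_derivative D) (at t)"
      unfolding h_def[abs_def] D_def using a t y
      by (auto intro!: derivative_eq_intros simp: algebra_simps)
    moreover have "0 \<le> D"
    proof -
      have "(a + t) powr (q - 1) + (q - 1) * (a + t) powr (q - 1 - 1) * ((a + t + y) - (a + t)) \<le> (a + t + y) powr (q - 1)"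
        using a t y q by (intro powr_ge_tangent) auto
      moreover have "(q - 1) * a powr (q - 2) * y \<le> (q - 1) * (a + t) powr (q - 2) * y"
        using a t y q by (intro mult_right_mono mult_left_mono powr_mono2) auto
      ultimately have "(a + t) powr (q - 1) + (q - 1) * a powr (q - 2) * y \<le> (a + t + y) powr (q - 1)"
        by simp
      then have "q * ((a + t) powr (q - 1) + (q - 1) * a powr (q - 2) * y) \<le> q * (a + t + y) powr (q - 1)"
        using q by (intro mult_left_mono) auto
      then show ?thesis
        by (simp add: D_def algebra_simps)
    qed
    ultimately show "\<exists>D. (h has_real_derivative D) (at t) \<and> 0 \<le> D"
      by blast
  qed
  then show ?thesis
    by (simp add: h_def)
qed

text \<open>A splitting of Brezis-Lieb type: for large x the cross terms have order |x| powr (r - 1)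
  and are absorbed into a small multiple of |x| powr r; elsewhere they are at most linear.\<close>

lemma abs_powr_shift:
  fixes r \<theta> :: real
  assumes r: "1 < r" and \<theta>: "0 < \<theta>"
  obtains C where "0 \<le> C" "\<And>x. \<bar>\<bar>1 + x\<bar> powr r - 1 - \<bar>x\<bar> powr r\<bar> \<le> \<theta> * \<bar>x\<bar> powr r + C * \<bar>x\<bar>"
proof -
  define A where "A = r * 2 powr (r - 1)"
  \<comment> \<open>At |x| = A / \<theta> the terms A |x| powr (r - 1) and \<theta> |x| powr r are
    equal; \<open>C\<close> is their common value divided by A / \<theta> and multiplied by A /
    \<theta> to no effect, that is, the largest cross term below this threshold.\<close>
  define C where "C = A * (A / \<theta>) powr (r - 1)"
  have A: "0 < A"
    using r by (simp add: A_def)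
  have C: "0 \<le> C"
    using A by (simp add: C_def)
  show thesis
  proof
    show "0 \<le> A + C + 1"
      using A C by simp
    fix x :: real
    show "\<bar>\<bar>1 + x\<bar> powr r - 1 - \<bar>x\<bar> powr r\<bar> \<le> \<theta> * \<bar>x\<bar> powr r + (A + C + 1) * \<bar>x\<bar>"
    proof (cases "\<bar>x\<bar> \<le> 1")
      case True
      have "\<bar>\<bar>1 + x\<bar> powr r - 1 powr r\<bar> \<le> r * 2 powr (r - 1) * \<bar>\<bar>1 + x\<bar> - 1\<bar>"
        using True r by (intro powr_diff_le_abs) auto
      also have "\<dots> \<le> A * \<bar>x\<bar>"
        unfolding A_def using r by (intro mult_left_mono) auto
      finally have 1: "\<bar>\<bar>1 + x\<bar> powr r - 1\<bar> \<le> A * \<bar>x\<bar>"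
        by simp
      have 2: "\<bar>x\<bar> powr r \<le> \<bar>x\<bar>"
        using True r powr_mono'[of 1 r "\<bar>x\<bar>"] by simp
      have "0 \<le> \<theta> * \<bar>x\<bar> powr r" "0 \<le> C * \<bar>x\<bar>" "0 \<le> \<bar>x\<bar> powr r"
        using \<theta> C by auto
      then show ?thesis
        using 1 2 unfolding distrib_right by linarith
    next
      case False
      have "\<bar>\<bar>1 + x\<bar> powr r - \<bar>x\<bar> powr r\<bar> \<le> r * (2 * \<bar>x\<bar>) powr (r - 1) * \<bar>\<bar>1 + x\<bar> - \<bar>x\<bar>\<bar>"
        using False r by (intro powr_diff_le_abs) auto
      also have "\<dots> \<le> r * (2 * \<bar>x\<bar>) powr (r - 1) * 1"
        using r by (intro mult_left_mono) auto
      also have "\<dots> = A * \<bar>x\<bar> powr (r - 1)"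
        by (simp add: A_def powr_mult)
      also have "\<dots> \<le> \<theta> * \<bar>x\<bar> powr r + C * \<bar>x\<bar>"
      proof (cases "A / \<theta> \<le> \<bar>x\<bar>")
        case True
        then have "A * \<bar>x\<bar> powr (r - 1) \<le> (\<theta> * \<bar>x\<bar>) * \<bar>x\<bar> powr (r - 1)"
          using \<theta> by (intro mult_right_mono) (auto simp: field_simps)
        also have "\<dots> = \<theta> * \<bar>x\<bar> powr r"
          using False powr_add[of "\<bar>x\<bar>" 1 "r - 1"] by simp
        finally show ?thesis
          using C by (simp add: add_increasing2)
      next
        case 2: False
        have "A * \<bar>x\<bar> powr (r - 1) \<le> C * 1"
          unfolding C_def using 2 r A by (auto intro!: mult_left_mono powr_mono2)
        also have "\<dots> \<le> C * \<bar>x\<bar>"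
          using False C by (intro mult_left_mono) auto
        finally show ?thesis
          using \<theta> by (simp add: add_increasing)
      qed
      finally have 1: "\<bar>\<bar>1 + x\<bar> powr r - \<bar>x\<bar> powr r\<bar> \<le> \<theta> * \<bar>x\<bar> powr r + C * \<bar>x\<bar>" .
      have "0 \<le> A * \<bar>x\<bar>"
        using A by simp
      then show ?thesis
        using 1 False unfolding distrib_right by linarith
    qed
  qed
qed

text \<open>For |x| \<le> 1 / 2 the tangent inequality at 1 + x leaves a quadratic error. Otherwise
  |1 + x| \<le> 3 |x|, and a negative linear term is compensated since |x| \<le> 2 x^2.\<close>

lemma abs_powr_quadratic_upper:
  fixes q :: real
  assumes q: "2 < q"
  obtains C where "0 \<le> C" "\<And>x. \<bar>1 + x\<bar> powr q \<le> 1 + q * x + C * (x\<^sup>2 + \<bar>x\<bar> powr q)"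
proof -
  define A where "A = q * ((q - 1) * 2 powr (q - 2))"
  have A: "0 \<le> A"
    using q by (simp add: A_def)
  show thesis
  proof
    show "0 \<le> A + 3 powr q + 2 * q"
      using A q by simp
    fix x :: real
    show "\<bar>1 + x\<bar> powr q \<le> 1 + q * x + (A + 3 powr q + 2 * q) * (x\<^sup>2 + \<bar>x\<bar> powr q)"
    proof (cases "\<bar>x\<bar> \<le> 1 / 2")
      case True
      then have x: "0 < 1 + x"
        by (auto simp: abs_if split: if_splits)
      have "(1 + x) powr q + q * (1 + x) powr (q - 1) * (1 - (1 + x)) \<le> 1 powr q"
        using q x by (intro powr_ge_tangent) auto
      then have "(1 + x) powr q - 1 - q * x \<le> q * (x * ((1 + x) powr (q - 1) - 1 powr (q - 1)))"
        by (simp add: algebra_simps)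
      also have "\<dots> \<le> q * (\<bar>x\<bar> * \<bar>(1 + x) powr (q - 1) - 1 powr (q - 1)\<bar>)"
        using q by (intro mult_left_mono) (auto simp: abs_mult[symmetric])
      also have "\<dots> \<le> q * (\<bar>x\<bar> * ((q - 1) * 2 powr (q - 1 - 1) * \<bar>(1 + x) - 1\<bar>))"
        using q x True by (intro mult_left_mono powr_diff_le_abs) auto
      also have "\<dots> = A * x\<^sup>2"
        by (simp add: A_def power2_eq_square)
      finally have 1: "(1 + x) powr q \<le> 1 + q * x + A * x\<^sup>2"
        by simp
      have "0 \<le> 3 powr q * x\<^sup>2" "0 \<le> 2 * q * x\<^sup>2" "0 \<le> (A + 3 powr q + 2 * q) * \<bar>x\<bar> powr q"
        using q A by auto
      then show ?thesis
        using 1 abs_of_pos[OF x] unfolding distrib_left distrib_right by linarith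
    next
      case False
      have 1: "\<bar>1 + x\<bar> powr q \<le> (3 * \<bar>x\<bar>) powr q"
        using False q by (intro powr_mono2) auto
      have "\<bar>x\<bar> * 1 \<le> \<bar>x\<bar> * (2 * \<bar>x\<bar>)"
        using False by (intro mult_left_mono) auto
      then have "\<bar>x\<bar> \<le> 2 * x\<^sup>2"
        by (simp add: power2_eq_square)
      then have "q * \<bar>x\<bar> \<le> q * (2 * x\<^sup>2)"
        using q by (intro mult_left_mono) auto
      moreover have "- (q * \<bar>x\<bar>) \<le> q * x"
        using q by (cases "x \<ge> 0") auto
      ultimately have 2: "0 \<le> 1 + q * x + 2 * q * x\<^sup>2"
        by simp
      have "0 \<le> A * x\<^sup>2" "0 \<le> A * \<bar>x\<bar> powr q" "0 \<le> 3 powr q * x\<^sup>2" "0 \<le> 2 * q * \<bar>x\<bar> powr q"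
        using q A by auto
      then show ?thesis
        using 1 2 unfolding powr_mult distrib_left distrib_right by linarith
    qed
  qed
qed

text \<open>Quantitative convexity for all p > 1, below and above 2. Taylor's formula settles small
  x; for larger x, convexity along rays propagates the gain from |x| = 1 / 2.\<close>

lemma abs_powr_convex_lower:
  fixes p :: real
  assumes p: "1 < p"
  obtains c where "0 < c" "\<And>x. \<bar>x\<bar> \<le> 1 / 2 \<Longrightarrow> 1 + p * x + c * x\<^sup>2 \<le> \<bar>1 + x\<bar> powr p"
    "\<And>x. 1 / 2 \<le> \<bar>x\<bar> \<Longrightarrow> 1 + p * x + c * \<bar>x\<bar> powr p \<le> \<bar>1 + x\<bar> powr p"
proof -
  define g where "g x = \<bar>1 + x\<bar> powr p - 1 - p * x" for x
  \<comment> \<open>The power p - 2 of 1 + t on |t| \<le> 1 / 2 is smallest at one of the two ends;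
    which one depends on the sign of p - 2.\<close>
  define k where "k = min ((1 / 2) powr (p - 2)) ((3 / 2) powr (p - 2))"
  define c where "c = p * (p - 1) * k / 2"
  have c: "0 < c"
    using p by (simp add: c_def k_def)
  have small: "c * x\<^sup>2 \<le> g x" if x: "\<bar>x\<bar> \<le> 1 / 2" for x
  proof (cases "x = 0")
    case False
    define diff where "diff n t = (if n = 0 then (1 + t) powr p else if n = 1 then p * (1 + t) powr (p - 1) else p * ((p - 1) * (1 + t) powr (p - 2)))"
      for n :: nat and t :: real
    have "\<exists>t. (if x < 0 then x < t \<and> t < 0 else 0 < t \<and> t < x) \<and>
        (1 + x) powr p = (\<Sum>m<2. diff m 0 / fact m * (x - 0) ^ m) + diff 2 t / fact 2 * (x - 0) ^ 2"
    proof (rule Taylor[where a = "- 1 / 2" and b = "1 / 2"])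
      show "\<forall>m t. m < 2 \<and> - 1 / 2 \<le> t \<and> t \<le> 1 / 2 \<longrightarrow> DERIV (diff m) t :> diff (Suc m) t"
      proof (intro allI impI)
        fix m :: nat and t :: real
        assume "m < 2 \<and> - 1 / 2 \<le> t \<and> t \<le> 1 / 2"
        then have t: "0 < 1 + t" and "m = 0 \<or> m = 1"
          by auto
        then show "DERIV (diff m) t :> diff (Suc m) t"
          by (auto simp: diff_def[abs_def] intro!: derivative_eq_intros)
      qed
    qed (use x False in \<open>auto simp: diff_def[abs_def] abs_le_iff\<close>)
    then obtain t where t: "if x < 0 then x < t \<and> t < 0 else 0 < t \<and> t < x"
      and eq: "(1 + x) powr p = (\<Sum>m<2. diff m 0 / fact m * (x - 0) ^ m) + diff 2 t / fact 2 * (x - 0) ^ 2"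
      by blast
    have t': "1 / 2 \<le> 1 + t" "1 + t \<le> 3 / 2"
      using t x by (auto simp: abs_le_iff split: if_splits)
    have kt: "k \<le> (1 + t) powr (p - 2)"
    proof (cases "p \<ge> 2")
      case True
      then have "(1 / 2) powr (p - 2) \<le> (1 + t) powr (p - 2)"
        using t' by (intro powr_mono2) auto
      then show ?thesis
        by (simp add: k_def)
    next
      case False
      then have "(3 / 2) powr (p - 2) \<le> (1 + t) powr (p - 2)"
        using t' by (intro powr_mono2') auto
      then show ?thesis
        by (simp add: k_def)
    qed
    have "(1 + x) powr p = 1 + p * x + p * (p - 1) * (1 + t) powr (p - 2) / 2 * x\<^sup>2"
      unfolding eq by (simp add: diff_def numeral_2_eq_2)
    moreover have "c * x\<^sup>2 \<le> p * (p - 1) * (1 + t) powr (p - 2) / 2 * x\<^sup>2"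
      unfolding c_def using kt p by (intro mult_right_mono divide_right_mono mult_left_mono) auto
    moreover have "\<bar>1 + x\<bar> = 1 + x"
      using x by (auto simp: abs_le_iff)
    ultimately show ?thesis
      by (simp add: g_def)
  qed (simp add: g_def)
  \<comment> \<open>Convexity of \<open>g\<close> with g 0 = 0: along a ray, \<open>g\<close> grows
    at least linearly.\<close>
  have scale: "g (t * x) \<le> t * g x" if t: "0 \<le> t" "t \<le> 1" for t x
  proof -
    define y where "y = \<bar>1 + x\<bar>"
    define a where "a = (1 - t) + t * y"
    have y: "0 \<le> y"
      by (simp add: y_def)
    have a: "0 \<le> a"
      using t y by (simp add: a_def)
    have "\<bar>1 + t * x\<bar> = \<bar>(1 - t) + t * (1 + x)\<bar>"
      by (simp add: algebra_simps)
    also have "\<dots> \<le> a"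
      using t abs_triangle_ineq[of "1 - t" "t * (1 + x)"] by (simp add: a_def y_def abs_mult)
    finally have "\<bar>1 + t * x\<bar> powr p \<le> a powr p"
      using p by (intro powr_mono2) auto
    also have "a powr p \<le> (1 - t) + t * y powr p"
    proof (cases "a = 0")
      case True
      then show ?thesis
        using t p by simp
    next
      case False
      then have a0: "0 < a"
        using a by simp
      have "a powr p + p * a powr (p - 1) * (y - a) \<le> y powr p" "a powr p + p * a powr (p - 1) * (1 - a) \<le> 1 powr p"
        using p a0 y by (intro powr_ge_tangent; simp)+
      then have "t * (a powr p + p * a powr (p - 1) * (y - a)) + (1 - t) * (a powr p + p * a powr (p - 1) * (1 - a))
          \<le> t * y powr p + (1 - t) * 1 powr p"
        using t by (intro add_mono mult_left_mono) auto
      moreover have "t * (a powr p + p * a powr (p - 1) * (y - a)) + (1 - t) * (a powr p + p * a powr (p - 1) * (1 - a))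
          = a powr p + p * a powr (p - 1) * ((1 - t) + t * y - a)"
        by (simp add: algebra_simps)
      ultimately show ?thesis
        by (simp add: a_def)
    qed
    finally show ?thesis
      by (simp add: g_def y_def algebra_simps)
  qed
  have lin: "c / 2 * \<bar>x\<bar> \<le> g x" if x: "1 / 2 \<le> \<bar>x\<bar>" for x
  proof -
    define t where "t = 1 / (2 * \<bar>x\<bar>)"
    have t: "0 < t" "t \<le> 1" "\<bar>t * x\<bar> = 1 / 2"
      using x by (auto simp: t_def abs_mult)
    have "c * (t * x)\<^sup>2 \<le> t * g x"
      using small[of "t * x"] scale[of t x] t by simp
    moreover have "(t * x)\<^sup>2 = 1 / 4"
    proof -
      have "(t * x)\<^sup>2 = \<bar>t * x\<bar>\<^sup>2"
        by simp
      then show ?thesis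
        unfolding t(3) by (simp add: power2_eq_square)
    qed
    ultimately have "c / 4 \<le> t * g x"
      by simp
    then have "2 * \<bar>x\<bar> * (c / 4) \<le> 2 * \<bar>x\<bar> * (t * g x)"
      by (intro mult_left_mono) auto
    also have "2 * \<bar>x\<bar> * (t * g x) = g x"
      using x by (simp add: t_def)
    finally show ?thesis
      by simp
  qed
  obtain C where C: "0 \<le> C" "\<And>x. \<bar>\<bar>1 + x\<bar> powr p - 1 - \<bar>x\<bar> powr p\<bar> \<le> 1 / 2 * \<bar>x\<bar> powr p + C * \<bar>x\<bar>"
    using abs_powr_shift[OF p, of "1 / 2"] by auto
  \<comment> \<open>The linear errors C |x| and p |x| are bounded by a multiple of \<open>g\<close>
    because \<open>g\<close> itself grows linearly; \<open>M\<close> collects that multiple.\<close>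
  define M where "M = 1 + (C + p) / (c / 2)"
  have M: "1 \<le> M"
    using C c p by (simp add: M_def)
  have large: "1 / (2 * M) * \<bar>x\<bar> powr p \<le> g x" if x: "1 / 2 \<le> \<bar>x\<bar>" for x
  proof -
    have "p * x \<le> p * \<bar>x\<bar>"
      using p by (intro mult_left_mono) auto
    moreover have "- (1 / 2 * \<bar>x\<bar> powr p + C * \<bar>x\<bar>) \<le> \<bar>1 + x\<bar> powr p - 1 - \<bar>x\<bar> powr p"
      using C(2)[of x] by (simp add: abs_le_iff)
    ultimately have "\<bar>x\<bar> powr p / 2 \<le> g x + (C + p) * \<bar>x\<bar>"
      by (simp add: g_def distrib_right)
    also have "(C + p) * \<bar>x\<bar> = (C + p) / (c / 2) * (c / 2 * \<bar>x\<bar>)"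
      using c by simp
    also have "\<dots> \<le> (C + p) / (c / 2) * g x"
      using lin[OF x] C c p by (intro mult_left_mono) auto
    finally have "\<bar>x\<bar> powr p / 2 \<le> M * g x"
      by (simp add: M_def distrib_right)
    then show ?thesis
      using M by (simp add: field_simps)
  qed
  show thesis
  proof
    show "0 < min c (1 / (2 * M))"
      using c M by simp
    show "1 + p * x + min c (1 / (2 * M)) * x\<^sup>2 \<le> \<bar>1 + x\<bar> powr p" if "\<bar>x\<bar> \<le> 1 / 2" for x
      using small[OF that] mult_right_mono[of "min c (1 / (2 * M))" c "x\<^sup>2"] by (simp add: g_def)
    show "1 + p * x + min c (1 / (2 * M)) * \<bar>x\<bar> powr p \<le> \<bar>1 + x\<bar> powr p" if "1 / 2 \<le> \<bar>x\<bar>" for x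
      using large[OF that] mult_right_mono[of "min c (1 / (2 * M))" "1 / (2 * M)" "\<bar>x\<bar> powr p"] by (simp add: g_def)
  qed
qed

section \<open>Closeness to a constant\<close>

text \<open>\<Gamma> stands for the power q of the sharp constant; the inequality is written with
  \<open>H\<close> and \<open>E\<close>, the integrals without their outer roots.\<close>

locale stab_sharp = stab T S m s p q for T :: "'a::euclidean_space itself" and S m s p q +
  fixes \<Gamma> :: real
  assumes \<Gamma>: "0 < \<Gamma>" and sharp: "\<And>u :: 'a \<Rightarrow> real. Lp u \<Longrightarrow> H u \<le> \<Gamma> * E u powr (q / p)"
begin

text \<open>One parameter \<tau> measures both the deficit and the failure of T v to be largest at
  the origin.\<close>

definition near_max :: "real \<Rightarrow> ('a \<Rightarrow> real) \<Rightarrow> bool" where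
  "near_max \<tau> v \<longleftrightarrow> Lp v \<and> (\<forall>\<eta>. 0 \<le> v \<eta>) \<and> E v = 1 \<and> \<Gamma> - \<tau> \<le> H v \<and> (\<forall>\<xi>. norm \<xi> < 1 \<longrightarrow> Tr s v \<xi> \<le> Tr s v 0 + \<tau>)"

lemma near_maxD:
  assumes "near_max \<tau> v"
  shows "Lp v" "0 \<le> v \<eta>" "E v = 1" "\<Gamma> - \<tau> \<le> H v" "norm \<xi> < 1 \<Longrightarrow> Tr s v \<xi> \<le> Tr s v 0 + \<tau>"
    "v \<in> borel_measurable borel" "integrable sph v"
  using assms Lp_integrable by (auto simp: near_max_def)

lemma Tr_0: "Tr s u 0 = (1 / 2) powr s * (\<integral>\<eta>. u \<eta> \<partial>sph)" if [measurable]: "u \<in> borel_measurable borel"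
proof -
  have "Tr s u 0 = (\<integral>\<eta>. (1 / 2) powr s * u \<eta> \<partial>sph)"
    unfolding Tr_def
  proof (rule integral_cong_AE)
    show "AE \<eta> in sph. ker s 0 \<eta> * u \<eta> = (1 / 2) powr s * u \<eta>"
      using AE_sph by eventually_elim (simp add: ker_def wt_def)
  qed measurable
  then show ?thesis
    by simp
qed

text \<open>The value T v 0 is a multiple of the mean and almost the supremum of T v. As H v \<ge>
  \<Gamma> / 2, the bound of \<open>strong_type\<close> by a positive power of this supremum keeps
  the mean away from 0.\<close>

lemma mean_lower:
  obtains m0 t0 where "0 < m0" "0 < t0" "\<And>v \<tau>. near_max \<tau> v \<Longrightarrow> 0 < \<tau> \<Longrightarrow> \<tau> \<le> t0 \<Longrightarrow> m0 \<le> (\<integral>\<eta>. v \<eta> \<partial>sph)"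
proof (rule strong_type)
  fix C e
  assume C: "0 < C" and e: "0 < e" "e < q"
    and strong: "\<And>v N. Lp v \<Longrightarrow> (\<And>\<eta>. 0 \<le> v \<eta>) \<Longrightarrow> E v \<le> 1 \<Longrightarrow> 0 \<le> N \<Longrightarrow> (\<And>\<xi>. norm \<xi> < 1 \<Longrightarrow> Tr s v \<xi> \<le> N) \<Longrightarrow>
      (\<integral>\<^sup>+\<xi>. ennreal (Tr s v \<xi> powr q) \<partial>hyp) \<le> ennreal (C * N powr (q - e))"
  \<comment> \<open>The value of \<open>N\<close> at which \<open>C * N powr (q - e)\<close> equals
    \<Gamma> / 2.\<close>
  define n0 where "n0 = (\<Gamma> / (2 * C)) powr (1 / (q - e))"
  have n0: "0 < n0"
    using \<Gamma> C by (simp add: n0_def)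
  show thesis
  proof
    show "0 < 2 powr s * (n0 / 2)" "0 < min (\<Gamma> / 2) (n0 / 2)"
      using n0 \<Gamma> by simp_all
    fix v \<tau>
    assume v: "near_max \<tau> v" and \<tau>: "0 < \<tau>" "\<tau> \<le> min (\<Gamma> / 2) (n0 / 2)"
    note vD = near_maxD[OF v]
    have T0: "0 \<le> Tr s v \<xi>" for \<xi>
      by (rule Tr_nonneg) (rule vD)
    define N where "N = Tr s v 0 + \<tau>"
    have N: "0 \<le> N"
      using T0[of 0] \<tau> by (simp add: N_def)
    have "ennreal (H v) = (\<integral>\<^sup>+\<xi>. ennreal (\<bar>Tr s v \<xi>\<bar> powr q) \<partial>hyp)"
      unfolding H_def by (rule nn_integral_eq_integral[symmetric, OF H_integrable[OF vD(1)]]) simp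
    also have "\<dots> = (\<integral>\<^sup>+\<xi>. ennreal (Tr s v \<xi> powr q) \<partial>hyp)"
      using T0 by simp
    also have "\<dots> \<le> ennreal (C * N powr (q - e))"
      by (rule strong[OF vD(1) vD(2) _ N]) (simp_all add: vD N_def)
    finally have "H v \<le> C * N powr (q - e)"
      using C by (subst (asm) ennreal_le_iff) simp_all
    then have "\<Gamma> / 2 \<le> C * N powr (q - e)"
      using vD(4) \<tau> by simp
    then have "\<Gamma> / (2 * C) \<le> N powr (q - e)"
      using C by (simp add: field_simps)
    then have "n0 \<le> (N powr (q - e)) powr (1 / (q - e))"
      unfolding n0_def using \<Gamma> C e by (intro powr_mono2) auto
    also have "\<dots> = N"
      using N e by (simp add: powr_powr)
    finally have "n0 / 2 \<le> Tr s v 0"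
      using \<tau> by (simp add: N_def)
    then have "2 powr s * (n0 / 2) \<le> 2 powr s * ((1 / 2) powr s * (\<integral>\<eta>. v \<eta> \<partial>sph))"
      unfolding Tr_0[OF vD(6)] by (intro mult_left_mono) auto
    also have "\<dots> = (\<integral>\<eta>. v \<eta> \<partial>sph)"
      unfolding mult.assoc[symmetric] powr_mult[symmetric] by simp
    finally show "2 powr s * (n0 / 2) \<le> (\<integral>\<eta>. v \<eta> \<partial>sph)" .
  qed
qed

lemma measure_sph_S: "measure (sph :: 'a measure) UNIV = S"
  by (simp add: measure_sph S)

lemma mean_upper:
  assumes "Lp u" "E u = 1"
  shows "(\<integral>\<eta>. \<bar>u \<eta>\<bar> \<partial>sph) \<le> S + 1"
proof -
  have "(\<integral>\<eta>. \<bar>u \<eta>\<bar> \<partial>sph) \<le> (\<integral>\<eta>. 1 + \<bar>u \<eta>\<bar> powr p \<partial>sph)"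
    using assms Lp_integrable[OF assms(1)] p1 by (intro integral_mono) (auto intro!: powr_sum_le)
  also have "\<dots> = S + 1"
    using assms by (simp add: measure_sph_S E_def)
  finally show ?thesis .
qed

lemma integrable_inner:
  fixes \<nu> :: 'a
  assumes "norm \<nu> = 1" and [measurable]: "z \<in> borel_measurable borel" and z: "integrable sph z"
  shows "integrable sph (\<lambda>\<eta>. (\<eta> \<bullet> \<nu>) * z \<eta>)"
proof (rule Bochner_Integration.integrable_bound[OF z])
  show "AE \<eta> in sph. norm ((\<eta> \<bullet> \<nu>) * z \<eta>) \<le> norm (z \<eta>)"
    using AE_sph
  proof eventually_elim
    fix \<eta> :: 'a
    assume "norm \<eta> = 1"
    then have "\<bar>\<eta> \<bullet> \<nu>\<bar> \<le> 1"
      using Cauchy_Schwarz_ineq2[of \<eta> \<nu>] assms(1) by simp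
    then show "norm ((\<eta> \<bullet> \<nu>) * z \<eta>) \<le> norm (z \<eta>)"
      using mult_right_mono[of "\<bar>\<eta> \<bullet> \<nu>\<bar>" 1 "\<bar>z \<eta>\<bar>"] by (simp add: abs_mult)
  qed
qed simp

text \<open>Comparison of \<open>Tv\<close> at the origin and at \<open>\<nu>\<surd>\<tau>\<close>, using \<open>X\<^sup>s \<ge> 1 + s ln X\<close>.\<close>

lemma first_moment:
  obtains K where "0 \<le> K" "\<And>v \<tau> \<nu>. near_max \<tau> v \<Longrightarrow> 0 < \<tau> \<Longrightarrow> \<tau> \<le> 1 / 4 \<Longrightarrow> norm \<nu> = 1 \<Longrightarrow>
    \<bar>\<integral>\<eta>. (\<eta> \<bullet> \<nu>) * v \<eta> \<partial>sph\<bar> \<le> K * sqrt \<tau>"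
proof
  define K where "K = 2 powr s / (2 * s) + 3 / 2 * (S + 1)"
  show "0 \<le> K"
    using s S_pos by (simp add: K_def)
  fix v \<tau> and \<nu> :: 'a
  assume v: "near_max \<tau> v" and \<tau>: "0 < \<tau>" "\<tau> \<le> 1 / 4" and \<nu>: "norm \<nu> = 1"
  note vD = near_maxD[OF v]
  note [measurable] = vD(6)
  \<comment> \<open>The step length balances the slack \<tau> in the maximum against the
    second-order error t^2; dividing by t leaves a bound of order sqrt \<tau> for the linear
    term.\<close>
  define t where "t = sqrt \<tau>"
  have t: "0 < t" "t \<le> 1 / 2" "t * t = \<tau>"
    using \<tau> real_sqrt_le_mono[of \<tau> "1 / 4"] by (simp_all add: t_def real_sqrt_divide)
  have one: "(\<integral>\<eta>. (\<eta> \<bullet> \<nu>) * v \<eta> \<partial>sph) \<le> K * t" if \<nu>: "norm \<nu> = 1" for \<nu> :: 'a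
  proof -
    define I M where "I = (\<integral>\<eta>. (\<eta> \<bullet> \<nu>) * v \<eta> \<partial>sph)" and "M = (\<integral>\<eta>. v \<eta> \<partial>sph)"
    have M: "M \<le> S + 1" "0 \<le> M"
      using mean_upper[OF vD(1,3)] vD(2) by (simp_all add: M_def)
    note int = integrable_inner[OF \<nu> vD(6,7)]
    have n: "norm (t *\<^sub>R \<nu>) < 1"
      using t \<nu> by simp
    have kge: "(1 / 2) powr s * (1 + s * (2 * t * (\<eta> \<bullet> \<nu>) - 3 * t\<^sup>2)) \<le> ker s (t *\<^sub>R \<nu>) \<eta>" if \<eta>: "norm \<eta> = 1" for \<eta>
    proof -
      define x where "x = \<eta> \<bullet> \<nu>"
      have x: "\<bar>x\<bar> \<le> 1"
        using Cauchy_Schwarz_ineq2[of \<eta> \<nu>] \<eta> \<nu> by (simp add: x_def)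
      define d where "d = 1 + t\<^sup>2 - 2 * t * x"
      have dn: "(norm (t *\<^sub>R \<nu> - \<eta>))\<^sup>2 = d"
        unfolding power2_norm_eq_inner d_def x_def using \<eta> \<nu>
        by (simp add: inner_diff_left inner_diff_right norm_eq_1 inner_commute[of \<nu> \<eta>] power2_eq_square right_diff_distrib)
      have d0: "0 < d"
        unfolding dn[symmetric] using n \<eta> by auto
      have t2: "t\<^sup>2 \<le> 1 / 4"
        using t \<tau> by (simp add: power2_eq_square)
      define X where "X = (1 - t\<^sup>2) / d"
      have X: "0 < X"
        using d0 t2 by (simp add: X_def)
      have "ln (1 - t\<^sup>2) \<ge> - 2 * t\<^sup>2"
      proof -
        have "ln (1 / (1 - t\<^sup>2)) \<le> 1 / (1 - t\<^sup>2) - 1"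
          using t2 by (intro ln_le_minus_one) simp
        also have "\<dots> = t\<^sup>2 / (1 - t\<^sup>2)"
          using t2 by (simp add: field_simps)
        also have "\<dots> \<le> t\<^sup>2 / (1 / 2)"
          using t2 by (intro divide_left_mono) auto
        finally show ?thesis
          using t2 by (simp add: ln_div)
      qed
      moreover have "ln d \<le> t\<^sup>2 - 2 * t * x"
        using ln_le_minus_one[OF d0] by (simp add: d_def)
      ultimately have lnX: "2 * t * x - 3 * t\<^sup>2 \<le> ln X"
        using t2 d0 by (simp add: X_def ln_div)
      have "1 + s * (2 * t * x - 3 * t\<^sup>2) \<le> 1 + s * ln X"
        using lnX s by simp
      also have "\<dots> \<le> exp (s * ln X)"
        by (rule exp_ge_add_one_self)
      also have "\<dots> = X powr s"
        using X by (simp add: powr_def)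
      finally have "(1 / 2) powr s * (1 + s * (2 * t * x - 3 * t\<^sup>2)) \<le> (1 / 2) powr s * X powr s"
        by (intro mult_left_mono) auto
      also have "\<dots> = ker s (t *\<^sub>R \<nu>) \<eta>"
        unfolding powr_mult[symmetric] ker_def dn wt_def X_def using \<nu> by (simp add: power_mult_distrib)
      finally show ?thesis
        by (simp add: x_def)
    qed
    have "(1 / 2) powr s * (M + s * (2 * t * I - 3 * t\<^sup>2 * M))
        = (\<integral>\<eta>. (1 / 2) powr s * (1 + s * (2 * t * (\<eta> \<bullet> \<nu>) - 3 * t\<^sup>2)) * v \<eta> \<partial>sph)"
    proof -
      have "(\<integral>\<eta>. (1 / 2) powr s * (1 + s * (2 * t * (\<eta> \<bullet> \<nu>) - 3 * t\<^sup>2)) * v \<eta> \<partial>sph)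
         = (\<integral>\<eta>. (1 / 2) powr s * ((1 - 3 * s * t\<^sup>2) * v \<eta> + 2 * s * t * ((\<eta> \<bullet> \<nu>) * v \<eta>)) \<partial>sph)"
        by (rule Bochner_Integration.integral_cong) (simp_all add: algebra_simps)
      also have "\<dots> = (1 / 2) powr s * ((1 - 3 * s * t\<^sup>2) * M + 2 * s * t * I)"
        using vD(7) int by (simp add: I_def M_def)
      finally show ?thesis
        by (simp add: algebra_simps)
    qed
    also have "\<dots> \<le> Tr s v (t *\<^sub>R \<nu>)"
      unfolding Tr_def
    proof (rule integral_mono_AE)
      have "(\<lambda>\<eta>. (1 / 2) powr s * (1 + s * (2 * t * (\<eta> \<bullet> \<nu>) - 3 * t\<^sup>2)) * v \<eta>)
         = (\<lambda>\<eta>. (1 / 2) powr s * ((1 - 3 * s * t\<^sup>2) * v \<eta> + 2 * s * t * ((\<eta> \<bullet> \<nu>) * v \<eta>)))"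
        by (simp add: fun_eq_iff algebra_simps)
      then show "integrable sph (\<lambda>\<eta>. (1 / 2) powr s * (1 + s * (2 * t * (\<eta> \<bullet> \<nu>) - 3 * t\<^sup>2)) * v \<eta>)"
        using vD(7) int by simp
      show "integrable sph (\<lambda>\<eta>. ker s (t *\<^sub>R \<nu>) \<eta> * v \<eta>)"
        using integrable_ker[OF n vD(6,7)] .
      show "AE \<eta> in sph. (1 / 2) powr s * (1 + s * (2 * t * (\<eta> \<bullet> \<nu>) - 3 * t\<^sup>2)) * v \<eta> \<le> ker s (t *\<^sub>R \<nu>) \<eta> * v \<eta>"
        using AE_sph by eventually_elim (intro mult_right_mono kge vD(2))
    qed
    also have "\<dots> \<le> (1 / 2) powr s * M + \<tau>"
      using vD(5)[OF n] Tr_0[OF vD(6)] by (simp add: M_def)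
    finally have "(1 / 2) powr s * (s * (2 * t * I - 3 * t\<^sup>2 * M)) \<le> \<tau>"
      by (simp add: distrib_left)
    then have "2 powr s * ((1 / 2) powr s * (s * (2 * t * I - 3 * t\<^sup>2 * M))) \<le> 2 powr s * \<tau>"
      by (intro mult_left_mono) auto
    moreover have "2 powr s * ((1 / 2) powr s * (s * (2 * t * I - 3 * t\<^sup>2 * M))) = s * (2 * t * I - 3 * t\<^sup>2 * M)"
      unfolding mult.assoc[symmetric] powr_mult[symmetric] by simp
    ultimately have "s * (2 * t * I - 3 * t\<^sup>2 * M) \<le> 2 powr s * \<tau>"
      by simp
    then have "t * (2 * s * I) \<le> t * (t * (2 powr s + 3 * s * M))"
      unfolding t(3)[symmetric] by (simp add: power2_eq_square algebra_simps)
    then have "2 * s * I \<le> t * (2 powr s + 3 * s * M)"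
      using t(1) by simp
    then have "I \<le> t * (2 powr s / (2 * s) + 3 / 2 * M)"
      using s by (simp add: field_simps)
    also have "\<dots> \<le> t * K"
      unfolding K_def using t M by (intro mult_left_mono add_left_mono) auto
    finally show ?thesis
      by (simp add: I_def mult.commute)
  qed
  have "(\<integral>\<eta>. (\<eta> \<bullet> - \<nu>) * v \<eta> \<partial>sph) = - (\<integral>\<eta>. (\<eta> \<bullet> \<nu>) * v \<eta> \<partial>sph)"
    by simp
  then show "\<bar>\<integral>\<eta>. (\<eta> \<bullet> \<nu>) * v \<eta> \<partial>sph\<bar> \<le> K * sqrt \<tau>"
    using one[OF \<nu>] one[of "- \<nu>"] \<nu> by (simp add: t_def abs_le_iff)
qed

text \<open>A boundary point is closer to an interior point on its own side than to the mirror
  image: the squared distances differ by 4 (\<xi> \<bullet> \<nu>) (\<eta> \<bullet> \<nu>).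
  Convexity of the power -s turns this into a lower bound, with the larger squared distance at most
  4.\<close>

lemma ker_refl_difference:
  fixes \<nu> \<xi> \<eta> :: 'a
  assumes \<nu>: "norm \<nu> = 1" and \<eta>: "norm \<eta> = 1" and \<xi>: "norm \<xi> < 1" and pos: "0 \<le> \<xi> \<bullet> \<nu>" "0 \<le> \<eta> \<bullet> \<nu>"
  shows "wt \<xi> powr s * (s * 4 powr (- s - 1) * (4 * (\<xi> \<bullet> \<nu>) * (\<eta> \<bullet> \<nu>))) \<le> ker s \<xi> \<eta> - ker s (hrefl \<nu> \<xi>) \<eta>"
proof -
  define X Y where "X = (norm (\<xi> - \<eta>))\<^sup>2" and "Y = (norm (hrefl \<nu> \<xi> - \<eta>))\<^sup>2"
  have n': "norm (hrefl \<nu> \<xi>) < 1"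
    using \<xi> \<nu> by simp
  have X0: "0 < X" and Y0: "0 < Y"
    using \<xi> n' \<eta> by (auto simp: X_def Y_def)
  have "norm (hrefl \<nu> \<xi> - \<eta>) \<le> 2"
    using norm_triangle_ineq4[of "hrefl \<nu> \<xi>" \<eta>] n' \<eta> by simp
  then have Y4: "Y \<le> 4"
    using power_mono[of "norm (hrefl \<nu> \<xi> - \<eta>)" 2 2] by (simp add: Y_def)
  have d: "Y - X = 4 * (\<xi> \<bullet> \<nu>) * (\<eta> \<bullet> \<nu>)"
  proof -
    have "Y = hrefl \<nu> \<xi> \<bullet> hrefl \<nu> \<xi> - 2 * (hrefl \<nu> \<xi> \<bullet> \<eta>) + \<eta> \<bullet> \<eta>"
      unfolding Y_def power2_norm_eq_inner by (simp add: inner_diff_left inner_diff_right inner_commute)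
    moreover have "X = \<xi> \<bullet> \<xi> - 2 * (\<xi> \<bullet> \<eta>) + \<eta> \<bullet> \<eta>"
      unfolding X_def power2_norm_eq_inner by (simp add: inner_diff_left inner_diff_right inner_commute)
    moreover have "hrefl \<nu> \<xi> \<bullet> \<eta> = \<xi> \<bullet> \<eta> - 2 * (\<xi> \<bullet> \<nu>) * (\<eta> \<bullet> \<nu>)"
      by (simp add: hrefl_def inner_diff_left inner_commute[of \<nu> \<eta>])
    ultimately show ?thesis
      using \<nu> by simp
  qed
  have YX: "X \<le> Y"
    using d pos by (metis diff_ge_0_iff_ge mult_nonneg_nonneg zero_le_numeral)
  have "s * Y powr (- s - 1) * (Y - X) \<le> X powr - s - Y powr - s"
  proof -
    have "1 + s * (1 - X / Y) \<le> 1 + - s * ln (X / Y)"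
      using ln_le_minus_one[of "X / Y"] X0 Y0 s mult_left_mono[of "1 - X / Y" "- ln (X / Y)" s] by simp
    also have "\<dots> \<le> exp (- s * ln (X / Y))"
      by (rule exp_ge_add_one_self)
    also have "\<dots> = (X / Y) powr - s"
      using X0 Y0 by (simp add: powr_def)
    finally have "Y powr - s * (1 + s * (1 - X / Y)) \<le> Y powr - s * (X / Y) powr - s"
      by (intro mult_left_mono) auto
    also have "Y powr - s * (X / Y) powr - s = X powr - s"
      using X0 Y0 unfolding powr_mult[symmetric] by simp
    finally have "Y powr - s + s * (Y powr - s / Y) * (Y - X) \<le> X powr - s"
      using Y0 by (simp add: field_simps)
    moreover have "Y powr - s / Y = Y powr (- s - 1)"
      using Y0 by (simp add: powr_diff)
    ultimately show ?thesis
      by simp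
  qed
  moreover have "s * 4 powr (- s - 1) * (Y - X) \<le> s * Y powr (- s - 1) * (Y - X)"
    using YX s Y0 Y4 by (intro mult_right_mono mult_left_mono powr_mono2') auto
  ultimately have "s * 4 powr (- s - 1) * (Y - X) \<le> X powr - s - Y powr - s"
    by linarith
  then have "wt \<xi> powr s * (s * 4 powr (- s - 1) * (Y - X)) \<le> wt \<xi> powr s * (X powr - s - Y powr - s)"
    by (intro mult_left_mono) auto
  also have "\<dots> = ker s \<xi> \<eta> - ker s (hrefl \<nu> \<xi>) \<eta>"
    unfolding ker_def X_def[symmetric] Y_def[symmetric] using \<nu>
    by (simp add: powr_divide powr_minus_divide right_diff_distrib)
  finally show ?thesis
    unfolding d .
qed

text \<open>Oddness makes 2 T z \<xi> the integral of z against the difference of the kernels at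
  \<xi> and its mirror image. That difference and z both have the sign of \<eta> \<bullet> \<nu>, so
  the contributions of the two half spaces add up.\<close>

lemma odd_function_bound:
  fixes \<nu> \<xi> :: 'a
  assumes \<nu>: "norm \<nu> = 1" and zm [measurable]: "z \<in> borel_measurable borel" and zi: "integrable sph z"
    and odd: "\<And>\<eta>. z (hrefl \<nu> \<eta>) = - z \<eta>" and sgn: "\<And>\<eta>. 0 \<le> (\<eta> \<bullet> \<nu>) * z \<eta>"
    and \<xi>: "norm \<xi> < 1" and pos: "0 \<le> \<xi> \<bullet> \<nu>"
  shows "2 * s * 4 powr (- s - 1) * wt \<xi> powr s * (\<xi> \<bullet> \<nu>) * (\<integral>\<eta>. (\<eta> \<bullet> \<nu>) * z \<eta> \<partial>sph) \<le> Tr s z \<xi>"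
    and "Tr s z (hrefl \<nu> \<xi>) = - Tr s z \<xi>"
proof -
  show neg: "Tr s z (hrefl \<nu> \<xi>) = - Tr s z \<xi>"
    using Tr_refl[OF \<nu> zm, of s \<xi>] by (simp add: odd Tr_def)
  have n': "norm (hrefl \<nu> \<xi>) < 1"
    using \<xi> \<nu> by simp
  define c where "c = wt \<xi> powr s * (s * 4 powr (- s - 1) * (4 * (\<xi> \<bullet> \<nu>)))"
  have k: "c * ((\<eta> \<bullet> \<nu>) * z \<eta>) \<le> (ker s \<xi> \<eta> - ker s (hrefl \<nu> \<xi>) \<eta>) * z \<eta>" if \<eta>: "norm \<eta> = 1" for \<eta>
  proof (cases "\<eta> \<bullet> \<nu> = 0")
    case True
    then have "hrefl \<nu> \<eta> = \<eta>"
      by (simp add: hrefl_def)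
    then have "z \<eta> = 0"
      using odd[of \<eta>] by simp
    then show ?thesis
      by simp
  next
    case False
    show ?thesis
    proof (cases "0 < \<eta> \<bullet> \<nu>")
      case True
      then have z0: "0 \<le> z \<eta>"
        using sgn[of \<eta>] by (simp add: zero_le_mult_iff)
      have "c * (\<eta> \<bullet> \<nu>) \<le> ker s \<xi> \<eta> - ker s (hrefl \<nu> \<xi>) \<eta>"
        using ker_refl_difference[OF \<nu> \<eta> \<xi> pos] True by (simp add: c_def mult_ac)
      from mult_right_mono[OF this z0] show ?thesis
        by (simp add: mult.assoc)
    next
      case 2: False
      then have neg: "\<eta> \<bullet> \<nu> < 0"
        using False by simp
      then have z0: "z \<eta> \<le> 0"
        using sgn[of \<eta>] by (simp add: zero_le_mult_iff)
      have "c * (hrefl \<nu> \<eta> \<bullet> \<nu>) \<le> ker s \<xi> (hrefl \<nu> \<eta>) - ker s (hrefl \<nu> \<xi>) (hrefl \<nu> \<eta>)"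
        using ker_refl_difference[OF \<nu> _ \<xi> pos(1), of "hrefl \<nu> \<eta>"] \<eta> \<nu> neg by (simp add: c_def mult_ac)
      then have "ker s \<xi> \<eta> - ker s (hrefl \<nu> \<xi>) \<eta> \<le> c * (\<eta> \<bullet> \<nu>)"
        using \<nu> by (simp add: ker_refl ker_refl1[symmetric])
      from mult_right_mono_neg[OF this z0] show ?thesis
        by (simp add: mult.assoc)
    qed
  qed
  have int: "integrable sph (\<lambda>\<eta>. (ker s \<xi> \<eta> - ker s (hrefl \<nu> \<xi>) \<eta>) * z \<eta>)"
    using integrable_ker[OF \<xi> zm zi] integrable_ker[OF n' zm zi] by (simp add: left_diff_distrib)
  have "c * (\<integral>\<eta>. (\<eta> \<bullet> \<nu>) * z \<eta> \<partial>sph) = (\<integral>\<eta>. c * ((\<eta> \<bullet> \<nu>) * z \<eta>) \<partial>sph)"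
    by simp
  also have "\<dots> \<le> (\<integral>\<eta>. (ker s \<xi> \<eta> - ker s (hrefl \<nu> \<xi>) \<eta>) * z \<eta> \<partial>sph)"
  proof (rule integral_mono_AE[OF _ int])
    show "integrable sph (\<lambda>\<eta>. c * ((\<eta> \<bullet> \<nu>) * z \<eta>))"
      using integrable_inner[OF \<nu> zm zi] by simp
    show "AE \<eta> in sph. c * ((\<eta> \<bullet> \<nu>) * z \<eta>) \<le> (ker s \<xi> \<eta> - ker s (hrefl \<nu> \<xi>) \<eta>) * z \<eta>"
      using AE_sph by eventually_elim (rule k)
  qed
  also have "\<dots> = Tr s z \<xi> - Tr s z (hrefl \<nu> \<xi>)"
    unfolding Tr_def using integrable_ker[OF \<xi> zm zi] integrable_ker[OF n' zm zi] by (simp add: left_diff_distrib)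
  finally show "2 * s * 4 powr (- s - 1) * wt \<xi> powr s * (\<xi> \<bullet> \<nu>) * (\<integral>\<eta>. (\<eta> \<bullet> \<nu>) * z \<eta> \<partial>sph) \<le> Tr s z \<xi>"
    unfolding neg by (simp add: c_def mult_ac)
qed

section \<open>Polarization, the two-point rearrangement across a hyperplane\<close>

definition polar :: "'a \<Rightarrow> ('a \<Rightarrow> real) \<Rightarrow> 'a \<Rightarrow> real" where
  "polar \<nu> v \<eta> = (if 0 \<le> \<eta> \<bullet> \<nu> then max (v \<eta>) (v (hrefl \<nu> \<eta>)) else min (v \<eta>) (v (hrefl \<nu> \<eta>)))"

lemma polar_borel [measurable]:
  assumes [measurable]: "v \<in> borel_measurable borel"
  shows "polar \<nu> v \<in> borel_measurable borel"
  unfolding polar_def[abs_def] by measurable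

text \<open>The two values at a mirror pair are only permuted. Integrals of functions of v are
  therefore unchanged, since the surface measure is invariant under the reflection.\<close>

lemma polar_sum:
  assumes "norm \<nu> = 1"
  shows "f (polar \<nu> v \<eta>) + f (polar \<nu> v (hrefl \<nu> \<eta>)) = f (v \<eta>) + (f (v (hrefl \<nu> \<eta>)) :: real)"
proof -
  have "hrefl \<nu> \<eta> = \<eta>" if "\<eta> \<bullet> \<nu> = 0"
    using that by (simp add: hrefl_def)
  then show ?thesis
    using assms by (cases "\<eta> \<bullet> \<nu>" "0::real" rule: linorder_cases) (auto simp: polar_def max_def min_def)
qed

lemma polar_nonneg: "(\<And>\<eta>. 0 \<le> v \<eta>) \<Longrightarrow> 0 \<le> polar \<nu> v \<eta>"
  by (simp add: polar_def max_def min_def)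

lemma polar_Lp:
  assumes \<nu>: "norm \<nu> = 1" and v: "Lp v" and v0: "\<And>\<eta>. 0 \<le> v \<eta>"
  shows "Lp (polar \<nu> v)" "E (polar \<nu> v) = E v" "(\<integral>\<eta>. polar \<nu> v \<eta> \<partial>sph) = (\<integral>\<eta>. v \<eta> \<partial>sph)"
proof -
  note [measurable] = LpD(1)[OF v]
  have vr: "integrable sph (\<lambda>\<eta>. \<bar>v (hrefl \<nu> \<eta>)\<bar> powr p)"
    using integrable_refl_sph[OF \<nu>, of "\<lambda>\<eta>. \<bar>v \<eta>\<bar> powr p"] LpD(2)[OF v] by simp
  have "integrable sph (\<lambda>\<eta>. \<bar>polar \<nu> v \<eta>\<bar> powr p)"
  proof (rule Bochner_Integration.integrable_bound[of _ "\<lambda>\<eta>. \<bar>v \<eta>\<bar> powr p + \<bar>v (hrefl \<nu> \<eta>)\<bar> powr p"])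
    show "AE \<eta> in sph. norm (\<bar>polar \<nu> v \<eta>\<bar> powr p) \<le> norm (\<bar>v \<eta>\<bar> powr p + \<bar>v (hrefl \<nu> \<eta>)\<bar> powr p)"
      by (intro AE_I2) (auto simp: polar_def max_def min_def)
  qed (use LpD(2)[OF v] vr in auto)
  then show Lp: "Lp (polar \<nu> v)"
    unfolding Lp_def by simp
  have half: "(\<integral>\<eta>. f (polar \<nu> v \<eta>) \<partial>sph) = (\<integral>\<eta>. f (v \<eta>) \<partial>sph)"
    if [measurable]: "f \<in> borel_measurable borel" and i1: "integrable sph (\<lambda>\<eta>. f (polar \<nu> v \<eta>))" and i2: "integrable sph (\<lambda>\<eta>. f (v \<eta>))"
    for f :: "real \<Rightarrow> real"
  proof -
    have r: "integrable sph (\<lambda>\<eta>. f (polar \<nu> v (hrefl \<nu> \<eta>)))" "integrable sph (\<lambda>\<eta>. f (v (hrefl \<nu> \<eta>)))"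
      "(\<integral>\<eta>. f (polar \<nu> v (hrefl \<nu> \<eta>)) \<partial>sph) = (\<integral>\<eta>. f (polar \<nu> v \<eta>) \<partial>sph)"
      "(\<integral>\<eta>. f (v (hrefl \<nu> \<eta>)) \<partial>sph) = (\<integral>\<eta>. f (v \<eta>) \<partial>sph)"
      using integrable_refl_sph[OF \<nu>, of "\<lambda>\<eta>. f (polar \<nu> v \<eta>)"] integrable_refl_sph[OF \<nu>, of "\<lambda>\<eta>. f (v \<eta>)"]
        integral_refl_sph[OF \<nu>, of "\<lambda>\<eta>. f (polar \<nu> v \<eta>)"] integral_refl_sph[OF \<nu>, of "\<lambda>\<eta>. f (v \<eta>)"] i1 i2
      by simp_all
    have "(\<integral>\<eta>. f (polar \<nu> v \<eta>) + f (polar \<nu> v (hrefl \<nu> \<eta>)) \<partial>sph) = (\<integral>\<eta>. f (v \<eta>) + f (v (hrefl \<nu> \<eta>)) \<partial>sph)"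
      by (simp only: polar_sum[OF \<nu>])
    then show ?thesis
      using i1 i2 r by simp
  qed
  show "E (polar \<nu> v) = E v"
    unfolding E_def using half[of "\<lambda>x. \<bar>x\<bar> powr p"] LpD(2)[OF v] LpD(2)[OF Lp] by simp
  show "(\<integral>\<eta>. polar \<nu> v \<eta> \<partial>sph) = (\<integral>\<eta>. v \<eta> \<partial>sph)"
    using half[of "\<lambda>x. x"] Lp_integrable[OF v] Lp_integrable[OF Lp] by simp
qed

lemma
  assumes \<nu>: "norm \<nu> = 1" and u: "Lp u"
  shows H_refl_integrable: "integrable hyp (\<lambda>\<xi>. \<bar>Tr s u (hrefl \<nu> \<xi>)\<bar> powr q)"
    and H_refl: "(\<integral>\<xi>. \<bar>Tr s u (hrefl \<nu> \<xi>)\<bar> powr q \<partial>hyp) = H u"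
proof -
  note [measurable] = LpD(1)[OF u]
  have sub: "(\<integral>\<^sup>+x. ennreal 1 * g (hrefl \<nu> x) \<partial>hyp) = (\<integral>\<^sup>+y. g y \<partial>hyp)" if "g \<in> borel_measurable hyp" for g :: "'a \<Rightarrow> ennreal"
    using that nn_integral_refl_hyp[OF \<nu>] by simp
  show "integrable hyp (\<lambda>\<xi>. \<bar>Tr s u (hrefl \<nu> \<xi>)\<bar> powr q)"
    "(\<integral>\<xi>. \<bar>Tr s u (hrefl \<nu> \<xi>)\<bar> powr q \<partial>hyp) = H u"
    using bochner_substitution[OF sub, of "\<lambda>\<xi>. \<bar>Tr s u \<xi>\<bar> powr q"] H_integrable[OF u] by (simp_all add: H_def)
qed

text \<open>On a mirror pair the change of the q-th powers is a mixed second difference with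
  increments T z and T z', hence at least a multiple of their product. On a fixed ball these
  increments dominate the two moments, while the total gain is at most 2 \<tau> by the sharp
  inequality. Only a product is bounded, because v may be close to its polarization or to the mirror
  image of it.\<close>

lemma polarization_estimate:
  assumes m0: "0 < m0"
  obtains K where "0 \<le> K" "\<And>v \<tau> \<nu>. near_max \<tau> v \<Longrightarrow> 0 < \<tau> \<Longrightarrow> m0 \<le> (\<integral>\<eta>. v \<eta> \<partial>sph) \<Longrightarrow> norm \<nu> = 1 \<Longrightarrow>
    (\<integral>\<eta>. (\<eta> \<bullet> \<nu>) * (polar \<nu> v \<eta> - v \<eta>) \<partial>sph) * (\<integral>\<eta>. (\<eta> \<bullet> \<nu>) * (polar \<nu> v \<eta> - v (hrefl \<nu> \<eta>)) \<partial>sph) \<le> K * \<tau>"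
proof -
  \<comment> \<open>On the ball of radius 1 / 4 around \<nu> / 2 one has |\<xi>| \<le> 3 / 4, so wt
    \<xi> \<ge> 7 / 32, and \<xi> \<bullet> \<nu> \<ge> 1 / 4.\<close>
  define c where "c = 2 * s * 4 powr (- s - 1) * (7 / 32) powr s * (1 / 4)"
  define a0 where "a0 = ((1 - (3 / 4)\<^sup>2) / 8) powr s * m0"
  define V where "V = measure lborel (ball (0::'a) (1 / 4))"
  define k where "k = q * (q - 1) * a0 powr (q - 2) * c * c"
  have c: "0 < c"
    using s by (simp add: c_def)
  have a0: "0 < a0"
    using m0 by (simp add: a0_def power2_eq_square)
  have V: "0 < V"
    unfolding V_def by (rule content_ball_pos) simp
  have k: "0 < k"
    using q2 a0 c by (simp add: k_def)
  show thesis
  proof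
    show "0 \<le> 2 / (k * V)"
      using k V by simp
    fix v \<tau> and \<nu> :: 'a
    assume v: "near_max \<tau> v" and \<tau>: "0 < \<tau>" and mean: "m0 \<le> (\<integral>\<eta>. v \<eta> \<partial>sph)" and \<nu>: "norm \<nu> = 1"
    note vD = near_maxD[OF v]
    note [measurable] = vD(6)
    define w where "w = polar \<nu> v"
    have w: "Lp w" "E w = 1" "(\<integral>\<eta>. w \<eta> \<partial>sph) = (\<integral>\<eta>. v \<eta> \<partial>sph)" "integrable sph w"
      using polar_Lp[OF \<nu> vD(1,2)] vD(3) Lp_integrable by (auto simp: w_def)
    note [measurable] = LpD(1)[OF w(1)]
    have w0: "0 \<le> w \<eta>" for \<eta>
      unfolding w_def by (rule polar_nonneg) (rule vD)
    have vr: "integrable sph (\<lambda>\<eta>. v (hrefl \<nu> \<eta>))"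
      using integrable_refl_sph[OF \<nu> vD(6)] vD(7) by simp
    define z z' where "z \<eta> = w \<eta> - v \<eta>" and "z' \<eta> = w \<eta> - v (hrefl \<nu> \<eta>)" for \<eta>
    have zm: "z \<in> borel_measurable borel" "z' \<in> borel_measurable borel"
      unfolding z_def z'_def by measurable
    have zi: "integrable sph z" "integrable sph z'"
      unfolding z_def z'_def using w vD(7) vr by simp_all
    have zodd: "z (hrefl \<nu> \<eta>) = - z \<eta>" "z' (hrefl \<nu> \<eta>) = - z' \<eta>" for \<eta>
      using polar_sum[OF \<nu>, of "\<lambda>x. x" v \<eta>] \<nu> by (simp_all add: z_def z'_def w_def)
    have zs: "0 \<le> (\<eta> \<bullet> \<nu>) * z \<eta>" "0 \<le> (\<eta> \<bullet> \<nu>) * z' \<eta>" for \<eta>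
      by (auto simp: z_def z'_def w_def polar_def max_def min_def zero_le_mult_iff)
    define A B where "A = (\<integral>\<eta>. (\<eta> \<bullet> \<nu>) * z \<eta> \<partial>sph)" and "B = (\<integral>\<eta>. (\<eta> \<bullet> \<nu>) * z' \<eta> \<partial>sph)"
    have AB: "0 \<le> A" "0 \<le> B"
      using zs by (simp_all add: A_def B_def)
    note ob = odd_function_bound[OF \<nu> zm(1) zi(1) zodd(1) zs(1)]
    note ob' = odd_function_bound[OF \<nu> zm(2) zi(2) zodd(2) zs(2)]
    define \<Delta> where "\<Delta> \<xi> = \<bar>Tr s w \<xi>\<bar> powr q + \<bar>Tr s w (hrefl \<nu> \<xi>)\<bar> powr q - \<bar>Tr s v \<xi>\<bar> powr q - \<bar>Tr s v (hrefl \<nu> \<xi>)\<bar> powr q" for \<xi>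
    have [measurable]: "\<Delta> \<in> borel_measurable borel"
      unfolding \<Delta>_def by measurable
    have main: "q * (q - 1) * Tr s w (hrefl \<nu> \<xi>) powr (q - 2) * Tr s z' \<xi> * Tr s z \<xi> \<le> \<Delta> \<xi>"
      and nn: "0 \<le> Tr s z \<xi>" "0 \<le> Tr s z' \<xi>"
      if \<xi>: "norm \<xi> < 1" and pos: "0 \<le> \<xi> \<bullet> \<nu>" for \<xi>
    proof -
      have n': "norm (hrefl \<nu> \<xi>) < 1"
        using \<xi> \<nu> by simp
      have pA: "0 \<le> 2 * s * 4 powr (- s - 1) * wt \<xi> powr s * (\<xi> \<bullet> \<nu>) * A" "0 \<le> 2 * s * 4 powr (- s - 1) * wt \<xi> powr s * (\<xi> \<bullet> \<nu>) * B"
        using s pos AB by simp_all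
      show nn: "0 \<le> Tr s z \<xi>" "0 \<le> Tr s z' \<xi>"
        using order_trans[OF pA(1)[unfolded A_def] ob(1)[OF \<xi> pos]] order_trans[OF pA(2)[unfolded B_def] ob'(1)[OF \<xi> pos]] .
      define a where "a = Tr s w (hrefl \<nu> \<xi>)"
      have "((1 - (norm \<xi>)\<^sup>2) / 8) powr s * (\<integral>\<eta>. w \<eta> \<partial>sph) \<le> a"
        unfolding a_def using \<xi> \<nu> w w0 by (intro Tr_ge) auto
      moreover have "0 < ((1 - (norm \<xi>)\<^sup>2) / 8) powr s * (\<integral>\<eta>. w \<eta> \<partial>sph)"
        using wt_pos[OF \<xi>] mean m0 by (simp add: w(3) wt_def)
      ultimately have a0: "0 < a"
        by linarith
      have Tz: "Tr s z \<xi> = Tr s w \<xi> - Tr s v \<xi>"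
        unfolding z_def using \<xi> w vD by (intro Tr_diff) auto
      have Tz': "Tr s z' \<xi> = Tr s w \<xi> - Tr s v (hrefl \<nu> \<xi>)"
        unfolding z'_def using \<xi> w vD vr Tr_refl[OF \<nu> vD(6), of s \<xi>] by (subst Tr_diff) auto
      have Tzr: "- Tr s z \<xi> = a - Tr s v (hrefl \<nu> \<xi>)"
        unfolding ob(2)[OF \<xi> pos, symmetric] a_def unfolding z_def using n' w vD by (intro Tr_diff) auto
      \<comment> \<open>The value \<open>a\<close> of T w at the mirror point is the smallest of the
        four; the others are obtained by adding T z, T z' or both. This is the pattern of
        \<open>powr_second_difference\<close>.\<close>
      have eqs: "Tr s v \<xi> = a + Tr s z' \<xi>" "Tr s v (hrefl \<nu> \<xi>) = a + Tr s z \<xi>" "Tr s w \<xi> = a + Tr s z' \<xi> + Tr s z \<xi>"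
        using Tz Tz' Tzr by simp_all
      have "q * (q - 1) * a powr (q - 2) * Tr s z' \<xi> * Tr s z \<xi>
         \<le> (a + Tr s z' \<xi> + Tr s z \<xi>) powr q + a powr q - (a + Tr s z' \<xi>) powr q - (a + Tr s z \<xi>) powr q"
        by (rule powr_second_difference[OF q2 a0 nn(2,1)])
      also have "\<dots> = \<Delta> \<xi>"
        unfolding \<Delta>_def a_def[symmetric] eqs using a0 nn by simp
      finally show "q * (q - 1) * Tr s w (hrefl \<nu> \<xi>) powr (q - 2) * Tr s z' \<xi> * Tr s z \<xi> \<le> \<Delta> \<xi>"
        by (simp add: a_def)
    qed
    have \<Delta>0: "0 \<le> \<Delta> \<xi>" if \<xi>: "norm \<xi> < 1" for \<xi>
    proof -
      have 1: "0 \<le> \<Delta> \<xi>" if "norm \<xi> < 1" "0 \<le> \<xi> \<bullet> \<nu>" for \<xi>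
      proof -
        have "0 \<le> q * (q - 1) * Tr s w (hrefl \<nu> \<xi>) powr (q - 2) * Tr s z' \<xi> * Tr s z \<xi>"
          using nn[OF that] q2 by simp
        then show ?thesis
          using main[OF that] by linarith
      qed
      show ?thesis
      proof (cases "0 \<le> \<xi> \<bullet> \<nu>")
        case False
        have "\<Delta> (hrefl \<nu> \<xi>) = \<Delta> \<xi>"
          using \<nu> by (simp add: \<Delta>_def)
        then show ?thesis
          using 1[of "hrefl \<nu> \<xi>"] False \<xi> \<nu> by simp
      qed (use 1 \<xi> in simp)
    qed
    have \<Delta>K: "k * (A * B) \<le> \<Delta> \<xi>" if "\<xi> \<in> ball (\<nu> /\<^sub>R 2) (1 / 4)" for \<xi>
    proof -
      have d: "norm (\<xi> - \<nu> /\<^sub>R 2) < 1 / 4"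
        using that by (simp add: dist_norm norm_minus_commute)
      have n: "norm \<xi> \<le> 3 / 4"
        using norm_triangle_ineq[of "\<xi> - \<nu> /\<^sub>R 2" "\<nu> /\<^sub>R 2"] d \<nu> by simp
      then have \<xi>: "norm \<xi> < 1"
        by simp
      have "\<bar>(\<xi> - \<nu> /\<^sub>R 2) \<bullet> \<nu>\<bar> \<le> 1 / 4"
        using Cauchy_Schwarz_ineq2[of "\<xi> - \<nu> /\<^sub>R 2" \<nu>] d \<nu> by simp
      moreover have "(\<xi> - \<nu> /\<^sub>R 2) \<bullet> \<nu> = \<xi> \<bullet> \<nu> - 1 / 2"
        using \<nu> by (simp add: inner_diff_left norm_eq_1)
      ultimately have pos: "1 / 4 \<le> \<xi> \<bullet> \<nu>"
        unfolding abs_le_iff by linarith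
      then have pos0: "0 \<le> \<xi> \<bullet> \<nu>"
        by simp
      have "(norm \<xi>)\<^sup>2 \<le> (3 / 4)\<^sup>2"
        using n by (intro power_mono) auto
      then have wt: "7 / 32 \<le> wt \<xi>"
        by (simp add: wt_def power2_eq_square)
      have cle: "c \<le> 2 * s * 4 powr (- s - 1) * wt \<xi> powr s * (\<xi> \<bullet> \<nu>)"
      proof -
        have "(7 / 32) powr s * (1 / 4) \<le> wt \<xi> powr s * (\<xi> \<bullet> \<nu>)"
          using s wt pos by (intro mult_mono powr_mono2) auto
        then have "2 * s * 4 powr (- s - 1) * ((7 / 32) powr s * (1 / 4)) \<le> 2 * s * 4 powr (- s - 1) * (wt \<xi> powr s * (\<xi> \<bullet> \<nu>))"
          using s by (intro mult_left_mono) auto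
        then show ?thesis
          by (simp add: c_def mult.assoc)
      qed
      have "c * A \<le> Tr s z \<xi>"
        using ob(1)[OF \<xi> pos0] mult_right_mono[OF cle AB(1)] by (simp add: A_def)
      moreover have "c * B \<le> Tr s z' \<xi>"
        using ob'(1)[OF \<xi> pos0] mult_right_mono[OF cle AB(2)] by (simp add: B_def)
      moreover have "a0 \<le> Tr s w (hrefl \<nu> \<xi>)"
      proof -
        have "a0 \<le> ((1 - (3 / 4)\<^sup>2) / 8) powr s * (\<integral>\<eta>. w \<eta> \<partial>sph)"
          unfolding a0_def w(3) using mean by (intro mult_left_mono) auto
        also have "\<dots> \<le> Tr s w (hrefl \<nu> \<xi>)"
          using n \<nu> w w0 by (intro Tr_ge) auto
        finally show ?thesis .
      qed
      ultimately have "q * (q - 1) * a0 powr (q - 2) * (c * B) * (c * A) \<le> q * (q - 1) * Tr s w (hrefl \<nu> \<xi>) powr (q - 2) * Tr s z' \<xi> * Tr s z \<xi>"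
        using q2 a0 c AB nn[OF \<xi> pos0] by (intro mult_mono powr_mono2) auto
      then show ?thesis
        using main[OF \<xi> pos0] by (simp add: k_def mult_ac)
    qed
    have \<Delta>i: "integrable hyp \<Delta>" "(\<integral>\<xi>. \<Delta> \<xi> \<partial>hyp) = 2 * H w - 2 * H v"
      unfolding \<Delta>_def using H_refl_integrable[OF \<nu>] H_integrable w(1) vD(1) H_refl[OF \<nu>] by (simp_all add: H_def)
    have "ennreal (k * (A * B)) * ennreal V \<le> ennreal (k * (A * B)) * emeasure hyp (ball (\<nu> /\<^sub>R 2) (1 / 4))"
    proof (rule mult_left_mono)
      have "ennreal V = emeasure lborel (ball (\<nu> /\<^sub>R 2) (1 / 4))"
        using emeasure_lborel_ball_finite[of "\<nu> /\<^sub>R 2" "1 / 4"] content_ball_conv_unit_ball[of "1 / 4" "\<nu> /\<^sub>R 2"] content_ball_conv_unit_ball[of "1 / 4" "0::'a"]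
        by (simp add: V_def emeasure_eq_ennreal_measure)
      also have "\<dots> = (\<integral>\<^sup>+x. indicator (ball (\<nu> /\<^sub>R 2) (1 / 4)) x \<partial>lborel)"
        by simp
      also have "\<dots> \<le> (\<integral>\<^sup>+x\<in>ball 0 1. ennreal (wt x powr - real DIM('a)) * indicator (ball (\<nu> /\<^sub>R 2) (1 / 4)) x \<partial>lborel)"
      proof (rule nn_integral_mono)
        fix x :: 'a
        show "indicator (ball (\<nu> /\<^sub>R 2) (1 / 4)) x \<le> ennreal (wt x powr - real DIM('a)) * indicator (ball (\<nu> /\<^sub>R 2) (1 / 4)) x * indicator (ball 0 1) x"
        proof (cases "x \<in> ball (\<nu> /\<^sub>R 2) (1 / 4)")
          case True
          then have "norm (x - \<nu> /\<^sub>R 2) < 1 / 4"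
            by (simp add: dist_norm norm_minus_commute)
          then have n: "norm x < 1"
            using norm_triangle_ineq[of "x - \<nu> /\<^sub>R 2" "\<nu> /\<^sub>R 2"] \<nu> by simp
          have "1 powr - real DIM('a) \<le> wt x powr - real DIM('a)"
            using wt_pos[OF n] wt_le[of x] by (intro powr_mono2') auto
          then have "ennreal 1 \<le> ennreal (wt x powr - real DIM('a))"
            by (intro ennreal_leI) simp
          then show ?thesis
            using True n by simp
        qed simp
      qed
      also have "\<dots> = emeasure hyp (ball (\<nu> /\<^sub>R 2) (1 / 4))"
        by (subst nn_integral_hyp[symmetric]) simp_all
      finally show "ennreal V \<le> emeasure hyp (ball (\<nu> /\<^sub>R 2) (1 / 4))" .
    qed simp
    also have "\<dots> = (\<integral>\<^sup>+\<xi>. ennreal (k * (A * B)) * indicator (ball (\<nu> /\<^sub>R 2) (1 / 4)) \<xi> \<partial>hyp)"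
      by (rule nn_integral_cmult_indicator[symmetric]) simp
    also have "\<dots> \<le> (\<integral>\<^sup>+\<xi>. ennreal (\<Delta> \<xi>) \<partial>hyp)"
      by (rule nn_integral_mono_AE, use AE_hyp in eventually_elim) (auto simp: indicator_def intro!: ennreal_leI \<Delta>K)
    also have "\<dots> = ennreal (2 * H w - 2 * H v)"
      unfolding \<Delta>i(2)[symmetric] using AE_hyp \<Delta>0 by (intro nn_integral_eq_integral \<Delta>i(1)) auto
    also have "\<dots> \<le> ennreal (2 * \<tau>)"
      using sharp[OF w(1)] w(2) vD(4) by (intro ennreal_leI) simp
    finally have "ennreal (k * (A * B) * V) \<le> ennreal (2 * \<tau>)"
      using k AB V by (subst ennreal_mult) auto
    then have "k * (A * B) * V \<le> 2 * \<tau>"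
      using \<tau> by (subst (asm) ennreal_le_iff) auto
    then have "A * B \<le> 2 / (k * V) * \<tau>"
      using k V by (simp add: field_simps)
    then show "(\<integral>\<eta>. (\<eta> \<bullet> \<nu>) * (polar \<nu> v \<eta> - v \<eta>) \<partial>sph) * (\<integral>\<eta>. (\<eta> \<bullet> \<nu>) * (polar \<nu> v \<eta> - v (hrefl \<nu> \<eta>)) \<partial>sph) \<le> 2 / (k * V) * \<tau>"
      by (simp add: A_def B_def z_def z'_def w_def)
  qed
qed

end

text \<open>The hyperbolic density is at least 1, as \<open>wt\<close> is at most 1 / 2.\<close>

lemma emeasure_hyp_ge:
  fixes A :: "'a::euclidean_space set"
  assumes [measurable]: "A \<in> sets borel" and A: "A \<subseteq> ball 0 1"
  shows "emeasure lborel A \<le> emeasure hyp A"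
proof -
  have "emeasure lborel A = (\<integral>\<^sup>+x. indicator A x \<partial>lborel)"
    by simp
  also have "\<dots> \<le> (\<integral>\<^sup>+x\<in>ball 0 1. ennreal (wt x powr - real DIM('a)) * indicator A x \<partial>lborel)"
  proof (rule nn_integral_mono)
    fix x :: 'a
    show "indicator A x \<le> ennreal (wt x powr - real DIM('a)) * indicator A x * indicator (ball 0 1) x"
    proof (cases "x \<in> A")
      case True
      then have n: "norm x < 1"
        using A by auto
      have "1 powr - real DIM('a) \<le> wt x powr - real DIM('a)"
        using wt_pos[OF n] wt_le[of x] by (intro powr_mono2') auto
      then have "ennreal 1 \<le> ennreal (wt x powr - real DIM('a))"
        by (intro ennreal_leI) simp
      then show ?thesis
        using True n by simp
    qed simp
  qed
  also have "\<dots> = emeasure hyp A"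
    by (subst nn_integral_hyp[symmetric]) simp_all
  finally show ?thesis .
qed

section \<open>From reflections to closeness to a constant in the mean\<close>

context stab_sharp
begin

text \<open>The integrand is the sum of the two moment integrands of
  \<open>polarization_estimate\<close>. Their product is of order \<tau>, and their difference is
  twice a first moment, of order sqrt \<tau>; together these bound the sum.\<close>

lemma reflection_bound:
  assumes m0: "0 < m0"
  obtains K where "0 \<le> K" "\<And>v \<tau> \<nu>. near_max \<tau> v \<Longrightarrow> 0 < \<tau> \<Longrightarrow> \<tau> \<le> 1 / 4 \<Longrightarrow> m0 \<le> (\<integral>\<eta>. v \<eta> \<partial>sph) \<Longrightarrow> norm \<nu> = 1 \<Longrightarrow>
    integrable sph (\<lambda>\<eta>. \<bar>v (hrefl \<nu> \<eta>) - v \<eta>\<bar> * \<bar>\<eta> \<bullet> \<nu>\<bar>) \<and> (\<integral>\<eta>. \<bar>v (hrefl \<nu> \<eta>) - v \<eta>\<bar> * \<bar>\<eta> \<bullet> \<nu>\<bar> \<partial>sph) \<le> K * sqrt \<tau>"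
proof (rule first_moment)
  fix K1
  assume K1: "0 \<le> K1" and mom: "\<And>v \<tau> \<nu>. near_max \<tau> v \<Longrightarrow> 0 < \<tau> \<Longrightarrow> \<tau> \<le> 1 / 4 \<Longrightarrow> norm \<nu> = 1 \<Longrightarrow>
    \<bar>\<integral>\<eta>. (\<eta> \<bullet> \<nu>) * v \<eta> \<partial>sph\<bar> \<le> K1 * sqrt \<tau>"
  show thesis
  proof (rule polarization_estimate[OF m0])
    fix K2
    assume K2: "0 \<le> K2" and pol: "\<And>v \<tau> \<nu>. near_max \<tau> v \<Longrightarrow> 0 < \<tau> \<Longrightarrow> m0 \<le> (\<integral>\<eta>. v \<eta> \<partial>sph) \<Longrightarrow> norm \<nu> = 1 \<Longrightarrow>
      (\<integral>\<eta>. (\<eta> \<bullet> \<nu>) * (polar \<nu> v \<eta> - v \<eta>) \<partial>sph) * (\<integral>\<eta>. (\<eta> \<bullet> \<nu>) * (polar \<nu> v \<eta> - v (hrefl \<nu> \<eta>)) \<partial>sph) \<le> K2 * \<tau>"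
    show thesis
    proof
      show "0 \<le> sqrt (4 * K1\<^sup>2 + 4 * K2)"
        using K2 by simp
      fix v \<tau> and \<nu> :: 'a
      assume v: "near_max \<tau> v" and \<tau>: "0 < \<tau>" "\<tau> \<le> 1 / 4" and mean: "m0 \<le> (\<integral>\<eta>. v \<eta> \<partial>sph)" and \<nu>: "norm \<nu> = 1"
      note vD = near_maxD[OF v]
      note [measurable] = vD(6)
      define z z' where "z \<eta> = polar \<nu> v \<eta> - v \<eta>" and "z' \<eta> = polar \<nu> v \<eta> - v (hrefl \<nu> \<eta>)" for \<eta>
      define A B where "A = (\<integral>\<eta>. (\<eta> \<bullet> \<nu>) * z \<eta> \<partial>sph)" and "B = (\<integral>\<eta>. (\<eta> \<bullet> \<nu>) * z' \<eta> \<partial>sph)"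
      have vr: "integrable sph (\<lambda>\<eta>. v (hrefl \<nu> \<eta>))"
        using integrable_refl_sph[OF \<nu> vD(6)] vD(7) by simp
      have pi: "integrable sph (polar \<nu> v)"
        using polar_Lp(1)[OF \<nu> vD(1,2)] Lp_integrable by blast
      have iz: "integrable sph (\<lambda>\<eta>. (\<eta> \<bullet> \<nu>) * z \<eta>)" "integrable sph (\<lambda>\<eta>. (\<eta> \<bullet> \<nu>) * z' \<eta>)"
        unfolding z_def z'_def using pi vr vD(7) by (intro integrable_inner[OF \<nu>]; simp)+
      have eq: "\<bar>v (hrefl \<nu> \<eta>) - v \<eta>\<bar> * \<bar>\<eta> \<bullet> \<nu>\<bar> = (\<eta> \<bullet> \<nu>) * z \<eta> + (\<eta> \<bullet> \<nu>) * z' \<eta>" for \<eta>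
        by (auto simp: z_def z'_def polar_def max_def min_def abs_if algebra_simps)
      have AB: "A * B \<le> K2 * \<tau>"
        using pol[OF v \<tau>(1) mean \<nu>] by (simp add: A_def B_def z_def z'_def)
      have BA: "B - A = 2 * (\<integral>\<eta>. (\<eta> \<bullet> \<nu>) * v \<eta> \<partial>sph)"
      proof -
        have i1: "integrable sph (\<lambda>\<eta>. (\<eta> \<bullet> \<nu>) * v \<eta>)" "integrable sph (\<lambda>\<eta>. (\<eta> \<bullet> \<nu>) * v (hrefl \<nu> \<eta>))"
          using vr vD(7) by (intro integrable_inner[OF \<nu>]; simp)+
        have "(\<integral>\<eta>. (\<eta> \<bullet> \<nu>) * v (hrefl \<nu> \<eta>) \<partial>sph) = (\<integral>\<eta>. - (\<eta> \<bullet> \<nu>) * v \<eta> \<partial>sph)"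
          using integral_refl_sph[OF \<nu>, of "\<lambda>\<eta>. - (\<eta> \<bullet> \<nu>) * v \<eta>"] \<nu> by simp
        then have refl: "(\<integral>\<eta>. (\<eta> \<bullet> \<nu>) * v (hrefl \<nu> \<eta>) \<partial>sph) = - (\<integral>\<eta>. (\<eta> \<bullet> \<nu>) * v \<eta> \<partial>sph)"
          by simp
        have "B - A = (\<integral>\<eta>. (\<eta> \<bullet> \<nu>) * z' \<eta> - (\<eta> \<bullet> \<nu>) * z \<eta> \<partial>sph)"
          unfolding A_def B_def using iz by simp
        also have "\<dots> = (\<integral>\<eta>. (\<eta> \<bullet> \<nu>) * v \<eta> - (\<eta> \<bullet> \<nu>) * v (hrefl \<nu> \<eta>) \<partial>sph)"
          by (rule Bochner_Integration.integral_cong) (simp_all add: z_def z'_def algebra_simps)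
        also have "\<dots> = (\<integral>\<eta>. (\<eta> \<bullet> \<nu>) * v \<eta> \<partial>sph) - (\<integral>\<eta>. (\<eta> \<bullet> \<nu>) * v (hrefl \<nu> \<eta>) \<partial>sph)"
          using i1 by simp
        finally show ?thesis
          unfolding refl by simp
      qed
      \<comment> \<open>Adding 4 A B turns this into the bound for (A + B)^2.\<close>
      have "(B - A)\<^sup>2 \<le> (2 * (K1 * sqrt \<tau>))\<^sup>2"
        unfolding abs_le_square_iff[symmetric] BA using mom[OF v \<tau> \<nu>] K1 \<tau> by (simp add: abs_mult)
      also have "\<dots> = 4 * K1\<^sup>2 * \<tau>"
        using \<tau> by (simp add: power_mult_distrib)
      finally have "(A + B)\<^sup>2 \<le> (4 * K1\<^sup>2 + 4 * K2) * \<tau>"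
        using AB by (simp add: power2_eq_square algebra_simps)
      then have "A + B \<le> sqrt ((4 * K1\<^sup>2 + 4 * K2) * \<tau>)"
        by (rule real_le_rsqrt)
      then have "(\<integral>\<eta>. \<bar>v (hrefl \<nu> \<eta>) - v \<eta>\<bar> * \<bar>\<eta> \<bullet> \<nu>\<bar> \<partial>sph) \<le> sqrt (4 * K1\<^sup>2 + 4 * K2) * sqrt \<tau>"
        unfolding eq using iz by (simp add: A_def B_def real_sqrt_mult)
      moreover have "integrable sph (\<lambda>\<eta>. \<bar>v (hrefl \<nu> \<eta>) - v \<eta>\<bar> * \<bar>\<eta> \<bullet> \<nu>\<bar>)"
        unfolding eq using iz by simp
      ultimately show "integrable sph (\<lambda>\<eta>. \<bar>v (hrefl \<nu> \<eta>) - v \<eta>\<bar> * \<bar>\<eta> \<bullet> \<nu>\<bar>) \<and>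
          (\<integral>\<eta>. \<bar>v (hrefl \<nu> \<eta>) - v \<eta>\<bar> * \<bar>\<eta> \<bullet> \<nu>\<bar> \<partial>sph) \<le> sqrt (4 * K1\<^sup>2 + 4 * K2) * sqrt \<tau>"
        by blast
    qed
  qed
qed

text \<open>A cap of radius 1 / 18 has at most a quarter of the area, because 9 * (1 / 18) / 2 = 1 /
  4 and the exponent is at least 1; removing two caps leaves at least half of the sphere.\<close>

lemma far_from_two_points:
  fixes \<eta> \<eta>' :: 'a
  assumes "norm \<eta> = 1" "norm \<eta>' = 1"
  shows "ennreal (S / 2) \<le> emeasure sph {\<zeta>. 1 / 18 \<le> norm (\<zeta> - \<eta>) \<and> 1 / 18 \<le> norm (\<zeta> - \<eta>')}"
proof -
  have cap: "measure sph {\<zeta>. norm (\<eta> - \<zeta>) < 1 / 18} \<le> S / 4" if "norm \<eta> = 1" for \<eta> :: 'a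
  proof -
    have "ennreal (measure sph {\<zeta>. norm (\<eta> - \<zeta>) < 1 / 18}) = emeasure sph {\<zeta>. norm (\<eta> - \<zeta>) < 1 / 18}"
      by (rule sph.emeasure_eq_measure[symmetric])
    also have "\<dots> \<le> ennreal (S * (9 * (1 / 18) / 2) ^ (DIM('a) - 1))"
      unfolding S using that by (intro cap_measure) auto
    finally have "measure sph {\<zeta>. norm (\<eta> - \<zeta>) < 1 / 18} \<le> S * (1 / 4) ^ (DIM('a) - 1)"
      using S_pos by (subst (asm) ennreal_le_iff) simp_all
    also have "\<dots> \<le> S * (1 / 4) ^ 1"
      using S_pos dim by (intro mult_left_mono power_decreasing) auto
    finally show ?thesis
      by simp
  qed
  let ?A = "{\<zeta>. norm (\<eta> - \<zeta>) < 1 / 18}" and ?B = "{\<zeta>. norm (\<eta>' - \<zeta>) < 1 / 18}"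
  have "measure sph (?A \<union> ?B) \<le> measure sph ?A + measure sph ?B"
    by (rule measure_Un_le) simp_all
  then have "measure sph (?A \<union> ?B) \<le> S / 2"
    using cap[OF assms(1)] cap[OF assms(2)] by simp
  moreover have "measure sph (UNIV - (?A \<union> ?B)) = measure (sph :: 'a measure) UNIV - measure sph (?A \<union> ?B)"
    by (rule sph.finite_measure_Diff) simp_all
  moreover have "UNIV - (?A \<union> ?B) = {\<zeta>. 1 / 18 \<le> norm (\<zeta> - \<eta>) \<and> 1 / 18 \<le> norm (\<zeta> - \<eta>')}"
    by (auto simp: norm_minus_commute not_less)
  ultimately have "S / 2 \<le> measure sph {\<zeta>. 1 / 18 \<le> norm (\<zeta> - \<eta>) \<and> 1 / 18 \<le> norm (\<zeta> - \<eta>')}"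
    using measure_sph_S by simp
  then show ?thesis
    unfolding sph.emeasure_eq_measure by (rule ennreal_leI)
qed

text \<open>Averaging the reflection bound over all directions controls |v \<zeta> - v \<eta>| over
  pairs at distance at least 1 / 18. Close pairs are compared through a third point far from both,
  and the distance to the mean is at most the average of all differences.\<close>

lemma L1_close_nonneg:
  assumes m0: "0 < m0"
  obtains K where "0 \<le> K" "\<And>v \<tau>. near_max \<tau> v \<Longrightarrow> 0 < \<tau> \<Longrightarrow> \<tau> \<le> 1 / 4 \<Longrightarrow> m0 \<le> (\<integral>\<eta>. v \<eta> \<partial>sph) \<Longrightarrow>
    (\<integral>\<eta>. \<bar>v \<eta> - (\<integral>\<zeta>. v \<zeta> \<partial>sph) / S\<bar> \<partial>sph) \<le> K * sqrt \<tau>"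
proof (rule reflection_bound[OF m0])
  fix K0
  assume K0: "0 \<le> K0" and rb: "\<And>v \<tau> \<nu>. near_max \<tau> v \<Longrightarrow> 0 < \<tau> \<Longrightarrow> \<tau> \<le> 1 / 4 \<Longrightarrow> m0 \<le> (\<integral>\<eta>. v \<eta> \<partial>sph) \<Longrightarrow> norm \<nu> = 1 \<Longrightarrow>
    integrable sph (\<lambda>\<eta>. \<bar>v (hrefl \<nu> \<eta>) - v \<eta>\<bar> * \<bar>\<eta> \<bullet> \<nu>\<bar>) \<and> (\<integral>\<eta>. \<bar>v (hrefl \<nu> \<eta>) - v \<eta>\<bar> * \<bar>\<eta> \<bullet> \<nu>\<bar> \<partial>sph) \<le> K0 * sqrt \<tau>"
  define C where "C = 2 * (fact DIM('a) * 6 ^ DIM('a)) / (1 / 18 :: real)"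
  have C: "0 \<le> C"
    by (simp add: C_def)
  show thesis
  proof
    show "0 \<le> 4 * C * K0"
      using C K0 by simp
    fix v \<tau>
    assume v: "near_max \<tau> v" and \<tau>: "0 < \<tau>" "\<tau> \<le> 1 / 4" and mean: "m0 \<le> (\<integral>\<eta>. v \<eta> \<partial>sph)"
    note vD = near_maxD[OF v]
    note vm [measurable] = vD(6)
    interpret SS: pair_sigma_finite "sph :: 'a measure" "sph :: 'a measure" ..
    define G where "G \<eta> = (\<integral>\<^sup>+\<zeta>. ennreal \<bar>v \<zeta> - v \<eta>\<bar> * indicator {\<zeta>. 1 / 18 \<le> norm (\<zeta> - \<eta>)} \<zeta> \<partial>sph)" for \<eta> :: 'a
    have [measurable]: "(\<lambda>x. hrefl (fst x) (snd x :: 'a)) \<in> borel \<Otimes>\<^sub>M borel \<rightarrow>\<^sub>M borel"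
      unfolding hrefl_def by measurable
    have m1 [measurable]: "(\<lambda>(\<nu>, \<eta>). ennreal \<bar>v (hrefl \<nu> \<eta>) - v \<eta>\<bar> * ennreal \<bar>\<nu> \<bullet> \<eta>\<bar>) \<in> borel_measurable (sph \<Otimes>\<^sub>M sph)"
      unfolding split_beta' by measurable
    have m2 [measurable]: "(\<lambda>(\<eta>, \<zeta>). ennreal \<bar>v \<zeta> - v \<eta>\<bar> * indicator {\<zeta>. 1 / 18 \<le> norm (\<zeta> - \<eta>)} \<zeta>) \<in> borel_measurable (sph \<Otimes>\<^sub>M sph)"
      by measurable
    have Gm [measurable]: "G \<in> borel_measurable borel"
      unfolding G_def[abs_def] by measurable
    have "(\<integral>\<^sup>+\<eta>. G \<eta> \<partial>sph) \<le> (\<integral>\<^sup>+\<eta>. ennreal C * (\<integral>\<^sup>+\<nu>. ennreal \<bar>v (hrefl \<nu> \<eta>) - v \<eta>\<bar> * ennreal \<bar>\<nu> \<bullet> \<eta>\<bar> \<partial>sph) \<partial>sph)"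
    proof (rule nn_integral_mono_AE, use AE_sph in eventually_elim)
      fix \<eta> :: 'a
      assume \<eta>: "norm \<eta> = 1"
      show "G \<eta> \<le> ennreal C * (\<integral>\<^sup>+\<nu>. ennreal \<bar>v (hrefl \<nu> \<eta>) - v \<eta>\<bar> * ennreal \<bar>\<nu> \<bullet> \<eta>\<bar> \<partial>sph)"
        unfolding G_def C_def by (rule refl_average[OF \<eta>, where f = "\<lambda>\<zeta>. ennreal \<bar>v \<zeta> - v \<eta>\<bar>"]) simp_all
    qed
    also have "\<dots> = ennreal C * (\<integral>\<^sup>+\<eta>. (\<integral>\<^sup>+\<nu>. ennreal \<bar>v (hrefl \<nu> \<eta>) - v \<eta>\<bar> * ennreal \<bar>\<nu> \<bullet> \<eta>\<bar> \<partial>sph) \<partial>sph)"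
      by (rule nn_integral_cmult) measurable
    also have "(\<integral>\<^sup>+\<eta>. (\<integral>\<^sup>+\<nu>. ennreal \<bar>v (hrefl \<nu> \<eta>) - v \<eta>\<bar> * ennreal \<bar>\<nu> \<bullet> \<eta>\<bar> \<partial>sph) \<partial>sph)
        = (\<integral>\<^sup>+\<nu>. (\<integral>\<^sup>+\<eta>. ennreal \<bar>v (hrefl \<nu> \<eta>) - v \<eta>\<bar> * ennreal \<bar>\<nu> \<bullet> \<eta>\<bar> \<partial>sph) \<partial>sph)"
      by (rule SS.Fubini'[OF m1])
    also have "\<dots> \<le> (\<integral>\<^sup>+\<nu>. ennreal (K0 * sqrt \<tau>) \<partial>(sph :: 'a measure))"
    proof (rule nn_integral_mono_AE, use AE_sph in eventually_elim)
      fix \<nu> :: 'a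
      assume \<nu>: "norm \<nu> = 1"
      note r = rb[OF v \<tau> mean \<nu>]
      have "(\<integral>\<^sup>+\<eta>. ennreal \<bar>v (hrefl \<nu> \<eta>) - v \<eta>\<bar> * ennreal \<bar>\<nu> \<bullet> \<eta>\<bar> \<partial>sph) = (\<integral>\<^sup>+\<eta>. ennreal (\<bar>v (hrefl \<nu> \<eta>) - v \<eta>\<bar> * \<bar>\<eta> \<bullet> \<nu>\<bar>) \<partial>sph)"
        by (simp add: ennreal_mult inner_commute)
      also have "\<dots> = ennreal (\<integral>\<eta>. \<bar>v (hrefl \<nu> \<eta>) - v \<eta>\<bar> * \<bar>\<eta> \<bullet> \<nu>\<bar> \<partial>sph)"
        using r by (intro nn_integral_eq_integral) auto
      also have "\<dots> \<le> ennreal (K0 * sqrt \<tau>)"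
        using r by (intro ennreal_leI) auto
      finally show "(\<integral>\<^sup>+\<eta>. ennreal \<bar>v (hrefl \<nu> \<eta>) - v \<eta>\<bar> * ennreal \<bar>\<nu> \<bullet> \<eta>\<bar> \<partial>sph) \<le> ennreal (K0 * sqrt \<tau>)" .
    qed
    also have "\<dots> = ennreal (K0 * sqrt \<tau> * S)"
      using K0 \<tau> S_pos by (simp add: emeasure_sph S ennreal_mult)
    finally have G: "(\<integral>\<^sup>+\<eta>. G \<eta> \<partial>sph) \<le> ennreal (C * (K0 * sqrt \<tau> * S))"
      using C K0 \<tau> S_pos by (simp add: ennreal_mult mult_left_mono)
    \<comment> \<open>Triangle inequality through all \<zeta> far from both points; they fill at
      least half of the sphere.\<close>
    have pair: "ennreal (S / 2) * ennreal \<bar>v \<eta> - v \<eta>'\<bar> \<le> G \<eta> + G \<eta>'" if "norm \<eta> = 1" "norm \<eta>' = 1" for \<eta> \<eta>' :: 'a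
    proof -
      let ?F = "{\<zeta>. 1 / 18 \<le> norm (\<zeta> - \<eta>) \<and> 1 / 18 \<le> norm (\<zeta> - \<eta>')}"
      have "ennreal (S / 2) * ennreal \<bar>v \<eta> - v \<eta>'\<bar> \<le> emeasure sph ?F * ennreal \<bar>v \<eta> - v \<eta>'\<bar>"
        by (intro mult_right_mono far_from_two_points that) simp
      also have "\<dots> = (\<integral>\<^sup>+\<zeta>. ennreal \<bar>v \<eta> - v \<eta>'\<bar> * indicator ?F \<zeta> \<partial>sph)"
        by (subst nn_integral_cmult_indicator) (simp_all add: mult.commute)
      also have "\<dots> \<le> (\<integral>\<^sup>+\<zeta>. ennreal \<bar>v \<zeta> - v \<eta>\<bar> * indicator {\<zeta>. 1 / 18 \<le> norm (\<zeta> - \<eta>)} \<zeta>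
          + ennreal \<bar>v \<zeta> - v \<eta>'\<bar> * indicator {\<zeta>. 1 / 18 \<le> norm (\<zeta> - \<eta>')} \<zeta> \<partial>sph)"
        by (rule nn_integral_mono) (auto simp: indicator_def intro!: ennreal_leI simp flip: ennreal_plus)
      also have "\<dots> = G \<eta> + G \<eta>'"
        unfolding G_def by (rule nn_integral_add) simp_all
      finally show ?thesis .
    qed
    define M where "M = (\<integral>\<zeta>. v \<zeta> \<partial>sph)"
    have dev: "ennreal S * ennreal \<bar>v \<eta> - M / S\<bar> \<le> (\<integral>\<^sup>+\<zeta>. ennreal \<bar>v \<eta> - v \<zeta>\<bar> \<partial>sph)" for \<eta>
    proof -
      have "S * \<bar>v \<eta> - M / S\<bar> = \<bar>S * v \<eta> - M\<bar>"
      proof -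
        have "S * (v \<eta> - M / S) = S * v \<eta> - M"
          using S_pos by (simp add: field_simps)
        then show ?thesis
          using S_pos by (metis abs_mult abs_of_pos)
      qed
      also have "S * v \<eta> - M = (\<integral>\<zeta>. v \<eta> - v \<zeta> \<partial>sph)"
        using vD(7) by (simp add: M_def measure_sph_S)
      also have "\<bar>\<dots>\<bar> \<le> (\<integral>\<zeta>. \<bar>v \<eta> - v \<zeta>\<bar> \<partial>sph)"
        by (rule integral_abs_bound)
      finally have "ennreal (S * \<bar>v \<eta> - M / S\<bar>) \<le> ennreal (\<integral>\<zeta>. \<bar>v \<eta> - v \<zeta>\<bar> \<partial>sph)"
        by (rule ennreal_leI)
      also have "\<dots> = (\<integral>\<^sup>+\<zeta>. ennreal \<bar>v \<eta> - v \<zeta>\<bar> \<partial>sph)"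
        using vD(7) by (intro nn_integral_eq_integral[symmetric]) auto
      finally show ?thesis
        using S_pos by (simp add: ennreal_mult)
    qed
    have "ennreal (S / 2) * (ennreal S * (\<integral>\<^sup>+\<eta>. ennreal \<bar>v \<eta> - M / S\<bar> \<partial>sph))
        = (\<integral>\<^sup>+\<eta>. ennreal (S / 2) * (ennreal S * ennreal \<bar>v \<eta> - M / S\<bar>) \<partial>sph)"
      by (simp add: nn_integral_cmult)
    also have "\<dots> \<le> (\<integral>\<^sup>+\<eta>. G \<eta> * ennreal S + (\<integral>\<^sup>+\<zeta>. G \<zeta> \<partial>sph) \<partial>sph)"
    proof (rule nn_integral_mono_AE, use AE_sph in eventually_elim)
      fix \<eta> :: 'a
      assume \<eta>: "norm \<eta> = 1"
      have "ennreal (S / 2) * (ennreal S * ennreal \<bar>v \<eta> - M / S\<bar>) \<le> ennreal (S / 2) * (\<integral>\<^sup>+\<zeta>. ennreal \<bar>v \<eta> - v \<zeta>\<bar> \<partial>sph)"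
        by (intro mult_left_mono dev) simp
      also have "\<dots> = (\<integral>\<^sup>+\<zeta>. ennreal (S / 2) * ennreal \<bar>v \<eta> - v \<zeta>\<bar> \<partial>sph)"
        by (rule nn_integral_cmult[symmetric]) simp
      also have "\<dots> \<le> (\<integral>\<^sup>+\<zeta>. G \<eta> + G \<zeta> \<partial>sph)"
        by (rule nn_integral_mono_AE, use AE_sph in eventually_elim) (rule pair[OF \<eta>])
      also have "\<dots> = (\<integral>\<^sup>+\<zeta>. G \<eta> \<partial>(sph :: 'a measure)) + (\<integral>\<^sup>+\<zeta>. G \<zeta> \<partial>sph)"
        by (rule nn_integral_add) simp_all
      also have "\<dots> = G \<eta> * ennreal S + (\<integral>\<^sup>+\<zeta>. G \<zeta> \<partial>sph)"
        by (simp add: emeasure_sph S)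
      finally show "ennreal (S / 2) * (ennreal S * ennreal \<bar>v \<eta> - M / S\<bar>) \<le> G \<eta> * ennreal S + (\<integral>\<^sup>+\<zeta>. G \<zeta> \<partial>sph)" .
    qed
    also have "\<dots> = (\<integral>\<^sup>+\<eta>. G \<eta> \<partial>sph) * ennreal S + (\<integral>\<^sup>+\<zeta>. G \<zeta> \<partial>sph) * ennreal S"
      by (simp add: nn_integral_add nn_integral_multc emeasure_sph S)
    also have "\<dots> \<le> ennreal (C * (K0 * sqrt \<tau> * S)) * ennreal S + ennreal (C * (K0 * sqrt \<tau> * S)) * ennreal S"
      by (intro add_mono mult_right_mono G) simp_all
    also have "\<dots> = ennreal (S / 2 * (S * (4 * C * K0 * sqrt \<tau>)))"
      using C K0 \<tau> S_pos by (simp add: ennreal_mult[symmetric] ennreal_plus[symmetric] del: ennreal_plus)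
    finally have fin: "ennreal (S / 2) * (ennreal S * (\<integral>\<^sup>+\<eta>. ennreal \<bar>v \<eta> - M / S\<bar> \<partial>sph)) \<le> ennreal (S / 2 * (S * (4 * C * K0 * sqrt \<tau>)))" .
    have "(\<integral>\<^sup>+\<eta>. ennreal \<bar>v \<eta> - M / S\<bar> \<partial>sph) = ennreal (\<integral>\<eta>. \<bar>v \<eta> - M / S\<bar> \<partial>sph)"
      using vD(7) by (intro nn_integral_eq_integral) auto
    then have "ennreal (S / 2 * (S * (\<integral>\<eta>. \<bar>v \<eta> - M / S\<bar> \<partial>sph))) \<le> ennreal (S / 2 * (S * (4 * C * K0 * sqrt \<tau>)))"
      using fin S_pos by (simp only: ennreal_mult'[of "S / 2"] ennreal_mult'[of S])
    then have "S / 2 * (S * (\<integral>\<eta>. \<bar>v \<eta> - M / S\<bar> \<partial>sph)) \<le> S / 2 * (S * (4 * C * K0 * sqrt \<tau>))"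
      using C K0 \<tau> S_pos by (subst (asm) ennreal_le_iff) simp_all
    then show "(\<integral>\<eta>. \<bar>v \<eta> - (\<integral>\<zeta>. v \<zeta> \<partial>sph) / S\<bar> \<partial>sph) \<le> 4 * C * K0 * sqrt \<tau>"
      using S_pos by (simp add: M_def)
  qed
qed

lemma H_abs:
  assumes u: "Lp u"
  shows "H u \<le> H (\<lambda>\<eta>. \<bar>u \<eta>\<bar>)"
  unfolding H_def
proof (rule integral_mono_AE)
  show "integrable hyp (\<lambda>\<xi>. \<bar>Tr s u \<xi>\<bar> powr q)" "integrable hyp (\<lambda>\<xi>. \<bar>Tr s (\<lambda>\<eta>. \<bar>u \<eta>\<bar>) \<xi>\<bar> powr q)"
    using H_integrable u Lp_abs by auto
  show "AE \<xi> in hyp. \<bar>Tr s u \<xi>\<bar> powr q \<le> \<bar>Tr s (\<lambda>\<eta>. \<bar>u \<eta>\<bar>) \<xi>\<bar> powr q"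
    using AE_hyp
  proof eventually_elim
    fix \<xi> :: 'a
    assume \<xi>: "norm \<xi> < 1"
    have "\<bar>Tr s u \<xi>\<bar> \<le> \<bar>Tr s (\<lambda>\<eta>. \<bar>u \<eta>\<bar>) \<xi>\<bar>"
      using Tr_abs[OF \<xi> LpD(1)[OF u] Lp_integrable[OF u]] by simp
    then show "\<bar>Tr s u \<xi>\<bar> powr q \<le> \<bar>Tr s (\<lambda>\<eta>. \<bar>u \<eta>\<bar>) \<xi>\<bar> powr q"
      using q2 by (intro powr_mono2) auto
  qed
qed

text \<open>Replacing u by |u| can raise H by at most \<tau>. On a fixed ball the gap between T |u|
  and |T u| is the smaller of T (|u| - u) and T (|u| + u), hence dominates the smaller of the two
  masses; so one of them must be small.\<close>

lemma sign_estimate: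
  assumes m0: "0 < m0"
  obtains K where "0 \<le> K" "\<And>u \<tau>. Lp u \<Longrightarrow> E u = 1 \<Longrightarrow> \<Gamma> - \<tau> \<le> H u \<Longrightarrow> 0 < \<tau> \<Longrightarrow> m0 \<le> (\<integral>\<eta>. \<bar>u \<eta>\<bar> \<partial>sph) \<Longrightarrow>
    (\<integral>\<eta>. \<bar>u \<eta>\<bar> - u \<eta> \<partial>sph) \<le> K * \<tau> \<or> (\<integral>\<eta>. \<bar>u \<eta>\<bar> + u \<eta> \<partial>sph) \<le> K * \<tau>"
proof -
  define k where "k = ((1 - (1 / 2)\<^sup>2) / 8) powr s"
  define V where "V = measure lborel (ball (0::'a) (1 / 2))"
  define c where "c = (k * m0) powr (q - 1) * k"
  have k: "0 < k"
    by (simp add: k_def power2_eq_square)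
  have V: "0 < V"
    unfolding V_def by (rule content_ball_pos) simp
  have c: "0 < c"
    using k m0 by (simp add: c_def)
  show thesis
  proof
    show "0 \<le> 1 / (c * V)"
      using c V by simp
    fix u \<tau>
    assume u: "Lp u" and Eu: "E u = 1" and Hu: "\<Gamma> - \<tau> \<le> H u" and \<tau>: "0 < \<tau>" and mean: "m0 \<le> (\<integral>\<eta>. \<bar>u \<eta>\<bar> \<partial>sph)"
    note [measurable] = LpD(1)[OF u]
    note ui = Lp_integrable[OF u]
    define a b where "a \<eta> = \<bar>u \<eta>\<bar> + u \<eta>" and "b \<eta> = \<bar>u \<eta>\<bar> - u \<eta>" for \<eta>
    have abm [measurable]: "a \<in> borel_measurable borel" "b \<in> borel_measurable borel"
      unfolding a_def b_def by measurable
    have ab: "integrable sph a" "integrable sph b" "\<And>\<eta>. 0 \<le> a \<eta>" "\<And>\<eta>. 0 \<le> b \<eta>"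
      unfolding a_def b_def using ui by auto
    define I where "I = min (\<integral>\<eta>. a \<eta> \<partial>sph) (\<integral>\<eta>. b \<eta> \<partial>sph)"
    have I: "0 \<le> I"
      using ab by (simp add: I_def)
    define \<Delta> where "\<Delta> \<xi> = \<bar>Tr s (\<lambda>\<eta>. \<bar>u \<eta>\<bar>) \<xi>\<bar> powr q - \<bar>Tr s u \<xi>\<bar> powr q" for \<xi>
    have \<Delta>0: "0 \<le> \<Delta> \<xi>" if \<xi>: "norm \<xi> < 1" for \<xi>
      unfolding \<Delta>_def using Tr_abs[OF \<xi> LpD(1)[OF u] ui] q2 powr_mono2[of q "\<bar>Tr s u \<xi>\<bar>" "\<bar>Tr s (\<lambda>\<eta>. \<bar>u \<eta>\<bar>) \<xi>\<bar>"] by simp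
    have \<Delta>K: "c * I \<le> \<Delta> \<xi>" if "\<xi> \<in> ball 0 (1 / 2)" for \<xi>
    proof -
      have n: "norm \<xi> \<le> 1 / 2" and \<xi>: "norm \<xi> < 1"
        using that by auto
      define X Y where "X = Tr s (\<lambda>\<eta>. \<bar>u \<eta>\<bar>) \<xi>" and "Y = \<bar>Tr s u \<xi>\<bar>"
      have Ta: "Tr s a \<xi> = X + Tr s u \<xi>" and Tb: "Tr s b \<xi> = X - Tr s u \<xi>"
        unfolding a_def[abs_def] b_def[abs_def] X_def using \<xi> ui by (subst Tr_add Tr_diff; simp)+
      have "k * (\<integral>\<eta>. a \<eta> \<partial>sph) \<le> Tr s a \<xi>" "k * (\<integral>\<eta>. b \<eta> \<partial>sph) \<le> Tr s b \<xi>"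
        unfolding k_def using n ab by (intro Tr_ge; simp)+
      moreover have "k * I \<le> k * (\<integral>\<eta>. a \<eta> \<partial>sph)" "k * I \<le> k * (\<integral>\<eta>. b \<eta> \<partial>sph)"
        using k by (auto simp: I_def)
      ultimately have XY: "k * I \<le> X - Y"
        using Ta Tb unfolding Y_def abs_if by (simp split: if_splits)
      have "k * m0 \<le> k * (\<integral>\<eta>. \<bar>u \<eta>\<bar> \<partial>sph)"
        using mean k by simp
      also have "\<dots> \<le> X"
        unfolding X_def k_def using n ui by (intro Tr_ge) auto
      finally have X: "k * m0 \<le> X" .
      have X0: "0 < X"
        using X k m0 by (smt (verit) mult_pos_pos)
      have Y: "0 \<le> Y" "Y \<le> X"
        using XY mult_nonneg_nonneg[OF less_imp_le[OF k] I] by (simp_all add: Y_def)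
      have "Y powr q = Y powr (q - 1) * Y"
        using Y(1) powr_add[of Y "q - 1" 1] q2 by (cases "Y = 0") auto
      also have "\<dots> \<le> X powr (q - 1) * Y"
        using Y q2 by (intro mult_right_mono powr_mono2) auto
      finally have "X powr (q - 1) * (X - Y) \<le> X powr q - Y powr q"
        using X0 powr_add[of X "q - 1" 1] by (simp add: right_diff_distrib)
      moreover have "(k * m0) powr (q - 1) * (k * I) \<le> X powr (q - 1) * (X - Y)"
        using X XY k m0 q2 I by (intro mult_mono powr_mono2) auto
      ultimately show ?thesis
        using X0 Y by (simp add: \<Delta>_def c_def X_def[symmetric] Y_def[symmetric] mult.assoc)
    qed
    have \<Delta>i: "integrable hyp \<Delta>" "(\<integral>\<xi>. \<Delta> \<xi> \<partial>hyp) = H (\<lambda>\<eta>. \<bar>u \<eta>\<bar>) - H u"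
      unfolding \<Delta>_def using H_integrable[OF u] H_integrable[OF Lp_abs[OF u]] by (simp_all add: H_def)
    have "ennreal (c * I) * ennreal V \<le> ennreal (c * I) * emeasure hyp (ball (0::'a) (1 / 2))"
    proof (rule mult_left_mono)
      have "ennreal V = emeasure lborel (ball (0::'a) (1 / 2))"
        using emeasure_lborel_ball_finite[of "0::'a" "1 / 2"] by (simp add: V_def emeasure_eq_ennreal_measure)
      also have "\<dots> \<le> emeasure hyp (ball (0::'a) (1 / 2))"
        by (rule emeasure_hyp_ge) auto
      finally show "ennreal V \<le> emeasure hyp (ball (0::'a) (1 / 2))" .
    qed simp
    also have "\<dots> = (\<integral>\<^sup>+\<xi>. ennreal (c * I) * indicator (ball (0::'a) (1 / 2)) \<xi> \<partial>hyp)"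
      by (rule nn_integral_cmult_indicator[symmetric]) simp
    also have "\<dots> \<le> (\<integral>\<^sup>+\<xi>. ennreal (\<Delta> \<xi>) \<partial>hyp)"
    proof (rule nn_integral_mono)
      fix \<xi> :: 'a
      show "ennreal (c * I) * indicator (ball 0 (1 / 2)) \<xi> \<le> ennreal (\<Delta> \<xi>)"
        using \<Delta>K[of \<xi>] by (cases "\<xi> \<in> ball 0 (1 / 2)") (simp_all add: ennreal_leI)
    qed
    also have "\<dots> = ennreal (H (\<lambda>\<eta>. \<bar>u \<eta>\<bar>) - H u)"
      unfolding \<Delta>i(2)[symmetric] using AE_hyp \<Delta>0 by (intro nn_integral_eq_integral \<Delta>i(1)) auto
    also have "\<dots> \<le> ennreal \<tau>"
      using sharp[OF Lp_abs[OF u]] Hu by (intro ennreal_leI) (simp add: E_abs Eu)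
    finally have "ennreal (c * I * V) \<le> ennreal \<tau>"
      using c I V by (subst ennreal_mult) auto
    then have "c * I * V \<le> \<tau>"
      using \<tau> by (subst (asm) ennreal_le_iff) auto
    then have "I \<le> 1 / (c * V) * \<tau>"
      using c V by (simp add: field_simps)
    then show "(\<integral>\<eta>. \<bar>u \<eta>\<bar> - u \<eta> \<partial>sph) \<le> 1 / (c * V) * \<tau> \<or> (\<integral>\<eta>. \<bar>u \<eta>\<bar> + u \<eta> \<partial>sph) \<le> 1 / (c * V) * \<tau>"
      unfolding I_def a_def b_def min_def by (auto split: if_splits)
  qed
qed

text \<open>The nonnegative case for |u| is combined with the sign estimate. The constant
  \<open>l\<close> is the mean of u, and its distance from 0 follows because |u| has mean bounded
  below and u has almost a fixed sign.\<close>

lemma L1_close: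
  obtains K t0 l0 where "0 \<le> K" "0 < t0" "0 < l0"
    "\<And>u \<tau>. Lp u \<Longrightarrow> E u = 1 \<Longrightarrow> \<Gamma> - \<tau> \<le> H u \<Longrightarrow> (\<And>\<xi>. norm \<xi> < 1 \<Longrightarrow> Tr s (\<lambda>\<eta>. \<bar>u \<eta>\<bar>) \<xi> \<le> Tr s (\<lambda>\<eta>. \<bar>u \<eta>\<bar>) 0 + \<tau>) \<Longrightarrow>
      0 < \<tau> \<Longrightarrow> \<tau> \<le> t0 \<Longrightarrow> \<exists>l. l0 \<le> \<bar>l\<bar> \<and> (\<integral>\<eta>. u \<eta> \<partial>sph) = l * S \<and> (\<integral>\<eta>. \<bar>u \<eta> - l\<bar> \<partial>sph) \<le> K * sqrt \<tau>"
proof (rule mean_lower)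
  fix m0 t1
  assume m0: "0 < m0" and t1: "0 < t1" and mean: "\<And>v \<tau>. near_max \<tau> v \<Longrightarrow> 0 < \<tau> \<Longrightarrow> \<tau> \<le> t1 \<Longrightarrow> m0 \<le> (\<integral>\<eta>. v \<eta> \<partial>sph)"
  show thesis
  proof (rule L1_close_nonneg[OF m0])
    fix K1
    assume K1: "0 \<le> K1" and close: "\<And>v \<tau>. near_max \<tau> v \<Longrightarrow> 0 < \<tau> \<Longrightarrow> \<tau> \<le> 1 / 4 \<Longrightarrow> m0 \<le> (\<integral>\<eta>. v \<eta> \<partial>sph) \<Longrightarrow>
      (\<integral>\<eta>. \<bar>v \<eta> - (\<integral>\<zeta>. v \<zeta> \<partial>sph) / S\<bar> \<partial>sph) \<le> K1 * sqrt \<tau>"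
    show thesis
    proof (rule sign_estimate[OF m0])
      fix K2
      assume K2: "0 \<le> K2" and sign: "\<And>u \<tau>. Lp u \<Longrightarrow> E u = 1 \<Longrightarrow> \<Gamma> - \<tau> \<le> H u \<Longrightarrow> 0 < \<tau> \<Longrightarrow> m0 \<le> (\<integral>\<eta>. \<bar>u \<eta>\<bar> \<partial>sph) \<Longrightarrow>
        (\<integral>\<eta>. \<bar>u \<eta>\<bar> - u \<eta> \<partial>sph) \<le> K2 * \<tau> \<or> (\<integral>\<eta>. \<bar>u \<eta>\<bar> + u \<eta> \<partial>sph) \<le> K2 * \<tau>"
      \<comment> \<open>The last entry makes K2 \<tau> at most m0 / 2, so the mass of the wrong sign
        cannot cancel the mean.\<close>
      define t0 where "t0 = min t1 (min (1 / 4) (m0 / (2 * (K2 + 1))))"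
      show thesis
      proof
        show "0 \<le> K1 + 2 * K2" "0 < t0" "0 < m0 / (2 * S)"
          using K1 K2 t1 m0 S_pos by (simp_all add: t0_def)
        fix u \<tau>
        assume u: "Lp u" and Eu: "E u = 1" and Hu: "\<Gamma> - \<tau> \<le> H u"
          and sup: "\<And>\<xi>. norm \<xi> < 1 \<Longrightarrow> Tr s (\<lambda>\<eta>. \<bar>u \<eta>\<bar>) \<xi> \<le> Tr s (\<lambda>\<eta>. \<bar>u \<eta>\<bar>) 0 + \<tau>"
          and \<tau>: "0 < \<tau>" "\<tau> \<le> t0"
        note ui = Lp_integrable[OF u]
        have \<tau>': "\<tau> \<le> t1" "\<tau> \<le> 1 / 4" "\<tau> \<le> m0 / (2 * (K2 + 1))"
          using \<tau> by (auto simp: t0_def)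
        have nm: "near_max \<tau> (\<lambda>\<eta>. \<bar>u \<eta>\<bar>)"
          unfolding near_max_def using u Eu Hu H_abs[OF u] sup by (auto simp: Lp_abs E_abs)
        define M where "M = (\<integral>\<eta>. \<bar>u \<eta>\<bar> \<partial>sph)"
        have M: "m0 \<le> M"
          unfolding M_def by (rule mean[OF nm \<tau>(1) \<tau>'(1)])
        have L1: "(\<integral>\<eta>. \<bar>\<bar>u \<eta>\<bar> - M / S\<bar> \<partial>sph) \<le> K1 * sqrt \<tau>"
          unfolding M_def by (rule close[OF nm \<tau>(1) \<tau>'(2)]) (use M in \<open>simp add: M_def\<close>)
        have "\<tau> * 1 \<le> sqrt \<tau> * sqrt \<tau>"
          using \<tau> by simp
        also have "\<dots> \<le> sqrt \<tau> * 1"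
          using \<tau> \<tau>' by (intro mult_left_mono) auto
        finally have \<tau>s: "\<tau> \<le> sqrt \<tau>"
          by simp
        have K2\<tau>: "K2 * \<tau> \<le> m0 / 2"
        proof -
          have "K2 * \<tau> \<le> (K2 + 1) * (m0 / (2 * (K2 + 1)))"
            using K2 \<tau> \<tau>' by (intro mult_mono) auto
          also have "\<dots> = m0 / 2"
            using K2 by (simp add: field_simps)
          finally show ?thesis .
        qed
        show "\<exists>l. m0 / (2 * S) \<le> \<bar>l\<bar> \<and> (\<integral>\<eta>. u \<eta> \<partial>sph) = l * S \<and> (\<integral>\<eta>. \<bar>u \<eta> - l\<bar> \<partial>sph) \<le> (K1 + 2 * K2) * sqrt \<tau>"
        proof -
          \<comment> \<open>\<open>g\<close> is the prevailing sign: g u agrees with |u| up to a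
            mass of order \<tau>.\<close>
          obtain g :: real where g: "g = 1 \<or> g = - 1" and le: "(\<integral>\<eta>. \<bar>u \<eta>\<bar> - g * u \<eta> \<partial>sph) \<le> K2 * \<tau>"
            using sign[OF u Eu Hu \<tau>(1)] M by (auto simp: M_def intro: that[of 1] that[of "- 1"])
          define l where "l = (\<integral>\<eta>. u \<eta> \<partial>sph) / S"
          have lS: "(\<integral>\<eta>. u \<eta> \<partial>sph) = l * S"
            using S_pos by (simp add: l_def)
          have Mg: "M - g * (l * S) \<le> K2 * \<tau>"
            using le ui by (simp add: M_def lS[symmetric])
          have g1: "\<bar>g\<bar> = 1" "g * g = 1"
            using g by auto
          have gu: "g * u \<eta> \<le> \<bar>u \<eta>\<bar>" for \<eta>
            using g by auto
          have Mg0: "0 \<le> M - g * (l * S)"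
          proof -
            have "0 \<le> (\<integral>\<eta>. \<bar>u \<eta>\<bar> - g * u \<eta> \<partial>sph)"
              using gu by simp
            then show ?thesis
              using ui by (simp add: M_def lS[symmetric])
          qed
          have "m0 / 2 \<le> (g * l) * S"
            using Mg M K2\<tau> by (simp add: mult.assoc)
          then have "m0 / (2 * S) \<le> g * l"
            using S_pos by (simp add: field_simps)
          also have "\<dots> \<le> \<bar>l\<bar>"
            using g by auto
          finally have l0: "m0 / (2 * S) \<le> \<bar>l\<bar>" .
          have pw: "\<bar>u \<eta> - l\<bar> \<le> (\<bar>u \<eta>\<bar> - g * u \<eta>) + \<bar>\<bar>u \<eta>\<bar> - M / S\<bar> + (M / S - g * l)" for \<eta>
          proof -
            have "\<bar>u \<eta> - l\<bar> = \<bar>g * u \<eta> - g * l\<bar>"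
              using g1 by (metis abs_mult mult_1 right_diff_distrib)
            moreover have "0 \<le> M / S - g * l"
              using Mg0 S_pos by (simp add: field_simps)
            ultimately show ?thesis
              using gu[of \<eta>] by linarith
          qed
          have "(\<integral>\<eta>. \<bar>u \<eta> - l\<bar> \<partial>sph) \<le> (\<integral>\<eta>. (\<bar>u \<eta>\<bar> - g * u \<eta>) + \<bar>\<bar>u \<eta>\<bar> - M / S\<bar> + (M / S - g * l) \<partial>sph)"
            using ui by (intro integral_mono pw) auto
          also have "\<dots> = (\<integral>\<eta>. \<bar>u \<eta>\<bar> - g * u \<eta> \<partial>sph) + (\<integral>\<eta>. \<bar>\<bar>u \<eta>\<bar> - M / S\<bar> \<partial>sph) + (M / S - g * l) * S"
            using ui by (simp add: measure_sph_S)
          also have "(M / S - g * l) * S = M - g * (l * S)"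
            using S_pos by (simp add: field_simps)
          also have "(\<integral>\<eta>. \<bar>u \<eta>\<bar> - g * u \<eta> \<partial>sph) + (\<integral>\<eta>. \<bar>\<bar>u \<eta>\<bar> - M / S\<bar> \<partial>sph) + (M - g * (l * S)) \<le> K2 * \<tau> + K1 * sqrt \<tau> + K2 * \<tau>"
            using le L1 Mg by linarith
          also have "\<dots> \<le> (K1 + 2 * K2) * sqrt \<tau>"
            using mult_left_mono[OF \<tau>s K2] by (simp add: distrib_right)
          finally show ?thesis
            using l0 lS by blast
        qed
      qed
    qed
  qed
qed

end

section \<open>The remainder\<close>

text \<open>X and Y are the masses of the constant part and of the remainder. If both X + Y and X
  powr k + Y powr k are close to 1 with k > 1, strict convexity forces one mass to be small; X is
  bounded below, so it is Y, at a linear rate in the error d. The slack \<theta> accommodates the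
  splitting errors.\<close>

lemma two_bubbles:
  fixes x0 k :: real
  assumes x0: "0 < x0" "x0 < 1" and k: "1 < k"
  obtains \<theta> C d0 where "0 < \<theta>" "0 \<le> C" "0 < d0"
    "\<And>X Y d. 0 \<le> d \<Longrightarrow> d \<le> d0 \<Longrightarrow> x0 \<le> X \<Longrightarrow> 0 \<le> Y \<Longrightarrow> X + (1 - \<theta>) * Y \<le> 1 + d \<Longrightarrow>
      1 - d \<le> X powr k + (1 + \<theta>) * Y powr k \<Longrightarrow> Y \<le> C * d"
proof -
  \<comment> \<open>X \<ge> x0 forces Y \<le> 1 - x0 / 2, hence Y powr k \<le> r Y with r <
    1.\<close>
  define r where "r = (1 - x0 / 2) powr (k - 1)"
  have r: "0 < r" "r < 1"
    using x0 k powr_less_mono2[of "k - 1" "1 - x0 / 2" 1] by (simp_all add: r_def)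
  \<comment> \<open>The first bound keeps Y below 1 - x0 / 2 despite the slack; the second leaves (1
    - \<theta>) - (1 + \<theta>) r at least (1 - r) / 2.\<close>
  define \<theta> where "\<theta> = min (x0 / 8) ((1 - r) / 4)"
  have \<theta>: "0 < \<theta>" "\<theta> \<le> x0 / 8" "\<theta> \<le> (1 - r) / 4" "\<theta> < 1"
    using x0 r by (auto simp: \<theta>_def min_def)
  define C where "C = 2 / (1 - r) * (k * 2 powr (k - 1) + 1)"
  show thesis
  proof
    show "0 < \<theta>" "0 \<le> C" "0 < x0 / 8"
      using \<theta> r k x0 by (simp_all add: C_def)
    fix X Y d :: real
    assume d: "0 \<le> d" "d \<le> x0 / 8" and X: "x0 \<le> X" and Y: "0 \<le> Y"
      and a: "X + (1 - \<theta>) * Y \<le> 1 + d" and b: "1 - d \<le> X powr k + (1 + \<theta>) * Y powr k"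
    have X1: "X \<le> 1 + d"
      using a Y \<theta> by (smt (verit) mult_nonneg_nonneg)
    have "(1 - \<theta>) * Y \<le> (1 - \<theta>) * (1 - x0 / 2)"
    proof -
      have "(1 - \<theta>) * Y \<le> 1 - 7 * x0 / 8"
        using a d X by linarith
      also have "\<dots> \<le> 1 - x0 / 2 - \<theta>"
        using \<theta> by linarith
      also have "\<dots> \<le> (1 - \<theta>) * (1 - x0 / 2)"
        using \<theta> x0 by (simp add: algebra_simps)
      finally show ?thesis .
    qed
    then have Y1: "Y \<le> 1 - x0 / 2"
      using \<theta> by simp
    have Xk: "X powr k \<le> X * (1 + d) powr (k - 1)"
    proof -
      have "X powr k = X * X powr (k - 1)"
        using X x0 powr_add[of X 1 "k - 1"] by simp
      also have "\<dots> \<le> X * (1 + d) powr (k - 1)"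
        using X X1 x0 k by (intro mult_left_mono powr_mono2) auto
      finally show ?thesis .
    qed
    have Yk: "Y powr k \<le> Y * r"
    proof -
      have "Y powr k = Y * Y powr (k - 1)"
        using Y powr_add[of Y 1 "k - 1"] k by (cases "Y = 0") auto
      also have "\<dots> \<le> Y * r"
        unfolding r_def using Y Y1 k by (intro mult_left_mono powr_mono2) auto
      finally show ?thesis .
    qed
    define g where "g = (1 + d) powr (k - 1)"
    have g1: "1 \<le> g"
      using d k by (auto simp: g_def intro: ge_one_powr_ge_zero)
    have "(1 + \<theta>) * Y powr k \<le> (1 + \<theta>) * (Y * r)"
      using Yk \<theta> by (intro mult_left_mono) auto
    then have "1 - d \<le> X * g + (1 + \<theta>) * (Y * r)"
      using b Xk unfolding g_def by linarith
    also have "\<dots> \<le> (1 + d - (1 - \<theta>) * Y) * g + (1 + \<theta>) * (Y * r)"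
      using a g1 by (intro add_right_mono mult_right_mono) auto
    also have "\<dots> \<le> (1 + d) * g - (1 - \<theta>) * Y + (1 + \<theta>) * (Y * r)"
    proof -
      have "(1 - \<theta>) * Y * 1 \<le> (1 - \<theta>) * Y * g"
        using g1 \<theta> Y by (intro mult_left_mono) auto
      then show ?thesis
        unfolding left_diff_distrib[of "1 + d"] by linarith
    qed
    finally have 1: "Y * ((1 - \<theta>) - (1 + \<theta>) * r) \<le> (1 + d) * g - 1 + d"
      by (simp add: algebra_simps)
    define x where "x = \<theta> * r"
    have "x \<le> \<theta>"
      unfolding x_def using \<theta> r mult_left_mono[of r 1 \<theta>] by simp
    moreover have "(1 - \<theta>) - (1 + \<theta>) * r = 1 - r - \<theta> - x"
      by (simp add: x_def algebra_simps)
    moreover have "2 * \<theta> \<le> (1 - r) / 2"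
      using \<theta>(3) by simp
    ultimately have "(1 - r) / 2 \<le> (1 - \<theta>) - (1 + \<theta>) * r"
      by (simp add: field_simps)
    then have "Y * ((1 - r) / 2) \<le> Y * ((1 - \<theta>) - (1 + \<theta>) * r)"
      using Y by (intro mult_left_mono) auto
    also have "\<dots> \<le> (1 + d) * g - 1 + d"
      by (rule 1)
    also have "(1 + d) * g = (1 + d) powr k"
      using d powr_add[of "1 + d" 1 "k - 1"] by (simp add: g_def)
    also have "(1 + d) powr k - 1 + d \<le> (k * 2 powr (k - 1) + 1) * d"
      using powr_diff_le_abs[of k 1 "1 + d" 2] d x0 k by (simp add: distrib_right)
    finally have "Y * ((1 - r) / 2) \<le> (k * 2 powr (k - 1) + 1) * d" .
    then have "2 / (1 - r) * (Y * ((1 - r) / 2)) \<le> 2 / (1 - r) * ((k * 2 powr (k - 1) + 1) * d)"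
      using r by (intro mult_left_mono) auto
    moreover have "2 / (1 - r) * (Y * ((1 - r) / 2)) = Y"
      using r by simp
    ultimately show "Y \<le> C * d"
      unfolding C_def mult.assoc by simp
  qed
qed

section \<open>Expansion around the constant function\<close>

context stab_sharp
begin

definition \<phi> :: "'a \<Rightarrow> real" where
  "\<phi> = Tr s (\<lambda>_. 1)"

lemma \<phi>_borel [measurable]: "\<phi> \<in> borel_measurable borel"
  unfolding \<phi>_def by measurable

lemma Lp_const: "Lp (\<lambda>_. c)"
  unfolding Lp_def by simp

lemma E_1: "E (\<lambda>_. 1) = S"
  by (simp add: E_def measure_sph_S)

lemma \<phi>_radial:
  assumes "norm \<xi> = norm \<zeta>"
  shows "\<phi> \<xi> = \<phi> \<zeta>"
proof (cases "\<xi> = \<zeta>")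
  case False
  define \<nu> where "\<nu> = (\<xi> - \<zeta>) /\<^sub>R norm (\<xi> - \<zeta>)"
  have "norm \<nu> = 1" "hrefl \<nu> \<xi> = \<zeta>"
    using False refl_swap[of \<xi> \<zeta>] assms by (simp_all add: \<nu>_def)
  then show ?thesis
    using Tr_refl[of \<nu> "\<lambda>_. 1" s \<xi>] by (simp add: \<phi>_def)
qed simp

text \<open>The radial profile of \<phi> as a function of one real variable, the form in which
  \<open>radial_test\<close> takes its weight.\<close>

definition \<phi>r :: "real \<Rightarrow> real" where
  "\<phi>r r = \<phi> (r *\<^sub>R (SOME b. b \<in> Basis))"

lemma \<phi>r_borel [measurable]: "\<phi>r \<in> borel_measurable borel"
  unfolding \<phi>r_def by measurable

lemma \<phi>_\<phi>r: "\<phi> \<xi> = \<phi>r (norm \<xi>)"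
  unfolding \<phi>r_def using norm_Basis[OF SOME_Basis, where 'a='a] by (intro \<phi>_radial) simp

lemma \<phi>_pos:
  assumes "norm \<xi> < 1"
  shows "0 < \<phi> \<xi>"
proof -
  have "((1 - (norm \<xi>)\<^sup>2) / 8) powr s * (\<integral>\<eta>. 1 \<partial>(sph :: 'a measure)) \<le> \<phi> \<xi>"
    unfolding \<phi>_def using assms by (intro Tr_ge) auto
  moreover have "0 < ((1 - (norm \<xi>)\<^sup>2) / 8) powr s * (\<integral>\<eta>. 1 \<partial>(sph :: 'a measure))"
    using wt_pos[OF assms] S_pos by (simp add: measure_sph_S wt_def)
  ultimately show ?thesis
    by linarith
qed

lemma \<phi>_integrable: "integrable hyp (\<lambda>\<xi>. \<phi> \<xi> powr q)"
  and \<phi>_H: "(\<integral>\<xi>. \<phi> \<xi> powr q \<partial>hyp) = H (\<lambda>_. 1)"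
proof -
  have eq: "AE \<xi> in hyp. \<bar>Tr s (\<lambda>_. 1) \<xi>\<bar> powr q = \<phi> \<xi> powr q"
    using AE_hyp
  proof eventually_elim
    fix \<xi> :: 'a
    assume "norm \<xi> < 1"
    then show "\<bar>Tr s (\<lambda>_. 1) \<xi>\<bar> powr q = \<phi> \<xi> powr q"
      using \<phi>_pos[of \<xi>] by (simp add: \<phi>_def)
  qed
  show "integrable hyp (\<lambda>\<xi>. \<phi> \<xi> powr q)"
    by (rule integrable_cong_AE_imp[OF H_integrable[OF Lp_const[of 1]] _ eq]) simp
  show "(\<integral>\<xi>. \<phi> \<xi> powr q \<partial>hyp) = H (\<lambda>_. 1)"
    unfolding H_def by (rule integral_cong_AE[OF _ _ AE_symmetric[OF eq]]) simp_all
qed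

text \<open>The adjoint of T sends radial functions to constants, by \<open>radial_average\<close>.
  Testing T g with a radial weight therefore sees only the mean of g.\<close>

lemma radial_test:
  assumes [measurable]: "F \<in> borel_measurable borel" "g \<in> borel_measurable borel"
    and gi: "integrable sph g" and g0: "\<And>\<eta>. 0 \<le> g \<eta>"
  shows "ennreal S * (\<integral>\<^sup>+\<xi>. F (norm \<xi>) * ennreal (Tr s g \<xi>) \<partial>hyp)
    = (\<integral>\<^sup>+\<xi>. F (norm \<xi>) * ennreal (\<phi> \<xi>) \<partial>hyp) * (\<integral>\<^sup>+\<eta>. ennreal (g \<eta>) \<partial>(sph :: 'a measure))"
proof -
  interpret HS: pair_sigma_finite hyp "sph :: 'a measure" ..
  \<comment> \<open>The radial part of the kernel joins the weight, so that a function of |\<xi> -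
    \<eta>| alone remains.\<close>
  define F' where "F' r = F r * ennreal (((1 - r\<^sup>2) / 2) powr s)" for r
  define k where "k r = ennreal (r powr (- 2 * s))" for r
  have [measurable]: "F' \<in> borel_measurable borel" "k \<in> borel_measurable borel"
    unfolding F'_def k_def by measurable
  have ker: "F (norm \<xi>) * ennreal (ker s \<xi> \<eta>) = F' (norm \<xi>) * k (norm (\<xi> - \<eta>))" if "norm \<xi> < 1" for \<xi> \<eta> :: 'a
  proof -
    have "ker s \<xi> \<eta> = wt \<xi> powr s * norm (\<xi> - \<eta>) powr (- 2 * s)"
    proof (cases "\<xi> = \<eta>")
      case False
      then have "(norm (\<xi> - \<eta>))\<^sup>2 powr s = norm (\<xi> - \<eta>) powr (2 * s)"
        by (simp add: powr_powr flip: powr_numeral)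
      then show ?thesis
        using False by (simp add: ker_def powr_divide powr_minus_divide)
    qed (use s in \<open>simp add: ker_def\<close>)
    then show ?thesis
      by (simp add: F'_def k_def wt_def ennreal_mult' mult.assoc)
  qed
  have inner: "ennreal S * (\<integral>\<^sup>+\<xi>. F' (norm \<xi>) * k (norm (\<xi> - \<eta>)) \<partial>hyp) = (\<integral>\<^sup>+\<xi>. F (norm \<xi>) * ennreal (\<phi> \<xi>) \<partial>hyp)" if "norm \<eta> = 1" for \<eta> :: 'a
  proof -
    have "ennreal S * (\<integral>\<^sup>+\<xi>. F' (norm \<xi>) * k (norm (\<xi> - \<eta>)) \<partial>hyp) = (\<integral>\<^sup>+\<xi>. F' (norm \<xi>) * (\<integral>\<^sup>+\<zeta>. k (norm (\<xi> - \<zeta>)) \<partial>sph) \<partial>(hyp :: 'a measure))"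
      unfolding S by (rule radial_average[OF that]) simp_all
    also have "\<dots> = (\<integral>\<^sup>+\<xi>. F (norm \<xi>) * ennreal (\<phi> \<xi>) \<partial>hyp)"
    proof (rule nn_integral_cong_AE, use AE_hyp in eventually_elim)
      fix \<xi> :: 'a
      assume \<xi>: "norm \<xi> < 1"
      have "F' (norm \<xi>) * (\<integral>\<^sup>+\<zeta>. k (norm (\<xi> - \<zeta>)) \<partial>sph) = (\<integral>\<^sup>+\<zeta>. F (norm \<xi>) * ennreal (ker s \<xi> \<zeta> * 1) \<partial>sph)"
        by (subst nn_integral_cmult[symmetric]) (simp_all add: ker[OF \<xi>])
      also have "\<dots> = F (norm \<xi>) * (\<integral>\<^sup>+\<zeta>. ennreal (ker s \<xi> \<zeta> * 1) \<partial>sph)"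
        by (rule nn_integral_cmult) simp
      also have "(\<integral>\<^sup>+\<zeta>. ennreal (ker s \<xi> \<zeta> * 1) \<partial>sph) = ennreal (\<phi> \<xi>)"
        unfolding \<phi>_def by (rule nn_Tr[OF \<xi>]) simp_all
      finally show "F' (norm \<xi>) * (\<integral>\<^sup>+\<zeta>. k (norm (\<xi> - \<zeta>)) \<partial>sph) = F (norm \<xi>) * ennreal (\<phi> \<xi>)" .
    qed
    finally show ?thesis .
  qed
  have "(\<integral>\<^sup>+\<xi>. F (norm \<xi>) * ennreal (Tr s g \<xi>) \<partial>hyp) = (\<integral>\<^sup>+\<xi>. (\<integral>\<^sup>+\<eta>. F' (norm \<xi>) * k (norm (\<xi> - \<eta>)) * ennreal (g \<eta>) \<partial>sph) \<partial>hyp)"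
  proof (rule nn_integral_cong_AE, use AE_hyp in eventually_elim)
    fix \<xi> :: 'a
    assume \<xi>: "norm \<xi> < 1"
    have "F (norm \<xi>) * ennreal (Tr s g \<xi>) = F (norm \<xi>) * (\<integral>\<^sup>+\<eta>. ennreal (ker s \<xi> \<eta> * g \<eta>) \<partial>sph)"
      using nn_Tr[OF \<xi> _ gi g0] by simp
    also have "\<dots> = (\<integral>\<^sup>+\<eta>. F (norm \<xi>) * ennreal (ker s \<xi> \<eta> * g \<eta>) \<partial>sph)"
      by (rule nn_integral_cmult[symmetric]) simp
    also have "\<dots> = (\<integral>\<^sup>+\<eta>. F' (norm \<xi>) * k (norm (\<xi> - \<eta>)) * ennreal (g \<eta>) \<partial>sph)"
      by (rule nn_integral_cong) (simp add: ker[OF \<xi>, symmetric] ennreal_mult' mult.assoc)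
    finally show "F (norm \<xi>) * ennreal (Tr s g \<xi>) = (\<integral>\<^sup>+\<eta>. F' (norm \<xi>) * k (norm (\<xi> - \<eta>)) * ennreal (g \<eta>) \<partial>sph)" .
  qed
  also have "\<dots> = (\<integral>\<^sup>+\<eta>. (\<integral>\<^sup>+\<xi>. F' (norm \<xi>) * k (norm (\<xi> - \<eta>)) * ennreal (g \<eta>) \<partial>hyp) \<partial>sph)"
    by (rule HS.Fubini'[symmetric]) measurable
  also have "\<dots> = (\<integral>\<^sup>+\<eta>. (\<integral>\<^sup>+\<xi>. F' (norm \<xi>) * k (norm (\<xi> - \<eta>)) \<partial>hyp) * ennreal (g \<eta>) \<partial>sph)"
    by (intro nn_integral_cong nn_integral_multc) simp
  finally have "ennreal S * (\<integral>\<^sup>+\<xi>. F (norm \<xi>) * ennreal (Tr s g \<xi>) \<partial>hyp)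
      = (\<integral>\<^sup>+\<eta>. ennreal S * ((\<integral>\<^sup>+\<xi>. F' (norm \<xi>) * k (norm (\<xi> - \<eta>)) \<partial>hyp) * ennreal (g \<eta>)) \<partial>sph)"
    by (subst nn_integral_cmult) (simp_all add: hyp.borel_measurable_nn_integral)
  also have "\<dots> = (\<integral>\<^sup>+\<eta>. (\<integral>\<^sup>+\<xi>. F (norm \<xi>) * ennreal (\<phi> \<xi>) \<partial>hyp) * ennreal (g \<eta>) \<partial>sph)"
  proof (rule nn_integral_cong_AE, use AE_sph in eventually_elim)
    fix \<eta> :: 'a
    assume "norm \<eta> = 1"
    from inner[OF this] show "ennreal S * ((\<integral>\<^sup>+\<xi>. F' (norm \<xi>) * k (norm (\<xi> - \<eta>)) \<partial>hyp) * ennreal (g \<eta>)) = (\<integral>\<^sup>+\<xi>. F (norm \<xi>) * ennreal (\<phi> \<xi>) \<partial>hyp) * ennreal (g \<eta>)"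
      by (simp only: mult.assoc[symmetric])
  qed
  also have "\<dots> = (\<integral>\<^sup>+\<xi>. F (norm \<xi>) * ennreal (\<phi> \<xi>) \<partial>hyp) * (\<integral>\<^sup>+\<eta>. ennreal (g \<eta>) \<partial>sph)"
    by (rule nn_integral_cmult) simp
  finally show ?thesis .
qed

text \<open>This is the first variation of \<open>H\<close> at the constant, with the radial weight
  given by the power q - 1 of \<phi>. It depends only on the mean of g, so the linear term
  disappears for perturbations of mean zero.\<close>

lemma
  assumes g: "Lp g" and g0: "\<And>\<eta>. 0 \<le> g \<eta>"
  shows \<phi>_test_integrable: "integrable hyp (\<lambda>\<xi>. \<phi> \<xi> powr (q - 1) * Tr s g \<xi>)"
    and \<phi>_test: "(\<integral>\<xi>. \<phi> \<xi> powr (q - 1) * Tr s g \<xi> \<partial>hyp) = H (\<lambda>_. 1) / S * (\<integral>\<eta>. g \<eta> \<partial>sph)"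
proof -
  note [measurable] = LpD(1)[OF g]
  have T0: "0 \<le> Tr s g \<xi>" for \<xi>
    by (rule Tr_nonneg) (rule g0)
  have 1: "(\<integral>\<^sup>+\<xi>. ennreal (\<phi> \<xi> powr (q - 1)) * ennreal (\<phi> \<xi>) \<partial>hyp) = ennreal (H (\<lambda>_. 1))"
  proof -
    have "(\<integral>\<^sup>+\<xi>. ennreal (\<phi> \<xi> powr (q - 1)) * ennreal (\<phi> \<xi>) \<partial>hyp) = (\<integral>\<^sup>+\<xi>. ennreal (\<phi> \<xi> powr q) \<partial>hyp)"
    proof (rule nn_integral_cong_AE, use AE_hyp in eventually_elim)
      fix \<xi> :: 'a
      assume "norm \<xi> < 1"
      then have "0 < \<phi> \<xi>"
        by (rule \<phi>_pos)
      then have "\<phi> \<xi> powr (q - 1) * \<phi> \<xi> = \<phi> \<xi> powr q"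
        using powr_add[of "\<phi> \<xi>" "q - 1" 1] by simp
      then show "ennreal (\<phi> \<xi> powr (q - 1)) * ennreal (\<phi> \<xi>) = ennreal (\<phi> \<xi> powr q)"
        by (simp add: ennreal_mult'[symmetric])
    qed
    also have "\<dots> = ennreal (H (\<lambda>_. 1))"
      unfolding \<phi>_H[symmetric] by (rule nn_integral_eq_integral[OF \<phi>_integrable]) simp
    finally show ?thesis .
  qed
  have "ennreal S * (\<integral>\<^sup>+\<xi>. ennreal (\<phi>r (norm \<xi>) powr (q - 1)) * ennreal (Tr s g \<xi>) \<partial>hyp)
     = (\<integral>\<^sup>+\<xi>. ennreal (\<phi>r (norm \<xi>) powr (q - 1)) * ennreal (\<phi> \<xi>) \<partial>hyp) * (\<integral>\<^sup>+\<eta>. ennreal (g \<eta>) \<partial>(sph :: 'a measure))"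
    by (rule radial_test[where F = "\<lambda>r. ennreal (\<phi>r r powr (q - 1))"]) (simp_all add: g0 Lp_integrable[OF g])
  also have "\<dots> = ennreal (H (\<lambda>_. 1)) * ennreal (\<integral>\<eta>. g \<eta> \<partial>sph)"
    unfolding \<phi>_\<phi>r[symmetric] 1 using Lp_integrable[OF g] g0 by (simp add: nn_integral_eq_integral)
  finally have 2: "ennreal S * (\<integral>\<^sup>+\<xi>. ennreal (\<phi> \<xi> powr (q - 1) * Tr s g \<xi>) \<partial>hyp) = ennreal (H (\<lambda>_. 1) * (\<integral>\<eta>. g \<eta> \<partial>sph))"
    using g0 by (simp add: \<phi>_\<phi>r[symmetric] ennreal_mult' H_nonneg)
  define Z where "Z = (\<integral>\<^sup>+\<xi>. ennreal (\<phi> \<xi> powr (q - 1) * Tr s g \<xi>) \<partial>hyp)"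
  have "Z = ennreal (1 / S) * (ennreal S * Z)"
    unfolding mult.assoc[symmetric] using S_pos by (simp add: ennreal_mult'[symmetric])
  also have "\<dots> = ennreal (H (\<lambda>_. 1) / S * (\<integral>\<eta>. g \<eta> \<partial>sph))"
    using 2 S_pos by (simp add: Z_def ennreal_mult'[symmetric])
  finally have Z: "Z = ennreal (H (\<lambda>_. 1) / S * (\<integral>\<eta>. g \<eta> \<partial>sph))" .
  show i: "integrable hyp (\<lambda>\<xi>. \<phi> \<xi> powr (q - 1) * Tr s g \<xi>)"
    using Z T0 by (intro integrableI_nonneg) (simp_all add: Z_def)
  have "ennreal (\<integral>\<xi>. \<phi> \<xi> powr (q - 1) * Tr s g \<xi> \<partial>hyp) = Z"
    unfolding Z_def by (rule nn_integral_eq_integral[symmetric, OF i]) (simp add: T0)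
  then show "(\<integral>\<xi>. \<phi> \<xi> powr (q - 1) * Tr s g \<xi> \<partial>hyp) = H (\<lambda>_. 1) / S * (\<integral>\<eta>. g \<eta> \<partial>sph)"
    unfolding Z using T0 g0 S_pos H_nonneg by (subst (asm) ennreal_inj) auto
qed

lemma Lp_add_const:
  assumes u: "Lp u"
  shows "Lp (\<lambda>\<eta>. c + u \<eta>)"
proof -
  note [measurable] = LpD(1)[OF u]
  have "integrable sph (\<lambda>\<eta>. \<bar>c + u \<eta>\<bar> powr p)"
  proof (rule Bochner_Integration.integrable_bound[of _ "\<lambda>\<eta>. (2 * \<bar>c\<bar>) powr p + 2 powr p * \<bar>u \<eta>\<bar> powr p"])
    show "AE \<eta> in sph. norm (\<bar>c + u \<eta>\<bar> powr p) \<le> norm ((2 * \<bar>c\<bar>) powr p + 2 powr p * \<bar>u \<eta>\<bar> powr p)"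
    proof (rule AE_I2)
      fix \<eta>
      have "\<bar>c + u \<eta>\<bar> powr p \<le> (max (2 * \<bar>c\<bar>) (2 * \<bar>u \<eta>\<bar>)) powr p"
        using p1 by (intro powr_mono2) auto
      also have "\<dots> \<le> (2 * \<bar>c\<bar>) powr p + (2 * \<bar>u \<eta>\<bar>) powr p"
        by (simp add: max_def)
      also have "(2 * \<bar>u \<eta>\<bar>) powr p = 2 powr p * \<bar>u \<eta>\<bar> powr p"
        by (rule powr_mult)
      finally show "norm (\<bar>c + u \<eta>\<bar> powr p) \<le> norm ((2 * \<bar>c\<bar>) powr p + 2 powr p * \<bar>u \<eta>\<bar> powr p)"
        by simp
    qed
  qed (use LpD(2)[OF u] in simp_all)
  then show ?thesis
    unfolding Lp_def by simp
qed

lemma Tr_1_add: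
  assumes "norm \<xi> < 1" "Lp w"
  shows "Tr s (\<lambda>\<eta>. 1 + w \<eta>) \<xi> = \<phi> \<xi> + Tr s w \<xi>"
  unfolding \<phi>_def using assms Lp_integrable[OF assms(2)] by (subst Tr_add) simp_all

lemma mixed_power_le:
  fixes a x r :: real
  assumes "0 \<le> a" "0 \<le> x" "0 \<le> r" "r \<le> q"
  shows "a powr (q - r) * x powr r \<le> a powr q + x powr q"
proof -
  have "a powr (q - r) * x powr r \<le> max a x powr (q - r) * max a x powr r"
    using assms by (intro mult_mono powr_mono2) auto
  also have "\<dots> = max a x powr q"
    unfolding powr_add[symmetric] by simp
  also have "\<dots> \<le> a powr q + x powr q"
    by (simp add: max_def)
  finally show ?thesis .
qed

lemma integrable_mixed:
  assumes w: "Lp w" and r: "0 \<le> r" "r \<le> q"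
  shows "integrable hyp (\<lambda>\<xi>. \<phi> \<xi> powr (q - r) * \<bar>Tr s w \<xi>\<bar> powr r)"
proof (rule Bochner_Integration.integrable_bound[of _ "\<lambda>\<xi>. \<phi> \<xi> powr q + \<bar>Tr s w \<xi>\<bar> powr q"])
  show "integrable hyp (\<lambda>\<xi>. \<phi> \<xi> powr q + \<bar>Tr s w \<xi>\<bar> powr q)"
    using \<phi>_integrable H_integrable[OF w] by simp
  show "AE \<xi> in hyp. norm (\<phi> \<xi> powr (q - r) * \<bar>Tr s w \<xi>\<bar> powr r) \<le> norm (\<phi> \<xi> powr q + \<bar>Tr s w \<xi>\<bar> powr q)"
    using AE_hyp
  proof eventually_elim
    fix \<xi> :: 'a
    assume "norm \<xi> < 1"
    then show "norm (\<phi> \<xi> powr (q - r) * \<bar>Tr s w \<xi>\<bar> powr r) \<le> norm (\<phi> \<xi> powr q + \<bar>Tr s w \<xi>\<bar> powr q)"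
      using mixed_power_le[of "\<phi> \<xi>" "\<bar>Tr s w \<xi>\<bar>" r] \<phi>_pos[of \<xi>] r by simp
  qed
qed (use LpD(1)[OF w] in simp)

lemma
  assumes w: "Lp w"
  shows \<phi>_test_signed_integrable: "integrable hyp (\<lambda>\<xi>. \<phi> \<xi> powr (q - 1) * Tr s w \<xi>)"
    and \<phi>_test_signed: "(\<integral>\<xi>. \<phi> \<xi> powr (q - 1) * Tr s w \<xi> \<partial>hyp) = H (\<lambda>_. 1) / S * (\<integral>\<eta>. w \<eta> \<partial>sph)"
proof -
  note wm [measurable] = LpD(1)[OF w]
  note wi = Lp_integrable[OF w]
  define a b where "a \<eta> = max (w \<eta>) 0" and "b \<eta> = max (- w \<eta>) 0" for \<eta>
  have abm: "a \<in> borel_measurable borel" "b \<in> borel_measurable borel"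
    unfolding a_def b_def by measurable
  have ab0: "\<And>\<eta>. 0 \<le> a \<eta>" "\<And>\<eta>. 0 \<le> b \<eta>"
    by (simp_all add: a_def b_def)
  have Lp_le: "Lp f" if "f \<in> borel_measurable borel" "\<And>\<eta>. \<bar>f \<eta>\<bar> \<le> \<bar>w \<eta>\<bar>" for f
  proof -
    have "integrable sph (\<lambda>\<eta>. \<bar>f \<eta>\<bar> powr p)"
      by (rule Bochner_Integration.integrable_bound[OF LpD(2)[OF w]]) (use that p1 in \<open>auto intro!: AE_I2 powr_mono2\<close>)
    then show ?thesis
      unfolding Lp_def using that by simp
  qed
  have ab: "Lp a" "Lp b"
    using abm by (auto intro!: Lp_le simp: a_def b_def)
  have w_eq: "w = (\<lambda>\<eta>. a \<eta> - b \<eta>)"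
    by (auto simp: a_def b_def fun_eq_iff)
  have TrAE: "AE \<xi> in hyp. \<phi> \<xi> powr (q - 1) * Tr s a \<xi> - \<phi> \<xi> powr (q - 1) * Tr s b \<xi> = \<phi> \<xi> powr (q - 1) * Tr s w \<xi>"
    using AE_hyp
  proof eventually_elim
    fix \<xi> :: 'a
    assume "norm \<xi> < 1"
    then have "Tr s w \<xi> = Tr s a \<xi> - Tr s b \<xi>"
      unfolding w_eq using ab Lp_integrable by (intro Tr_diff) auto
    then show "\<phi> \<xi> powr (q - 1) * Tr s a \<xi> - \<phi> \<xi> powr (q - 1) * Tr s b \<xi> = \<phi> \<xi> powr (q - 1) * Tr s w \<xi>"
      by (simp add: right_diff_distrib)
  qed
  note [measurable] = abm
  note ia = \<phi>_test_integrable[OF ab(1) ab0(1)] and ib = \<phi>_test_integrable[OF ab(2) ab0(2)]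
  show "integrable hyp (\<lambda>\<xi>. \<phi> \<xi> powr (q - 1) * Tr s w \<xi>)"
    by (rule integrable_cong_AE_imp[OF Bochner_Integration.integrable_diff[OF ia ib] _ TrAE]) simp
  have "(\<integral>\<xi>. \<phi> \<xi> powr (q - 1) * Tr s w \<xi> \<partial>hyp) = (\<integral>\<xi>. \<phi> \<xi> powr (q - 1) * Tr s a \<xi> - \<phi> \<xi> powr (q - 1) * Tr s b \<xi> \<partial>hyp)"
    by (rule integral_cong_AE[OF _ _ AE_symmetric[OF TrAE]]) simp_all
  also have "\<dots> = H (\<lambda>_. 1) / S * (\<integral>\<eta>. a \<eta> \<partial>sph) - H (\<lambda>_. 1) / S * (\<integral>\<eta>. b \<eta> \<partial>sph)"
    using ia ib \<phi>_test[OF ab(1) ab0(1)] \<phi>_test[OF ab(2) ab0(2)] by simp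
  also have "\<dots> = H (\<lambda>_. 1) / S * (\<integral>\<eta>. a \<eta> - b \<eta> \<partial>sph)"
    using Lp_integrable ab by (simp add: right_diff_distrib)
  finally show "(\<integral>\<xi>. \<phi> \<xi> powr (q - 1) * Tr s w \<xi> \<partial>hyp) = H (\<lambda>_. 1) / S * (\<integral>\<eta>. w \<eta> \<partial>sph)"
    by (simp add: w_eq[symmetric])
qed

lemma H_cmult: "H (\<lambda>\<eta>. c * u \<eta>) = \<bar>c\<bar> powr q * H u"
  by (simp add: H_def Tr_cmult abs_mult powr_mult)

lemma H_1_le: "H (\<lambda>_. 1 :: real) \<le> \<Gamma> * S powr (q / p)"
  using sharp[OF Lp_const[of 1]] by (simp add: E_1)

lemma integrable_Lp_1: "Lp w \<Longrightarrow> integrable sph (\<lambda>\<eta>. \<bar>1 + w \<eta>\<bar> powr p)"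
  using LpD(2)[OF Lp_add_const] .

lemma E_shift_lower:
  assumes C: "\<And>x. \<bar>\<bar>1 + x\<bar> powr p - 1 - \<bar>x\<bar> powr p\<bar> \<le> \<theta> * \<bar>x\<bar> powr p + C * \<bar>x\<bar>" and w: "Lp w"
  shows "S + (1 - \<theta>) * E w - C * (\<integral>\<eta>. \<bar>w \<eta>\<bar> \<partial>sph) \<le> E (\<lambda>\<eta>. 1 + w \<eta>)"
proof -
  have i: "integrable sph (\<lambda>\<eta>. 1 + (1 - \<theta>) * \<bar>w \<eta>\<bar> powr p - C * \<bar>w \<eta>\<bar>)"
    using LpD(2)[OF w] Lp_integrable[OF w] by simp
  have "S + (1 - \<theta>) * E w - C * (\<integral>\<eta>. \<bar>w \<eta>\<bar> \<partial>sph) = (\<integral>\<eta>. 1 + (1 - \<theta>) * \<bar>w \<eta>\<bar> powr p - C * \<bar>w \<eta>\<bar> \<partial>sph)"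
    using LpD(2)[OF w] Lp_integrable[OF w] by (simp add: E_def measure_sph_S)
  also have "\<dots> \<le> E (\<lambda>\<eta>. 1 + w \<eta>)"
    unfolding E_def
  proof (rule integral_mono[OF i integrable_Lp_1[OF w]])
    fix \<eta>
    have "- (\<theta> * \<bar>w \<eta>\<bar> powr p + C * \<bar>w \<eta>\<bar>) \<le> \<bar>1 + w \<eta>\<bar> powr p - 1 - \<bar>w \<eta>\<bar> powr p"
      using C[of "w \<eta>"] unfolding abs_le_iff by linarith
    then show "1 + (1 - \<theta>) * \<bar>w \<eta>\<bar> powr p - C * \<bar>w \<eta>\<bar> \<le> \<bar>1 + w \<eta>\<bar> powr p"
      unfolding left_diff_distrib by linarith
  qed
  finally show ?thesis .
qed

lemma powr_scale_expand:
  assumes "0 < a"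
  shows "\<bar>a + x\<bar> powr q = a powr q * \<bar>1 + x / a\<bar> powr q" "a powr q * \<bar>x / a\<bar> powr r = a powr (q - r) * \<bar>x\<bar> powr r"
proof -
  have "a + x = a * (1 + x / a)"
    using assms by (simp add: distrib_left)
  then have "\<bar>a + x\<bar> = a * \<bar>1 + x / a\<bar>"
    using assms by (simp only: abs_mult abs_of_pos)
  then show "\<bar>a + x\<bar> powr q = a powr q * \<bar>1 + x / a\<bar> powr q"
    by (simp add: powr_mult)
  show "a powr q * \<bar>x / a\<bar> powr r = a powr (q - r) * \<bar>x\<bar> powr r"
    using assms by (simp add: abs_divide powr_divide powr_diff)
qed

text \<open>The splitting inequality is applied to T w / \<phi> pointwise. The mixed term is at most
  the integral of \<phi> powr (q - 1) times T |w|, which by \<open>\<phi>_test\<close> costs only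
  the L^1 norm of w.\<close>

lemma H_shift_upper:
  assumes C0: "0 \<le> C" and C: "\<And>x. \<bar>\<bar>1 + x\<bar> powr q - 1 - \<bar>x\<bar> powr q\<bar> \<le> \<theta> * \<bar>x\<bar> powr q + C * \<bar>x\<bar>" and w: "Lp w"
  shows "H (\<lambda>\<eta>. 1 + w \<eta>) \<le> H (\<lambda>_. 1) + (1 + \<theta>) * H w + C * (H (\<lambda>_. 1) / S * (\<integral>\<eta>. \<bar>w \<eta>\<bar> \<partial>sph))"
proof -
  have wa: "Lp (\<lambda>\<eta>. \<bar>w \<eta>\<bar>)"
    using Lp_abs[OF w] .
  note it = \<phi>_test_integrable[OF wa abs_ge_zero]
  have i: "integrable hyp (\<lambda>\<xi>. \<phi> \<xi> powr q + (1 + \<theta>) * \<bar>Tr s w \<xi>\<bar> powr q + C * (\<phi> \<xi> powr (q - 1) * Tr s (\<lambda>\<eta>. \<bar>w \<eta>\<bar>) \<xi>))"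
    using \<phi>_integrable H_integrable[OF w] it by simp
  have "H (\<lambda>\<eta>. 1 + w \<eta>) \<le> (\<integral>\<xi>. \<phi> \<xi> powr q + (1 + \<theta>) * \<bar>Tr s w \<xi>\<bar> powr q + C * (\<phi> \<xi> powr (q - 1) * Tr s (\<lambda>\<eta>. \<bar>w \<eta>\<bar>) \<xi>) \<partial>hyp)"
    unfolding H_def
  proof (rule integral_mono_AE[OF H_integrable[OF Lp_add_const[OF w]] i], use AE_hyp in eventually_elim)
    fix \<xi> :: 'a
    assume \<xi>: "norm \<xi> < 1"
    define a x where "a = \<phi> \<xi>" and "x = Tr s w \<xi>"
    have a: "0 < a"
      unfolding a_def by (rule \<phi>_pos[OF \<xi>])
    have "\<bar>a + x\<bar> powr q \<le> a powr q * (1 + (1 + \<theta>) * \<bar>x / a\<bar> powr q + C * \<bar>x / a\<bar> powr 1)"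
    proof -
      have "\<bar>1 + x / a\<bar> powr q - 1 - \<bar>x / a\<bar> powr q \<le> \<theta> * \<bar>x / a\<bar> powr q + C * \<bar>x / a\<bar>"
        using C[of "x / a"] unfolding abs_le_iff by linarith
      moreover have "C * \<bar>x / a\<bar> powr 1 = C * \<bar>x / a\<bar>"
        by (simp only: powr_one abs_ge_zero)
      ultimately have "\<bar>1 + x / a\<bar> powr q \<le> 1 + (1 + \<theta>) * \<bar>x / a\<bar> powr q + C * \<bar>x / a\<bar> powr 1"
        unfolding distrib_right by linarith
      then show ?thesis
        unfolding powr_scale_expand(1)[OF a] by (intro mult_left_mono) auto
    qed
    also have "\<dots> = a powr q + (1 + \<theta>) * (a powr q * \<bar>x / a\<bar> powr q) + C * (a powr q * \<bar>x / a\<bar> powr 1)"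
      by (simp add: distrib_left mult_ac)
    also have "\<dots> = a powr q + (1 + \<theta>) * \<bar>x\<bar> powr q + C * (a powr (q - 1) * \<bar>x\<bar>)"
      unfolding powr_scale_expand(2)[OF a] using a by simp
    also have "\<dots> \<le> a powr q + (1 + \<theta>) * \<bar>x\<bar> powr q + C * (a powr (q - 1) * Tr s (\<lambda>\<eta>. \<bar>w \<eta>\<bar>) \<xi>)"
      using C0 Tr_abs[OF \<xi> LpD(1)[OF w] Lp_integrable[OF w]] by (intro add_left_mono mult_left_mono) (auto simp: x_def)
    finally show "\<bar>Tr s (\<lambda>\<eta>. 1 + w \<eta>) \<xi>\<bar> powr q \<le> \<phi> \<xi> powr q + (1 + \<theta>) * \<bar>Tr s w \<xi>\<bar> powr q + C * (\<phi> \<xi> powr (q - 1) * Tr s (\<lambda>\<eta>. \<bar>w \<eta>\<bar>) \<xi>)"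
      by (simp add: Tr_1_add[OF \<xi> w] a_def x_def)
  qed
  also have "\<dots> = H (\<lambda>_. 1) + (1 + \<theta>) * H w + C * (H (\<lambda>_. 1) / S * (\<integral>\<eta>. \<bar>w \<eta>\<bar> \<partial>sph))"
    using \<phi>_integrable H_integrable[OF w] it \<phi>_test[OF wa abs_ge_zero] by (simp add: \<phi>_H H_def[of w])
  finally show ?thesis .
qed

text \<open>The size of |1 + x| powr p - 1 - p x for p on either side of 2: quadratic near 0, of
  power p beyond. The break at 1 / 2 is that of \<open>abs_powr_convex_lower\<close>.\<close>

definition mp :: "real \<Rightarrow> real" where
  "mp x = (if \<bar>x\<bar> \<le> 1 / 2 then x\<^sup>2 else \<bar>x\<bar> powr p)"

lemma mp_borel [measurable]: "mp \<in> borel_measurable borel"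
  unfolding mp_def[abs_def] by measurable

lemma mp_nonneg: "0 \<le> mp x"
  by (simp add: mp_def)

lemma integrable_mp:
  assumes w: "Lp w"
  shows "integrable sph (\<lambda>\<eta>. mp (w \<eta>))"
proof (rule Bochner_Integration.integrable_bound[of _ "\<lambda>\<eta>. 1 + \<bar>w \<eta>\<bar> powr p"])
  show "AE \<eta> in sph. norm (mp (w \<eta>)) \<le> norm (1 + \<bar>w \<eta>\<bar> powr p)"
  proof (rule AE_I2)
    fix \<eta>
    have "(w \<eta>)\<^sup>2 \<le> 1" if "\<bar>w \<eta>\<bar> \<le> 1 / 2"
      using that by (simp add: abs_square_le_1)
    then show "norm (mp (w \<eta>)) \<le> norm (1 + \<bar>w \<eta>\<bar> powr p)"
      by (auto simp: mp_def intro: add_increasing2)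
  qed
qed (use LpD[OF w] in simp_all)

text \<open>The second-order term of \<open>H\<close> at the constant, up to a numerical
  factor.\<close>

definition J :: "('a \<Rightarrow> real) \<Rightarrow> real" where
  "J w = (\<integral>\<xi>. \<phi> \<xi> powr (q - 2) * \<bar>Tr s w \<xi>\<bar> powr 2 \<partial>hyp)"

text \<open>The mean of w vanishes, so neither expansion has a linear term: E gains at least a
  multiple of the integral of \<open>mp\<close>, while H gains at most a multiple of J w + H w. The
  constant terms cancel by the sharp inequality for the function 1, and H w is bounded by the power
  q / p of E w.\<close>

lemma quadratic_estimate:
  assumes l0: "0 < l0"
  obtains C where "0 \<le> C" "\<And>w l \<tau>. Lp w \<Longrightarrow> (\<integral>\<eta>. w \<eta> \<partial>sph) = 0 \<Longrightarrow> l0 \<le> \<bar>l\<bar> \<Longrightarrow> 1 = \<bar>l\<bar> powr p * E (\<lambda>\<eta>. 1 + w \<eta>) \<Longrightarrow>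
    \<Gamma> - \<tau> \<le> \<bar>l\<bar> powr q * H (\<lambda>\<eta>. 1 + w \<eta>) \<Longrightarrow> 0 < \<tau> \<Longrightarrow> (\<integral>\<eta>. mp (w \<eta>) \<partial>sph) \<le> C * (\<tau> + J w + E w powr (q / p))"
proof -
  define k where "k = q / p"
  have k: "1 < k"
    using pq p1 by (simp add: k_def)
  obtain c where c: "0 < c" and cl: "\<And>x. \<bar>x\<bar> \<le> 1 / 2 \<Longrightarrow> 1 + p * x + c * x\<^sup>2 \<le> \<bar>1 + x\<bar> powr p"
    "\<And>x. 1 / 2 \<le> \<bar>x\<bar> \<Longrightarrow> 1 + p * x + c * \<bar>x\<bar> powr p \<le> \<bar>1 + x\<bar> powr p"
    using abs_powr_convex_lower[OF p1] by blast
  have clow: "1 + p * x + c * mp x \<le> \<bar>1 + x\<bar> powr p" for x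
    using cl[of x] by (auto simp: mp_def)
  obtain D where D: "0 \<le> D" and Du: "\<And>x. \<bar>1 + x\<bar> powr q \<le> 1 + q * x + D * (x\<^sup>2 + \<bar>x\<bar> powr q)"
    using abs_powr_quadratic_upper[OF q2] by blast
  define g where "g = \<Gamma> * k * S powr (k - 1) * c"
  have g: "0 < g"
    using \<Gamma> k S_pos c by (simp add: g_def)
  define C where "C = (l0 powr - q + D + D * \<Gamma>) / g"
  show thesis
  proof
    show "0 \<le> C"
      using D \<Gamma> g by (simp add: C_def)
    fix w :: "'a \<Rightarrow> real" and l \<tau> :: real
    assume w: "Lp w" and w0: "(\<integral>\<eta>. w \<eta> \<partial>sph) = 0" and l: "l0 \<le> \<bar>l\<bar>" and El: "1 = \<bar>l\<bar> powr p * E (\<lambda>\<eta>. 1 + w \<eta>)"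
      and Hl: "\<Gamma> - \<tau> \<le> \<bar>l\<bar> powr q * H (\<lambda>\<eta>. 1 + w \<eta>)" and \<tau>: "0 < \<tau>"
    define M where "M = (\<integral>\<eta>. mp (w \<eta>) \<partial>sph)"
    define e where "e = E (\<lambda>\<eta>. 1 + w \<eta>)"
    have M0: "0 \<le> M"
      by (simp add: M_def mp_nonneg)
    have lp: "0 < \<bar>l\<bar>"
      using l l0 by simp
    have eM: "S + c * M \<le> e"
    proof -
      have "S + c * M = (\<integral>\<eta>. 1 + p * w \<eta> + c * mp (w \<eta>) \<partial>sph)"
        using integrable_mp[OF w] Lp_integrable[OF w] w0 by (simp add: M_def measure_sph_S)
      also have "\<dots> \<le> e"
        unfolding e_def E_def using integrable_mp[OF w] Lp_integrable[OF w] integrable_Lp_1[OF w]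
        by (intro integral_mono clow) auto
      finally show ?thesis .
    qed
    have e0: "0 < e"
      using eM M0 c S_pos by (smt (verit) mult_nonneg_nonneg)
    have HD: "H (\<lambda>\<eta>. 1 + w \<eta>) \<le> H (\<lambda>_. 1) + D * (J w + H w)"
    proof -
      note i1 = \<phi>_test_signed_integrable[OF w]
      have i2: "integrable hyp (\<lambda>\<xi>. \<phi> \<xi> powr (q - 2) * \<bar>Tr s w \<xi>\<bar> powr 2)"
        using q2 by (intro integrable_mixed w) auto
      have i: "integrable hyp (\<lambda>\<xi>. \<phi> \<xi> powr q + q * (\<phi> \<xi> powr (q - 1) * Tr s w \<xi>) + D * (\<phi> \<xi> powr (q - 2) * \<bar>Tr s w \<xi>\<bar> powr 2 + \<bar>Tr s w \<xi>\<bar> powr q))"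
        using \<phi>_integrable H_integrable[OF w] i1 i2 by simp
      have "H (\<lambda>\<eta>. 1 + w \<eta>) \<le> (\<integral>\<xi>. \<phi> \<xi> powr q + q * (\<phi> \<xi> powr (q - 1) * Tr s w \<xi>) + D * (\<phi> \<xi> powr (q - 2) * \<bar>Tr s w \<xi>\<bar> powr 2 + \<bar>Tr s w \<xi>\<bar> powr q) \<partial>hyp)"
        unfolding H_def
      proof (rule integral_mono_AE[OF H_integrable[OF Lp_add_const[OF w]] i], use AE_hyp in eventually_elim)
        fix \<xi> :: 'a
        assume \<xi>: "norm \<xi> < 1"
        define a x where "a = \<phi> \<xi>" and "x = Tr s w \<xi>"
        have a: "0 < a"
          unfolding a_def by (rule \<phi>_pos[OF \<xi>])
        have sq: "(x / a)\<^sup>2 = \<bar>x / a\<bar> powr 2"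
          by (simp only: powr_numeral abs_ge_zero power2_abs)
        have "\<bar>a + x\<bar> powr q \<le> a powr q * (1 + q * (x / a) + D * (\<bar>x / a\<bar> powr 2 + \<bar>x / a\<bar> powr q))"
          unfolding powr_scale_expand(1)[OF a] sq[symmetric] by (intro mult_left_mono Du) auto
        also have "\<dots> = a powr q + q * (a powr q / a * x) + D * (a powr q * \<bar>x / a\<bar> powr 2 + a powr q * \<bar>x / a\<bar> powr q)"
          by (simp add: distrib_left mult_ac)
        also have "\<dots> = a powr q + q * (a powr (q - 1) * x) + D * (a powr (q - 2) * \<bar>x\<bar> powr 2 + \<bar>x\<bar> powr q)"
          unfolding powr_scale_expand(2)[OF a] using a by (simp add: powr_diff)
        finally show "\<bar>Tr s (\<lambda>\<eta>. 1 + w \<eta>) \<xi>\<bar> powr q \<le> \<phi> \<xi> powr q + q * (\<phi> \<xi> powr (q - 1) * Tr s w \<xi>) + D * (\<phi> \<xi> powr (q - 2) * \<bar>Tr s w \<xi>\<bar> powr 2 + \<bar>Tr s w \<xi>\<bar> powr q)"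
          by (simp add: Tr_1_add[OF \<xi> w] a_def x_def)
      qed
      also have "\<dots> = H (\<lambda>_. 1) + D * (J w + H w)"
        using \<phi>_integrable H_integrable[OF w] i1 i2 \<phi>_test_signed[OF w] by (simp add: \<phi>_H H_def[of w] J_def w0)
      finally show ?thesis .
    qed
    have ek: "e powr k = \<bar>l\<bar> powr - q"
    proof -
      have "e = \<bar>l\<bar> powr - p"
        using El lp by (simp add: e_def powr_minus field_simps)
      then show ?thesis
        using p1 by (simp add: powr_powr k_def)
    qed
    have "(\<Gamma> - \<tau>) * e powr k \<le> \<bar>l\<bar> powr q * H (\<lambda>\<eta>. 1 + w \<eta>) * \<bar>l\<bar> powr - q"
      unfolding ek using Hl by (intro mult_right_mono) auto
    also have "\<dots> = H (\<lambda>\<eta>. 1 + w \<eta>)"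
      using lp by (simp add: powr_minus)
    finally have 1: "\<Gamma> * e powr k \<le> H (\<lambda>\<eta>. 1 + w \<eta>) + \<tau> * e powr k"
      by (simp add: left_diff_distrib)
    \<comment> \<open>The tangent at S transfers the convexity gain in E to its power k = q / p, the
      scale on which H is compared.\<close>
    have "S powr k + k * S powr (k - 1) * (c * M) \<le> (S + c * M) powr k"
      using powr_ge_tangent[of k S "S + c * M"] k S_pos c M0 by simp
    also have "\<dots> \<le> e powr k"
      using eM S_pos c M0 k by (intro powr_mono2) auto
    finally have "\<Gamma> * (S powr k + k * S powr (k - 1) * (c * M)) \<le> \<Gamma> * e powr k"
      using \<Gamma> by (intro mult_left_mono) auto
    then have 2: "\<Gamma> * S powr k + g * M \<le> \<Gamma> * e powr k"
      by (simp add: g_def distrib_left mult_ac)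
    have 3: "\<tau> * e powr k \<le> \<tau> * l0 powr - q"
      unfolding ek using \<tau> l l0 q2 by (intro mult_left_mono powr_mono2') auto
    have 4: "D * (J w + H w) \<le> D * (J w + \<Gamma> * E w powr k)"
      using sharp[OF w] D by (intro mult_left_mono) (auto simp: k_def)
    have "g * M \<le> \<tau> * l0 powr - q + D * (J w + \<Gamma> * E w powr k)"
      using 1 2 3 4 HD H_1_le unfolding k_def[symmetric] by linarith
    also have "\<dots> \<le> (l0 powr - q + D + D * \<Gamma>) * (\<tau> + J w + E w powr k)"
    proof -
      have J0: "0 \<le> J w"
        by (simp add: J_def)
      have "0 \<le> l0 powr - q * J w" "0 \<le> l0 powr - q * E w powr k" "0 \<le> D * \<tau>" "0 \<le> D * E w powr k" "0 \<le> D * \<Gamma> * \<tau>" "0 \<le> D * \<Gamma> * J w"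
        using D \<Gamma> \<tau> J0 by simp_all
      then show ?thesis
        by (simp add: algebra_simps)
    qed
    finally have "g * M \<le> (l0 powr - q + D + D * \<Gamma>) * (\<tau> + J w + E w powr k)" .
    then have "M \<le> (l0 powr - q + D + D * \<Gamma>) * (\<tau> + J w + E w powr k) / g"
      using g by (simp add: field_simps)
    then show "(\<integral>\<eta>. mp (w \<eta>) \<partial>sph) \<le> C * (\<tau> + J w + E w powr (q / p))"
      by (simp add: C_def M_def k_def)
  qed
qed

text \<open>The signed counterpart of \<open>near_max\<close>: the maximum condition concerns T |u|,
  while the deficit is that of u itself.\<close>

definition near_opt :: "real \<Rightarrow> ('a \<Rightarrow> real) \<Rightarrow> bool" where
  "near_opt \<tau> u \<longleftrightarrow> Lp u \<and> E u = 1 \<and> \<Gamma> - \<tau> \<le> H u \<and> 0 < \<tau> \<and>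
     (\<forall>\<xi>. norm \<xi> < 1 \<longrightarrow> Tr s (\<lambda>\<eta>. \<bar>u \<eta>\<bar>) \<xi> \<le> Tr s (\<lambda>\<eta>. \<bar>u \<eta>\<bar>) 0 + \<tau>)"

text \<open>\<open>L1_close\<close> makes w small in L^1 only, and mass could still concentrate in
  L^p. With X and Y the shares of the constant and of w in E u = 1, the splitting of E and H has
  errors of the order of the L^1 norm, and \<open>two_bubbles\<close> makes Y of order sqrt
  \<tau>.\<close>

lemma remainder:
  obtains K t0 l0 where "0 \<le> K" "0 < t0" "0 < l0"
    "\<And>u \<tau>. near_opt \<tau> u \<Longrightarrow> \<tau> \<le> t0 \<Longrightarrow> \<exists>l w. l0 \<le> \<bar>l\<bar> \<and> w = (\<lambda>\<eta>. u \<eta> / l - 1) \<and> Lp w \<and> (\<integral>\<eta>. w \<eta> \<partial>sph) = 0 \<and>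
      (\<integral>\<eta>. \<bar>w \<eta>\<bar> \<partial>sph) \<le> K * sqrt \<tau> \<and> E w \<le> K * sqrt \<tau> \<and> 1 = \<bar>l\<bar> powr p * E (\<lambda>\<eta>. 1 + w \<eta>) \<and>
      \<Gamma> - \<tau> \<le> \<bar>l\<bar> powr q * H (\<lambda>\<eta>. 1 + w \<eta>)"
proof (rule L1_close)
  fix K1 t1 l0
  assume K1: "0 \<le> K1" and t1: "0 < t1" and l0: "0 < l0"
    and L1: "\<And>u \<tau>. Lp u \<Longrightarrow> E u = 1 \<Longrightarrow> \<Gamma> - \<tau> \<le> H u \<Longrightarrow> (\<And>\<xi>. norm \<xi> < 1 \<Longrightarrow> Tr s (\<lambda>\<eta>. \<bar>u \<eta>\<bar>) \<xi> \<le> Tr s (\<lambda>\<eta>. \<bar>u \<eta>\<bar>) 0 + \<tau>) \<Longrightarrow>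
      0 < \<tau> \<Longrightarrow> \<tau> \<le> t1 \<Longrightarrow> \<exists>l. l0 \<le> \<bar>l\<bar> \<and> (\<integral>\<eta>. u \<eta> \<partial>sph) = l * S \<and> (\<integral>\<eta>. \<bar>u \<eta> - l\<bar> \<partial>sph) \<le> K1 * sqrt \<tau>"
  define k where "k = q / p"
  \<comment> \<open>The lower bound for the share of the constant, capped at 1 / 2 to stay below
    1.\<close>
  define x0 where "x0 = min (l0 powr p * S) (1 / 2)"
  have k: "1 < k" and x0: "0 < x0" "x0 < 1"
    using pq p1 l0 S_pos by (auto simp: k_def x0_def)
  show thesis
  proof (rule two_bubbles[OF x0 k])
    fix \<theta> C d0
    assume \<theta>: "0 < \<theta>" and C: "0 \<le> C" and d0: "0 < d0"
      and tb: "\<And>X Y d. 0 \<le> d \<Longrightarrow> d \<le> d0 \<Longrightarrow> x0 \<le> X \<Longrightarrow> 0 \<le> Y \<Longrightarrow> X + (1 - \<theta>) * Y \<le> 1 + d \<Longrightarrow>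
      1 - d \<le> X powr k + (1 + \<theta>) * Y powr k \<Longrightarrow> Y \<le> C * d"
    have q1: "1 < q"
      using q2 by simp
    obtain C1 where C1: "0 \<le> C1" "\<And>x. \<bar>\<bar>1 + x\<bar> powr p - 1 - \<bar>x\<bar> powr p\<bar> \<le> \<theta> * \<bar>x\<bar> powr p + C1 * \<bar>x\<bar>"
      using abs_powr_shift[OF p1 \<theta>] by blast
    obtain C2 where C2: "0 \<le> C2" "\<And>x. \<bar>\<bar>1 + x\<bar> powr q - 1 - \<bar>x\<bar> powr q\<bar> \<le> \<theta> * \<bar>x\<bar> powr q + C2 * \<bar>x\<bar>"
      using abs_powr_shift[OF q1 \<theta>] by blast
    \<comment> \<open>An upper bound for |l|: the mean of |u| is at most (S + 1) / S when E u =
      1.\<close>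
    define l1 where "l1 = (S + 1) / S"
    define K2 where "K2 = K1 / l0"
    define h where "h = H (\<lambda>_. 1) / S"
    define D1 where "D1 = l1 powr p * C1 * K2"
    define D2 where "D2 = l1 powr q * C2 * h * K2"
    define D where "D = D1 + (1 + D2) / \<Gamma>"
    have nn: "0 \<le> K2" "0 \<le> h" "0 \<le> D1" "0 \<le> D2"
      using K1 l0 C1 C2 H_nonneg S_pos by (simp_all add: K2_def h_def D1_def D2_def)
    have D: "0 \<le> D"
      using nn \<Gamma> by (simp add: D_def)
    define K where "K = K2 + C * D / l0 powr p"
    \<comment> \<open>The last entry ensures D sqrt \<tau> \<le> d0, and \<tau> \<le> 1 allows
      \<tau> to be replaced by sqrt \<tau>.\<close>
    define t0 where "t0 = min t1 (min 1 ((d0 / (D + 1))\<^sup>2))"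
    show thesis
    proof (rule that[of K t0 l0])
      show "0 \<le> K" "0 < t0" "0 < l0"
        using nn C D l0 t1 d0 by (simp_all add: K_def t0_def)
      fix u :: "'a \<Rightarrow> real" and \<tau> :: real
      assume no: "near_opt \<tau> u" and \<tau>t: "\<tau> \<le> t0"
      have u: "Lp u" and Eu: "E u = 1" and Hu: "\<Gamma> - \<tau> \<le> H u" and \<tau>: "0 < \<tau>"
        using no by (simp_all add: near_opt_def)
      have "\<tau> \<le> t1"
        using \<tau>t by (simp add: t0_def)
      then have "\<exists>l. l0 \<le> \<bar>l\<bar> \<and> (\<integral>\<eta>. u \<eta> \<partial>sph) = l * S \<and> (\<integral>\<eta>. \<bar>u \<eta> - l\<bar> \<partial>sph) \<le> K1 * sqrt \<tau>"
        using no by (intro L1) (simp_all add: near_opt_def)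
      then obtain l where l: "l0 \<le> \<bar>l\<bar>" and lS: "(\<integral>\<eta>. u \<eta> \<partial>sph) = l * S" and lK: "(\<integral>\<eta>. \<bar>u \<eta> - l\<bar> \<partial>sph) \<le> K1 * sqrt \<tau>"
        by auto
      have ln: "0 < \<bar>l\<bar>" "l \<noteq> 0"
        using l l0 by auto
      have ll1: "\<bar>l\<bar> \<le> l1"
      proof -
        have "\<bar>l * S\<bar> \<le> S + 1"
          using integral_abs_bound[of sph u] mean_upper[OF u Eu] lS by simp
        then show ?thesis
          using S_pos by (simp add: l1_def abs_mult field_simps)
      qed
      define w where "w = (\<lambda>\<eta>. u \<eta> / l - 1)"
      have w: "Lp w"
        using Lp_add_const[OF Lp_cmult[OF u, of "1 / l"], of "-1"] by (simp add: w_def)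
      have w0: "(\<integral>\<eta>. w \<eta> \<partial>sph) = 0"
        using Lp_integrable[OF u] ln lS by (simp add: w_def measure_sph_S)
      define W1 where "W1 = (\<integral>\<eta>. \<bar>w \<eta>\<bar> \<partial>sph)"
      have W1: "0 \<le> W1" "W1 \<le> K2 * sqrt \<tau>"
      proof -
        show "0 \<le> W1"
          by (simp add: W1_def)
        have "\<bar>w \<eta>\<bar> = \<bar>u \<eta> - l\<bar> / \<bar>l\<bar>" for \<eta>
          using ln by (simp add: w_def diff_divide_distrib flip: abs_divide)
        then have "W1 = (\<integral>\<eta>. \<bar>u \<eta> - l\<bar> \<partial>sph) / \<bar>l\<bar>"
          by (simp add: W1_def)
        also have "\<dots> \<le> K1 * sqrt \<tau> / l0"
          using lK l l0 by (intro frac_le) (auto intro: order_trans[OF _ lK])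
        finally show "W1 \<le> K2 * sqrt \<tau>"
          by (simp add: K2_def)
      qed
      have ul: "u = (\<lambda>\<eta>. l * (1 + w \<eta>))"
        using ln by (simp add: w_def fun_eq_iff)
      have E1: "1 = \<bar>l\<bar> powr p * E (\<lambda>\<eta>. 1 + w \<eta>)"
        using Eu unfolding ul E_cmult by simp
      have H1: "\<Gamma> - \<tau> \<le> \<bar>l\<bar> powr q * H (\<lambda>\<eta>. 1 + w \<eta>)"
        using Hu unfolding ul H_cmult by simp
      define X where "X = \<bar>l\<bar> powr p * S"
      define Y where "Y = \<bar>l\<bar> powr p * E w"
      have lpp: "l0 powr p \<le> \<bar>l\<bar> powr p" "\<bar>l\<bar> powr p \<le> l1 powr p" "\<bar>l\<bar> powr q \<le> l1 powr q"
        using l l0 ll1 p1 q1 by (auto intro: powr_mono2)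
      have X: "x0 \<le> X"
        using mult_right_mono[OF lpp(1), of S] S_pos unfolding x0_def X_def by linarith
      have Y: "0 \<le> Y"
        by (simp add: Y_def E_nonneg)
      have st: "\<tau> \<le> sqrt \<tau>"
      proof -
        have "\<tau>\<^sup>2 \<le> \<tau>"
          using \<tau>t \<tau> by (simp add: t0_def power2_eq_square mult_left_le)
        then show ?thesis
          using real_le_rsqrt by blast
      qed
      define d where "d = D * sqrt \<tau>"
      have d: "0 \<le> d" "d \<le> d0"
      proof -
        show "0 \<le> d"
          using D \<tau> by (simp add: d_def)
        have "sqrt \<tau> \<le> d0 / (D + 1)"
          using \<tau>t d0 D by (intro real_le_lsqrt) (auto simp: t0_def)
        then have "D * sqrt \<tau> \<le> D * (d0 / (D + 1))"
          using D by (intro mult_left_mono)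
        also have "\<dots> \<le> d0"
          using D d0 by (simp add: field_simps)
        finally show "d \<le> d0"
          by (simp add: d_def)
      qed
      have e1: "X + (1 - \<theta>) * Y \<le> 1 + d"
      proof -
        have "\<bar>l\<bar> powr p * (S + (1 - \<theta>) * E w - C1 * W1) \<le> \<bar>l\<bar> powr p * E (\<lambda>\<eta>. 1 + w \<eta>)"
          unfolding W1_def by (intro mult_left_mono E_shift_lower[OF C1(2) w]) auto
        also note E1[symmetric]
        finally have "\<bar>l\<bar> powr p * (S + (1 - \<theta>) * E w - C1 * W1) \<le> 1" .
        then have "X + (1 - \<theta>) * Y \<le> 1 + \<bar>l\<bar> powr p * (C1 * W1)"
          by (simp add: X_def Y_def algebra_simps)
        also have "\<bar>l\<bar> powr p * (C1 * W1) \<le> l1 powr p * (C1 * (K2 * sqrt \<tau>))"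
          using lpp W1 C1 by (intro mult_mono) auto
        also have "\<dots> = D1 * sqrt \<tau>"
          by (simp add: D1_def)
        also have "\<dots> \<le> d"
          unfolding d_def D_def using nn \<Gamma> \<tau> by (intro mult_right_mono) auto
        finally show ?thesis by simp
      qed
      have pk: "(\<bar>l\<bar> powr p * x) powr k = \<bar>l\<bar> powr q * x powr k" for x
        using p1 by (simp add: powr_mult powr_powr k_def)
      have e2: "1 - d \<le> X powr k + (1 + \<theta>) * Y powr k"
      proof -
        have "\<Gamma> - \<tau> \<le> \<bar>l\<bar> powr q * (H (\<lambda>_. 1) + (1 + \<theta>) * H w + C2 * (h * W1))"
          using H1 mult_left_mono[OF H_shift_upper[OF C2 w], of "\<bar>l\<bar> powr q"] by (simp add: W1_def h_def)
        also have "\<dots> \<le> \<bar>l\<bar> powr q * (\<Gamma> * S powr k + (1 + \<theta>) * (\<Gamma> * E w powr k) + C2 * (h * W1))"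
          using H_1_le sharp[OF w] \<theta> by (intro mult_left_mono add_mono order_refl) (auto simp: k_def)
        also have "\<dots> = \<Gamma> * (X powr k + (1 + \<theta>) * Y powr k) + \<bar>l\<bar> powr q * (C2 * (h * W1))"
          unfolding X_def Y_def pk by (simp add: algebra_simps)
        also have "\<bar>l\<bar> powr q * (C2 * (h * W1)) \<le> l1 powr q * (C2 * (h * (K2 * sqrt \<tau>)))"
          using lpp W1 C2 nn by (intro mult_mono) auto
        also have "\<dots> = D2 * sqrt \<tau>"
          by (simp add: D2_def)
        finally have "\<Gamma> * (1 - (X powr k + (1 + \<theta>) * Y powr k)) \<le> \<tau> + D2 * sqrt \<tau>"
          by (simp add: right_diff_distrib)
        also have "\<dots> \<le> (1 + D2) * sqrt \<tau>"
          using st by (simp add: distrib_right)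
        finally have "1 - (X powr k + (1 + \<theta>) * Y powr k) \<le> (1 + D2) / \<Gamma> * sqrt \<tau>"
          using \<Gamma> by (simp add: field_simps)
        also have "\<dots> \<le> d"
          unfolding d_def D_def using nn \<tau> by (intro mult_right_mono) auto
        finally show ?thesis by simp
      qed
      have "l0 powr p * E w \<le> Y"
        unfolding Y_def using lpp E_nonneg by (intro mult_right_mono)
      also have "Y \<le> C * d"
        by (rule tb[OF d X Y e1 e2])
      finally have "E w \<le> C * D / l0 powr p * sqrt \<tau>"
        using l0 by (simp add: field_simps d_def)
      also have "\<dots> \<le> K * sqrt \<tau>"
        unfolding K_def using nn \<tau> by (intro mult_right_mono) auto
      finally have Ew: "E w \<le> K * sqrt \<tau>" .
      have "K2 * sqrt \<tau> \<le> K * sqrt \<tau>"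
        unfolding K_def using C D \<tau> by (intro mult_right_mono) auto
      with W1 have "(\<integral>\<eta>. \<bar>w \<eta>\<bar> \<partial>sph) \<le> K * sqrt \<tau>"
        by (simp add: W1_def)
      then show "\<exists>l w. l0 \<le> \<bar>l\<bar> \<and> w = (\<lambda>\<eta>. u \<eta> / l - 1) \<and> Lp w \<and> (\<integral>\<eta>. w \<eta> \<partial>sph) = 0 \<and>
      (\<integral>\<eta>. \<bar>w \<eta>\<bar> \<partial>sph) \<le> K * sqrt \<tau> \<and> E w \<le> K * sqrt \<tau> \<and> 1 = \<bar>l\<bar> powr p * E (\<lambda>\<eta>. 1 + w \<eta>) \<and>
      \<Gamma> - \<tau> \<le> \<bar>l\<bar> powr q * H (\<lambda>\<eta>. 1 + w \<eta>)"
        using l w w0 Ew E1 H1 by (intro exI[of _ l] exI[of _ w] conjI) (simp_all add: w_def)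
    qed
  qed
qed

section \<open>The quadratic term near the sphere\<close>

definition tail :: "real \<Rightarrow> real" where
  "tail R = (\<integral>\<xi>. indicator {R..} (norm \<xi>) * \<phi> \<xi> powr q \<partial>hyp)"

lemma integrable_tail: "integrable hyp (\<lambda>\<xi>. indicator {R..} (norm \<xi>) * \<phi> \<xi> powr q)"
  by (rule Bochner_Integration.integrable_bound[OF \<phi>_integrable]) (auto simp: indicator_def)

lemma tail_nonneg: "0 \<le> tail R"
  by (simp add: tail_def)

lemma tail_small:
  assumes "0 < \<epsilon>"
  obtains R where "0 \<le> R" "R < 1" "tail R < \<epsilon>"
proof -
  define R where "R i = 1 - inverse (real (Suc i))" for i
  have R: "0 \<le> R i" "R i < 1" for i
    by (simp_all add: R_def inverse_le_1_iff)
  have Rl: "R \<longlonglongrightarrow> 1"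
    unfolding R_def[abs_def] using tendsto_diff[OF tendsto_const LIMSEQ_inverse_real_of_nat, of 1] by simp
  have "(\<lambda>i. tail (R i)) \<longlonglongrightarrow> (\<integral>\<xi>. 0 \<partial>(hyp :: 'a measure))"
    unfolding tail_def
  proof (rule integral_dominated_convergence[OF _ _ \<phi>_integrable])
    show "AE \<xi> in hyp. (\<lambda>i. indicator {R i..} (norm \<xi>) * \<phi> \<xi> powr q) \<longlonglongrightarrow> 0"
      using AE_hyp
    proof eventually_elim
      fix \<xi> :: 'a
      assume "norm \<xi> < 1"
      then have "\<forall>\<^sub>F i in sequentially. norm \<xi> < R i"
        by (rule order_tendstoD(1)[OF Rl])
      then have "\<forall>\<^sub>F i in sequentially. indicator {R i..} (norm \<xi>) * \<phi> \<xi> powr q = 0"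
        by eventually_elim simp
      then show "(\<lambda>i. indicator {R i..} (norm \<xi>) * \<phi> \<xi> powr q) \<longlonglongrightarrow> 0"
        by (rule tendsto_eventually)
    qed
  qed (auto simp: indicator_def)
  then have "\<forall>\<^sub>F i in sequentially. tail (R i) < \<epsilon>"
    using assms by (intro order_tendstoD(2)) auto
  then obtain i where "tail (R i) < \<epsilon>"
    by (auto simp: eventually_sequentially)
  then show thesis
    using R that by blast
qed

definition J_tail :: "real \<Rightarrow> ('a \<Rightarrow> real) \<Rightarrow> real" where
  "J_tail R w = (\<integral>\<xi>. indicator {R..} (norm \<xi>) * (\<phi> \<xi> powr (q - 2) * \<bar>Tr s w \<xi>\<bar> powr 2) \<partial>hyp)"

lemma integrable_J: "Lp w \<Longrightarrow> integrable hyp (\<lambda>\<xi>. \<phi> \<xi> powr (q - 2) * \<bar>Tr s w \<xi>\<bar> powr 2)"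
  using q2 by (intro integrable_mixed) auto

lemma integrable_J_tail:
  assumes w: "Lp w"
  shows "integrable hyp (\<lambda>\<xi>. indicator {R..} (norm \<xi>) * (\<phi> \<xi> powr (q - 2) * \<bar>Tr s w \<xi>\<bar> powr 2))"
  using LpD(1)[OF w]
  by (intro Bochner_Integration.integrable_bound[OF integrable_J[OF w]]) (auto simp: indicator_def)

lemma ennreal_J_tail:
  assumes "Lp w"
  shows "ennreal (J_tail R w) = (\<integral>\<^sup>+\<xi>. ennreal (indicator {R..} (norm \<xi>) * (\<phi> \<xi> powr (q - 2) * \<bar>Tr s w \<xi>\<bar> powr 2)) \<partial>hyp)"
  unfolding J_tail_def by (rule nn_integral_eq_integral[symmetric, OF integrable_J_tail[OF assms]]) simp

lemma ennreal_tail: "ennreal (tail R) = (\<integral>\<^sup>+\<xi>. ennreal (indicator {R..} (norm \<xi>) * \<phi> \<xi> powr q) \<partial>hyp)"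
  unfolding tail_def by (rule nn_integral_eq_integral[symmetric, OF integrable_tail]) simp

text \<open>For |\<xi>| < R the kernel is bounded above and \<phi> is bounded below, so |T w| is at
  most a constant times the L^1 norm of w times \<phi>. What remains of J lives near the
  sphere.\<close>

lemma J_split:
  assumes R: "0 \<le> R" "R < 1"
  obtains A where "0 \<le> A" "\<And>w. Lp w \<Longrightarrow> J w \<le> A * (\<integral>\<eta>. \<bar>w \<eta>\<bar> \<partial>sph)\<^sup>2 + J_tail R w"
proof -
  define k1 where "k1 = ((1 - R\<^sup>2) / 8) powr s * S"
  define k2 where "k2 = (1 / (2 * (1 - R)\<^sup>2)) powr s"
  define c where "c = k2 / k1"
  have "R\<^sup>2 < 1"
    using R by (simp add: abs_square_less_1)
  then have k1: "0 < k1" and c: "0 \<le> c"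
    using S_pos by (simp_all add: k1_def k2_def c_def)
  show thesis
  proof
    show "0 \<le> c\<^sup>2 * H (\<lambda>_. 1)"
      using H_nonneg by simp
    fix w :: "'a \<Rightarrow> real"
    assume w: "Lp w"
    define W where "W = (\<integral>\<eta>. \<bar>w \<eta>\<bar> \<partial>sph)"
    have W: "0 \<le> W"
      by (simp add: W_def)
    have i: "integrable hyp (\<lambda>\<xi>. (c * W)\<^sup>2 * \<phi> \<xi> powr q + indicator {R..} (norm \<xi>) * (\<phi> \<xi> powr (q - 2) * \<bar>Tr s w \<xi>\<bar> powr 2))"
      using \<phi>_integrable integrable_J_tail[OF w] by simp
    have "J w \<le> (\<integral>\<xi>. (c * W)\<^sup>2 * \<phi> \<xi> powr q + indicator {R..} (norm \<xi>) * (\<phi> \<xi> powr (q - 2) * \<bar>Tr s w \<xi>\<bar> powr 2) \<partial>hyp)"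
      unfolding J_def
    proof (rule integral_mono_AE[OF integrable_J[OF w] i], use AE_hyp in eventually_elim)
      fix \<xi> :: 'a
      assume \<xi>: "norm \<xi> < 1"
      show "\<phi> \<xi> powr (q - 2) * \<bar>Tr s w \<xi>\<bar> powr 2 \<le> (c * W)\<^sup>2 * \<phi> \<xi> powr q + indicator {R..} (norm \<xi>) * (\<phi> \<xi> powr (q - 2) * \<bar>Tr s w \<xi>\<bar> powr 2)"
      proof (cases "R \<le> norm \<xi>")
        case False
        then have R': "norm \<xi> \<le> R" by simp
        note \<phi> = \<phi>_pos[OF \<xi>]
        have "k1 \<le> \<phi> \<xi>"
          using Tr_ge[OF R' R(2), of "\<lambda>_. 1"] by (simp add: k1_def \<phi>_def measure_sph_S)
        then have "c * W * k1 \<le> c * W * \<phi> \<xi>"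
          using c W by (intro mult_left_mono) auto
        then have "k2 * W \<le> c * W * \<phi> \<xi>"
          using k1 by (simp add: c_def)
        then have "\<bar>Tr s w \<xi>\<bar> \<le> c * W * \<phi> \<xi>"
          using Tr_le[OF R' R(2) LpD(1)[OF w] Lp_integrable[OF w]] by (simp add: k2_def W_def)
        then have "\<bar>Tr s w \<xi>\<bar> powr 2 \<le> (c * W * \<phi> \<xi>) powr 2"
          by (intro powr_mono2) auto
        then have "\<phi> \<xi> powr (q - 2) * \<bar>Tr s w \<xi>\<bar> powr 2 \<le> \<phi> \<xi> powr (q - 2) * (c * W * \<phi> \<xi>) powr 2"
          by (intro mult_left_mono) auto
        also have "\<dots> = (c * W)\<^sup>2 * (\<phi> \<xi> powr (q - 2) * \<phi> \<xi> powr 2)"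
          using c W \<phi> by (simp add: powr_mult power_mult_distrib)
        also have "\<dots> = (c * W)\<^sup>2 * \<phi> \<xi> powr q"
          unfolding powr_add[symmetric] by simp
        finally show ?thesis
          by (simp add: indicator_def)
      qed simp
    qed
    also have "\<dots> = (c * W)\<^sup>2 * H (\<lambda>_. 1) + J_tail R w"
      using \<phi>_integrable integrable_J_tail[OF w] by (simp add: J_tail_def \<phi>_H)
    finally show "J w \<le> c\<^sup>2 * H (\<lambda>_. 1) * (\<integral>\<eta>. \<bar>w \<eta>\<bar> \<partial>sph)\<^sup>2 + J_tail R w"
      by (simp add: W_def power_mult_distrib mult_ac)
  qed
qed

text \<open>Hoelder's inequality with exponents q / (q - 2) and q / 2, followed by the sharp
  inequality for w. This version serves p < 2, where w need not be square integrable.\<close>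

lemma J_tail_Lp:
  assumes w: "Lp w"
  shows "J_tail R w \<le> tail R powr ((q - 2) / q) * (\<Gamma> powr (2 / q) * E w powr (2 / p))"
proof -
  note [measurable] = LpD(1)[OF w]
  have e: "(\<integral>\<^sup>+\<xi>. ennreal (indicator {R..} (norm \<xi>) * \<phi> \<xi> powr (q - 2) * \<bar>Tr s w \<xi>\<bar> powr 2) \<partial>hyp)
    \<le> ennreal (tail R powr (1 / (q / (q - 2))) * H w powr (1 / (q / 2)))"
  proof (rule nn_integral_Holder)
    show "1 / (q / (q - 2)) + 1 / (q / 2) = 1"
      using q2 by (simp add: field_simps)
    have "(indicator {R..} (norm \<xi>) * \<phi> \<xi> powr (q - 2)) powr (q / (q - 2)) = indicator {R..} (norm \<xi>) * \<phi> \<xi> powr q" for \<xi>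
      using q2 by (simp add: indicator_def powr_powr)
    then show "(\<integral>\<^sup>+\<xi>. ennreal ((indicator {R..} (norm \<xi>) * \<phi> \<xi> powr (q - 2)) powr (q / (q - 2))) \<partial>hyp) \<le> ennreal (tail R)"
      by (simp add: ennreal_tail)
    have "(\<bar>Tr s w \<xi>\<bar> powr 2) powr (q / 2) = \<bar>Tr s w \<xi>\<bar> powr q" for \<xi>
      unfolding powr_powr by simp
    then show "(\<integral>\<^sup>+\<xi>. ennreal ((\<bar>Tr s w \<xi>\<bar> powr 2) powr (q / 2)) \<partial>hyp) \<le> ennreal (H w)"
      unfolding H_def using nn_integral_eq_integral[OF H_integrable[OF w]] by simp
  qed (use q2 tail_nonneg H_nonneg in \<open>auto simp: less_divide_eq\<close>)
  have "J_tail R w \<le> tail R powr (1 / (q / (q - 2))) * H w powr (1 / (q / 2))"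
  proof -
    have "ennreal (J_tail R w) \<le> ennreal (tail R powr (1 / (q / (q - 2))) * H w powr (1 / (q / 2)))"
      unfolding ennreal_J_tail[OF w] using e by (simp only: mult.assoc)
    then show ?thesis
      by (simp add: ennreal_le_iff)
  qed
  also have "\<dots> = tail R powr ((q - 2) / q) * H w powr (2 / q)"
    by simp
  also have "\<dots> \<le> tail R powr ((q - 2) / q) * (\<Gamma> powr (2 / q) * E w powr (2 / p))"
  proof -
    have "H w powr (2 / q) \<le> (\<Gamma> * E w powr (q / p)) powr (2 / q)"
      using sharp[OF w] q2 H_nonneg by (intro powr_mono2) auto
    also have "\<dots> = \<Gamma> powr (2 / q) * E w powr (2 / p)"
      using q2 \<Gamma> by (simp add: powr_mult powr_powr)
    finally show ?thesis
      by (intro mult_left_mono) auto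
  qed
  finally show ?thesis .
qed

text \<open>Cauchy-Schwarz for the measure with density \<open>ker s \<xi>\<close>, whose mass is
  \<phi> \<xi>: the variance about the mean t = T w / \<phi> is nonnegative.\<close>

lemma Tr_square:
  assumes \<xi>: "norm \<xi> < 1" and w: "Lp w" and w2: "integrable sph (\<lambda>\<eta>. (w \<eta>)\<^sup>2)"
  shows "(Tr s w \<xi>)\<^sup>2 \<le> \<phi> \<xi> * Tr s (\<lambda>\<eta>. (w \<eta>)\<^sup>2) \<xi>"
proof -
  note [measurable] = LpD(1)[OF w]
  define t where "t = Tr s w \<xi> / \<phi> \<xi>"
  note iw = integrable_ker[OF \<xi> LpD(1)[OF w] Lp_integrable[OF w]]
  have i2: "integrable sph (\<lambda>\<eta>. ker s \<xi> \<eta> * (w \<eta>)\<^sup>2)"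
    using w2 by (intro integrable_ker[OF \<xi>]) auto
  have i1: "integrable sph (\<lambda>\<eta>. ker s \<xi> \<eta> * 1)"
    by (intro integrable_ker[OF \<xi>]) auto
  have "0 \<le> (\<integral>\<eta>. ker s \<xi> \<eta> * (w \<eta> - t)\<^sup>2 \<partial>sph)"
    by (intro integral_nonneg_AE AE_I2 mult_nonneg_nonneg) (auto simp: ker_def)
  also have "\<dots> = (\<integral>\<eta>. ker s \<xi> \<eta> * (w \<eta>)\<^sup>2 - 2 * t * (ker s \<xi> \<eta> * w \<eta>) + t\<^sup>2 * (ker s \<xi> \<eta> * 1) \<partial>sph)"
    by (intro Bochner_Integration.integral_cong) (auto simp: power2_diff algebra_simps)
  also have "\<dots> = Tr s (\<lambda>\<eta>. (w \<eta>)\<^sup>2) \<xi> - 2 * t * Tr s w \<xi> + t\<^sup>2 * \<phi> \<xi>"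
    unfolding Tr_def \<phi>_def using i1 i2 iw by simp
  also have "\<dots> = Tr s (\<lambda>\<eta>. (w \<eta>)\<^sup>2) \<xi> - (Tr s w \<xi>)\<^sup>2 / \<phi> \<xi>"
    using \<phi>_pos[OF \<xi>] by (simp add: t_def power2_eq_square field_simps)
  finally show ?thesis
    using \<phi>_pos[OF \<xi>] by (simp add: field_simps)
qed

text \<open>By \<open>Tr_square\<close> one factor \<phi> is gained and T (w^2) appears linearly;
  tested with a radial weight it depends only on the integral of w^2. This version serves p \<ge>
  2.\<close>

lemma J_tail_L2:
  assumes w: "Lp w" and w2: "integrable sph (\<lambda>\<eta>. (w \<eta>)\<^sup>2)"
  shows "J_tail R w \<le> tail R / S * (\<integral>\<eta>. (w \<eta>)\<^sup>2 \<partial>sph)"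
proof -
  note [measurable] = LpD(1)[OF w]
  define F where "F r = ennreal (indicator {R..} r * \<phi>r r powr (q - 1))" for r
  have [measurable]: "F \<in> borel_measurable borel"
    unfolding F_def by measurable
  have "ennreal (J_tail R w) \<le> (\<integral>\<^sup>+\<xi>. F (norm \<xi>) * ennreal (Tr s (\<lambda>\<eta>. (w \<eta>)\<^sup>2) \<xi>) \<partial>hyp)"
    unfolding ennreal_J_tail[OF w]
  proof (rule nn_integral_mono_AE, use AE_hyp in eventually_elim)
    fix \<xi> :: 'a
    assume \<xi>: "norm \<xi> < 1"
    have "\<phi> \<xi> powr (q - 2) * \<bar>Tr s w \<xi>\<bar> powr 2 \<le> \<phi> \<xi> powr (q - 2) * (\<phi> \<xi> * Tr s (\<lambda>\<eta>. (w \<eta>)\<^sup>2) \<xi>)"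
      using Tr_square[OF \<xi> w w2] by (intro mult_left_mono) auto
    also have "\<dots> = \<phi> \<xi> powr (q - 1) * Tr s (\<lambda>\<eta>. (w \<eta>)\<^sup>2) \<xi>"
    proof -
      have "\<phi> \<xi> powr (q - 2) * \<phi> \<xi> = \<phi> \<xi> powr (q - 1)"
        using \<phi>_pos[OF \<xi>] powr_add[of "\<phi> \<xi>" "q - 2" 1] by simp
      then show ?thesis
        by (simp flip: mult.assoc)
    qed
    finally show "ennreal (indicator {R..} (norm \<xi>) * (\<phi> \<xi> powr (q - 2) * \<bar>Tr s w \<xi>\<bar> powr 2))
      \<le> F (norm \<xi>) * ennreal (Tr s (\<lambda>\<eta>. (w \<eta>)\<^sup>2) \<xi>)"
      by (simp add: F_def \<phi>_\<phi>r[symmetric] indicator_def ennreal_leI flip: ennreal_mult')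
  qed
  then have "ennreal S * ennreal (J_tail R w) \<le> ennreal S * (\<integral>\<^sup>+\<xi>. F (norm \<xi>) * ennreal (Tr s (\<lambda>\<eta>. (w \<eta>)\<^sup>2) \<xi>) \<partial>hyp)"
    by (rule mult_left_mono) simp
  also have "\<dots> = (\<integral>\<^sup>+\<xi>. F (norm \<xi>) * ennreal (\<phi> \<xi>) \<partial>hyp) * (\<integral>\<^sup>+\<eta>. ennreal ((w \<eta>)\<^sup>2) \<partial>(sph :: 'a measure))"
    using w2 by (intro radial_test) auto
  also have "(\<integral>\<^sup>+\<xi>. F (norm \<xi>) * ennreal (\<phi> \<xi>) \<partial>hyp) = ennreal (tail R)"
    unfolding ennreal_tail
  proof (rule nn_integral_cong_AE, use AE_hyp in eventually_elim)
    fix \<xi> :: 'a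
    assume \<xi>: "norm \<xi> < 1"
    have "\<phi> \<xi> powr (q - 1) * \<phi> \<xi> = \<phi> \<xi> powr q"
      using \<phi>_pos[OF \<xi>] powr_add[of "\<phi> \<xi>" "q - 1" 1] by simp
    then show "F (norm \<xi>) * ennreal (\<phi> \<xi>) = ennreal (indicator {R..} (norm \<xi>) * \<phi> \<xi> powr q)"
      by (simp add: F_def \<phi>_\<phi>r[symmetric] indicator_def flip: ennreal_mult')
  qed
  also have "(\<integral>\<^sup>+\<eta>. ennreal ((w \<eta>)\<^sup>2) \<partial>(sph :: 'a measure)) = ennreal (\<integral>\<eta>. (w \<eta>)\<^sup>2 \<partial>sph)"
    by (rule nn_integral_eq_integral[OF w2]) simp
  finally have "ennreal (S * J_tail R w) \<le> ennreal (tail R * (\<integral>\<eta>. (w \<eta>)\<^sup>2 \<partial>sph))"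
    using S_pos tail_nonneg by (simp add: ennreal_mult')
  then have "S * J_tail R w \<le> tail R * (\<integral>\<eta>. (w \<eta>)\<^sup>2 \<partial>sph)"
    using tail_nonneg by (simp add: ennreal_le_iff)
  then show ?thesis
    using S_pos by (simp add: field_simps)
qed

section \<open>Absorption of the error terms, for p on either side of 2\<close>

lemma absorb:
  fixes V C B \<tau> \<epsilon> \<omega> :: real
  assumes "V \<le> C * (\<tau> + B * \<tau> + \<epsilon> * V + \<omega> * V)" "0 \<le> V" "C * \<epsilon> \<le> 1 / 4" "C * \<omega> \<le> 1 / 4"
  shows "V \<le> 2 * C * (1 + B) * \<tau>"
proof -
  have "C * \<epsilon> * V \<le> 1 / 4 * V" "C * \<omega> * V \<le> 1 / 4 * V"
    using assms by (intro mult_right_mono; simp)+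
  with assms(1) show ?thesis
    by (simp add: algebra_simps)
qed

text \<open>Chooses \<tau> so small that a quantity of order sqrt \<tau> contributes at most a
  quarter even after multiplication by C, as \<open>absorb\<close> demands.\<close>

lemma smallness:
  fixes K C \<kappa> :: real
  assumes K: "0 \<le> K" and C: "0 \<le> C" and \<kappa>: "0 < \<kappa>"
  obtains t where "0 < t" "\<And>\<tau> W. 0 \<le> W \<Longrightarrow> W \<le> K * sqrt \<tau> \<Longrightarrow> 0 < \<tau> \<Longrightarrow> \<tau> \<le> t \<Longrightarrow> W \<le> 1 \<and> C * W powr \<kappa> \<le> 1 / 4"
proof -
  define b where "b = 1 / (4 * (C + 1))"
  define r where "r = b powr (1 / \<kappa>)"
  have b: "0 < b" "b \<le> 1" "C * b \<le> 1 / 4"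
    using C by (auto simp: b_def field_simps)
  have r: "0 < r" "r \<le> 1" "r powr \<kappa> = b"
    using b \<kappa> by (auto simp: r_def powr_le1 powr_powr)
  show thesis
  proof
    show "0 < (r / (K + 1))\<^sup>2"
      using r K by simp
    fix \<tau> W :: real
    assume W: "0 \<le> W" "W \<le> K * sqrt \<tau>" and \<tau>: "0 < \<tau>" "\<tau> \<le> (r / (K + 1))\<^sup>2"
    have "sqrt \<tau> \<le> r / (K + 1)"
      using \<tau> r K by (intro real_le_lsqrt) auto
    then have "K * sqrt \<tau> \<le> K * (r / (K + 1))"
      using K by (intro mult_left_mono)
    also have "\<dots> \<le> r"
      using K r by (simp add: field_simps)
    finally have Wr: "W \<le> r"
      using W by simp
    then have "W powr \<kappa> \<le> b"
      using powr_mono2[of \<kappa> W r] W \<kappa> r by simp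
    then have "C * W powr \<kappa> \<le> C * b"
      using C by (rule mult_left_mono)
    then show "W \<le> 1 \<and> C * W powr \<kappa> \<le> 1 / 4"
      using b r Wr by linarith
  qed
qed

lemma mean_square_bound:
  assumes "(\<integral>\<eta>. \<bar>w \<eta>\<bar> \<partial>sph) \<le> K * sqrt \<tau>" "0 < \<tau>"
  shows "(\<integral>\<eta>. \<bar>w \<eta>\<bar> \<partial>(sph :: 'a measure))\<^sup>2 \<le> K\<^sup>2 * \<tau>"
proof -
  have "(\<integral>\<eta>. \<bar>w \<eta>\<bar> \<partial>(sph :: 'a measure))\<^sup>2 \<le> (K * sqrt \<tau>)\<^sup>2"
    using assms by (intro power_mono) auto
  also have "\<dots> = K\<^sup>2 * \<tau>"
    using assms by (simp add: power_mult_distrib)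
  finally show ?thesis .
qed

text \<open>For p \<ge> 2 the power p is the smaller one near 0 and the square is dominated beyond 1
  / 2; the factor 2 powr (p - 2) comes from the break point.\<close>

lemma mp_ge:
  assumes "2 \<le> p"
  shows "x\<^sup>2 + \<bar>x\<bar> powr p \<le> (2 + 2 powr (p - 2)) * mp x"
proof (cases "\<bar>x\<bar> \<le> 1 / 2")
  case True
  have "\<bar>x\<bar> powr p \<le> \<bar>x\<bar> powr 2"
    using True assms by (intro powr_mono') auto
  then have "\<bar>x\<bar> powr p \<le> x\<^sup>2"
    by simp
  moreover have "0 \<le> 2 powr (p - 2) * x\<^sup>2" and mp: "mp x = x\<^sup>2"
    using True by (simp_all add: mp_def)
  ultimately show ?thesis
    unfolding distrib_right mp by linarith
next
  case False
  have "x\<^sup>2 = \<bar>x\<bar> powr p * \<bar>x\<bar> powr (2 - p)"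
    unfolding powr_add[symmetric] by simp
  also have "\<dots> \<le> \<bar>x\<bar> powr p * (1 / 2) powr (2 - p)"
    using False assms by (intro mult_left_mono powr_mono2') auto
  also have "(1 / 2 :: real) powr (2 - p) = 2 powr (p - 2)"
    by (simp add: powr_divide powr_diff)
  finally have "x\<^sup>2 \<le> 2 powr (p - 2) * \<bar>x\<bar> powr p"
    by (simp add: mult.commute)
  moreover have mp: "mp x = \<bar>x\<bar> powr p"
    using False by (simp add: mp_def)
  ultimately show ?thesis
    unfolding distrib_right mp using powr_ge_zero[of "\<bar>x\<bar>" p] by linarith
qed

lemma square_integrable:
  assumes p2: "2 \<le> p" and w: "Lp w"
  shows "integrable sph (\<lambda>\<eta>. (w \<eta>)\<^sup>2)"
    and "E w + (\<integral>\<eta>. (w \<eta>)\<^sup>2 \<partial>sph) \<le> (2 + 2 powr (p - 2)) * (\<integral>\<eta>. mp (w \<eta>) \<partial>sph)"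
proof -
  note [measurable] = LpD(1)[OF w]
  have i: "integrable sph (\<lambda>\<eta>. (2 + 2 powr (p - 2)) * mp (w \<eta>))"
    using integrable_mp[OF w] by simp
  show i2: "integrable sph (\<lambda>\<eta>. (w \<eta>)\<^sup>2)"
  proof (rule Bochner_Integration.integrable_bound[OF i], measurable, intro AE_I2)
    fix \<eta>
    have "(w \<eta>)\<^sup>2 \<le> (2 + 2 powr (p - 2)) * mp (w \<eta>)"
      using mp_ge[OF p2, of "w \<eta>"] powr_ge_zero[of "\<bar>w \<eta>\<bar>" p] by linarith
    then show "norm ((w \<eta>)\<^sup>2) \<le> norm ((2 + 2 powr (p - 2)) * mp (w \<eta>))"
      by (simp add: abs_mult mp_nonneg)
  qed
  have "E w + (\<integral>\<eta>. (w \<eta>)\<^sup>2 \<partial>sph) = (\<integral>\<eta>. (w \<eta>)\<^sup>2 + \<bar>w \<eta>\<bar> powr p \<partial>sph)"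
    using i2 LpD(2)[OF w] by (simp add: E_def)
  also have "\<dots> \<le> (\<integral>\<eta>. (2 + 2 powr (p - 2)) * mp (w \<eta>) \<partial>sph)"
    using i i2 LpD(2)[OF w] mp_ge[OF p2] by (intro integral_mono) auto
  finally show "E w + (\<integral>\<eta>. (w \<eta>)\<^sup>2 \<partial>sph) \<le> (2 + 2 powr (p - 2)) * (\<integral>\<eta>. mp (w \<eta>) \<partial>sph)"
    by simp
qed

text \<open>With V = E w plus the integral of w^2, the quadratic estimate gives V \<le> C (\<tau> +
  J w + E w powr k). Away from the sphere J w is of order \<tau>; its tail is at most \<epsilon> V,
  and the last term is a small factor times V because k > 1. Both are absorbed.\<close>

theorem stability_ge_2:
  assumes p2: "2 \<le> p"
  obtains C t where "0 \<le> C" "0 < t" "\<And>u \<tau>. near_opt \<tau> u \<Longrightarrow> \<tau> \<le> t \<Longrightarrow>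
    \<exists>l w. l \<noteq> 0 \<and> w = (\<lambda>\<eta>. u \<eta> / l - 1) \<and> E w + (\<integral>\<eta>. (w \<eta>)\<^sup>2 \<partial>sph) \<le> C * \<tau>"
proof (rule remainder)
  fix K t0 l0
  assume K: "0 \<le> K" and t0: "0 < t0" and l0: "0 < l0" and
    rem: "\<And>u \<tau>. near_opt \<tau> u \<Longrightarrow> \<tau> \<le> t0 \<Longrightarrow> \<exists>l w. l0 \<le> \<bar>l\<bar> \<and> w = (\<lambda>\<eta>. u \<eta> / l - 1) \<and> Lp w \<and> (\<integral>\<eta>. w \<eta> \<partial>sph) = 0 \<and>
      (\<integral>\<eta>. \<bar>w \<eta>\<bar> \<partial>sph) \<le> K * sqrt \<tau> \<and> E w \<le> K * sqrt \<tau> \<and> 1 = \<bar>l\<bar> powr p * E (\<lambda>\<eta>. 1 + w \<eta>) \<and>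
      \<Gamma> - \<tau> \<le> \<bar>l\<bar> powr q * H (\<lambda>\<eta>. 1 + w \<eta>)"
  show thesis
  proof (rule quadratic_estimate[OF l0])
    fix C0
    assume C0: "0 \<le> C0" and quad: "\<And>w l \<tau>. Lp w \<Longrightarrow> (\<integral>\<eta>. w \<eta> \<partial>sph) = 0 \<Longrightarrow> l0 \<le> \<bar>l\<bar> \<Longrightarrow> 1 = \<bar>l\<bar> powr p * E (\<lambda>\<eta>. 1 + w \<eta>) \<Longrightarrow>
      \<Gamma> - \<tau> \<le> \<bar>l\<bar> powr q * H (\<lambda>\<eta>. 1 + w \<eta>) \<Longrightarrow> 0 < \<tau> \<Longrightarrow> (\<integral>\<eta>. mp (w \<eta>) \<partial>sph) \<le> C0 * (\<tau> + J w + E w powr (q / p))"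
    define k where "k = q / p"
    have k: "0 < k - 1"
      using pq p1 by (simp add: k_def)
    define C8 where "C8 = 2 + 2 powr (p - 2)"
    define C where "C = C8 * C0"
    have C8: "0 \<le> C8"
      by (simp add: C8_def add_nonneg_nonneg)
    then have C: "0 \<le> C"
      using C0 by (simp add: C_def)
    \<comment> \<open>Chosen so that C \<epsilon> \<le> 1 / 4, before the radius R and thus the
      constant A are fixed.\<close>
    define \<epsilon> where "\<epsilon> = 1 / (4 * (C + 1))"
    have \<epsilon>: "0 < \<epsilon>" "C * \<epsilon> \<le> 1 / 4"
      using C by (auto simp: \<epsilon>_def field_simps)
    obtain R where R: "0 \<le> R" "R < 1" "tail R < \<epsilon> * S"
      using tail_small[of "\<epsilon> * S"] \<epsilon> S_pos by auto
    obtain A where A: "0 \<le> A" "\<And>w. Lp w \<Longrightarrow> J w \<le> A * (\<integral>\<eta>. \<bar>w \<eta>\<bar> \<partial>sph)\<^sup>2 + J_tail R w"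
      using J_split[OF R(1,2)] by blast
    show thesis
    proof (rule smallness[OF K C k])
      fix t1
      assume t1: "0 < t1" and small: "\<And>\<tau> W. 0 \<le> W \<Longrightarrow> W \<le> K * sqrt \<tau> \<Longrightarrow> 0 < \<tau> \<Longrightarrow> \<tau> \<le> t1 \<Longrightarrow> W \<le> 1 \<and> C * W powr (k - 1) \<le> 1 / 4"
      show thesis
      proof (rule that[of "2 * C * (1 + A * K\<^sup>2)" "min t0 t1"])
        show "0 \<le> 2 * C * (1 + A * K\<^sup>2)" "0 < min t0 t1"
          using C A t0 t1 by simp_all
        fix u :: "'a \<Rightarrow> real" and \<tau>
        assume no: "near_opt \<tau> u" and "\<tau> \<le> min t0 t1"
        then have \<tau>: "\<tau> \<le> t0" "\<tau> \<le> t1" "0 < \<tau>"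
          by (auto simp: near_opt_def)
        from rem[OF no \<tau>(1)] obtain l w where l: "l0 \<le> \<bar>l\<bar>" and wd: "w = (\<lambda>\<eta>. u \<eta> / l - 1)" and w: "Lp w" and w0: "(\<integral>\<eta>. w \<eta> \<partial>sph) = 0"
          and W1: "(\<integral>\<eta>. \<bar>w \<eta>\<bar> \<partial>sph) \<le> K * sqrt \<tau>" and Ew: "E w \<le> K * sqrt \<tau>"
          and El: "1 = \<bar>l\<bar> powr p * E (\<lambda>\<eta>. 1 + w \<eta>)" and Hl: "\<Gamma> - \<tau> \<le> \<bar>l\<bar> powr q * H (\<lambda>\<eta>. 1 + w \<eta>)"
          by auto
        define V where "V = E w + (\<integral>\<eta>. (w \<eta>)\<^sup>2 \<partial>sph)"
        have EV: "E w \<le> V" "(\<integral>\<eta>. (w \<eta>)\<^sup>2 \<partial>sph) \<le> V" "0 \<le> V"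
          using E_nonneg[of w] by (simp_all add: V_def)
        note sq = square_integrable[OF p2 w]
        have J: "J w \<le> A * K\<^sup>2 * \<tau> + \<epsilon> * V"
        proof -
          have "A * (\<integral>\<eta>. \<bar>w \<eta>\<bar> \<partial>sph)\<^sup>2 \<le> A * (K\<^sup>2 * \<tau>)"
            using mean_square_bound[OF W1 \<tau>(3)] A by (intro mult_left_mono) auto
          moreover have "J_tail R w \<le> \<epsilon> * V"
          proof -
            have "J_tail R w \<le> tail R / S * (\<integral>\<eta>. (w \<eta>)\<^sup>2 \<partial>sph)"
              by (rule J_tail_L2[OF w sq(1)])
            also have "\<dots> \<le> \<epsilon> * V"
              using R S_pos EV \<epsilon> by (intro mult_mono) (auto simp: field_simps)
            finally show ?thesis .
          qed
          ultimately show ?thesis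
            using A(2)[OF w] by simp
        qed
        have Wk: "E w powr k \<le> E w powr (k - 1) * V"
        proof -
          have "E w powr k = E w powr (k - 1) * E w"
            using E_nonneg[of w] powr_add[of "E w" "k - 1" 1] by simp
          then show ?thesis
            using EV by (simp add: mult_left_mono)
        qed
        have "V \<le> C8 * (\<integral>\<eta>. mp (w \<eta>) \<partial>sph)"
          using sq(2) by (simp add: V_def C8_def)
        also have "\<dots> \<le> C8 * (C0 * (\<tau> + J w + E w powr k))"
          using quad[OF w w0 l El Hl \<tau>(3)] C8 by (intro mult_left_mono) (auto simp: k_def)
        also have "\<dots> = C * (\<tau> + J w + E w powr k)"
          by (simp add: C_def)
        also have "\<dots> \<le> C * (\<tau> + A * K\<^sup>2 * \<tau> + \<epsilon> * V + E w powr (k - 1) * V)"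
          using J Wk C by (intro mult_left_mono) auto
        finally have "V \<le> 2 * C * (1 + A * K\<^sup>2) * \<tau>"
          using small[OF E_nonneg Ew \<tau>(3,2)] EV \<epsilon> by (intro absorb[where \<epsilon>=\<epsilon> and \<omega>="E w powr (k - 1)"]) auto
        then show "\<exists>l w. l \<noteq> 0 \<and> w = (\<lambda>\<eta>. u \<eta> / l - 1) \<and> E w + (\<integral>\<eta>. (w \<eta>)\<^sup>2 \<partial>sph) \<le> 2 * C * (1 + A * K\<^sup>2) * \<tau>"
          using l l0 wd by (intro exI[of _ l] exI[of _ w]) (auto simp: V_def)
      qed
    qed
  qed
qed

text \<open>For p < 2 the coercive term is quadratic near 0 and controls E w only after
  interpolation. Its bound M yields E w of order M powr (p / 2), which explains the exponent 2 / p.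
  When M > 1, E w \<le> 1 suffices.\<close>

lemma E_le_mp:
  assumes p2: "p < 2" and w: "Lp w" and W1: "E w \<le> 1" and M: "(\<integral>\<eta>. mp (w \<eta>) \<partial>sph) \<le> M" "0 < M"
  shows "E w powr (2 / p) \<le> (S + 2) powr (2 / p) * M"
proof (cases "M \<le> 1")
  case True
  \<comment> \<open>Values below \<delta> contribute at most S times \<delta> powr p, larger ones
    \<delta> powr (p - 2) M and M; the choice sqrt M makes the first two of equal order.\<close>
  define \<delta> where "\<delta> = sqrt M"
  have \<delta>: "0 < \<delta>" "\<delta> powr p = M powr (p / 2)" "\<delta> powr (p - 2) * M = M powr (p / 2)"
  proof -
    show "0 < \<delta>" and a: "\<delta> powr p = M powr (p / 2)"
      using M by (simp_all add: \<delta>_def powr_half_sqrt[symmetric] powr_powr)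
    have "\<delta> powr (p - 2) * M = \<delta> powr (p - 2) * \<delta> powr 2"
      using M by (simp add: \<delta>_def)
    then show "\<delta> powr (p - 2) * M = M powr (p / 2)"
      unfolding powr_add[symmetric] a[symmetric] by simp
  qed
  have pt: "\<bar>x\<bar> powr p \<le> \<delta> powr p + (\<delta> powr (p - 2) + 1) * mp x" for x
  proof (cases "\<bar>x\<bar> \<le> \<delta>")
    case True
    then have "\<bar>x\<bar> powr p \<le> \<delta> powr p"
      using p1 by (intro powr_mono2) auto
    then show ?thesis
      using mp_nonneg[of x] by (smt (verit) mult_nonneg_nonneg powr_ge_zero)
  next
    case d: False
    show ?thesis
    proof (cases "\<bar>x\<bar> \<le> 1 / 2")
      case True
      have "\<bar>x\<bar> powr p = \<bar>x\<bar> powr (p - 2) * \<bar>x\<bar> powr 2"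
        unfolding powr_add[symmetric] by simp
      also have "\<dots> \<le> \<delta> powr (p - 2) * \<bar>x\<bar> powr 2"
        using d \<delta> p2 by (intro mult_right_mono powr_mono2') auto
      finally have "\<bar>x\<bar> powr p \<le> \<delta> powr (p - 2) * mp x"
        using True by (simp add: mp_def)
      then show ?thesis
        unfolding distrib_right using mp_nonneg[of x] powr_ge_zero[of \<delta> p] by linarith
    next
      case False
      then have "\<bar>x\<bar> powr p = mp x"
        by (simp add: mp_def)
      moreover have "0 \<le> \<delta> powr (p - 2) * mp x"
        by (simp add: mp_nonneg)
      ultimately show ?thesis
        unfolding distrib_right using powr_ge_zero[of \<delta> p] by linarith
    qed
  qed
  have "E w \<le> (\<integral>\<eta>. \<delta> powr p + (\<delta> powr (p - 2) + 1) * mp (w \<eta>) \<partial>sph)"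
    unfolding E_def using LpD(2)[OF w] integrable_mp[OF w] pt by (intro integral_mono) auto
  also have "\<dots> = \<delta> powr p * S + (\<delta> powr (p - 2) + 1) * (\<integral>\<eta>. mp (w \<eta>) \<partial>sph)"
    using integrable_mp[OF w] by (simp add: measure_sph_S)
  also have "\<dots> \<le> \<delta> powr p * S + (\<delta> powr (p - 2) + 1) * M"
    using M by (intro add_left_mono mult_left_mono) (auto intro: add_nonneg_nonneg)
  also have "\<dots> = M powr (p / 2) * (S + 1) + M"
    by (simp add: distrib_right distrib_left \<delta>)
  also have "\<dots> \<le> (S + 2) * M powr (p / 2)"
  proof -
    have "M powr 1 \<le> M powr (p / 2)"
      using M True p2 p1 by (intro powr_mono') auto
    then show ?thesis
      using M by (simp add: algebra_simps)
  qed
  finally have "E w powr (2 / p) \<le> ((S + 2) * M powr (p / 2)) powr (2 / p)"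
    using p1 E_nonneg by (intro powr_mono2) auto
  also have "\<dots> = (S + 2) powr (2 / p) * M"
    using p1 M by (simp add: powr_mult powr_powr)
  finally show ?thesis .
next
  case False
  have "E w powr (2 / p) \<le> 1"
    using W1 p1 E_nonneg by (intro powr_le1) auto
  also have "1 \<le> (S + 2) powr (2 / p) * M"
  proof -
    have "1 * 1 \<le> (S + 2) powr (2 / p) * M"
      using False S_pos p1 by (intro mult_mono ge_one_powr_ge_zero) auto
    then show ?thesis by simp
  qed
  finally show ?thesis .
qed

text \<open>The same absorption with V = E w powr (2 / p), the squared L^p norm. The power q / p of
  E w is V times the positive power (q - 2) / p of E w, hence a small multiple of V.\<close>

theorem stability_less_2:
  assumes p2: "p < 2"
  obtains C t where "0 \<le> C" "0 < t" "\<And>u \<tau>. near_opt \<tau> u \<Longrightarrow> \<tau> \<le> t \<Longrightarrow>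
    \<exists>l w. l \<noteq> 0 \<and> w = (\<lambda>\<eta>. u \<eta> / l - 1) \<and> E w powr (2 / p) \<le> C * \<tau>"
proof (rule remainder)
  fix K t0 l0
  assume K: "0 \<le> K" and t0: "0 < t0" and l0: "0 < l0" and
    rem: "\<And>u \<tau>. near_opt \<tau> u \<Longrightarrow> \<tau> \<le> t0 \<Longrightarrow> \<exists>l w. l0 \<le> \<bar>l\<bar> \<and> w = (\<lambda>\<eta>. u \<eta> / l - 1) \<and> Lp w \<and> (\<integral>\<eta>. w \<eta> \<partial>sph) = 0 \<and>
      (\<integral>\<eta>. \<bar>w \<eta>\<bar> \<partial>sph) \<le> K * sqrt \<tau> \<and> E w \<le> K * sqrt \<tau> \<and> 1 = \<bar>l\<bar> powr p * E (\<lambda>\<eta>. 1 + w \<eta>) \<and>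
      \<Gamma> - \<tau> \<le> \<bar>l\<bar> powr q * H (\<lambda>\<eta>. 1 + w \<eta>)"
  show thesis
  proof (rule quadratic_estimate[OF l0])
    fix C0
    assume C0: "0 \<le> C0" and quad: "\<And>w l \<tau>. Lp w \<Longrightarrow> (\<integral>\<eta>. w \<eta> \<partial>sph) = 0 \<Longrightarrow> l0 \<le> \<bar>l\<bar> \<Longrightarrow> 1 = \<bar>l\<bar> powr p * E (\<lambda>\<eta>. 1 + w \<eta>) \<Longrightarrow>
      \<Gamma> - \<tau> \<le> \<bar>l\<bar> powr q * H (\<lambda>\<eta>. 1 + w \<eta>) \<Longrightarrow> 0 < \<tau> \<Longrightarrow> (\<integral>\<eta>. mp (w \<eta>) \<partial>sph) \<le> C0 * (\<tau> + J w + E w powr (q / p))"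
    define \<kappa> where "\<kappa> = (q - 2) / p"
    have \<kappa>: "0 < \<kappa>"
      using q2 p1 by (simp add: \<kappa>_def)
    define C9 where "C9 = (S + 2) powr (2 / p)"
    define C where "C = C9 * (C0 + 1)"
    have C: "0 \<le> C"
      using C0 by (simp add: C_def C9_def)
    define \<epsilon> where "\<epsilon> = 1 / (4 * (C + 1))"
    \<comment> \<open>The tail mass for which the coefficient in \<open>J_tail_Lp\<close> equals
      \<epsilon>.\<close>
    define \<epsilon>1 where "\<epsilon>1 = (\<epsilon> / \<Gamma> powr (2 / q)) powr (q / (q - 2))"
    have \<epsilon>: "0 < \<epsilon>" "C * \<epsilon> \<le> 1 / 4"
      using C by (auto simp: \<epsilon>_def field_simps)
    have \<epsilon>1: "0 < \<epsilon>1" "\<epsilon>1 powr ((q - 2) / q) * \<Gamma> powr (2 / q) = \<epsilon>"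
      using \<epsilon> \<Gamma> q2 by (simp_all add: \<epsilon>1_def powr_powr)
    obtain R where R: "0 \<le> R" "R < 1" "tail R < \<epsilon>1"
      using tail_small[OF \<epsilon>1(1)] by auto
    obtain A where A: "0 \<le> A" "\<And>w. Lp w \<Longrightarrow> J w \<le> A * (\<integral>\<eta>. \<bar>w \<eta>\<bar> \<partial>sph)\<^sup>2 + J_tail R w"
      using J_split[OF R(1,2)] by blast
    show thesis
    proof (rule smallness[OF K C \<kappa>])
      fix t1
      assume t1: "0 < t1" and small: "\<And>\<tau> W. 0 \<le> W \<Longrightarrow> W \<le> K * sqrt \<tau> \<Longrightarrow> 0 < \<tau> \<Longrightarrow> \<tau> \<le> t1 \<Longrightarrow> W \<le> 1 \<and> C * W powr \<kappa> \<le> 1 / 4"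
      show thesis
      proof (rule that[of "2 * C * (1 + A * K\<^sup>2)" "min t0 t1"])
        show "0 \<le> 2 * C * (1 + A * K\<^sup>2)" "0 < min t0 t1"
          using C A t0 t1 by simp_all
        fix u :: "'a \<Rightarrow> real" and \<tau>
        assume no: "near_opt \<tau> u" and "\<tau> \<le> min t0 t1"
        then have \<tau>: "\<tau> \<le> t0" "\<tau> \<le> t1" "0 < \<tau>"
          by (auto simp: near_opt_def)
        from rem[OF no \<tau>(1)] obtain l w where l: "l0 \<le> \<bar>l\<bar>" and wd: "w = (\<lambda>\<eta>. u \<eta> / l - 1)" and w: "Lp w" and w0: "(\<integral>\<eta>. w \<eta> \<partial>sph) = 0"
          and W1: "(\<integral>\<eta>. \<bar>w \<eta>\<bar> \<partial>sph) \<le> K * sqrt \<tau>" and Ew: "E w \<le> K * sqrt \<tau>"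
          and El: "1 = \<bar>l\<bar> powr p * E (\<lambda>\<eta>. 1 + w \<eta>)" and Hl: "\<Gamma> - \<tau> \<le> \<bar>l\<bar> powr q * H (\<lambda>\<eta>. 1 + w \<eta>)"
          by auto
        define V where "V = E w powr (2 / p)"
        have V: "0 \<le> V"
          by (simp add: V_def)
        note sm = small[OF E_nonneg Ew \<tau>(3,2)]
        have J: "J w \<le> A * K\<^sup>2 * \<tau> + \<epsilon> * V"
        proof -
          have "A * (\<integral>\<eta>. \<bar>w \<eta>\<bar> \<partial>sph)\<^sup>2 \<le> A * (K\<^sup>2 * \<tau>)"
            using mean_square_bound[OF W1 \<tau>(3)] A by (intro mult_left_mono) auto
          moreover have "J_tail R w \<le> \<epsilon> * V"
          proof -
            have "J_tail R w \<le> tail R powr ((q - 2) / q) * (\<Gamma> powr (2 / q) * V)"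
              unfolding V_def by (rule J_tail_Lp[OF w])
            also have "\<dots> \<le> \<epsilon>1 powr ((q - 2) / q) * (\<Gamma> powr (2 / q) * V)"
              using R tail_nonneg q2 V by (intro mult_right_mono powr_mono2) auto
            also have "\<dots> = \<epsilon> * V"
              unfolding \<epsilon>1(2)[symmetric] by simp
            finally show ?thesis .
          qed
          ultimately show ?thesis
            using A(2)[OF w] by simp
        qed
        have Wk: "E w powr (q / p) = E w powr \<kappa> * V"
          unfolding V_def \<kappa>_def powr_add[symmetric] by (simp flip: add_divide_distrib)
        define B where "B = \<tau> + J w + E w powr (q / p)"
        have B: "\<tau> \<le> B"
          by (simp add: B_def J_def)
        have "V \<le> C9 * ((C0 + 1) * B)"
          unfolding V_def C9_def
        proof (rule E_le_mp[OF p2 w])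
          show "(\<integral>\<eta>. mp (w \<eta>) \<partial>sph) \<le> (C0 + 1) * B"
            using quad[OF w w0 l El Hl \<tau>(3)] B \<tau>(3) by (simp add: B_def[symmetric] distrib_right)
        qed (use sm B \<tau> C0 in auto)
        also have "\<dots> = C * B"
          by (simp add: C_def)
        also have "\<dots> \<le> C * (\<tau> + A * K\<^sup>2 * \<tau> + \<epsilon> * V + E w powr \<kappa> * V)"
          unfolding B_def Wk using J C by (intro mult_left_mono) auto
        finally have "V \<le> 2 * C * (1 + A * K\<^sup>2) * \<tau>"
          using sm V \<epsilon> by (intro absorb[where \<epsilon>=\<epsilon> and \<omega>="E w powr \<kappa>"]) auto
        then show "\<exists>l w. l \<noteq> 0 \<and> w = (\<lambda>\<eta>. u \<eta> / l - 1) \<and> E w powr (2 / p) \<le> 2 * C * (1 + A * K\<^sup>2) * \<tau>"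
          using l l0 wd by (intro exI[of _ l] exI[of _ w]) (auto simp: V_def)
      qed
    qed
  qed
qed

end

section \<open>Conformal normalization and the theorem\<close>

lemma
  fixes g g0 :: "'a::euclidean_space \<Rightarrow> real"
  assumes g0: "g0 \<in> borel_measurable borel" and eq: "\<And>\<eta>. norm \<eta> = 1 \<Longrightarrow> g \<eta> = g0 \<eta>"
  shows integral_sphere_cong: "(\<integral>\<eta>. g \<eta> \<partial>sphere_measure) = (\<integral>\<eta>. g0 \<eta> \<partial>sph)"
    and integrable_sphere_cong: "integrable sphere_measure g \<longleftrightarrow> integrable sph g0"
  unfolding integral_sph[OF g0] integrable_sph[OF g0]
  by (auto intro!: Bochner_Integration.integral_cong Bochner_Integration.integrable_cong simp: eq)

lemma Lp_norm_cong: "(\<And>x. x \<in> space M \<Longrightarrow> f x = g x) \<Longrightarrow> Lp_norm M r f = Lp_norm M r g"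
  unfolding Lp_norm_def by (intro arg_cong[where f="\<lambda>x. x powr _"] Bochner_Integration.integral_cong) auto

text \<open>The deficit d may be 0, whereas \<tau> must be positive: the estimate at d is reached by
  letting \<tau> decrease to d. If d \<ge> t, the trivial bound B is at most (B / t) d.\<close>

lemma le_linear_of_small:
  fixes G :: real
  assumes "\<And>\<tau>. 0 < \<tau> \<Longrightarrow> d \<le> \<tau> \<Longrightarrow> \<tau> \<le> t \<Longrightarrow> G \<le> C * \<tau>" and "G \<le> B" "0 \<le> d" "0 \<le> C" "0 \<le> B" "0 < t"
  shows "G \<le> (C + B / t) * d"
proof (cases "d < t")
  case True
  have "G \<le> C * d"
  proof (rule field_le_epsilon)
    fix e :: real
    assume e: "0 < e"
    define \<tau> where "\<tau> = min t (d + e / (C + 1))"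
    have "0 < e / (C + 1)"
      using e assms by simp
    then have "0 < \<tau>" "d \<le> \<tau>" "\<tau> \<le> t" "\<tau> \<le> d + e / (C + 1)"
      using True assms(3,6) unfolding \<tau>_def by linarith+
    then have "G \<le> C * \<tau>" "C * \<tau> \<le> C * (d + e / (C + 1))"
      using assms by (auto intro: mult_left_mono)
    moreover have "C * (e / (C + 1)) \<le> e"
      using e assms by (simp add: field_simps)
    ultimately show "G \<le> C * d + e"
      unfolding distrib_left by linarith
  qed
  moreover have "0 \<le> B / t * d"
    using assms by simp
  ultimately show ?thesis
    unfolding distrib_right by linarith
next
  case False
  have "B * 1 \<le> B * (d / t)"
    using assms False by (intro mult_left_mono) auto
  moreover have "0 \<le> C * d"
    using assms by simp
  ultimately show ?thesis
    unfolding distrib_right using assms(2) by (simp add: field_simps)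
qed

section \<open>Dictionary between the original operator and the invariant form\<close>

context stab
begin

lemma Lp_norm_sphere:
  assumes "u0 \<in> borel_measurable borel" "\<And>\<eta>. norm \<eta> = 1 \<Longrightarrow> u \<eta> = u0 \<eta>"
  shows "Lp_norm sphere_measure p u = E u0 powr (1 / p)" "Lp_norm sphere_measure p u powr p = E u0"
proof -
  show *: "Lp_norm sphere_measure p u = E u0 powr (1 / p)"
    unfolding Lp_norm_def E_def using assms by (subst integral_sphere_cong[of "\<lambda>\<eta>. \<bar>u0 \<eta>\<bar> powr p"]) auto
  show "Lp_norm sphere_measure p u powr p = E u0"
    unfolding * using p1 by (simp add: powr_powr E_nonneg)
qed

text \<open>Q u is T u times the power \<beta> - s of \<open>wt\<close>. Since (s - \<beta>) q = n,
  the weight left after taking the power q is exactly the hyperbolic density.\<close>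

lemma Lp_norm_ball:
  assumes [measurable]: "u0 \<in> borel_measurable borel" and eq: "\<And>\<eta>. norm \<eta> = 1 \<Longrightarrow> u \<eta> = u0 \<eta>"
    and \<alpha>: "real DIM('a) - \<alpha> = 2 * s" and \<beta>: "(s - \<beta>) * q = real DIM('a)"
  shows "Lp_norm ball_measure q (Qop \<alpha> \<beta> u) = H u0 powr (1 / q)"
proof -
  have Q: "\<bar>Qop \<alpha> \<beta> u \<xi>\<bar> powr q = wt \<xi> powr - real DIM('a) * \<bar>Tr s u0 \<xi>\<bar> powr q" if \<xi>: "norm \<xi> < 1" for \<xi>
  proof -
    have w: "0 < wt \<xi>"
      using wt_pos[OF \<xi>] .
    have "Tr s u0 \<xi> = (\<integral>\<eta>. ker s \<xi> \<eta> * u \<eta> \<partial>sphere_measure)"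
      unfolding Tr_def by (rule integral_sphere_cong[symmetric]) (use eq in auto)
    also have "\<dots> = (\<integral>\<eta>. wt \<xi> powr s * (norm (\<xi> - \<eta>) powr (\<alpha> - real DIM('a)) * u \<eta>) \<partial>sphere_measure)"
    proof (rule Bochner_Integration.integral_cong[OF refl])
      fix \<eta> :: 'a
      assume "\<eta> \<in> space sphere_measure"
      then have "0 < norm (\<xi> - \<eta>)"
        using \<xi> by auto
      then have d: "((norm (\<xi> - \<eta>))\<^sup>2) powr s = norm (\<xi> - \<eta>) powr (2 * s)"
        unfolding powr_powr[symmetric] by simp
      have \<alpha>': "\<alpha> - real DIM('a) = - (2 * s)"
        using \<alpha> by simp
      have "ker s \<xi> \<eta> = wt \<xi> powr s * norm (\<xi> - \<eta>) powr (\<alpha> - real DIM('a))"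
        unfolding ker_def \<alpha>' powr_minus using w by (subst powr_divide) (simp_all add: d divide_inverse)
      then show "ker s \<xi> \<eta> * u \<eta> = wt \<xi> powr s * (norm (\<xi> - \<eta>) powr (\<alpha> - real DIM('a)) * u \<eta>)"
        by simp
    qed
    also have "\<dots> = wt \<xi> powr s * (\<integral>\<eta>. norm (\<xi> - \<eta>) powr (\<alpha> - real DIM('a)) * u \<eta> \<partial>sphere_measure)"
      by (rule integral_mult_right_zero)
    finally have T: "Tr s u0 \<xi> = wt \<xi> powr s * (\<integral>\<eta>. norm (\<xi> - \<eta>) powr (\<alpha> - real DIM('a)) * u \<eta> \<partial>sphere_measure)" .
    have "wt \<xi> powr \<beta> = wt \<xi> powr (\<beta> - s) * wt \<xi> powr s"
      unfolding powr_add[symmetric] by simp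
    then have "Qop \<alpha> \<beta> u \<xi> = wt \<xi> powr (\<beta> - s) * Tr s u0 \<xi>"
      unfolding Qop_def wt_def[symmetric] T by (simp only: mult.assoc)
    then have "\<bar>Qop \<alpha> \<beta> u \<xi>\<bar> powr q = wt \<xi> powr ((\<beta> - s) * q) * \<bar>Tr s u0 \<xi>\<bar> powr q"
      by (simp add: abs_mult powr_mult powr_powr)
    moreover have "(\<beta> - s) * q = - real DIM('a)"
      using \<beta> by (simp add: algebra_simps)
    ultimately show ?thesis
      by simp
  qed
  have "(\<integral>\<xi>. \<bar>Qop \<alpha> \<beta> u \<xi>\<bar> powr q \<partial>ball_measure) = (\<integral>\<xi>. indicator (ball 0 1) \<xi> *\<^sub>R (\<bar>Qop \<alpha> \<beta> u \<xi>\<bar> powr q) \<partial>lborel)"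
    unfolding ball_measure_def by (rule integral_restrict_space) simp
  also have "\<dots> = (\<integral>\<xi>. (wt \<xi> powr - real DIM('a) * indicator (ball 0 1) \<xi>) *\<^sub>R (\<bar>Tr s u0 \<xi>\<bar> powr q) \<partial>lborel)"
    by (rule Bochner_Integration.integral_cong) (auto simp: Q indicator_def)
  also have "\<dots> = (\<integral>\<xi>. \<bar>Tr s u0 \<xi>\<bar> powr q \<partial>density lborel (\<lambda>\<xi>. ennreal (wt \<xi> powr - real DIM('a) * indicator (ball 0 1) \<xi>)))"
    by (rule integral_density[symmetric]) auto
  also have "density lborel (\<lambda>\<xi>::'a. ennreal (wt \<xi> powr - real DIM('a) * indicator (ball 0 1) \<xi>)) = hyp"
    unfolding hyp_def by (intro arg_cong[where f="density lborel"] ext) (simp add: indicator_def)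
  finally show ?thesis
    unfolding Lp_norm_def H_def by simp
qed

text \<open>Extension by zero off the sphere yields a function that is Borel on the whole
  space.\<close>

lemma in_Lp_sphere_representative:
  assumes u: "in_Lp sphere_measure p u"
  obtains u0 where "Lp u0" "\<And>\<eta>. norm \<eta> = 1 \<Longrightarrow> u \<eta> = u0 \<eta>"
proof
  let ?u = "\<lambda>\<eta>. indicator (sphere 0 1) \<eta> *\<^sub>R u \<eta>"
  show eq: "u \<eta> = ?u \<eta>" if "norm \<eta> = 1" for \<eta>
    using that by simp
  have "u \<in> borel_measurable (restrict_space borel (sphere 0 1))"
    using u measurable_cong_sets[OF sets_sphere_measure refl, of borel] by (auto simp: in_Lp_def)
  then have um [measurable]: "?u \<in> borel_measurable borel"
    by (subst (asm) borel_measurable_restrict_space_iff) auto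
  have "integrable sphere_measure (\<lambda>\<eta>. \<bar>u \<eta>\<bar> powr p) \<longleftrightarrow> integrable sph (\<lambda>\<eta>. \<bar>?u \<eta>\<bar> powr p)"
  proof (rule integrable_sphere_cong)
    show "(\<lambda>\<eta>. \<bar>?u \<eta>\<bar> powr p) \<in> borel_measurable borel"
      by measurable
  qed simp
  moreover have "integrable sphere_measure (\<lambda>\<eta>. \<bar>u \<eta>\<bar> powr p)"
    using u unfolding in_Lp_def by (rule conjunct2)
  ultimately show "Lp ?u"
    unfolding Lp_def using um by simp
qed

end

section \<open>Conformal normalization and the return to the original quotient\<close>

context stab_sharp
begin

text \<open>The exponent m - s serves both sides: its product with \<open>p\<close> is
  \<open>m\<close>, so the power p of the norm is preserved by the spherical Jacobian, and it is the
  exponent under which T commutes with the inversion, which preserves \<open>hyp\<close>.\<close>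

lemma inversion_normalized:
  fixes a :: 'a
  assumes a: "1 < norm a" and u: "Lp u"
  defines "v \<equiv> \<lambda>\<eta>. inv_fac a \<eta> powr (m - s) * u (inv_map a \<eta>)"
  shows "Lp v" "E v = E u" "H v = H u" "norm \<xi> < 1 \<Longrightarrow> Tr s (\<lambda>\<eta>. \<bar>v \<eta>\<bar>) \<xi> = Tr s (\<lambda>\<eta>. \<bar>u \<eta>\<bar>) (inv_map a \<xi>)"
    "norm \<eta> = 1 \<Longrightarrow> pullback p (inv_map a) u \<eta> = v \<eta>"
proof -
  note [measurable] = LpD(1)[OF u]
  have [measurable]: "v \<in> borel_measurable borel"
    unfolding v_def by measurable
  have pos: "0 < inv_fac a \<eta>" if "norm \<eta> = 1" for \<eta> :: 'a
    using inv_fac_pos[OF a] inversion_center_ne[OF a, of \<eta>] that by simp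
  have vp: "AE \<eta> in sph. \<bar>v \<eta>\<bar> powr p = inv_fac a \<eta> ^ (DIM('a) - 1) * \<bar>u (inv_map a \<eta>)\<bar> powr p"
  proof (use AE_sph in eventually_elim)
    fix \<eta> :: 'a
    assume \<eta>: "norm \<eta> = 1"
    have "(inv_fac a \<eta> powr (m - s)) powr p = inv_fac a \<eta> ^ (DIM('a) - 1)"
      using s pos[OF \<eta>] by (simp add: powr_powr p m powr_realpow[symmetric])
    then show "\<bar>v \<eta>\<bar> powr p = inv_fac a \<eta> ^ (DIM('a) - 1) * \<bar>u (inv_map a \<eta>)\<bar> powr p"
      by (simp add: v_def abs_mult powr_mult)
  qed
  have "integrable sph (\<lambda>\<eta>. inv_fac a \<eta> ^ (DIM('a) - 1) * \<bar>u (inv_map a \<eta>)\<bar> powr p)"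
    using integrable_inversion_sph[OF a, of "\<lambda>\<eta>. \<bar>u \<eta>\<bar> powr p"] LpD(2)[OF u] by simp
  then have "integrable sph (\<lambda>\<eta>. \<bar>v \<eta>\<bar> powr p)"
    by (subst integrable_cong_AE[OF _ _ vp]) measurable
  then show "Lp v"
    unfolding Lp_def by simp
  have "E v = (\<integral>\<eta>. inv_fac a \<eta> ^ (DIM('a) - 1) * \<bar>u (inv_map a \<eta>)\<bar> powr p \<partial>sph)"
    unfolding E_def by (rule integral_cong_AE[OF _ _ vp]) measurable
  then show "E v = E u"
    using integral_inversion_sph[OF a, of "\<lambda>\<eta>. \<bar>u \<eta>\<bar> powr p"] by (simp add: E_def)
  have Trv: "Tr s v \<xi> = Tr s u (inv_map a \<xi>)" if "norm \<xi> < 1" for \<xi>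
    unfolding v_def m by (rule Tr_inversion[OF a that]) measurable
  have "(\<integral>\<^sup>+\<xi>. ennreal (\<bar>Tr s v \<xi>\<bar> powr q) \<partial>hyp) = (\<integral>\<^sup>+\<xi>. ennreal (\<bar>Tr s u (inv_map a \<xi>)\<bar> powr q) \<partial>hyp)"
    by (rule nn_integral_cong_AE, use AE_hyp in eventually_elim) (simp add: Trv)
  also have "\<dots> = (\<integral>\<^sup>+\<xi>. ennreal (\<bar>Tr s u \<xi>\<bar> powr q) \<partial>hyp)"
    by (rule nn_integral_inversion_hyp[OF a]) measurable
  finally show "H v = H u"
    unfolding H_def by (simp add: integral_eq_nn_integral)
  have "(\<lambda>\<eta>. \<bar>v \<eta>\<bar>) = (\<lambda>\<eta>. inv_fac a \<eta> powr (real (DIM('a) - 1) - s) * \<bar>u (inv_map a \<eta>)\<bar>)"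
    by (simp add: v_def abs_mult m)
  then show "norm \<xi> < 1 \<Longrightarrow> Tr s (\<lambda>\<eta>. \<bar>v \<eta>\<bar>) \<xi> = Tr s (\<lambda>\<eta>. \<bar>u \<eta>\<bar>) (inv_map a \<xi>)"
    using Tr_inversion[OF a, of \<xi> "\<lambda>\<eta>. \<bar>u \<eta>\<bar>" s] by simp
  show "pullback p (inv_map a) u \<eta> = v \<eta>" if \<eta>: "norm \<eta> = 1"
    using pos[OF \<eta>] s by (simp add: pullback_def v_def sphere_jac_inv_map[OF a \<eta>] p m powr_realpow[symmetric] powr_powr)
qed

text \<open>T |u| is bounded, so some \<zeta> comes within \<tau> of its supremum, and the inversion
  centred at the mirror image of \<zeta> brings this value to the origin. The case \<zeta> = 0 uses
  the identity.\<close>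

lemma conformal_normalization:
  assumes u: "Lp u" "E u = 1" and \<tau>: "0 < \<tau>" "\<Gamma> - \<tau> \<le> H u"
  obtains \<Psi> v where "conformal_ball_auto \<Psi>" "near_opt \<tau> v" "\<And>\<eta>. norm \<eta> = 1 \<Longrightarrow> norm (\<Psi> \<eta>) = 1"
    "\<And>\<eta>. norm \<eta> = 1 \<Longrightarrow> pullback p \<Psi> u \<eta> = v \<eta>"
proof -
  define f where "f = Tr s (\<lambda>\<eta>. \<bar>u \<eta>\<bar>)"
  have bdd: "bdd_above (f ` ball 0 1)"
  proof (rule bdd_aboveI2)
    fix \<xi> :: 'a
    assume "\<xi> \<in> ball 0 1"
    then show "f \<xi> \<le> (S / 2 powr m) powr (s / m) * E (\<lambda>\<eta>. \<bar>u \<eta>\<bar>) powr (1 / p)"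
      unfolding f_def using Tr_sup_bound[OF Lp_abs[OF u(1)], of \<xi>] by (simp add: abs_le_iff)
  qed
  have "Sup (f ` ball 0 1) - \<tau> < Sup (f ` ball 0 1)"
    using \<tau> by simp
  then obtain \<zeta> where \<zeta>: "norm \<zeta> < 1" "Sup (f ` ball 0 1) - \<tau> < f \<zeta>"
    using less_cSup_iff[OF _ bdd] by (auto simp: image_iff)
  have f: "f \<xi> \<le> f \<zeta> + \<tau>" if "norm \<xi> < 1" for \<xi>
    using cSUP_upper[OF _ bdd, of \<xi>] that \<zeta> by simp
  show thesis
  proof (cases "\<zeta> = 0")
    case True
    show thesis
    proof (rule that[of "\<lambda>x. x" u])
      show "conformal_ball_auto (\<lambda>x::'a. x)"
        by (rule conformal_ball_auto_id)
      show "near_opt \<tau> u"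
        using u \<tau> f True by (simp add: near_opt_def f_def)
      show "pullback p (\<lambda>x. x) u \<eta> = u \<eta>" if "norm \<eta> = 1" for \<eta>
        using that by (simp add: pullback_def sphere_jac_id)
    qed
  next
    case False
    define a where "a = \<zeta> /\<^sub>R (norm \<zeta>)\<^sup>2"
    have a: "1 < norm a" "inv_map a 0 = \<zeta>"
      using inversion_center_of_point[OF \<zeta>(1) False] by (simp_all add: a_def)
    note I = inversion_normalized[OF a(1) u(1)]
    show thesis
    proof (rule that[of "inv_map a" "\<lambda>\<eta>. inv_fac a \<eta> powr (m - s) * u (inv_map a \<eta>)"])
      show "conformal_ball_auto (inv_map a)"
        by (rule conformal_ball_auto_inv_map[OF a(1)])
      show "norm (inv_map a \<eta>) = 1" if "norm \<eta> = 1" for \<eta>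
        using inv_map_norm_eq_iff[OF a(1), of \<eta>] inversion_center_ne[OF a(1), of \<eta>] that by simp
      show "near_opt \<tau> (\<lambda>\<eta>. inv_fac a \<eta> powr (m - s) * u (inv_map a \<eta>))"
        unfolding near_opt_def
      proof (intro conjI allI impI)
        fix \<xi> :: 'a
        assume \<xi>: "norm \<xi> < 1"
        have "norm (inv_map a \<xi>) < 1"
          using inv_map_norm_less_iff[OF a(1), of \<xi>] inversion_center_ne[OF a(1), of \<xi>] \<xi> by simp
        from f[OF this] show "Tr s (\<lambda>\<eta>. \<bar>inv_fac a \<eta> powr (m - s) * u (inv_map a \<eta>)\<bar>) \<xi>
          \<le> Tr s (\<lambda>\<eta>. \<bar>inv_fac a \<eta> powr (m - s) * u (inv_map a \<eta>)\<bar>) 0 + \<tau>"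
          unfolding I(4)[OF \<xi>] by (subst I(4)) (simp_all add: a f_def)
      qed (use I u \<tau> in auto)
      show "pullback p (inv_map a) u \<eta> = inv_fac a \<eta> powr (m - s) * u (inv_map a \<eta>)" if "norm \<eta> = 1" for \<eta>
        using I(5)[OF that] .
    qed
  qed
qed

lemma INF_INF_le:
  fixes f :: "'b \<Rightarrow> 'c \<Rightarrow> real"
  assumes "\<And>x y. 0 \<le> f x y" "x \<in> A"
  shows "(INF x\<in>A. INF y. f x y) \<le> f x y"
proof (rule cINF_lower2[OF _ assms(2)])
  show "bdd_below ((\<lambda>x. INF y. f x y) ` A)"
    using assms by (intro bdd_belowI2[of _ 0] cINF_greatest) auto
  show "(INF y. f x y) \<le> f x y"
    using assms by (intro cINF_lower bdd_belowI2[of _ 0]) auto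
qed

text \<open>\<Phi> stands for either of the two distances to the constant 1. After scaling to norm 1
  and conformal normalization, the bound for near-optimal functions gives one competitor for the
  infimum; large deficits are covered by the competitor with factor 0.\<close>

lemma stability_from_near_opt:
  fixes \<Phi> :: "('a \<Rightarrow> real) \<Rightarrow> real"
  assumes C: "0 \<le> C" and t: "0 < t"
    and near: "\<And>u \<tau>. near_opt \<tau> u \<Longrightarrow> \<tau> \<le> t \<Longrightarrow> \<exists>l. l \<noteq> 0 \<and> \<Phi> (\<lambda>\<eta>. u \<eta> / l - 1) \<le> C * \<tau>"
    and cong: "\<And>f g. (\<And>\<eta>. norm \<eta> = 1 \<Longrightarrow> f \<eta> = g \<eta>) \<Longrightarrow> \<Phi> f = \<Phi> g" and nn: "\<And>f. 0 \<le> \<Phi> f"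
    and c: "0 < c" "\<Gamma> = c powr q"
    and \<alpha>: "real DIM('a) - \<alpha> = 2 * s" and \<beta>: "(s - \<beta>) * q = real DIM('a)"
  shows "\<exists>c0>0. \<forall>u :: 'a \<Rightarrow> real. in_Lp sphere_measure p u \<and> Lp_norm sphere_measure p u \<noteq> 0 \<longrightarrow>
    c0 * (INF \<Psi>\<in>{\<Psi>. conformal_ball_auto \<Psi>}. INF lam::real. \<Phi> (\<lambda>\<eta>. lam * S powr (1 / p) * pullback p \<Psi> u \<eta> - 1))
    \<le> c powr p - Lp_norm ball_measure q (Qop \<alpha> \<beta> u) powr p / Lp_norm sphere_measure p u powr p"
proof -
  define k where "k = q / p"
  have k: "1 < k"
    using pq p1 by (simp add: k_def)
  \<comment> \<open>The derivative of x powr k at c powr p. By the tangent inequality it converts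
    the deficit of the p-th powers into an upper bound for \<Gamma> - H v.\<close>
  define L where "L = k * (c powr p) powr (k - 1)"
  define B where "B = \<Phi> (\<lambda>_. - 1)"
  define M where "M = (C + B / t) * L"
  have L: "0 \<le> L" and B: "0 \<le> B"
    using k nn by (simp_all add: L_def B_def)
  have M: "0 \<le> M"
    using C B t L by (simp add: M_def)
  show ?thesis
  proof (intro exI[of _ "1 / (M + 1)"] conjI allI impI)
    show "0 < 1 / (M + 1)"
      using M by simp
    fix u :: "'a \<Rightarrow> real"
    assume u: "in_Lp sphere_measure p u \<and> Lp_norm sphere_measure p u \<noteq> 0"
    obtain u0 where u0: "Lp u0" and uu0: "\<And>\<eta>. norm \<eta> = 1 \<Longrightarrow> u \<eta> = u0 \<eta>"
      using in_Lp_sphere_representative u by blast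
    note u0m = LpD(1)[OF u0]
    define N where "N = E u0 powr (1 / p)"
    have Np: "Lp_norm sphere_measure p u = N" "N powr p = E u0" "0 < N"
      using Lp_norm_sphere[OF u0m uu0] u by (simp_all add: N_def)
    define v where "v = (\<lambda>\<eta>. 1 / N * u0 \<eta>)"
    have v: "Lp v" "E v = 1"
    proof -
      show "Lp v"
        unfolding v_def by (rule Lp_cmult[OF u0])
      show "E v = 1"
        unfolding v_def E_cmult Np(2)[symmetric] using Np(3) by (simp add: powr_divide)
    qed
    define G where "G = (INF \<Psi>\<in>{\<Psi>. conformal_ball_auto \<Psi>}. INF lam::real. \<Phi> (\<lambda>\<eta>. lam * S powr (1 / p) * pullback p \<Psi> u \<eta> - 1))"
    have G: "G \<le> \<Phi> (\<lambda>\<eta>. lam * S powr (1 / p) * pullback p \<Psi> u \<eta> - 1)" if "conformal_ball_auto \<Psi>" for lam \<Psi>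
      unfolding G_def by (rule INF_INF_le[where f="\<lambda>\<Psi> lam. \<Phi> (\<lambda>\<eta>. lam * S powr (1 / p) * pullback p \<Psi> u \<eta> - 1)"]) (use nn that in auto)
    define D where "D = c powr p - H v powr (p / q)"
    have HD: "H v powr (p / q) = Lp_norm ball_measure q (Qop \<alpha> \<beta> u) powr p / Lp_norm sphere_measure p u powr p"
    proof -
      have "H v = H u0 / N powr q"
        unfolding v_def H_cmult using Np by (simp add: powr_divide)
      moreover have "Lp_norm ball_measure q (Qop \<alpha> \<beta> u) = H u0 powr (1 / q)"
        using uu0 by (intro Lp_norm_ball[OF u0m _ \<alpha> \<beta>])
      ultimately show ?thesis
        unfolding Np(1) using q2 Np(3) by (simp add: powr_divide powr_powr)
    qed
    have xk: "(H v powr (p / q)) powr k = H v" "(c powr p) powr k = \<Gamma>"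
      using H_nonneg q2 p1 c by (simp_all add: powr_powr k_def)
    have Hv: "H v \<le> \<Gamma>"
      using sharp[OF v(1)] v by simp
    have D: "0 \<le> D"
    proof -
      have "H v powr (p / q) \<le> \<Gamma> powr (p / q)"
        using Hv H_nonneg p1 q2 by (intro powr_mono2) auto
      then show ?thesis
        using c q2 by (simp add: D_def powr_powr)
    qed
    have defi: "\<Gamma> - H v \<le> L * D"
      using powr_ge_tangent[of k "c powr p" "H v powr (p / q)"] k c unfolding xk D_def L_def by (simp add: algebra_simps)
    have "G \<le> (C + B / t) * (L * D)"
    proof (rule le_linear_of_small)
      show "G \<le> B"
        using G[OF conformal_ball_auto_id, of 0] by (simp add: B_def)
      show "0 \<le> L * D"
        using L D by simp
      fix \<tau>
      assume \<tau>: "0 < \<tau>" "L * D \<le> \<tau>" "\<tau> \<le> t"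
      then have "\<Gamma> - \<tau> \<le> H v"
        using defi by simp
      with v \<tau>(1) show "G \<le> C * \<tau>"
      proof (rule conformal_normalization)
        fix \<Psi> w
        assume \<Psi>: "conformal_ball_auto \<Psi>" and w: "near_opt \<tau> w" and \<Psi>1: "\<And>\<eta>. norm \<eta> = 1 \<Longrightarrow> norm (\<Psi> \<eta>) = 1"
          and pw: "\<And>\<eta>. norm \<eta> = 1 \<Longrightarrow> pullback p \<Psi> v \<eta> = w \<eta>"
        from near[OF w \<tau>(3)] obtain l where l: "l \<noteq> 0" "\<Phi> (\<lambda>\<eta>. w \<eta> / l - 1) \<le> C * \<tau>"
          by auto
        \<comment> \<open>Cancels the factor S powr (1 / p), the norm N of u and the constant l, so
          that the competitor is w / l - 1.\<close>
        define lam where "lam = 1 / (l * N * S powr (1 / p))"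
        have "G \<le> \<Phi> (\<lambda>\<eta>. lam * S powr (1 / p) * pullback p \<Psi> u \<eta> - 1)"
          by (rule G[OF \<Psi>])
        also have "\<dots> = \<Phi> (\<lambda>\<eta>. w \<eta> / l - 1)"
        proof (rule cong)
          fix \<eta> :: 'a
          assume \<eta>: "norm \<eta> = 1"
          have "w \<eta> = pullback p \<Psi> u \<eta> / N"
            unfolding pw[OF \<eta>, symmetric] pullback_def v_def by (simp add: uu0[OF \<Psi>1[OF \<eta>]])
          then show "lam * S powr (1 / p) * pullback p \<Psi> u \<eta> - 1 = w \<eta> / l - 1"
            using S_pos by (simp add: lam_def)
        qed
        also note l(2)
        finally show "G \<le> C * \<tau>" .
      qed
    qed (use C B t in auto)
    then have "G \<le> M * D"
      by (simp add: M_def mult.assoc)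
    also have "\<dots> \<le> (M + 1) * D"
      using D by (intro mult_right_mono) auto
    finally have "1 / (M + 1) * G \<le> D"
      using M by (simp add: field_simps)
    then show "1 / (M + 1) * (INF \<Psi>\<in>{\<Psi>. conformal_ball_auto \<Psi>}. INF lam::real. \<Phi> (\<lambda>\<eta>. lam * S powr (1 / p) * pullback p \<Psi> u \<eta> - 1))
      \<le> c powr p - Lp_norm ball_measure q (Qop \<alpha> \<beta> u) powr p / Lp_norm sphere_measure p u powr p"
      unfolding G_def D_def HD .
  qed
qed

lemma stability_bound_ge_2:
  assumes p2: "2 \<le> p" and c: "0 < c" "\<Gamma> = c powr q"
    and \<alpha>: "real DIM('a) - \<alpha> = 2 * s" and \<beta>: "(s - \<beta>) * q = real DIM('a)"
  shows "\<exists>c0>0. \<forall>u :: 'a \<Rightarrow> real. in_Lp sphere_measure p u \<and> Lp_norm sphere_measure p u \<noteq> 0 \<longrightarrow>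
    c0 * (INF \<Psi>\<in>{\<Psi>. conformal_ball_auto \<Psi>}. INF lam::real.
        Lp_norm sphere_measure p (\<lambda>\<eta>. lam * S powr (1 / p) * pullback p \<Psi> u \<eta> - 1) powr p
      + Lp_norm sphere_measure 2 (\<lambda>\<eta>. lam * S powr (1 / p) * pullback p \<Psi> u \<eta> - 1) powr 2)
    \<le> c powr p - Lp_norm ball_measure q (Qop \<alpha> \<beta> u) powr p / Lp_norm sphere_measure p u powr p"
proof (rule stability_ge_2[OF p2])
  fix C t
  assume C: "0 \<le> C" "0 < t" and near: "\<And>u \<tau>. near_opt \<tau> u \<Longrightarrow> \<tau> \<le> t \<Longrightarrow>
    \<exists>l w. l \<noteq> 0 \<and> w = (\<lambda>\<eta>. u \<eta> / l - 1) \<and> E w + (\<integral>\<eta>. (w \<eta>)\<^sup>2 \<partial>sph) \<le> C * \<tau>"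
  show ?thesis
  proof (rule stability_from_near_opt[OF C _ _ _ c \<alpha> \<beta>, where \<Phi>="\<lambda>f. Lp_norm sphere_measure p f powr p + Lp_norm sphere_measure 2 f powr 2"])
    fix u :: "'a \<Rightarrow> real" and \<tau>
    assume u: "near_opt \<tau> u" and "\<tau> \<le> t"
    from near[OF this] obtain l w where l: "l \<noteq> 0" and w: "w = (\<lambda>\<eta>. u \<eta> / l - 1)" and le: "E w + (\<integral>\<eta>. (w \<eta>)\<^sup>2 \<partial>sph) \<le> C * \<tau>"
      by auto
    have "Lp u"
      using u by (simp add: near_opt_def)
    note [measurable] = LpD(1)[OF this]
    have wm [measurable]: "w \<in> borel_measurable borel"
      unfolding w by measurable
    have "Lp_norm sphere_measure 2 w powr 2 = (\<integral>\<eta>. \<bar>w \<eta>\<bar> powr 2 \<partial>sphere_measure)"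
      unfolding Lp_norm_def powr_powr by simp
    also have "\<dots> = (\<integral>\<eta>. (w \<eta>)\<^sup>2 \<partial>sph)"
      by (rule integral_sphere_cong) auto
    finally have "Lp_norm sphere_measure p w powr p + Lp_norm sphere_measure 2 w powr 2 \<le> C * \<tau>"
      using le Lp_norm_sphere(2)[OF wm refl] by simp
    then show "\<exists>l. l \<noteq> 0 \<and> Lp_norm sphere_measure p (\<lambda>\<eta>. u \<eta> / l - 1) powr p + Lp_norm sphere_measure 2 (\<lambda>\<eta>. u \<eta> / l - 1) powr 2 \<le> C * \<tau>"
      using l unfolding w by blast
  next
    fix f g :: "'a \<Rightarrow> real"
    assume "\<And>\<eta>. norm \<eta> = 1 \<Longrightarrow> f \<eta> = g \<eta>"
    then have "Lp_norm sphere_measure r f = Lp_norm sphere_measure r g" for r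
      by (intro Lp_norm_cong) auto
    then show "Lp_norm sphere_measure p f powr p + Lp_norm sphere_measure 2 f powr 2 = Lp_norm sphere_measure p g powr p + Lp_norm sphere_measure 2 g powr 2"
      by simp
  qed simp
qed

lemma stability_bound_less_2:
  assumes p2: "p < 2" and c: "0 < c" "\<Gamma> = c powr q"
    and \<alpha>: "real DIM('a) - \<alpha> = 2 * s" and \<beta>: "(s - \<beta>) * q = real DIM('a)"
  shows "\<exists>c0>0. \<forall>u :: 'a \<Rightarrow> real. in_Lp sphere_measure p u \<and> Lp_norm sphere_measure p u \<noteq> 0 \<longrightarrow>
    c0 * (INF \<Psi>\<in>{\<Psi>. conformal_ball_auto \<Psi>}. INF lam::real.
        Lp_norm sphere_measure p (\<lambda>\<eta>. lam * S powr (1 / p) * pullback p \<Psi> u \<eta> - 1) powr 2)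
    \<le> c powr p - Lp_norm ball_measure q (Qop \<alpha> \<beta> u) powr p / Lp_norm sphere_measure p u powr p"
proof (rule stability_less_2[OF p2])
  fix C t
  assume C: "0 \<le> C" "0 < t" and near: "\<And>u \<tau>. near_opt \<tau> u \<Longrightarrow> \<tau> \<le> t \<Longrightarrow>
    \<exists>l w. l \<noteq> 0 \<and> w = (\<lambda>\<eta>. u \<eta> / l - 1) \<and> E w powr (2 / p) \<le> C * \<tau>"
  show ?thesis
  proof (rule stability_from_near_opt[OF C _ _ _ c \<alpha> \<beta>, where \<Phi>="\<lambda>f. Lp_norm sphere_measure p f powr 2"])
    fix u :: "'a \<Rightarrow> real" and \<tau>
    assume u: "near_opt \<tau> u" and "\<tau> \<le> t"
    from near[OF this] obtain l w where l: "l \<noteq> 0" and w: "w = (\<lambda>\<eta>. u \<eta> / l - 1)" and le: "E w powr (2 / p) \<le> C * \<tau>"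
      by auto
    have "Lp u"
      using u by (simp add: near_opt_def)
    note [measurable] = LpD(1)[OF this]
    have wm [measurable]: "w \<in> borel_measurable borel"
      unfolding w by measurable
    have "Lp_norm sphere_measure p w powr 2 \<le> C * \<tau>"
      unfolding Lp_norm_sphere(1)[OF wm refl] powr_powr using le by simp
    then show "\<exists>l. l \<noteq> 0 \<and> Lp_norm sphere_measure p (\<lambda>\<eta>. u \<eta> / l - 1) powr 2 \<le> C * \<tau>"
      using l unfolding w by blast
  next
    fix f g :: "'a \<Rightarrow> real"
    assume "\<And>\<eta>. norm \<eta> = 1 \<Longrightarrow> f \<eta> = g \<eta>"
    then have "Lp_norm sphere_measure p f = Lp_norm sphere_measure p g"
      by (intro Lp_norm_cong) auto
    then show "Lp_norm sphere_measure p f powr 2 = Lp_norm sphere_measure p g powr 2"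
      by simp
  qed simp
qed

end

section \<open>The supremum as a sharp constant\<close>

context stab
begin

text \<open>The set of quotients is bounded by \<open>H_bound\<close>, so its supremum really bounds
  each of them; the function 1 shows that the supremum is positive.\<close>

lemma stab_sharp_sharp_const:
  assumes pd: "p = p_exp TYPE('a) \<alpha>" and qd: "q = q_exp TYPE('a) \<alpha> \<beta>"
    and \<alpha>: "real DIM('a) - \<alpha> = 2 * s" and \<beta>: "(s - \<beta>) * q = real DIM('a)"
  defines "c \<equiv> sharp_const TYPE('a) \<alpha> \<beta>"
  shows "0 < c" "stab_sharp TYPE('a) S m s p q (c powr q)"
proof -
  define X where "X = {Lp_norm (ball_measure :: 'a measure) q (Qop \<alpha> \<beta> u) / Lp_norm (sphere_measure :: 'a measure) p u | u.
       in_Lp (sphere_measure :: 'a measure) p u \<and> Lp_norm (sphere_measure :: 'a measure) p u \<noteq> 0}"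
  have cX: "c = Sup X"
    unfolding c_def sharp_const_def X_def pd qd ..
  have q0: "0 < q" and p0: "0 < p"
    using q2 p1 by simp_all
  have "0 < c \<and> stab_sharp TYPE('a) S m s p q (c powr q)"
  proof (rule H_bound)
    fix A
    assume A: "0 \<le> A" and HA: "\<And>u. Lp u \<Longrightarrow> H u \<le> A * E u powr (q / p)"
    have bdd: "bdd_above X"
    proof (rule bdd_aboveI)
      fix x
      assume "x \<in> X"
      then obtain u :: "'a \<Rightarrow> real" where u: "in_Lp sphere_measure p u" "Lp_norm sphere_measure p u \<noteq> 0"
        and x: "x = Lp_norm ball_measure q (Qop \<alpha> \<beta> u) / Lp_norm sphere_measure p u"
        by (auto simp: X_def)
      obtain u0 where u0: "Lp u0" "\<And>\<eta>. norm \<eta> = 1 \<Longrightarrow> u \<eta> = u0 \<eta>"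
        using in_Lp_sphere_representative[OF u(1)] by blast
      have n: "Lp_norm sphere_measure p u = E u0 powr (1 / p)" "Lp_norm ball_measure q (Qop \<alpha> \<beta> u) = H u0 powr (1 / q)"
        using u0(2) by (intro Lp_norm_sphere(1)[OF LpD(1)[OF u0(1)]] Lp_norm_ball[OF LpD(1)[OF u0(1)] _ \<alpha> \<beta>]; simp)+
      have e: "0 < E u0 powr (1 / p)"
        using u(2) unfolding n by simp
      have "H u0 powr (1 / q) \<le> (A * E u0 powr (q / p)) powr (1 / q)"
        using HA[OF u0(1)] H_nonneg q0 by (intro powr_mono2) auto
      also have "\<dots> = A powr (1 / q) * E u0 powr (1 / p)"
        using q0 A by (simp add: powr_mult powr_powr)
      finally show "x \<le> A powr (1 / q)"
        unfolding x n using e by (simp add: field_simps)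
    qed
    have ratio: "H u powr (1 / q) / E u powr (1 / p) \<le> c" if u: "Lp u" and e: "0 < E u" for u
    proof -
      have "in_Lp sphere_measure p u"
        using LpD[OF u] borel_measurable_sphere_measureI[OF LpD(1)[OF u]] integrable_sph[of "\<lambda>\<eta>. \<bar>u \<eta>\<bar> powr p"] unfolding in_Lp_def by simp
      then have "H u powr (1 / q) / E u powr (1 / p) \<in> X"
        unfolding X_def using Lp_norm_sphere(1)[OF LpD(1)[OF u] refl] Lp_norm_ball[OF LpD(1)[OF u] refl \<alpha> \<beta>] e
        by (intro CollectI exI[of _ u]) auto
      then show ?thesis
        unfolding cX using bdd by (rule cSup_upper)
    qed
    have one: "Lp (\<lambda>_. 1)" "E (\<lambda>_. 1) = S"
      unfolding Lp_def E_def by (simp_all add: S measure_sph)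
    have "0 < H (\<lambda>_. 1)"
    proof -
      have "(\<integral>\<xi>. \<bar>Tr s (\<lambda>_. 1) \<xi>\<bar> powr q \<partial>(hyp :: 'a measure)) \<noteq> 0"
      proof
        assume "(\<integral>\<xi>. \<bar>Tr s (\<lambda>_. 1) \<xi>\<bar> powr q \<partial>(hyp :: 'a measure)) = 0"
        then have "AE \<xi> in (hyp :: 'a measure). \<bar>Tr s (\<lambda>_. 1) \<xi>\<bar> powr q = 0"
          using integral_nonneg_eq_0_iff_AE[OF H_integrable[OF one(1)]] by simp
        then have "AE \<xi> in (hyp :: 'a measure). False"
          using AE_hyp
        proof eventually_elim
          fix \<xi> :: 'a
          assume z: "\<bar>Tr s (\<lambda>_. 1) \<xi>\<bar> powr q = 0" and \<xi>: "norm \<xi> < 1"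
          have "0 < ((1 - (norm \<xi>)\<^sup>2) / 8) powr s * (\<integral>\<eta>. 1 \<partial>(sph :: 'a measure))"
            using wt_pos[OF \<xi>] S_pos by (simp add: S measure_sph wt_def)
          also have "\<dots> \<le> Tr s (\<lambda>_. 1) \<xi>"
            using \<xi> by (intro Tr_ge) auto
          finally show False
            using z by simp
        qed
        then have "emeasure (hyp :: 'a measure) UNIV = 0"
          by (subst (asm) AE_iff_measurable[of UNIV]) auto
        moreover have "emeasure lborel (ball (0::'a) 1) \<le> emeasure hyp (ball (0::'a) 1)"
          by (rule emeasure_hyp_ge) auto
        moreover have "emeasure hyp (ball (0::'a) 1) \<le> emeasure hyp (UNIV :: 'a set)"
          by (rule emeasure_mono) auto
        moreover have "emeasure lborel (ball (0::'a) 1) \<noteq> 0"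
          using content_ball_pos[of 1 "0::'a"] by (auto simp: measure_def)
        ultimately show False
          by simp
      qed
      then show ?thesis
        using H_nonneg[of "\<lambda>_. 1"] unfolding H_def by linarith
    qed
    then have "0 < H (\<lambda>_. 1) powr (1 / q) / E (\<lambda>_. 1) powr (1 / p)"
      using S_pos one by simp
    also have "\<dots> \<le> c"
      using S_pos one by (intro ratio) auto
    finally have c: "0 < c" .
    have "stab_sharp TYPE('a) S m s p q (c powr q)"
    proof (unfold_locales)
      show "0 < c powr q"
        using c by simp
      fix u :: "'a \<Rightarrow> real"
      assume u: "Lp u"
      show "H u \<le> c powr q * E u powr (q / p)"
      \<comment> \<open>A function of norm zero gives no quotient in the set; here H u = 0 follows
        from the non-sharp bound.\<close>
      proof (cases "E u = 0")
        case True
        then show ?thesis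
          using HA[OF u] by simp
      next
        case False
        then have e: "0 < E u"
          using E_nonneg[of u] by simp
        have "H u powr (1 / q) \<le> c * E u powr (1 / p)"
          using ratio[OF u e] e by (simp add: field_simps)
        then have "(H u powr (1 / q)) powr q \<le> (c * E u powr (1 / p)) powr q"
          using q0 by (intro powr_mono2) auto
        then show ?thesis
          using q0 c H_nonneg[of u] by (simp add: powr_powr powr_mult)
      qed
    qed
    with c show ?thesis ..
  qed
  then show "0 < c" "stab_sharp TYPE('a) S m s p q (c powr q)"
    by simp_all
qed

end

theorem theorem1p1:
  fixes \<alpha> \<beta> :: real
  defines "n \<equiv> real DIM('a::euclidean_space)"
    and "p \<equiv> p_exp TYPE('a) \<alpha>"
    and "q \<equiv> q_exp TYPE('a) \<alpha> \<beta>"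
    and "c \<equiv> sharp_const TYPE('a) \<alpha> \<beta>"
    and "S \<equiv> sphere_area TYPE('a)"
  assumes "DIM('a) \<ge> 3"
    and "\<beta> \<ge> 0" and "0 < \<alpha> + \<beta>" and "\<alpha> + \<beta> < n - \<beta>"
    and "(n - \<alpha> - 2 * \<beta>) / (2 * n) + (n - \<alpha>) / (2 * (n - 1)) < 1"
  shows
   "(\<alpha> \<le> 1 \<longrightarrow>
      (\<exists>c0>0. \<forall>u :: 'a \<Rightarrow> real.
         in_Lp sphere_measure p u \<and> Lp_norm sphere_measure p u \<noteq> 0 \<longrightarrow>
         c powr p - Lp_norm ball_measure q (Qop \<alpha> \<beta> u) powr p / Lp_norm sphere_measure p u powr p
         \<ge> c0 * (INF \<Psi>\<in>{\<Psi>. conformal_ball_auto \<Psi>}. INF lam::real.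
               Lp_norm sphere_measure p (\<lambda>\<eta>. lam * S powr (1 / p) * pullback p \<Psi> u \<eta> - 1) powr p
             + Lp_norm sphere_measure 2 (\<lambda>\<eta>. lam * S powr (1 / p) * pullback p \<Psi> u \<eta> - 1) powr 2)))
  \<and> (1 < \<alpha> \<and> \<alpha> < n \<longrightarrow>
      (\<exists>c0>0. \<forall>u :: 'a \<Rightarrow> real.
         in_Lp sphere_measure p u \<and> Lp_norm sphere_measure p u \<noteq> 0 \<longrightarrow>
         c powr p - Lp_norm ball_measure q (Qop \<alpha> \<beta> u) powr p / Lp_norm sphere_measure p u powr p
         \<ge> c0 * (INF \<Psi>\<in>{\<Psi>. conformal_ball_auto \<Psi>}. INF lam::real.
               Lp_norm sphere_measure p (\<lambda>\<eta>. lam * S powr (1 / p) * pullback p \<Psi> u \<eta> - 1) powr 2)))"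
proof -
  define m where "m = real (DIM('a) - 1)"
  \<comment> \<open>The kernel |\<xi> - \<eta>| powr (\<alpha> - n) is the power -s of the squared
    distance.\<close>
  define s where "s = (n - \<alpha>) / 2"
  have nm: "n = m + 1" and m2: "2 \<le> m"
    using assms(6) by (simp_all add: n_def m_def of_nat_diff)
  have s: "0 < s" "0 < s - \<beta>"
    using assms(7,9) by (simp_all add: s_def)
  \<comment> \<open>The last hypothesis rewritten. As (s - \<beta>) / n = 1 / q and s / m = 1 - 1 /
    p, it says p < q; positivity of the first summand also gives s < m.\<close>
  have h: "(s - \<beta>) / n + s / m < 1"
  proof -
    have "(n - \<alpha> - 2 * \<beta>) / (2 * n) = (s - \<beta>) / n" "(n - \<alpha>) / (2 * (n - 1)) = s / m"
      using m2 by (simp_all add: s_def nm field_simps)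
    then show ?thesis
      using assms(10) by simp
  qed
  have sm: "s < m"
  proof -
    have "0 < (s - \<beta>) / n"
      using s m2 nm by simp
    then have "s / m < 1"
      using h by linarith
    then show ?thesis
      using m2 by simp
  qed
  have p: "p = m / (m - s)"
    using sm by (simp add: p_def p_exp_def n_def[symmetric] nm s_def field_simps)
  have q: "q = n / (s - \<beta>)"
    using s by (simp add: q_def q_exp_def n_def[symmetric] s_def field_simps)
  have pq: "p < q"
  proof -
    have "(s - \<beta>) / n < (m - s) / m"
      using h m2 by (simp add: diff_divide_distrib)
    then show ?thesis
      unfolding p q using s sm m2 nm by (simp add: field_simps)
  qed
  have sq: "m / s < q"
  proof -
    have "m / s < n / s"
      using s nm by (simp add: divide_strict_right_mono)
    also have "\<dots> \<le> n / (s - \<beta>)"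
      using s assms(7) m2 nm by (intro divide_left_mono) auto
    finally show ?thesis
      by (simp add: q)
  qed
  interpret st: stab "TYPE('a)" S m s p q
    using assms(6) m_def s sm p pq sq by unfold_locales (simp_all add: S_def)
  have \<alpha>: "real DIM('a) - \<alpha> = 2 * s" and \<beta>: "(s - \<beta>) * q = real DIM('a)"
    using s by (simp_all add: s_def q n_def)
  have pd: "p = p_exp TYPE('a) \<alpha>" and qd: "q = q_exp TYPE('a) \<alpha> \<beta>"
    by (simp_all add: p_def q_def)
  note sh = st.stab_sharp_sharp_const[OF pd qd \<alpha> \<beta>, folded c_def]
  interpret sh: stab_sharp "TYPE('a)" S m s p q "c powr q"
    by (rule sh(2))
  show ?thesis
  proof (intro conjI impI)
    assume "\<alpha> \<le> 1"
    then have "2 \<le> p"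
      unfolding p using sm by (simp add: s_def nm field_simps)
    from sh.stability_bound_ge_2[OF this sh(1) refl \<alpha> \<beta>]
    show "\<exists>c0>0. \<forall>u :: 'a \<Rightarrow> real.
         in_Lp sphere_measure p u \<and> Lp_norm sphere_measure p u \<noteq> 0 \<longrightarrow>
         c powr p - Lp_norm ball_measure q (Qop \<alpha> \<beta> u) powr p / Lp_norm sphere_measure p u powr p
         \<ge> c0 * (INF \<Psi>\<in>{\<Psi>. conformal_ball_auto \<Psi>}. INF lam::real.
               Lp_norm sphere_measure p (\<lambda>\<eta>. lam * S powr (1 / p) * pullback p \<Psi> u \<eta> - 1) powr p
             + Lp_norm sphere_measure 2 (\<lambda>\<eta>. lam * S powr (1 / p) * pullback p \<Psi> u \<eta> - 1) powr 2)" .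
  next
    assume "1 < \<alpha> \<and> \<alpha> < n"
    then have "p < 2"
      unfolding p using sm by (simp add: s_def nm field_simps)
    from sh.stability_bound_less_2[OF this sh(1) refl \<alpha> \<beta>]
    show "\<exists>c0>0. \<forall>u :: 'a \<Rightarrow> real.
         in_Lp sphere_measure p u \<and> Lp_norm sphere_measure p u \<noteq> 0 \<longrightarrow>
         c powr p - Lp_norm ball_measure q (Qop \<alpha> \<beta> u) powr p / Lp_norm sphere_measure p u powr p
         \<ge> c0 * (INF \<Psi>\<in>{\<Psi>. conformal_ball_auto \<Psi>}. INF lam::real.
               Lp_norm sphere_measure p (\<lambda>\<eta>. lam * S powr (1 / p) * pullback p \<Psi> u \<eta> - 1) powr 2)" .
  qed
qed

end
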